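(* Let $X$ be a projective, irreducible, non-singular curve over an algebraically closed field $\Bbbk$, let $p$ be a prime different from $\operatorname{char}(\Bbbk)$, let $\mathcal{C}_p$ be the cyclic group of order $p$, and fix a nontrivial character $\chi:\mathcal{C}_p\to\Bbbk^*$. Consider the maps - $\upsilon:\mathbb{I}_X/\mathbb{I}_X^p\to\bigoplus_{x\in X}\mathbb{Z}/(p)$, $u\mapsto(\upsilon_x(u_x)\bmod p)_x$; - $i_{(\mathbb{A}_X,\chi)}:\mathbb{I}_X/\mathbb{I}_X^p\to\mathbb{H}(\mathbb{A}_X,\mathcal{C}_p)$, sending $u\in\mathbb{I}_X$ to the class of the $(\mathcal{C}_p,\chi)$-Kummer extension $\mathbb{A}_X[T]/(T^p-u)$; - $(\upsilon_x)_x:\prod_{x\in X}K_x^*/K_x^{*p}\to\prod_{x\in X}\mathbb{Z}/(p)$, given in each component by $u\mapsto\upsilon_x(u)\bmod p$; - $(i_{(K_x,\chi)})_x:\prod_{x\in X}K_x^*/K_x^{*p}\to\prod_{x\in X}\mathbb{H}(K_x,\mathcal{C}_p)$, given in each component by sending $u\in K_x^*$ to the class of the $(\mathcal{C}_p,\chi)$-Kummer extension $K_x[T]/(T^p-u)$. Then these four maps are (well-defined) group isomorphisms; the natural maps $\bigoplus_{x}\mathbb{Z}/(p)\to\prod_{x}\mathbb{Z}/(p)$ (inclusion), $\mathbb{I}_X/\mathbb{I}_X^p\to\prod_{x}K_x^*/K_x^{*p}$ (components), and $\mathbb{H}(\mathbb{A}_X,\mathcal{C}_p)\to\prod_{x}\mathbb{H}(K_x,\mathcal{C}_p)$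 (class of $S$ to the classes of $S\otimes_{\mathbb{A}_X}K_x$) are injective; and the diagram $$\begin{array}{ccccc}\bigoplus_{x}\mathbb{Z}/(p)&\xleftarrow{\ \upsilon\ }&\mathbb{I}_X/\mathbb{I}_X^p&\xrightarrow{\ i_{(\mathbb{A}_X,\chi)}\ }&\mathbb{H}(\mathbb{A}_X,\mathcal{C}_p)\\ \downarrow&&\downarrow&&\downarrow\\ \prod_{x}\mathbb{Z}/(p)&\xleftarrow{(\upsilon_x)_x}&\prod_{x}K_x^*/K_x^{*p}&\xrightarrow{(i_{(K_x,\chi)})_x}&\prod_{x}\mathbb{H}(K_x,\mathcal{C}_p)\end{array}$$ is commutative.
   Context: "$x\in X$" means a closed point. For $x\in X$, $A_x$ is the completion of the local ring of $X$ at $x$, $K_x$ its fraction field, $\upsilon_x$ the (normalized discrete) valuation on $K_x$. $\mathbb{A}_X=\{(\alpha_x)_x\in\prod_{x}K_x : \alpha_x\in A_x \text{ for all but finitely many } x\}$, $\mathbb{I}_X=\mathbb{A}_X^*$; $\Bbbk$ embeds diagonally in $\mathbb{A}_X$ and in each $K_x$, and $K_x$ is an $\mathbb{A}_X$-algebra by projection. $\mu_p\subseteq\Bbbk^*$ is the group of $p$th roots of unity. Galois extension: a commutative ring extension $S$ of a commutative ring $R$ with an action of a finite group $G$ is a $G$-Galois extension of $R$ if $G$ acts faithfully on $S$ by $R$-algebra automorphisms, $S^G=R$, $S$ is a separable $R$-algebra (projective as $S\otimes_R S$-module), and for all $g\neq h$ in $G$ and every nonzero idempotent $e\in S$ there is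 $s\in S$ with $g(s)e\neq h(s)e$. Harrison group: for $G$ finite abelian, $\mathbb{H}(R,G)$ is the set of $G$-Galois extensions of $R$ modulo $G$-equivariant $R$-algebra isomorphism. For $G$ cyclic of order $p$ and $R$ a $\Bbbk$-algebra, its group law is induced by $S_1\cdot S_2=\bigoplus_{\chi\in\operatorname{Hom}(G,\mu_p)}(S_1^\chi\otimes_R S_2^\chi)\subseteq S_1\otimes_R S_2$, where $S^\chi=\{s\in S: g(s)=\chi(g)s\ \forall g\in G\}$ and $G$ acts on $S_1^\chi\otimes_R S_2^\chi$ via multiplication by $\chi(g)$. $(G,\chi)$-Kummer extension: for $u\in R^*$, the $R$-algebra $R[T]/(T^p-u)$ with $G$ acting by $R$-algebra automorphisms via $g(T)=\chi(g)T$. *)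

theory Defs
  imports
    "HOL-Computational_Algebra.Computational_Algebra"
    "HOL-Library.Poly_Mapping"
    "HOL-Library.Extended_Nat"
    "HOL-Algebra.Algebraic_Closure_Type"
    "HOL-Algebra.Group_Action"
    "HOL-Algebra.Ideal_Product"
    "HOL-Algebra.Embedded_Algebras"
    "HOL-Algebra.Free_Abelian_Groups"
    "HOL-Algebra.Elementary_Groups"
    "HOL-Algebra.UnivPoly"
begin

section \<open>Projective curves\<close>

text \<open>
  Over an algebraically closed field the closed points of a projective variety are its points in
  the classical sense. Homogeneous coordinates are indexed by a finite type \<open>'n\<close>, so the ambient
  space has dimension \<open>CARD('n) - 1\<close>, and a point is a line through the origin without the origin.
  Polynomials are finitely supported functions from exponent vectors to coefficients.
\<close>

type_synonym ('n, 'k) mvpoly = "('n \<Rightarrow>\<^sub>0 nat) \<Rightarrow>\<^sub>0 'k"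
type_synonym ('n, 'k) ppoint = "('n \<Rightarrow> 'k) set"

definition mv_eval :: "('n::finite, 'k::field) mvpoly \<Rightarrow> ('n \<Rightarrow> 'k) \<Rightarrow> 'k" where
  "mv_eval f v = (\<Sum>m\<in>Poly_Mapping.keys f.
     Poly_Mapping.lookup f m * (\<Prod>i\<in>UNIV. v i ^ Poly_Mapping.lookup m i))"

definition homogeneous :: "nat \<Rightarrow> ('n::finite, 'k::field) mvpoly \<Rightarrow> bool" where
  "homogeneous d f \<longleftrightarrow>
     (\<forall>m\<in>Poly_Mapping.keys f. (\<Sum>i\<in>UNIV. Poly_Mapping.lookup m i) = d)"

definition proj_point :: "('n \<Rightarrow> 'k::field) \<Rightarrow> ('n, 'k) ppoint" where
  "proj_point a = {(\<lambda>i. c * a i) | c. c \<noteq> 0}"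

definition proj_space :: "('n::finite, 'k::field) ppoint set" where
  "proj_space = proj_point ` {a. \<exists>i. a i \<noteq> 0}"

definition zero_locus :: "('n::finite, 'k::field) mvpoly set \<Rightarrow> ('n, 'k) ppoint set" where
  "zero_locus F = {y \<in> proj_space. \<forall>f\<in>F. \<forall>v\<in>y. mv_eval f v = 0}"

definition zariski_closed :: "('n::finite, 'k::field) ppoint set \<Rightarrow> bool" where
  "zariski_closed Z \<longleftrightarrow> (\<exists>F. (\<forall>f\<in>F. \<exists>d. homogeneous d f) \<and> Z = zero_locus F)"

definition irreducible_closed :: "('n::finite, 'k::field) ppoint set \<Rightarrow> bool" where
  "irreducible_closed Z \<longleftrightarrow> zariski_closed Z \<and> Z \<noteq> {} \<and>
     (\<forall>A B. zariski_closed A \<and> zariski_closed B \<and> Z \<subseteq> A \<union> B \<longrightarrow> Z \<subseteq> A \<or> Z \<subseteq> B)"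

definition zariski_dim :: "('n::finite, 'k::field) ppoint set \<Rightarrow> enat" where
  "zariski_dim \<X> = Sup {enat m | m Z.
     (\<forall>i\<le>m. irreducible_closed (Z i) \<and> Z i \<subseteq> \<X>) \<and> (\<forall>i<m. Z i \<subset> Z (Suc i))}"

definition open_nbhd :: "('n::finite, 'k::field) ppoint set \<Rightarrow> ('n, 'k) ppoint \<Rightarrow>
    ('n, 'k) ppoint set \<Rightarrow> bool" where
  "open_nbhd \<X> x U \<longleftrightarrow> x \<in> U \<and> (\<exists>Z. zariski_closed Z \<and> U = \<X> - Z)"

text \<open>
  A function is regular at \<open>x\<close> if, on a neighbourhood of \<open>x\<close> in \<open>\<X>\<close>, it is a quotient of
  homogeneous polynomials of equal degree. The stalk at \<open>x\<close> identifies functions that agree near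
  \<open>x\<close>; functions are total, so the values away from \<open>x\<close> are discarded by this identification.
\<close>

definition regular_at :: "('n::finite, 'k::field) ppoint set \<Rightarrow> ('n, 'k) ppoint \<Rightarrow>
    (('n, 'k) ppoint \<Rightarrow> 'k) \<Rightarrow> bool" where
  "regular_at \<X> x f \<longleftrightarrow> (\<exists>U d g h. open_nbhd \<X> x U \<and> homogeneous d g \<and> homogeneous d h \<and>
     (\<forall>y\<in>U. \<forall>v\<in>y. mv_eval h v \<noteq> 0 \<and> f y = mv_eval g v / mv_eval h v))"

definition regular_ring :: "('n::finite, 'k::field) ppoint set \<Rightarrow> ('n, 'k) ppoint \<Rightarrow>
    (('n, 'k) ppoint \<Rightarrow> 'k) ring" where
  "regular_ring \<X> x = \<lparr>carrier = {f. regular_at \<X> x f},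
     monoid.mult = (\<lambda>f g y. f y * g y), one = (\<lambda>_. 1),
     ring.zero = (\<lambda>_. 0), add = (\<lambda>f g y. f y + g y)\<rparr>"

definition vanishing_germs :: "('n::finite, 'k::field) ppoint set \<Rightarrow> ('n, 'k) ppoint \<Rightarrow>
    (('n, 'k) ppoint \<Rightarrow> 'k) set" where
  "vanishing_germs \<X> x =
     {f. regular_at \<X> x f \<and> (\<exists>U. open_nbhd \<X> x U \<and> (\<forall>y\<in>U. f y = 0))}"

type_synonym ('n, 'k) germ = "(('n, 'k) ppoint \<Rightarrow> 'k) set"

definition local_ring :: "('n::finite, 'k::field) ppoint set \<Rightarrow> ('n, 'k) ppoint \<Rightarrow>
    ('n, 'k) germ ring" where
  "local_ring \<X> x = regular_ring \<X> x Quot vanishing_germs \<X> x"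

definition const_germ :: "('n::finite, 'k::field) ppoint set \<Rightarrow> ('n, 'k) ppoint \<Rightarrow>
    'k \<Rightarrow> ('n, 'k) germ" where
  "const_germ \<X> x c = vanishing_germs \<X> x +>\<^bsub>regular_ring \<X> x\<^esub> (\<lambda>_. c)"

definition nonunits :: "('a, 'm) ring_scheme \<Rightarrow> 'a set" where
  "nonunits R = carrier R - Units R"

text \<open>
  For a local ring \<open>nonunits\<close> is the maximal ideal. A point of an irreducible variety is
  nonsingular if its Zariski cotangent space \<open>m / m\<^sup>2\<close> has the dimension of the variety as a vector
  space over the ground field; the cotangent space is taken inside the ring \<open>O / m\<^sup>2\<close>, whose
  subfield of constants provides the scalars.
\<close>

definition nonsingular_at :: "('n::finite, 'k::field) ppoint set \<Rightarrow> ('n, 'k) ppoint \<Rightarrow> bool" where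
  "nonsingular_at \<X> x \<longleftrightarrow>
     (let R = local_ring \<X> x; m = nonunits R; m2 = ideal_prod R m m in
      \<exists>d. zariski_dim \<X> = enat d \<and>
        ring.dimension (R Quot m2) d
          (range (\<lambda>c. m2 +>\<^bsub>R\<^esub> const_germ \<X> x c))
          ((\<lambda>a. m2 +>\<^bsub>R\<^esub> a) ` m))"

definition nonsingular_projective_curve :: "('n::finite, 'k::field) ppoint set \<Rightarrow> bool" where
  "nonsingular_projective_curve \<X> \<longleftrightarrow>
     irreducible_closed \<X> \<and> zariski_dim \<X> = 1 \<and> (\<forall>x\<in>\<X>. nonsingular_at \<X> x)"


section \<open>Completions, fraction fields, valuations\<close>

text \<open>
  The inverse limit of the rings \<open>R / I\<^sup>n\<close>. Two cosets of successive powers correspond under the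
  transition map precisely if one contains the other.
\<close>

definition adic_completion :: "('a, 'm) ring_scheme \<Rightarrow> 'a set \<Rightarrow> (nat \<Rightarrow> 'a set) ring" where
  "adic_completion R I =
     (let Q = (\<lambda>n::nat. R Quot (I [^]\<^bsub>ideals_set R\<^esub> n)) in
      \<lparr>carrier = {a. (\<forall>n. a n \<in> carrier (Q n)) \<and> (\<forall>n. a (Suc n) \<subseteq> a n)},
       monoid.mult = (\<lambda>a b n. a n \<otimes>\<^bsub>Q n\<^esub> b n), one = (\<lambda>n. \<one>\<^bsub>Q n\<^esub>),
       ring.zero = (\<lambda>n. \<zero>\<^bsub>Q n\<^esub>), add = (\<lambda>a b n. a n \<oplus>\<^bsub>Q n\<^esub> b n)\<rparr>)"

definition to_completion :: "('a, 'm) ring_scheme \<Rightarrow> 'a set \<Rightarrow> 'a \<Rightarrow> (nat \<Rightarrow> 'a set)" where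
  "to_completion R I a = (\<lambda>n. (I [^]\<^bsub>ideals_set R\<^esub> n) +>\<^bsub>R\<^esub> a)"

definition fraction :: "('a, 'm) ring_scheme \<Rightarrow> 'a \<Rightarrow> 'a \<Rightarrow> ('a \<times> 'a) set" where
  "fraction R a b = {(c, d). c \<in> carrier R \<and> d \<in> carrier R - {\<zero>\<^bsub>R\<^esub>} \<and> a \<otimes>\<^bsub>R\<^esub> d = c \<otimes>\<^bsub>R\<^esub> b}"

text \<open>The unions below are over equal sets: the operations do not depend on representatives.\<close>

definition fraction_field :: "('a, 'm) ring_scheme \<Rightarrow> ('a \<times> 'a) set ring" where
  "fraction_field R =
     \<lparr>carrier = {fraction R a b | a b. a \<in> carrier R \<and> b \<in> carrier R - {\<zero>\<^bsub>R\<^esub>}},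
      monoid.mult = (\<lambda>P Q. \<Union>(a, b)\<in>P. \<Union>(c, d)\<in>Q. fraction R (a \<otimes>\<^bsub>R\<^esub> c) (b \<otimes>\<^bsub>R\<^esub> d)),
      one = fraction R \<one>\<^bsub>R\<^esub> \<one>\<^bsub>R\<^esub>,
      ring.zero = fraction R \<zero>\<^bsub>R\<^esub> \<one>\<^bsub>R\<^esub>,
      add = (\<lambda>P Q. \<Union>(a, b)\<in>P. \<Union>(c, d)\<in>Q.
               fraction R ((a \<otimes>\<^bsub>R\<^esub> d) \<oplus>\<^bsub>R\<^esub> (c \<otimes>\<^bsub>R\<^esub> b)) (b \<otimes>\<^bsub>R\<^esub> d))\<rparr>"

definition to_fraction :: "('a, 'm) ring_scheme \<Rightarrow> 'a \<Rightarrow> ('a \<times> 'a) set" where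
  "to_fraction R a = fraction R a \<one>\<^bsub>R\<^esub>"

text \<open>
  For a discrete valuation ring \<open>R\<close>, \<open>dvr_order\<close> is the exponent of the largest power of the
  maximal ideal containing a nonzero element, and \<open>dvr_valuation\<close> is the normalized discrete
  valuation it induces on the nonzero fractions.
\<close>

definition dvr_order :: "('a, 'm) ring_scheme \<Rightarrow> 'a \<Rightarrow> nat" where
  "dvr_order R a = (GREATEST n. a \<in> nonunits R [^]\<^bsub>ideals_set R\<^esub> n)"

definition dvr_valuation :: "('a, 'm) ring_scheme \<Rightarrow> ('a \<times> 'a) set \<Rightarrow> int" where
  "dvr_valuation R q = (THE z. \<exists>a b. a \<in> carrier R - {\<zero>\<^bsub>R\<^esub>} \<and> b \<in> carrier R - {\<zero>\<^bsub>R\<^esub>} \<and>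
     q = fraction R a b \<and> z = int (dvr_order R a) - int (dvr_order R b))"

type_synonym ('n, 'k) cgerm = "nat \<Rightarrow> ('n, 'k) germ set"
type_synonym ('n, 'k) lfrac = "(('n, 'k) cgerm \<times> ('n, 'k) cgerm) set"

definition complete_local_ring :: "('n::finite, 'k::field) ppoint set \<Rightarrow> ('n, 'k) ppoint \<Rightarrow>
    ('n, 'k) cgerm ring" where
  "complete_local_ring \<X> x = adic_completion (local_ring \<X> x) (nonunits (local_ring \<X> x))"

definition local_field :: "('n::finite, 'k::field) ppoint set \<Rightarrow> ('n, 'k) ppoint \<Rightarrow>
    ('n, 'k) lfrac ring" where
  "local_field \<X> x = fraction_field (complete_local_ring \<X> x)"

definition local_integers :: "('n::finite, 'k::field) ppoint set \<Rightarrow> ('n, 'k) ppoint \<Rightarrow>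
    ('n, 'k) lfrac set" where
  "local_integers \<X> x =
     to_fraction (complete_local_ring \<X> x) ` carrier (complete_local_ring \<X> x)"

definition local_const :: "('n::finite, 'k::field) ppoint set \<Rightarrow> ('n, 'k) ppoint \<Rightarrow>
    'k \<Rightarrow> ('n, 'k) lfrac" where
  "local_const \<X> x c = to_fraction (complete_local_ring \<X> x)
     (to_completion (local_ring \<X> x) (nonunits (local_ring \<X> x)) (const_germ \<X> x c))"

definition local_valuation :: "('n::finite, 'k::field) ppoint set \<Rightarrow> ('n, 'k) ppoint \<Rightarrow>
    ('n, 'k) lfrac \<Rightarrow> int" where
  "local_valuation \<X> x = dvr_valuation (complete_local_ring \<X> x)"

type_synonym ('n, 'k) adele = "('n, 'k) ppoint \<Rightarrow> ('n, 'k) lfrac"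

definition adele_ring :: "('n::finite, 'k::field) ppoint set \<Rightarrow> ('n, 'k) adele ring" where
  "adele_ring \<X> =
     \<lparr>carrier = {\<alpha> \<in> \<Pi>\<^sub>E x\<in>\<X>. carrier (local_field \<X> x). finite {x \<in> \<X>. \<alpha> x \<notin> local_integers \<X> x}},
      monoid.mult = (\<lambda>\<alpha> \<beta>. \<lambda>x\<in>\<X>. \<alpha> x \<otimes>\<^bsub>local_field \<X> x\<^esub> \<beta> x),
      one = (\<lambda>x\<in>\<X>. \<one>\<^bsub>local_field \<X> x\<^esub>),
      ring.zero = (\<lambda>x\<in>\<X>. \<zero>\<^bsub>local_field \<X> x\<^esub>),
      add = (\<lambda>\<alpha> \<beta>. \<lambda>x\<in>\<X>. \<alpha> x \<oplus>\<^bsub>local_field \<X> x\<^esub> \<beta> x)\<rparr>"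

definition adele_const :: "('n::finite, 'k::field) ppoint set \<Rightarrow> 'k \<Rightarrow> ('n, 'k) adele" where
  "adele_const \<X> c = (\<lambda>x\<in>\<X>. local_const \<X> x c)"


section \<open>Units modulo powers, and maps induced on classes\<close>

definition unit_powers :: "('a, 'm) ring_scheme \<Rightarrow> nat \<Rightarrow> 'a set" where
  "unit_powers R p = (\<lambda>u. u [^]\<^bsub>R\<^esub> p) ` Units R"

definition unit_classes :: "('a, 'm) ring_scheme \<Rightarrow> nat \<Rightarrow> 'a set monoid" where
  "unit_classes R p = units_of R Mod unit_powers R p"

definition unit_class :: "('a, 'm) ring_scheme \<Rightarrow> nat \<Rightarrow> 'a \<Rightarrow> 'a set" where
  "unit_class R p u = unit_powers R p #>\<^bsub>units_of R\<^esub> u"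

text \<open>\<open>induced f\<close> is meaningful on a set of classes where \<open>f\<close> is a \<open>class_function\<close>.\<close>

definition class_function :: "'a set set \<Rightarrow> ('a \<Rightarrow> 'b) \<Rightarrow> bool" where
  "class_function \<C> f \<longleftrightarrow> (\<forall>C\<in>\<C>. \<forall>u\<in>C. \<forall>w\<in>C. f u = f w)"

definition induced :: "('a \<Rightarrow> 'b) \<Rightarrow> 'a set \<Rightarrow> 'b" where
  "induced f C = the_elem (f ` C)"


section \<open>Projective modules and tensor products\<close>

text \<open>
  \<open>R\<^sup>(\<^sup>I\<^sup>)\<close> as an \<open>R\<close>-module. The record type requires the fields \<open>mult\<close> and \<open>one\<close>, which play no role.
\<close>

definition free_module :: "('r, 'm) ring_scheme \<Rightarrow> 'i set \<Rightarrow> ('r, 'i \<Rightarrow> 'r) module" where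
  "free_module R I =
     \<lparr>carrier = {f \<in> I \<rightarrow>\<^sub>E carrier R. finite {i \<in> I. f i \<noteq> \<zero>\<^bsub>R\<^esub>}},
      monoid.mult = (\<lambda>f g. \<lambda>i\<in>I. f i \<otimes>\<^bsub>R\<^esub> g i), one = (\<lambda>i\<in>I. \<one>\<^bsub>R\<^esub>),
      ring.zero = (\<lambda>i\<in>I. \<zero>\<^bsub>R\<^esub>), add = (\<lambda>f g. \<lambda>i\<in>I. f i \<oplus>\<^bsub>R\<^esub> g i),
      module.smult = (\<lambda>r f. \<lambda>i\<in>I. r \<otimes>\<^bsub>R\<^esub> f i)\<rparr>"

definition module_homs :: "('r, 'm) ring_scheme \<Rightarrow> ('r, 'a, 'c) module_scheme \<Rightarrow>
    ('r, 'b, 'd) module_scheme \<Rightarrow> ('a \<Rightarrow> 'b) set" where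
  "module_homs R M N = {f \<in> carrier M \<rightarrow> carrier N.
     (\<forall>a\<in>carrier M. \<forall>b\<in>carrier M. f (a \<oplus>\<^bsub>M\<^esub> b) = f a \<oplus>\<^bsub>N\<^esub> f b) \<and>
     (\<forall>r\<in>carrier R. \<forall>a\<in>carrier M. f (r \<odot>\<^bsub>M\<^esub> a) = r \<odot>\<^bsub>N\<^esub> f a)}"

text \<open>
  Projective: a direct summand of a free module. If \<open>M\<close> is a summand of any free module then the
  canonical surjection from the free module on \<open>carrier M\<close> splits, so it is no restriction that
  the basis lives in the type of the elements of \<open>M\<close>.
\<close>

definition projective_module :: "('r, 'm) ring_scheme \<Rightarrow> ('r, 'a, 'c) module_scheme \<Rightarrow> bool" where
  "projective_module R M \<longleftrightarrow> module R M \<and>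
     (\<exists>(I::'a set) i q. i \<in> module_homs R M (free_module R I) \<and>
        q \<in> module_homs R (free_module R I) M \<and> (\<forall>a\<in>carrier M. q (i a) = a))"

text \<open>
  The tensor product over \<open>R\<close> of commutative algebras \<open>(A, \<phi>)\<close> and \<open>(B, \<psi>)\<close>, given by their
  structure maps: the quotient of the integral monoid ring on the multiplicative monoid \<open>A \<times> B\<close> by
  the ideal of bilinearity relations (the subgroup they generate is already an ideal).
\<close>

definition pair_ring :: "('a, 'm) ring_scheme \<Rightarrow> ('b, 'n) ring_scheme \<Rightarrow> ('a \<times> 'b \<Rightarrow>\<^sub>0 int) ring" where
  "pair_ring A B =
     \<lparr>carrier = {c. Poly_Mapping.keys c \<subseteq> carrier A \<times> carrier B},
      monoid.mult = (\<lambda>c d. frag_extend (\<lambda>(a, b).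
         frag_extend (\<lambda>(a', b'). frag_of (a \<otimes>\<^bsub>A\<^esub> a', b \<otimes>\<^bsub>B\<^esub> b')) d) c),
      one = frag_of (\<one>\<^bsub>A\<^esub>, \<one>\<^bsub>B\<^esub>), ring.zero = 0, add = (+)\<rparr>"

definition tensor_ideal :: "('r, 'l) ring_scheme \<Rightarrow> ('a, 'm) ring_scheme \<Rightarrow> ('r \<Rightarrow> 'a) \<Rightarrow>
    ('b, 'n) ring_scheme \<Rightarrow> ('r \<Rightarrow> 'b) \<Rightarrow> ('a \<times> 'b \<Rightarrow>\<^sub>0 int) set" where
  "tensor_ideal R A \<phi> B \<psi> = Idl\<^bsub>pair_ring A B\<^esub>
     ({frag_of (a \<oplus>\<^bsub>A\<^esub> a', b) - frag_of (a, b) - frag_of (a', b) | a a' b.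
         a \<in> carrier A \<and> a' \<in> carrier A \<and> b \<in> carrier B} \<union>
      {frag_of (a, b \<oplus>\<^bsub>B\<^esub> b') - frag_of (a, b) - frag_of (a, b') | a b b'.
         a \<in> carrier A \<and> b \<in> carrier B \<and> b' \<in> carrier B} \<union>
      {frag_of (\<phi> r \<otimes>\<^bsub>A\<^esub> a, b) - frag_of (a, \<psi> r \<otimes>\<^bsub>B\<^esub> b) | r a b.
         r \<in> carrier R \<and> a \<in> carrier A \<and> b \<in> carrier B})"

definition tensor :: "('r, 'l) ring_scheme \<Rightarrow> ('a, 'm) ring_scheme \<Rightarrow> ('r \<Rightarrow> 'a) \<Rightarrow>
    ('b, 'n) ring_scheme \<Rightarrow> ('r \<Rightarrow> 'b) \<Rightarrow> ('a \<times> 'b \<Rightarrow>\<^sub>0 int) set ring" where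
  "tensor R A \<phi> B \<psi> = pair_ring A B Quot tensor_ideal R A \<phi> B \<psi>"

definition pure_tensor :: "('r, 'l) ring_scheme \<Rightarrow> ('a, 'm) ring_scheme \<Rightarrow> ('r \<Rightarrow> 'a) \<Rightarrow>
    ('b, 'n) ring_scheme \<Rightarrow> ('r \<Rightarrow> 'b) \<Rightarrow> 'a \<Rightarrow> 'b \<Rightarrow> ('a \<times> 'b \<Rightarrow>\<^sub>0 int) set" where
  "pure_tensor R A \<phi> B \<psi> a b = tensor_ideal R A \<phi> B \<psi> +>\<^bsub>pair_ring A B\<^esub> frag_of (a, b)"

text \<open>The map \<open>A \<otimes>\<^sub>R A \<rightarrow> A\<close> given by multiplication, evaluated on representatives.\<close>

definition tensor_mult :: "('a, 'm) ring_scheme \<Rightarrow> ('a \<times> 'a \<Rightarrow>\<^sub>0 int) set \<Rightarrow> 'a" where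
  "tensor_mult A = induced (\<lambda>c. \<Oplus>\<^bsub>A\<^esub>z\<in>Poly_Mapping.keys c.
     add_pow A (Poly_Mapping.lookup c z) (fst z \<otimes>\<^bsub>A\<^esub> snd z))"

definition enveloping_module :: "('a, 'm) ring_scheme \<Rightarrow> (('a \<times> 'a \<Rightarrow>\<^sub>0 int) set, 'a) module" where
  "enveloping_module A =
     \<lparr>carrier = carrier A, monoid.mult = monoid.mult A, one = monoid.one A, ring.zero = ring.zero A, add = add A,
      module.smult = (\<lambda>C a. tensor_mult A C \<otimes>\<^bsub>A\<^esub> a)\<rparr>"

definition separable_algebra :: "('r, 'l) ring_scheme \<Rightarrow> ('a, 'm) ring_scheme \<Rightarrow> ('r \<Rightarrow> 'a) \<Rightarrow> bool" where
  "separable_algebra R A \<phi> \<longleftrightarrow> projective_module (tensor R A \<phi> A \<phi>) (enveloping_module A)"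


section \<open>Galois extensions\<close>

text \<open>A ring with a structure map from \<open>R\<close> and an operation of \<open>G\<close>.\<close>

record ('r, 'g, 's) gext = "'s ring" +
  base_map :: "'r \<Rightarrow> 's"
  g_action :: "'g \<Rightarrow> 's \<Rightarrow> 's"

definition galois_ext :: "('r, 'l) ring_scheme \<Rightarrow> ('g, 'm) monoid_scheme \<Rightarrow>
    ('r, 'g, 's) gext \<Rightarrow> bool" where
  "galois_ext R G S \<longleftrightarrow>
     cring R \<and> cring S \<and> base_map S \<in> ring_hom R S \<and> inj_on (base_map S) (carrier R) \<and>
     finite (carrier G) \<and> faithful_action G (carrier S) (g_action S) \<and>
     (\<forall>g\<in>carrier G. g_action S g \<in> ring_iso S S \<and>
        (\<forall>r\<in>carrier R. g_action S g (base_map S r) = base_map S r)) \<and>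
     {s \<in> carrier S. \<forall>g\<in>carrier G. g_action S g s = s} = base_map S ` carrier R \<and>
     separable_algebra R S (base_map S) \<and>
     (\<forall>g\<in>carrier G. \<forall>h\<in>carrier G. g \<noteq> h \<longrightarrow>
        (\<forall>e\<in>carrier S. e \<otimes>\<^bsub>S\<^esub> e = e \<and> e \<noteq> \<zero>\<^bsub>S\<^esub> \<longrightarrow>
           (\<exists>s\<in>carrier S. g_action S g s \<otimes>\<^bsub>S\<^esub> e \<noteq> g_action S h s \<otimes>\<^bsub>S\<^esub> e)))"

definition gext_iso :: "('r, 'l) ring_scheme \<Rightarrow> ('g, 'm) monoid_scheme \<Rightarrow>
    ('r, 'g, 's) gext \<Rightarrow> ('r, 'g, 't) gext \<Rightarrow> bool" where
  "gext_iso R G S T \<longleftrightarrow> (\<exists>f \<in> ring_iso S T.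
     (\<forall>r\<in>carrier R. f (base_map S r) = base_map T r) \<and>
     (\<forall>g\<in>carrier G. \<forall>s\<in>carrier S. f (g_action S g s) = g_action T g (f s)))"

text \<open>
  \<open>\<Bbbk>\<close>-algebras are given by a ring \<open>R\<close> together with its structure map \<open>\<iota>\<close>. In the Kummer extension
  the group acts through the substitution \<open>T \<mapsto> \<chi>(g)T\<close>, which preserves the ideal that is divided
  out, so the image of a coset is a coset.
\<close>

definition kummer_ext :: "('r, 'l) ring_scheme \<Rightarrow> ('k \<Rightarrow> 'r) \<Rightarrow> ('g \<Rightarrow> 'k) \<Rightarrow> nat \<Rightarrow> 'r \<Rightarrow>
    ('r, 'g, (nat \<Rightarrow> 'r) set) gext" where
  "kummer_ext R \<iota> \<chi> p u =
     (let P = UP R;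
          J = PIdl\<^bsub>P\<^esub> (up_ring.monom P \<one>\<^bsub>R\<^esub> p \<ominus>\<^bsub>P\<^esub> up_ring.monom P u 0);
          subst = (\<lambda>g. UnivPoly.eval R P (\<lambda>a. up_ring.monom P a 0) (up_ring.monom P (\<iota> (\<chi> g)) 1))
      in ring.extend (P Quot J)
           (gext.fields (\<lambda>r. J +>\<^bsub>P\<^esub> up_ring.monom P r 0)
              (\<lambda>g. \<lambda>C\<in>carrier (P Quot J). subst g ` C)))"

definition base_change :: "('r, 'l) ring_scheme \<Rightarrow> ('r, 'g, 's) gext \<Rightarrow>
    ('b, 'm) ring_scheme \<Rightarrow> ('r \<Rightarrow> 'b) \<Rightarrow> ('b, 'g, ('s \<times> 'b \<Rightarrow>\<^sub>0 int) set) gext" where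
  "base_change R S B \<psi> =
     (let T = tensor R S (base_map S) B \<psi>
      in ring.extend T
           (gext.fields (pure_tensor R S (base_map S) B \<psi> \<one>\<^bsub>S\<^esub>)
              (\<lambda>g. \<lambda>C\<in>carrier T. frag_extend (\<lambda>(s, b). frag_of (g_action S g s, b)) ` C)))"


section \<open>The Harrison group\<close>

abbreviation scalar_group :: "'k::field monoid" where
  "scalar_group \<equiv> units_of (ring_of_type_algebra :: 'k ring)"

text \<open>\<open>Hom(G, \<mu>\<^sub>p)\<close>; characters are normalized outside the carrier to be determined by their values.\<close>

definition characters :: "('g, 'm) monoid_scheme \<Rightarrow> nat \<Rightarrow> ('g \<Rightarrow> 'k::field) set" where
  "characters G p = {\<psi> \<in> hom G scalar_group.
     \<psi> \<in> extensional (carrier G) \<and> (\<forall>g\<in>carrier G. \<psi> g ^ p = 1)}"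

definition isotypic :: "('k::field \<Rightarrow> 'r) \<Rightarrow> ('g, 'm) monoid_scheme \<Rightarrow> ('r, 'g, 's) gext \<Rightarrow>
    ('g \<Rightarrow> 'k) \<Rightarrow> 's set" where
  "isotypic \<iota> G S \<psi> = {s \<in> carrier S. \<forall>g\<in>carrier G.
     g_action S g s = base_map S (\<iota> (\<psi> g)) \<otimes>\<^bsub>S\<^esub> s}"

text \<open>
  \<open>comp \<psi>\<close> is the image of \<open>S\<^sub>1\<^sup>\<psi> \<otimes>\<^sub>R S\<^sub>2\<^sup>\<psi>\<close> in \<open>S\<^sub>1 \<otimes>\<^sub>R S\<^sub>2\<close>.
\<close>

definition harrison_product :: "('r, 'l) ring_scheme \<Rightarrow> ('k::field \<Rightarrow> 'r) \<Rightarrow> ('g, 'm) monoid_scheme \<Rightarrow>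
    nat \<Rightarrow> ('r, 'g, 's) gext \<Rightarrow> ('r, 'g, 't) gext \<Rightarrow> ('r, 'g, ('s \<times> 't \<Rightarrow>\<^sub>0 int) set) gext" where
  "harrison_product R \<iota> G p S1 S2 =
     (let T = tensor R S1 (base_map S1) S2 (base_map S2);
          pure = pure_tensor R S1 (base_map S1) S2 (base_map S2);
          comp = (\<lambda>\<psi>. generate (add_monoid T)
                    {pure a b | a b. a \<in> isotypic \<iota> G S1 \<psi> \<and> b \<in> isotypic \<iota> G S2 \<psi>});
          base = (\<lambda>r. pure (base_map S1 r) \<one>\<^bsub>S2\<^esub>);
          D = {\<Oplus>\<^bsub>T\<^esub>\<psi>\<in>characters G p. c \<psi> | c. c \<in> Pi (characters G p) comp}
      in ring.extend (T\<lparr>carrier := D\<rparr>)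
           (gext.fields base
              (\<lambda>g. \<lambda>z\<in>D. THE y. \<exists>c \<in> Pi (characters G p) comp.
                 z = (\<Oplus>\<^bsub>T\<^esub>\<psi>\<in>characters G p. c \<psi>) \<and>
                 y = (\<Oplus>\<^bsub>T\<^esub>\<psi>\<in>characters G p. base (\<iota> (\<psi> g)) \<otimes>\<^bsub>T\<^esub> c \<psi>))))"

text \<open>
  Isomorphism classes are formed among the extensions whose elements lie in \<open>('r, 's) universe\<close>.
  The right summand holds the quotients of the polynomial ring over \<open>R\<close>, and a Galois extension is
  a finitely generated \<open>R\<close>-module, so every Galois extension has an isomorphic copy there. The left
  summand is an arbitrary type \<open>'s\<close>, so that extensions on any given type are themselves included
  up to renaming of their elements. The representative \<open>T\<close> of a class may have any type.
\<close>

type_synonym ('r, 's) universe = "'s + (nat \<Rightarrow> 'r) set"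
type_synonym ('r, 'g, 's) gclass = "('r, 'g, ('r, 's) universe) gext set"

definition harrison_class :: "('r, 'l) ring_scheme \<Rightarrow> ('g, 'm) monoid_scheme \<Rightarrow>
    ('r, 'g, 't) gext \<Rightarrow> ('r, 'g, 's) gclass" where
  "harrison_class R G T = {S. galois_ext R G S \<and> gext_iso R G S T}"

definition harrison_classes :: "('r, 'l) ring_scheme \<Rightarrow> ('g, 'm) monoid_scheme \<Rightarrow>
    ('r, 'g, 's) gclass set" where
  "harrison_classes R G =
     {harrison_class R G S | S :: ('r, 'g, ('r, 's) universe) gext. galois_ext R G S}"

definition harrison_mult :: "('r, 'l) ring_scheme \<Rightarrow> ('k::field \<Rightarrow> 'r) \<Rightarrow> ('g, 'm) monoid_scheme \<Rightarrow>
    nat \<Rightarrow> ('r, 'g, 's) gclass \<Rightarrow> ('r, 'g, 's) gclass \<Rightarrow> ('r, 'g, 's) gclass" where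
  "harrison_mult R \<iota> G p A B =
     (\<Union>S1\<in>A. \<Union>S2\<in>B. harrison_class R G (harrison_product R \<iota> G p S1 S2))"

text \<open>The unit of the group is determined by the multiplication.\<close>

definition harrison_group :: "('r, 'l) ring_scheme \<Rightarrow> ('k::field \<Rightarrow> 'r) \<Rightarrow> ('g, 'm) monoid_scheme \<Rightarrow>
    nat \<Rightarrow> ('r, 'g, 's) gclass monoid" where
  "harrison_group R \<iota> G p =
     \<lparr>carrier = harrison_classes R G, monoid.mult = harrison_mult R \<iota> G p,
      one = (THE E. E \<in> harrison_classes R G \<and>
               (\<forall>A\<in>harrison_classes R G. harrison_mult R \<iota> G p E A = A \<and> harrison_mult R \<iota> G p A E = A))\<rparr>"

end

theory Submission
  imports Defs
begin

text \<open>
  At a point \<open>x\<close> of the curve the coordinate germs generate the maximal ideal, so by Nakayama's lemma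
  the one-dimensional cotangent space yields a single generator \<open>t\<close>. Expanding germs successively in
  powers of \<open>t\<close> identifies the completed local ring with the power series ring over \<open>\<Bbbk>\<close> and
  \<open>K\<^sub>x\<close> with the Laurent series field. Since \<open>p\<close> is invertible and \<open>\<Bbbk>\<close> algebraically closed, a
  power series with nonzero constant term is a \<open>p\<close>th power; hence units of \<open>K\<^sub>x\<close>, and of the adele ring
  componentwise, are classified modulo \<open>p\<close>th powers by their valuations modulo \<open>p\<close>.

  Let \<open>R\<close> be a local field or the adele ring. As \<open>R\<close> contains \<open>1/p\<close> and the \<open>p\<close>th roots of unity, a
  Galois extension \<open>S\<close> with group \<open>C\<^sub>p\<close> is the sum of its isotypic parts, and separability provides
  \<open>x\<^sub>i \<in> S\<^sup>\<chi>\<close> and \<open>y\<^sub>i\<close> in the part of the inverse character with \<open>\<Sum> x\<^sub>i y\<^sub>i = 1\<close>. Choosing a suitable summand at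
  each place separately produces a unit \<open>a \<in> S\<^sup>\<chi>\<close>, so that \<open>S\<close> is the Kummer extension \<open>R[a]\<close> with
  \<open>u = a\<^sup>p\<close>, and \<open>u\<close> is unique up to \<open>p\<close>th powers of units. In the product of two Kummer extensions
  generated by \<open>a\<close> and \<open>b\<close> the element \<open>a \<otimes> b\<close> is a generator, and in a base change \<open>a \<otimes> 1\<close> is one;
  this gives the group isomorphisms and the right square. The left square is immediate, and the
  injectivity of the vertical maps follows from the diagram.
\<close>

section \<open>Tensor products of algebras\<close>

text \<open>The algebras to be compared live on unrelated types, and the universe of a Harrison
  group is only one of them. Hence everything goes through \<open>kummer_gen S u a\<close>: the
  algebra \<open>S\<close> has a generator \<open>a\<close> with \<open>a^p = u\<close>, a power
  basis, and the action through \<chi>. Such a generator is found separately for the polynomial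
  quotient, the product, the base change and every Galois extension, and algebras with the same
  \<open>u\<close> are then isomorphic. The group axioms of the Harrison group are not checked on
  extensions; they are transported from the units modulo powers.

  The adele ring is not a field, and infinitely many places are treated at once, so local choices
  need control of valuations. If integral series sum to 1, one of their constant terms is nonzero,
  so the chosen summand can be taken of valuation 0 at almost all places; this makes the local
  choices an idele. In the same way a componentwise \<open>p\<close>-th root of an idele is an
  idele, as its valuations are the given ones divided by \<open>p\<close>.\<close>

lemma frag_extend_add_fun:
  "frag_extend (\<lambda>x. f x + g x) c = frag_extend f c + frag_extend g c"
  by (simp add: frag_extend_def frag_cmul_distrib2 sum.distrib)

lemma frag_extend_minus_fun:
  fixes f :: "'a \<Rightarrow> 'b \<Rightarrow>\<^sub>0 int"
  shows "frag_extend (\<lambda>x. - f x) c = - frag_extend f c"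
proof -
  have "frag_cmul k (- y) = - frag_cmul k y" for k :: int and y :: "'b \<Rightarrow>\<^sub>0 int"
    by (rule poly_mapping_eqI) (simp only: lookup_frag_cmul lookup_uminus mult_minus_right)
  then show ?thesis
    unfolding frag_extend_def by (simp only: sum_negf)
qed

lemma frag_extend_diff_fun:
  "frag_extend (\<lambda>x. f x - g x) c = frag_extend f c - frag_extend g c"
  using frag_extend_add_fun[of f "\<lambda>x. - g x" c] by (simp add: frag_extend_minus_fun)

lemma frag_extend_zero_fun: "frag_extend (\<lambda>x. 0) c = 0"
  by (simp add: frag_extend_def)

lemma (in abelian_group) a_group_hom_diff:
  assumes "h \<in> hom (add_monoid G) (add_monoid C)" "abelian_group C" "x \<in> carrier G" "y \<in> carrier G"
  shows "h (x \<ominus> y) = h x \<ominus>\<^bsub>C\<^esub> h y"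
proof -
  interpret C: abelian_group C by fact
  interpret group_hom "add_monoid G" "add_monoid C" h
    using assms by (simp add: group_hom_def group_hom_axioms_def a_group C.a_group)
  show ?thesis
    using assms hom_mult[of x "\<ominus> y"] hom_inv[of y]
    by (simp add: a_minus_def a_inv_def)
qed

section \<open>The integral monoid ring on pairs\<close>

locale ring_pair = A: cring A + B: cring B
  for A :: "('a, 'm) ring_scheme" (structure) and B :: "('b, 'n) ring_scheme" (structure)
begin

abbreviation "P \<equiv> pair_ring A B"

lemma pair_carrier: "c \<in> carrier P \<longleftrightarrow> Poly_Mapping.keys c \<subseteq> carrier A \<times> carrier B"
  by (simp add: pair_ring_def)

text \<open>A finitely supported integral combination is reached from generators by differences
  alone, so one case serves for sums and negatives. The ring laws of \<open>pair_ring\<close>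
  thereby reduce to generators in each variable.\<close>

lemma pair_induct [consumes 1, case_names zero one diff]:
  assumes "c \<in> carrier P" "Q 0"
    and "\<And>a b. a \<in> carrier A \<Longrightarrow> b \<in> carrier B \<Longrightarrow> Q (frag_of (a, b))"
    and "\<And>x y. x \<in> carrier P \<Longrightarrow> y \<in> carrier P \<Longrightarrow> Q x \<Longrightarrow> Q y \<Longrightarrow> Q (x - y)"
  shows "Q c"
proof -
  have "c \<in> carrier P \<and> Q c" if "Poly_Mapping.keys c \<subseteq> carrier A \<times> carrier B"
    using that
  proof (induction c rule: frag_induction)
    case (diff a b)
    then show ?case
      by (auto simp: assms(4) pair_carrier dest: subsetD[OF keys_diff])
  qed (auto simp: assms pair_carrier)
  with assms(1) show ?thesis by (simp add: pair_carrier)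
qed

lemma pair_simps:
  "x \<oplus>\<^bsub>P\<^esub> y = x + y" "\<zero>\<^bsub>P\<^esub> = 0" "\<one>\<^bsub>P\<^esub> = frag_of (\<one>\<^bsub>A\<^esub>, \<one>\<^bsub>B\<^esub>)"
  "frag_of (a, b) \<otimes>\<^bsub>P\<^esub> frag_of (a', b') = frag_of (a \<otimes>\<^bsub>A\<^esub> a', b \<otimes>\<^bsub>B\<^esub> b')"
  "(x - y) \<otimes>\<^bsub>P\<^esub> z = x \<otimes>\<^bsub>P\<^esub> z - y \<otimes>\<^bsub>P\<^esub> z"
  "z \<otimes>\<^bsub>P\<^esub> (x - y) = z \<otimes>\<^bsub>P\<^esub> x - z \<otimes>\<^bsub>P\<^esub> y"
  "(x + y) \<otimes>\<^bsub>P\<^esub> z = x \<otimes>\<^bsub>P\<^esub> z + y \<otimes>\<^bsub>P\<^esub> z"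
  "z \<otimes>\<^bsub>P\<^esub> (x + y) = z \<otimes>\<^bsub>P\<^esub> x + z \<otimes>\<^bsub>P\<^esub> y"
  "0 \<otimes>\<^bsub>P\<^esub> z = 0" "z \<otimes>\<^bsub>P\<^esub> 0 = 0"
  by (simp_all add: pair_ring_def frag_extend_diff frag_extend_add case_prod_unfold
      frag_extend_diff_fun frag_extend_add_fun frag_extend_zero_fun)

lemma pair_closed [simp]:
  "a \<in> carrier A \<Longrightarrow> b \<in> carrier B \<Longrightarrow> frag_of (a, b) \<in> carrier P"
  "0 \<in> carrier P"
  "x \<in> carrier P \<Longrightarrow> y \<in> carrier P \<Longrightarrow> x + y \<in> carrier P"
  "x \<in> carrier P \<Longrightarrow> y \<in> carrier P \<Longrightarrow> x - y \<in> carrier P"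
  "x \<in> carrier P \<Longrightarrow> - x \<in> carrier P"
  by (auto simp: pair_carrier dest: subsetD[OF keys_diff] subsetD[OF keys_add])

lemma pair_mult_closed [simp]:
  assumes "x \<in> carrier P" "y \<in> carrier P"
  shows "x \<otimes>\<^bsub>P\<^esub> y \<in> carrier P"
  using assms(1)
proof (induction rule: pair_induct)
  case (one a b)
  show ?case
    using assms(2) by (induction rule: pair_induct) (use one in \<open>simp_all add: pair_simps\<close>)
qed (simp_all add: pair_simps)

lemma pair_assoc:
  assumes "x \<in> carrier P" "y \<in> carrier P" "z \<in> carrier P"
  shows "x \<otimes>\<^bsub>P\<^esub> y \<otimes>\<^bsub>P\<^esub> z = x \<otimes>\<^bsub>P\<^esub> (y \<otimes>\<^bsub>P\<^esub> z)"
  using assms(1)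
proof (induction rule: pair_induct)
  case (one a b)
  note ab = this
  show ?case
    using assms(2)
  proof (induction rule: pair_induct)
    case (one a' b')
    show ?case
      using assms(3) by (induction rule: pair_induct)
        (use one ab in \<open>simp_all add: pair_simps A.m_assoc B.m_assoc\<close>)
  qed (simp_all add: pair_simps)
qed (simp_all add: pair_simps)

lemma pair_comm:
  assumes "x \<in> carrier P" "y \<in> carrier P"
  shows "x \<otimes>\<^bsub>P\<^esub> y = y \<otimes>\<^bsub>P\<^esub> x"
  using assms(1)
proof (induction rule: pair_induct)
  case (one a b)
  show ?case
    using assms(2) by (induction rule: pair_induct)
      (use one in \<open>simp_all add: pair_simps A.m_comm B.m_comm\<close>)
qed (simp_all add: pair_simps)

lemma pair_one:
  assumes "x \<in> carrier P"
  shows "\<one>\<^bsub>P\<^esub> \<otimes>\<^bsub>P\<^esub> x = x"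
  using assms by (induction rule: pair_induct) (simp_all add: pair_simps)

sublocale P: cring P
proof (rule cringI)
  show "abelian_group P"
    by (rule abelian_groupI)
      (auto simp: pair_simps add.assoc add.commute intro!: bexI[of _ "- _"])
  show "comm_monoid P"
  proof (rule comm_monoidI)
    show "\<one>\<^bsub>P\<^esub> \<in> carrier P" by (simp add: pair_simps)
  qed (simp_all add: pair_assoc pair_one, rule pair_comm)
qed (simp add: pair_simps)

lemma pair_a_inv [simp]: "x \<in> carrier P \<Longrightarrow> \<ominus>\<^bsub>P\<^esub> x = - x"
  by (rule P.minus_equality) (auto simp: pair_simps)

lemma pair_minus [simp]: "x \<in> carrier P \<Longrightarrow> y \<in> carrier P \<Longrightarrow> x \<ominus>\<^bsub>P\<^esub> y = x - y"
  by (simp add: a_minus_def pair_simps)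

end

section \<open>The tensor product as a quotient ring and its universal property\<close>

locale algebra_pair = ring_pair A B + R: cring R
  for R :: "('r, 'l) ring_scheme" (structure)
    and A :: "('a, 'm) ring_scheme" (structure) and B :: "('b, 'n) ring_scheme" (structure) +
  fixes \<phi> :: "'r \<Rightarrow> 'a" and \<psi> :: "'r \<Rightarrow> 'b"
  assumes phi: "\<phi> \<in> ring_hom R A" and psi: "\<psi> \<in> ring_hom R B"
begin

abbreviation "I \<equiv> tensor_ideal R A \<phi> B \<psi>"
abbreviation "T \<equiv> tensor R A \<phi> B \<psi>"
abbreviation "pure \<equiv> pure_tensor R A \<phi> B \<psi>"

lemma phi_closed [simp]: "r \<in> carrier R \<Longrightarrow> \<phi> r \<in> carrier A"
  by (rule ring_hom_closed[OF phi])

lemma psi_closed [simp]: "r \<in> carrier R \<Longrightarrow> \<psi> r \<in> carrier B"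
  by (rule ring_hom_closed[OF psi])

text \<open>The relations of \<open>tensor_ideal\<close> are named so that inclusions can be checked
  on them before passing to the generated ideal.\<close>

definition gens where
  "gens = {frag_of (a \<oplus>\<^bsub>A\<^esub> a', b) - frag_of (a, b) - frag_of (a', b) | a a' b.
         a \<in> carrier A \<and> a' \<in> carrier A \<and> b \<in> carrier B} \<union>
      {frag_of (a, b \<oplus>\<^bsub>B\<^esub> b') - frag_of (a, b) - frag_of (a, b') | a b b'.
         a \<in> carrier A \<and> b \<in> carrier B \<and> b' \<in> carrier B} \<union>
      {frag_of (\<phi> r \<otimes>\<^bsub>A\<^esub> a, b) - frag_of (a, \<psi> r \<otimes>\<^bsub>B\<^esub> b) | r a b.
         r \<in> carrier R \<and> a \<in> carrier A \<and> b \<in> carrier B}"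

lemma gens_carrier: "gens \<subseteq> carrier P"
  by (auto simp: gens_def)

lemma I_eq: "I = Idl\<^bsub>P\<^esub> gens"
  by (simp add: tensor_ideal_def gens_def)

sublocale I: ideal I P
  unfolding I_eq by (rule P.genideal_ideal[OF gens_carrier])

lemma gens_I: "gens \<subseteq> I"
  unfolding I_eq by (rule P.genideal_self[OF gens_carrier])

sublocale T: cring T
  unfolding tensor_def by (rule I.quotient_is_cring) (rule P.is_cring)

lemma coset_hom: "(+>\<^bsub>P\<^esub>) I \<in> ring_hom P T"
  unfolding tensor_def by (rule I.rcos_ring_hom)

lemma coset_eq_iff:
  "x \<in> carrier P \<Longrightarrow> y \<in> carrier P \<Longrightarrow> I +>\<^bsub>P\<^esub> x = I +>\<^bsub>P\<^esub> y \<longleftrightarrow> x - y \<in> I"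
  using P.quotient_eq_iff_same_a_r_cos[OF I.is_ideal, of x y] by simp

lemma T_cases:
  assumes "W \<in> carrier T"
  obtains c where "c \<in> carrier P" "W = I +>\<^bsub>P\<^esub> c"
  using assms by (auto simp: tensor_def FactRing_def A_RCOSETS_def')

lemma pure_eq: "pure a b = I +>\<^bsub>P\<^esub> frag_of (a, b)"
  by (simp add: pure_tensor_def)

lemma coset_closed [simp]: "c \<in> carrier P \<Longrightarrow> I +>\<^bsub>P\<^esub> c \<in> carrier T"
  by (rule ring_hom_closed[OF coset_hom])

lemma coset_diff:
  "x \<in> carrier P \<Longrightarrow> y \<in> carrier P \<Longrightarrow> I +>\<^bsub>P\<^esub> (x - y) = (I +>\<^bsub>P\<^esub> x) \<ominus>\<^bsub>T\<^esub> (I +>\<^bsub>P\<^esub> y)"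
proof -
  interpret ring_hom_cring P T "(+>\<^bsub>P\<^esub>) I"
    by (rule ring_hom_cringI[OF P.is_cring T.is_cring coset_hom])
  assume "x \<in> carrier P" "y \<in> carrier P"
  then show ?thesis
    using hom_add[of x "\<ominus>\<^bsub>P\<^esub> y"] hom_a_inv[of y] by (simp add: a_minus_def pair_simps)
qed

lemma pure_closed [simp]: "a \<in> carrier A \<Longrightarrow> b \<in> carrier B \<Longrightarrow> pure a b \<in> carrier T"
  by (simp add: pure_eq)

lemma pure_one: "pure \<one>\<^bsub>A\<^esub> \<one>\<^bsub>B\<^esub> = \<one>\<^bsub>T\<^esub>"
  using ring_hom_one[OF coset_hom] by (simp add: pure_eq pair_simps)

lemma pure_mult:
  "\<lbrakk>a \<in> carrier A; a' \<in> carrier A; b \<in> carrier B; b' \<in> carrier B\<rbrakk> \<Longrightarrow>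
   pure a b \<otimes>\<^bsub>T\<^esub> pure a' b' = pure (a \<otimes>\<^bsub>A\<^esub> a') (b \<otimes>\<^bsub>B\<^esub> b')"
  using ring_hom_mult[OF coset_hom, of "frag_of (a, b)" "frag_of (a', b')"]
  by (simp add: pure_eq pair_simps)

lemma pure_add_left:
  assumes "a \<in> carrier A" "a' \<in> carrier A" "b \<in> carrier B"
  shows "pure (a \<oplus>\<^bsub>A\<^esub> a') b = pure a b \<oplus>\<^bsub>T\<^esub> pure a' b"
proof -
  have "frag_of (a \<oplus>\<^bsub>A\<^esub> a', b) - (frag_of (a, b) + frag_of (a', b)) \<in> I"
    unfolding diff_diff_eq[symmetric]
    by (rule subsetD[OF gens_I]) (use assms in \<open>auto simp: gens_def\<close>)
  then have "I +>\<^bsub>P\<^esub> frag_of (a \<oplus>\<^bsub>A\<^esub> a', b) = I +>\<^bsub>P\<^esub> (frag_of (a, b) + frag_of (a', b))"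
    using assms coset_eq_iff by simp
  then show ?thesis
    using assms ring_hom_add[OF coset_hom, of "frag_of (a, b)" "frag_of (a', b)"]
    by (simp add: pure_eq pair_simps)
qed

lemma pure_add_right:
  assumes "a \<in> carrier A" "b \<in> carrier B" "b' \<in> carrier B"
  shows "pure a (b \<oplus>\<^bsub>B\<^esub> b') = pure a b \<oplus>\<^bsub>T\<^esub> pure a b'"
proof -
  have "frag_of (a, b \<oplus>\<^bsub>B\<^esub> b') - (frag_of (a, b) + frag_of (a, b')) \<in> I"
    unfolding diff_diff_eq[symmetric]
    by (rule subsetD[OF gens_I]) (use assms in \<open>auto simp: gens_def\<close>)
  then have "I +>\<^bsub>P\<^esub> frag_of (a, b \<oplus>\<^bsub>B\<^esub> b') = I +>\<^bsub>P\<^esub> (frag_of (a, b) + frag_of (a, b'))"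
    using assms coset_eq_iff by simp
  then show ?thesis
    using assms ring_hom_add[OF coset_hom, of "frag_of (a, b)" "frag_of (a, b')"]
    by (simp add: pure_eq pair_simps)
qed

lemma pure_balanced:
  assumes "r \<in> carrier R" "a \<in> carrier A" "b \<in> carrier B"
  shows "pure (\<phi> r \<otimes>\<^bsub>A\<^esub> a) b = pure a (\<psi> r \<otimes>\<^bsub>B\<^esub> b)"
proof -
  have "frag_of (\<phi> r \<otimes>\<^bsub>A\<^esub> a, b) - frag_of (a, \<psi> r \<otimes>\<^bsub>B\<^esub> b) \<in> I"
    by (rule subsetD[OF gens_I]) (use assms in \<open>auto simp: gens_def\<close>)
  then show ?thesis
    using assms coset_eq_iff by (simp add: pure_eq)
qed

lemma left_hom: "(\<lambda>a. pure a \<one>\<^bsub>B\<^esub>) \<in> ring_hom A T"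
  by (rule ring_hom_memI) (simp_all add: pure_mult pure_add_left pure_one)

lemma right_hom: "(\<lambda>b. pure \<one>\<^bsub>A\<^esub> b) \<in> ring_hom B T"
  by (rule ring_hom_memI) (simp_all add: pure_mult pure_add_right pure_one)

lemma pure_split:
  "a \<in> carrier A \<Longrightarrow> b \<in> carrier B \<Longrightarrow> pure a b = pure a \<one>\<^bsub>B\<^esub> \<otimes>\<^bsub>T\<^esub> pure \<one>\<^bsub>A\<^esub> b"
  by (simp add: pure_mult)

lemma pure_base: "r \<in> carrier R \<Longrightarrow> pure (\<phi> r) \<one>\<^bsub>B\<^esub> = pure \<one>\<^bsub>A\<^esub> (\<psi> r)"
  using pure_balanced[of r "\<one>\<^bsub>A\<^esub>" "\<one>\<^bsub>B\<^esub>"] by simp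

lemma tensor_induct [consumes 1, case_names zero pure diff]:
  assumes "W \<in> carrier T" "Q \<zero>\<^bsub>T\<^esub>"
    and "\<And>a b. a \<in> carrier A \<Longrightarrow> b \<in> carrier B \<Longrightarrow> Q (pure a b)"
    and "\<And>x y. x \<in> carrier T \<Longrightarrow> y \<in> carrier T \<Longrightarrow> Q x \<Longrightarrow> Q y \<Longrightarrow> Q (x \<ominus>\<^bsub>T\<^esub> y)"
  shows "Q W"
proof -
  obtain c where c: "c \<in> carrier P" "W = I +>\<^bsub>P\<^esub> c"
    using assms(1) by (rule T_cases)
  have "Q (I +>\<^bsub>P\<^esub> c)"
    using c(1)
  proof (induction rule: pair_induct)
    case zero
    have "I +>\<^bsub>P\<^esub> 0 = \<zero>\<^bsub>T\<^esub>"
      using ring_hom_zero[OF coset_hom P.ring_axioms T.ring_axioms] by (simp add: pair_simps)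
    then show ?case using assms(2) by simp
  next
    case (diff x y)
    then show ?case using assms(4) by (simp add: coset_diff)
  qed (simp add: assms(3) flip: pure_eq)
  with c show ?thesis by simp
qed

text \<open>A universal property with additive targets, although the relations are imposed through a
  ring ideal. The last conclusion evaluates the map on an arbitrary representative, which is the
  form in which \<open>tensor_mult\<close> is defined.\<close>

lemma tensor_lift:
  assumes C: "abelian_group C"
    and closed: "\<And>a b. a \<in> carrier A \<Longrightarrow> b \<in> carrier B \<Longrightarrow> \<beta> a b \<in> carrier C"
    and addl: "\<And>a a' b. a \<in> carrier A \<Longrightarrow> a' \<in> carrier A \<Longrightarrow> b \<in> carrier B \<Longrightarrow>
      \<beta> (a \<oplus>\<^bsub>A\<^esub> a') b = \<beta> a b \<oplus>\<^bsub>C\<^esub> \<beta> a' b"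
    and addr: "\<And>a b b'. a \<in> carrier A \<Longrightarrow> b \<in> carrier B \<Longrightarrow> b' \<in> carrier B \<Longrightarrow>
      \<beta> a (b \<oplus>\<^bsub>B\<^esub> b') = \<beta> a b \<oplus>\<^bsub>C\<^esub> \<beta> a b'"
    and bal: "\<And>r a b. r \<in> carrier R \<Longrightarrow> a \<in> carrier A \<Longrightarrow> b \<in> carrier B \<Longrightarrow>
      \<beta> (\<phi> r \<otimes>\<^bsub>A\<^esub> a) b = \<beta> a (\<psi> r \<otimes>\<^bsub>B\<^esub> b)"
  obtains h where "h \<in> hom (add_monoid T) (add_monoid C)"
    "\<And>a b. a \<in> carrier A \<Longrightarrow> b \<in> carrier B \<Longrightarrow> h (pure a b) = \<beta> a b"
    "\<And>c. c \<in> carrier P \<Longrightarrow> h (I +>\<^bsub>P\<^esub> c) = (\<Oplus>\<^bsub>C\<^esub>z\<in>Poly_Mapping.keys c.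
       add_pow C (Poly_Mapping.lookup c z) (\<beta> (fst z) (snd z)))"
proof -
  interpret C: abelian_group C by fact
  let ?S = "carrier A \<times> carrier B"
  obtain h where h: "h \<in> hom (free_Abelian_group ?S) (add_monoid C)"
    and h_of: "\<And>z. z \<in> ?S \<Longrightarrow> h (frag_of z) = \<beta> (fst z) (snd z)"
  proof (rule comm_group.free_Abelian_group_universal[OF C.a_comm_group, of "\<lambda>z. \<beta> (fst z) (snd z)" ?S])
    show "(\<lambda>z. \<beta> (fst z) (snd z)) ` ?S \<subseteq> carrier (add_monoid C)"
      using closed by auto
  qed auto
  interpret h: group_hom "free_Abelian_group ?S" "add_monoid C" h
    using h by (simp add: group_hom_def group_hom_axioms_def C.a_group)
  have h_closed: "h c \<in> carrier C" if "c \<in> carrier P" for c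
    using h.hom_closed[of c] that by (simp add: pair_carrier)
  have h0: "h 0 = \<zero>\<^bsub>C\<^esub>"
    using h.hom_one by simp
  have h_add: "h (x + y) = h x \<oplus>\<^bsub>C\<^esub> h y" if "x \<in> carrier P" "y \<in> carrier P" for x y
    using h.hom_mult[of x y] that by (simp add: pair_carrier)
  have h_neg: "h (- x) = \<ominus>\<^bsub>C\<^esub> h x" if "x \<in> carrier P" for x
    using h.hom_inv[of x] that by (simp add: pair_carrier a_inv_def)
  have h_diff: "h (x - y) = h x \<ominus>\<^bsub>C\<^esub> h y" if "x \<in> carrier P" "y \<in> carrier P" for x y
    using h_add[of x "- y"] h_neg[of y] that by (simp add: a_minus_def)
  \<comment> \<open>The kernel of the additive map \<open>h\<close> need not be an ideal. It is
    replaced by the largest ideal inside it, the elements all of whose multiples are killed.\<close>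
  let ?N = "{c \<in> carrier P. \<forall>d\<in>carrier P. h (d \<otimes>\<^bsub>P\<^esub> c) = \<zero>\<^bsub>C\<^esub>}"
  have idealN: "ideal ?N P"
  proof (rule idealI)
    show "ring P" by (rule P.ring_axioms)
    show "subgroup ?N (add_monoid P)"
    proof (rule P.add.subgroupI)
      show "?N \<subseteq> carrier P" by blast
      show "?N \<noteq> {}" using h0 by (auto simp: pair_simps intro!: exI[of _ 0])
    next
      fix x assume x: "x \<in> ?N"
      have "h (d \<otimes>\<^bsub>P\<^esub> (\<ominus>\<^bsub>P\<^esub> x)) = \<zero>\<^bsub>C\<^esub>" if d: "d \<in> carrier P" for d
      proof -
        have "d \<otimes>\<^bsub>P\<^esub> (\<ominus>\<^bsub>P\<^esub> x) = \<ominus>\<^bsub>P\<^esub> (d \<otimes>\<^bsub>P\<^esub> x)"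
          using x d by (intro P.r_minus) auto
        also have "\<dots> = - (d \<otimes>\<^bsub>P\<^esub> x)"
          using x d by (intro pair_a_inv) auto
        finally show ?thesis
          using x d by (simp add: h_neg)
      qed
      then show "\<ominus>\<^bsub>P\<^esub> x \<in> ?N"
        using x P.a_inv_closed by blast
    next
      fix x y assume "x \<in> ?N" "y \<in> ?N"
      then show "x \<oplus>\<^bsub>P\<^esub> y \<in> ?N"
        by (simp add: pair_simps h_add)
    qed
    fix a x assume a: "a \<in> ?N" "x \<in> carrier P"
    have "h (d \<otimes>\<^bsub>P\<^esub> (x \<otimes>\<^bsub>P\<^esub> a)) = \<zero>\<^bsub>C\<^esub>" if "d \<in> carrier P" for d
      using a that by (simp flip: P.m_assoc)
    then show "x \<otimes>\<^bsub>P\<^esub> a \<in> ?N" "a \<otimes>\<^bsub>P\<^esub> x \<in> ?N"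
      using a by (simp_all add: P.m_comm)
  qed
  have "gens \<subseteq> ?N"
  proof
    fix c assume c: "c \<in> gens"
    then have cP: "c \<in> carrier P" using gens_carrier by blast
    have "h (d \<otimes>\<^bsub>P\<^esub> c) = \<zero>\<^bsub>C\<^esub>" if "d \<in> carrier P" for d
      using that
    proof (induction rule: pair_induct)
      case (one a b)
      note [simp] = one
      from c consider
        (1) x x' y where "c = frag_of (x \<oplus>\<^bsub>A\<^esub> x', y) - frag_of (x, y) - frag_of (x', y)"
          "x \<in> carrier A" "x' \<in> carrier A" "y \<in> carrier B"
        | (2) x y y' where "c = frag_of (x, y \<oplus>\<^bsub>B\<^esub> y') - frag_of (x, y) - frag_of (x, y')"
          "x \<in> carrier A" "y \<in> carrier B" "y' \<in> carrier B"
        | (3) r x y where "c = frag_of (\<phi> r \<otimes>\<^bsub>A\<^esub> x, y) - frag_of (x, \<psi> r \<otimes>\<^bsub>B\<^esub> y)"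
          "r \<in> carrier R" "x \<in> carrier A" "y \<in> carrier B"
        unfolding gens_def by blast
      then show ?case
      proof cases
        case 1
        then show ?thesis
          by (simp add: pair_simps h_diff h_of closed A.r_distr addl C.minus_eq C.minus_add,
              simp add: closed C.a_ac C.r_neg C.r_neg1 C.r_neg2)
      next
        case 2
        then show ?thesis
          by (simp add: pair_simps h_diff h_of closed B.r_distr addr C.minus_eq C.minus_add,
              simp add: closed C.a_ac C.r_neg C.r_neg1 C.r_neg2)
      next
        case 3
        then have "a \<otimes>\<^bsub>A\<^esub> (\<phi> r \<otimes>\<^bsub>A\<^esub> x) = \<phi> r \<otimes>\<^bsub>A\<^esub> (a \<otimes>\<^bsub>A\<^esub> x)"
          "b \<otimes>\<^bsub>B\<^esub> (\<psi> r \<otimes>\<^bsub>B\<^esub> y) = \<psi> r \<otimes>\<^bsub>B\<^esub> (b \<otimes>\<^bsub>B\<^esub> y)"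
          by (simp_all add: A.m_lcomm B.m_lcomm)
        with 3 show ?thesis
          by (simp add: pair_simps h_diff h_of closed bal C.minus_eq C.r_neg)
      qed
    qed (use cP in \<open>simp_all add: pair_simps h0 h_diff C.minus_eq C.r_neg\<close>)
    with cP show "c \<in> ?N" by blast
  qed
  then have IN: "I \<subseteq> ?N"
    unfolding I_eq by (rule P.genideal_minimal[OF idealN])
  have I0: "h c = \<zero>\<^bsub>C\<^esub>" if "c \<in> I" for c
  proof -
    have "c \<in> carrier P" "h (\<one>\<^bsub>P\<^esub> \<otimes>\<^bsub>P\<^esub> c) = \<zero>\<^bsub>C\<^esub>"
      using IN that P.one_closed by blast+
    then show ?thesis by (simp only: pair_one)
  qed
  \<comment> \<open>The choice of representative does not matter: two of them differ by an element
    of the ideal, on which \<open>h\<close> vanishes.\<close>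
  define k where "k W = h (SOME c. c \<in> carrier P \<and> W = I +>\<^bsub>P\<^esub> c)" for W
  have k: "k (I +>\<^bsub>P\<^esub> c) = h c" if "c \<in> carrier P" for c
  proof -
    define d where "d = (SOME d. d \<in> carrier P \<and> I +>\<^bsub>P\<^esub> c = I +>\<^bsub>P\<^esub> d)"
    have d: "d \<in> carrier P" "I +>\<^bsub>P\<^esub> c = I +>\<^bsub>P\<^esub> d"
      using someI[of "\<lambda>d. d \<in> carrier P \<and> I +>\<^bsub>P\<^esub> c = I +>\<^bsub>P\<^esub> d" c] that by (simp_all add: d_def)
    then have "c - d \<in> I" using that coset_eq_iff by blast
    then have "h c \<ominus>\<^bsub>C\<^esub> h d = \<zero>\<^bsub>C\<^esub>"
      using I0[of "c - d"] h_diff d that by simp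
    then show ?thesis
      using d(1) that h_closed C.minus_equality[of "h c" "\<ominus>\<^bsub>C\<^esub> h d"]
      by (simp add: k_def a_minus_def flip: d_def)
  qed
  show thesis
  proof
    show "k \<in> hom (add_monoid T) (add_monoid C)"
    proof (rule homI)
      fix W assume "W \<in> carrier (add_monoid T)"
      then show "k W \<in> carrier (add_monoid C)"
        by (auto simp: k h_closed elim: T_cases)
    next
      fix W Y assume "W \<in> carrier (add_monoid T)" "Y \<in> carrier (add_monoid T)"
      then obtain x y where xy: "x \<in> carrier P" "W = I +>\<^bsub>P\<^esub> x" "y \<in> carrier P" "Y = I +>\<^bsub>P\<^esub> y"
        by (auto elim!: T_cases)
      have "W \<oplus>\<^bsub>T\<^esub> Y = I +>\<^bsub>P\<^esub> (x + y)"
        using ring_hom_add[OF coset_hom, of x y] xy by (simp add: pair_simps)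
      then show "k (W \<otimes>\<^bsub>add_monoid T\<^esub> Y) = k W \<otimes>\<^bsub>add_monoid C\<^esub> k Y"
        using xy by (simp add: k h_add)
    qed
    show "k (pure a b) = \<beta> a b" if "a \<in> carrier A" "b \<in> carrier B" for a b
      using that by (simp add: pure_eq k h_of)
    show "k (I +>\<^bsub>P\<^esub> c) = (\<Oplus>\<^bsub>C\<^esub>z\<in>Poly_Mapping.keys c.
       add_pow C (Poly_Mapping.lookup c z) (\<beta> (fst z) (snd z)))" if c: "c \<in> carrier P" for c
    proof -
      have cmul: "h (frag_cmul n (frag_of z)) = add_pow C n (\<beta> (fst z) (snd z))" if "z \<in> ?S" for n z
      proof -
        have "h (frag_of z [^]\<^bsub>free_Abelian_group ?S\<^esub> n) = h (frag_of z) [^]\<^bsub>add_monoid C\<^esub> n"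
          by (rule h.hom_int_pow) (use that in simp)
        then show ?thesis
          using that by (simp add: h_of add_pow_def)
      qed
      have sum: "h (\<Sum>z\<in>K. frag_cmul (f z) (frag_of z)) = (\<Oplus>\<^bsub>C\<^esub>z\<in>K. h (frag_cmul (f z) (frag_of z)))
          \<and> (\<Sum>z\<in>K. frag_cmul (f z) (frag_of z)) \<in> carrier P"
        if "finite K" "K \<subseteq> ?S" for K and f :: "_ \<Rightarrow> int"
        using that
      proof (induction K)
        case (insert z K)
        have cl: "frag_cmul (f w) (frag_of w) \<in> carrier P" if "w \<in> insert z K" for w
          using that insert(4) by (auto simp: pair_carrier)
        then have "(\<lambda>w. h (frag_cmul (f w) (frag_of w))) \<in> K \<rightarrow> carrier C"
          using h_closed by auto
        with cl insert show ?case
          by (simp add: h_add h_closed)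
      qed (simp add: h0)
      have "c = (\<Sum>z\<in>Poly_Mapping.keys c. frag_cmul (Poly_Mapping.lookup c z) (frag_of z))"
        by (subst frag_expansion) (simp add: frag_extend_def)
      then have "h c = (\<Oplus>\<^bsub>C\<^esub>z\<in>Poly_Mapping.keys c. h (frag_cmul (Poly_Mapping.lookup c z) (frag_of z)))"
        using sum[of "Poly_Mapping.keys c" "Poly_Mapping.lookup c"] c by (simp add: pair_carrier)
      also have "\<dots> = (\<Oplus>\<^bsub>C\<^esub>z\<in>Poly_Mapping.keys c. add_pow C (Poly_Mapping.lookup c z) (\<beta> (fst z) (snd z)))"
      proof (rule C.finsum_cong')
        have "add_pow C n (\<beta> (fst z) (snd z)) \<in> carrier C" if "z \<in> ?S" for z and n :: int
          by (rule C.add.int_pow_closed) (use that closed in auto)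
        then show "(\<lambda>z. add_pow C (Poly_Mapping.lookup c z) (\<beta> (fst z) (snd z))) \<in> Poly_Mapping.keys c \<rightarrow> carrier C"
          using c by (auto simp: pair_carrier)
      qed (use c cmul in \<open>auto simp: pair_carrier\<close>)
      finally show ?thesis by (simp add: k c)
    qed
  qed
qed

text \<open>The additive map given by \<open>f a\<close> times \<open>g b\<close> respects products
  of pure tensors, and distributivity carries this to all elements.\<close>

lemma tensor_lift_ring:
  assumes C: "cring C" and f: "f \<in> ring_hom A C" and g: "g \<in> ring_hom B C"
    and fg: "\<And>r. r \<in> carrier R \<Longrightarrow> f (\<phi> r) = g (\<psi> r)"
  obtains h where "h \<in> ring_hom T C"
    "\<And>a b. a \<in> carrier A \<Longrightarrow> b \<in> carrier B \<Longrightarrow> h (pure a b) = f a \<otimes>\<^bsub>C\<^esub> g b"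
    "\<And>c. c \<in> carrier P \<Longrightarrow> h (I +>\<^bsub>P\<^esub> c) = (\<Oplus>\<^bsub>C\<^esub>z\<in>Poly_Mapping.keys c.
       add_pow C (Poly_Mapping.lookup c z) (f (fst z) \<otimes>\<^bsub>C\<^esub> g (snd z)))"
proof -
  interpret C: cring C by fact
  note [simp] = ring_hom_closed[OF f] ring_hom_closed[OF g] ring_hom_add[OF f] ring_hom_add[OF g]
    ring_hom_mult[OF f] ring_hom_mult[OF g]
  obtain h where h: "h \<in> hom (add_monoid T) (add_monoid C)"
    and hp: "\<And>a b. a \<in> carrier A \<Longrightarrow> b \<in> carrier B \<Longrightarrow> h (pure a b) = f a \<otimes>\<^bsub>C\<^esub> g b"
    and hc: "\<And>c. c \<in> carrier P \<Longrightarrow> h (I +>\<^bsub>P\<^esub> c) = (\<Oplus>\<^bsub>C\<^esub>z\<in>Poly_Mapping.keys c.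
       add_pow C (Poly_Mapping.lookup c z) (f (fst z) \<otimes>\<^bsub>C\<^esub> g (snd z)))"
  proof (rule tensor_lift[OF C.abelian_group_axioms, of "\<lambda>a b. f a \<otimes>\<^bsub>C\<^esub> g b"])
    fix r a b assume "r \<in> carrier R" "a \<in> carrier A" "b \<in> carrier B"
    then show "f (\<phi> r \<otimes>\<^bsub>A\<^esub> a) \<otimes>\<^bsub>C\<^esub> g b = f a \<otimes>\<^bsub>C\<^esub> g (\<psi> r \<otimes>\<^bsub>B\<^esub> b)"
      by (simp add: fg[symmetric]) (simp add: fg C.m_ac)
  qed (auto simp: C.l_distr C.r_distr)
  interpret h: group_hom "add_monoid T" "add_monoid C" h
    by (intro group_hom.intro group_hom_axioms.intro T.a_group C.a_group h)
  have hcl: "h x \<in> carrier C" if "x \<in> carrier T" for x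
    using h.hom_closed that by simp
  have h0: "h \<zero>\<^bsub>T\<^esub> = \<zero>\<^bsub>C\<^esub>"
    using h.hom_one by simp
  have hd: "h (x \<ominus>\<^bsub>T\<^esub> y) = h x \<ominus>\<^bsub>C\<^esub> h y" if "x \<in> carrier T" "y \<in> carrier T" for x y
    using T.a_group_hom_diff[OF h C.abelian_group_axioms] that .
  have hm: "h (x \<otimes>\<^bsub>T\<^esub> y) = h x \<otimes>\<^bsub>C\<^esub> h y" if x: "x \<in> carrier T" and y: "y \<in> carrier T" for x y
    using x
  proof (induction rule: tensor_induct)
    case (pure a b)
    show ?case
      using y
    proof (induction rule: tensor_induct)
      case (pure a' b')
      then show ?case
        using \<open>a \<in> carrier A\<close> \<open>b \<in> carrier B\<close> by (simp add: pure_mult hp C.m_ac)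
    next
      case (diff u v)
      have "pure a b \<otimes>\<^bsub>T\<^esub> (u \<ominus>\<^bsub>T\<^esub> v) = pure a b \<otimes>\<^bsub>T\<^esub> u \<ominus>\<^bsub>T\<^esub> pure a b \<otimes>\<^bsub>T\<^esub> v"
        using diff pure by (simp add: T.minus_eq T.r_distr T.r_minus)
      with diff pure show ?case
        by (simp add: hd hcl) (simp add: hcl C.minus_eq C.r_distr C.r_minus)
    qed (use pure in \<open>simp add: h0 hcl\<close>)
  next
    case (diff u v)
    have "(u \<ominus>\<^bsub>T\<^esub> v) \<otimes>\<^bsub>T\<^esub> y = u \<otimes>\<^bsub>T\<^esub> y \<ominus>\<^bsub>T\<^esub> v \<otimes>\<^bsub>T\<^esub> y"
      using diff y by (simp add: T.minus_eq T.l_distr T.l_minus)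
    with diff y show ?case
      by (simp add: hd hcl) (simp add: hcl C.minus_eq C.l_distr C.l_minus)
  qed (use y in \<open>simp add: h0 hcl\<close>)
  have "h \<in> ring_hom T C"
  proof (rule ring_hom_memI)
    fix x y assume "x \<in> carrier T" "y \<in> carrier T"
    then show "h (x \<oplus>\<^bsub>T\<^esub> y) = h x \<oplus>\<^bsub>C\<^esub> h y"
      using h.hom_mult by simp
  next
    show "h \<one>\<^bsub>T\<^esub> = \<one>\<^bsub>C\<^esub>"
      using hp[of "\<one>\<^bsub>A\<^esub>" "\<one>\<^bsub>B\<^esub>"] by (simp add: pure_one ring_hom_one[OF f] ring_hom_one[OF g])
  qed (use hm hcl in auto)
  from that[OF this hp hc] show thesis .
qed

text \<open>Signs are absorbed into the first factor, so plain sums of pure tensors suffice and no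
  integer coefficients remain.\<close>

lemma tensor_finite_sum:
  assumes "W \<in> carrier T"
  obtains n :: nat and x y where "x \<in> {..<n} \<rightarrow> carrier A" "y \<in> {..<n} \<rightarrow> carrier B"
    "W = (\<Oplus>\<^bsub>T\<^esub>i\<in>{..<n}. pure (x i) (y i))"
proof -
  define Q where "Q = {(\<Oplus>\<^bsub>T\<^esub>i\<in>{..<n}. pure (x i) (y i)) | (n::nat) x y.
    x \<in> {..<n} \<rightarrow> carrier A \<and> y \<in> {..<n} \<rightarrow> carrier B}"
  have QT: "V \<in> carrier T" if "V \<in> Q" for V
    using that by (auto simp: Q_def Pi_iff intro!: T.finsum_closed)
  have Q0: "\<zero>\<^bsub>T\<^esub> \<in> Q"
    by (force simp: Q_def intro!: exI[of _ "0::nat"])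
  have step: "V \<oplus>\<^bsub>T\<^esub> pure a b \<in> Q" if V: "V \<in> Q" and a: "a \<in> carrier A" and b: "b \<in> carrier B" for V a b
  proof -
    obtain n :: nat and x y where xy: "x \<in> {..<n} \<rightarrow> carrier A" "y \<in> {..<n} \<rightarrow> carrier B"
      "V = (\<Oplus>\<^bsub>T\<^esub>i\<in>{..<n}. pure (x i) (y i))"
      using V by (auto simp: Q_def)
    let ?x = "x(n := a)" and ?y = "y(n := b)"
    have cl: "(\<lambda>i. pure (?x i) (?y i)) \<in> {..<n} \<rightarrow> carrier T" "(\<lambda>i. pure (x i) (y i)) \<in> {..<n} \<rightarrow> carrier T"
      using xy by (auto simp: Pi_iff)
    have "(\<Oplus>\<^bsub>T\<^esub>i\<in>{..<Suc n}. pure (?x i) (?y i)) = pure a b \<oplus>\<^bsub>T\<^esub> (\<Oplus>\<^bsub>T\<^esub>i\<in>{..<n}. pure (?x i) (?y i))"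
      using cl a b by (simp add: lessThan_Suc)
    also have "(\<Oplus>\<^bsub>T\<^esub>i\<in>{..<n}. pure (?x i) (?y i)) = V"
      unfolding xy(3) by (rule T.finsum_cong') (use cl in auto)
    finally have "V \<oplus>\<^bsub>T\<^esub> pure a b = (\<Oplus>\<^bsub>T\<^esub>i\<in>{..<Suc n}. pure (?x i) (?y i))"
      using a b QT[OF V] by (simp add: T.a_comm)
    moreover have "?x \<in> {..<Suc n} \<rightarrow> carrier A" "?y \<in> {..<Suc n} \<rightarrow> carrier B"
      using xy a b by (auto simp: Pi_iff less_Suc_eq)
    ultimately show ?thesis unfolding Q_def by blast
  qed
  have neg: "pure (\<ominus>\<^bsub>A\<^esub> a) b = \<ominus>\<^bsub>T\<^esub> pure a b" if "a \<in> carrier A" "b \<in> carrier B" for a b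
  proof -
    have "pure \<zero>\<^bsub>A\<^esub> b \<oplus>\<^bsub>T\<^esub> pure \<zero>\<^bsub>A\<^esub> b = pure \<zero>\<^bsub>A\<^esub> b"
      using pure_add_left[of "\<zero>\<^bsub>A\<^esub>" "\<zero>\<^bsub>A\<^esub>" b] that by simp
    then have "pure \<zero>\<^bsub>A\<^esub> b = \<zero>\<^bsub>T\<^esub>"
      using that by (simp add: T.add.l_cancel_one')
    then have "pure (\<ominus>\<^bsub>A\<^esub> a) b \<oplus>\<^bsub>T\<^esub> pure a b = \<zero>\<^bsub>T\<^esub>"
      using pure_add_left[of "\<ominus>\<^bsub>A\<^esub> a" a b] that by (simp add: A.l_neg)
    then show ?thesis
      using T.minus_equality[of "pure (\<ominus>\<^bsub>A\<^esub> a) b" "pure a b"] that by simp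
  qed
  \<comment> \<open>The induction principle offers only differences. Stability under both adding and
    subtracting \<open>W\<close>, for every \<open>V\<close> at once, is what makes that case go
    through.\<close>
  have "\<forall>V\<in>Q. V \<oplus>\<^bsub>T\<^esub> W \<in> Q \<and> V \<ominus>\<^bsub>T\<^esub> W \<in> Q"
    using assms
  proof (induction rule: tensor_induct)
    case zero
    then show ?case using QT by (simp add: T.minus_eq)
  next
    case (pure a b)
    then show ?case
      using step[of _ a b] step[of _ "\<ominus>\<^bsub>A\<^esub> a" b] by (simp add: neg T.minus_eq)
  next
    case (diff u v)
    show ?case
    proof (intro ballI conjI)
      fix V assume V: "V \<in> Q"
      have "V \<oplus>\<^bsub>T\<^esub> (u \<ominus>\<^bsub>T\<^esub> v) = (V \<oplus>\<^bsub>T\<^esub> u) \<ominus>\<^bsub>T\<^esub> v"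
        using QT[OF V] diff by (simp add: T.minus_eq T.a_assoc)
      then show "V \<oplus>\<^bsub>T\<^esub> (u \<ominus>\<^bsub>T\<^esub> v) \<in> Q"
        using V diff by simp
      have "V \<ominus>\<^bsub>T\<^esub> (u \<ominus>\<^bsub>T\<^esub> v) = (V \<ominus>\<^bsub>T\<^esub> u) \<oplus>\<^bsub>T\<^esub> v"
        using QT[OF V] diff by (simp add: T.minus_eq T.a_assoc T.minus_add)
      then show "V \<ominus>\<^bsub>T\<^esub> (u \<ominus>\<^bsub>T\<^esub> v) \<in> Q"
        using V diff by simp
    qed
  qed
  then have "W \<in> Q" using Q0 assms by force
  then show thesis using that by (auto simp: Q_def)
qed

text \<open>Images of cosets under automorphisms of a factor are taken representative by representative
  in the definition of a base change; inverting the automorphism shows that they are cosets.\<close>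

definition twist :: "('a \<Rightarrow> 'a) \<Rightarrow> ('a \<times> 'b \<Rightarrow>\<^sub>0 int) \<Rightarrow> ('a \<times> 'b \<Rightarrow>\<^sub>0 int)" where
  "twist \<sigma> = frag_extend (\<lambda>(s, b). frag_of (\<sigma> s, b))"

text \<open>The tensor product of \<sigma> with the identity exists by the universal property.
  Comparing it with \<open>twist\<close> shows that acting on representatives computes its value on
  cosets.\<close>

lemma twist_hom:
  assumes s: "\<sigma> \<in> ring_hom A A" and fixb: "\<And>r. r \<in> carrier R \<Longrightarrow> \<sigma> (\<phi> r) = \<phi> r"
  obtains h where "h \<in> ring_hom T T"
    "\<And>c. c \<in> carrier P \<Longrightarrow> twist \<sigma> c \<in> carrier P \<and> h (I +>\<^bsub>P\<^esub> c) = I +>\<^bsub>P\<^esub> twist \<sigma> c"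
    "\<And>a b. a \<in> carrier A \<Longrightarrow> b \<in> carrier B \<Longrightarrow> h (pure a b) = pure (\<sigma> a) b"
proof -
  note [simp] = ring_hom_closed[OF s]
  obtain h where h: "h \<in> ring_hom T T" and
    hp: "\<And>a b. a \<in> carrier A \<Longrightarrow> b \<in> carrier B \<Longrightarrow>
      h (pure a b) = pure (\<sigma> a) \<one>\<^bsub>B\<^esub> \<otimes>\<^bsub>T\<^esub> pure \<one>\<^bsub>A\<^esub> b"
  proof (rule tensor_lift_ring[OF T.is_cring _ right_hom, of "\<lambda>a. pure (\<sigma> a) \<one>\<^bsub>B\<^esub>"])
    show "(\<lambda>a. pure (\<sigma> a) \<one>\<^bsub>B\<^esub>) \<in> ring_hom A T"
      using ring_hom_trans[OF s left_hom] by (simp add: comp_def)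
  qed (auto simp: fixb pure_base)
  have hp': "h (pure a b) = pure (\<sigma> a) b" if "a \<in> carrier A" "b \<in> carrier B" for a b
    using that by (simp add: hp pure_mult)
  have tw: "twist \<sigma> c \<in> carrier P \<and> h (I +>\<^bsub>P\<^esub> c) = I +>\<^bsub>P\<^esub> twist \<sigma> c" if "c \<in> carrier P" for c
    using that
  proof (induction rule: pair_induct)
    case zero
    have "I +>\<^bsub>P\<^esub> 0 = \<zero>\<^bsub>T\<^esub>"
      using ring_hom_zero[OF coset_hom P.ring_axioms T.ring_axioms] by (simp add: pair_simps)
    then show ?case
      using ring_hom_zero[OF h T.ring_axioms T.ring_axioms] by (simp add: twist_def)
  next
    case (one a b)
    then show ?case using hp'[of a b] by (simp add: twist_def pure_eq)
  next
    case (diff x y)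
    have "h \<in> hom (add_monoid T) (add_monoid T)"
      using h by (auto simp: ring_hom_def hom_def)
    from T.a_group_hom_diff[OF this T.abelian_group_axioms, of "I +>\<^bsub>P\<^esub> x" "I +>\<^bsub>P\<^esub> y"] diff
    have "h ((I +>\<^bsub>P\<^esub> x) \<ominus>\<^bsub>T\<^esub> (I +>\<^bsub>P\<^esub> y)) = (I +>\<^bsub>P\<^esub> twist \<sigma> x) \<ominus>\<^bsub>T\<^esub> (I +>\<^bsub>P\<^esub> twist \<sigma> y)"
      by simp
    also have "\<dots> = I +>\<^bsub>P\<^esub> twist \<sigma> (x - y)"
      using diff by (simp add: coset_diff twist_def frag_extend_diff)
    finally show ?case
      using diff by (simp add: coset_diff) (simp add: twist_def frag_extend_diff)
  qed
  show thesis by (rule that[OF h tw hp'])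
qed

lemma twist_twist:
  assumes "c \<in> carrier P" "\<And>a. a \<in> carrier A \<Longrightarrow> \<sigma> (\<sigma>' a) = a"
  shows "twist \<sigma> (twist \<sigma>' c) = c"
  using assms(1) by (induction rule: pair_induct) (simp_all add: twist_def frag_extend_diff assms(2))

lemma twist_image:
  assumes s: "\<sigma> \<in> ring_hom A A" "\<And>r. r \<in> carrier R \<Longrightarrow> \<sigma> (\<phi> r) = \<phi> r"
    and s': "\<sigma>' \<in> ring_hom A A" "\<And>r. r \<in> carrier R \<Longrightarrow> \<sigma>' (\<phi> r) = \<phi> r"
    and inv: "\<And>a. a \<in> carrier A \<Longrightarrow> \<sigma> (\<sigma>' a) = a"
    and c: "c \<in> carrier P"
  shows "twist \<sigma> ` (I +>\<^bsub>P\<^esub> c) = I +>\<^bsub>P\<^esub> twist \<sigma> c"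
proof -
  \<comment> \<open>Stability of the ideal is read off from the induced ring map, which sends zero
    to zero.\<close>
  have I_stable: "twist \<rho> i \<in> I" if r: "\<rho> \<in> ring_hom A A" "\<And>r. r \<in> carrier R \<Longrightarrow> \<rho> (\<phi> r) = \<phi> r"
    and i: "i \<in> I" for \<rho> i
  proof -
    obtain h where h: "h \<in> ring_hom T T"
      "\<And>c. c \<in> carrier P \<Longrightarrow> twist \<rho> c \<in> carrier P \<and> h (I +>\<^bsub>P\<^esub> c) = I +>\<^bsub>P\<^esub> twist \<rho> c"
      by (rule twist_hom[OF r]) auto
    have iP: "i \<in> carrier P" using i I.Icarr by blast
    have z: "I +>\<^bsub>P\<^esub> 0 = \<zero>\<^bsub>T\<^esub>"
      using ring_hom_zero[OF coset_hom P.ring_axioms T.ring_axioms] by (simp add: pair_simps)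
    have "I +>\<^bsub>P\<^esub> i = I +>\<^bsub>P\<^esub> 0"
      using coset_eq_iff[of i 0] i iP by simp
    then have "I +>\<^bsub>P\<^esub> twist \<rho> i = h \<zero>\<^bsub>T\<^esub>"
      using h(2)[OF iP] z by simp
    also have "\<dots> = I +>\<^bsub>P\<^esub> 0"
      using ring_hom_zero[OF h(1) T.ring_axioms T.ring_axioms] z by simp
    finally show ?thesis
      using coset_eq_iff[of "twist \<rho> i" 0] h(2)[OF iP] by simp
  qed
  have cos: "I +>\<^bsub>P\<^esub> d = (\<lambda>i. i + d) ` I" for d
    by (auto simp: a_r_coset_def' pair_simps)
  have "twist \<sigma> ` I = I"
  proof
    show "I \<subseteq> twist \<sigma> ` I"
    proof
      fix i assume i: "i \<in> I"
      then have "i = twist \<sigma> (twist \<sigma>' i)"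
        using twist_twist[of i \<sigma> \<sigma>'] inv I.Icarr by simp
      then show "i \<in> twist \<sigma> ` I"
        using I_stable[OF s' i] by blast
    qed
  qed (use I_stable[OF s] in blast)
  moreover have "twist \<sigma> ` (\<lambda>i. i + c) ` I = (\<lambda>i. i + twist \<sigma> c) ` twist \<sigma> ` I"
    by (simp add: image_image twist_def frag_extend_add)
  ultimately show ?thesis
    unfolding cos by simp
qed

end

section \<open>Separability idempotents\<close>

locale algebra_over = algebra_pair R S S \<beta> \<beta>
  for R :: "('r, 'l) ring_scheme" (structure)
    and S :: "('s, 'm) ring_scheme" (structure) and \<beta> :: "'r \<Rightarrow> 's"
begin

text \<open>\<open>tensor_mult\<close> takes the common value of a formula over all representatives.
  The explicit clause of \<open>tensor_lift_ring\<close> identifies this formula with the value of a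
  ring map on the coset, so it is constant there.\<close>

lemma tensor_mult:
  shows tensor_mult_hom: "tensor_mult S \<in> ring_hom T S"
    and tensor_mult_pure: "a \<in> carrier S \<Longrightarrow> b \<in> carrier S \<Longrightarrow> tensor_mult S (pure a b) = a \<otimes>\<^bsub>S\<^esub> b"
proof -
  have id: "(\<lambda>a. a) \<in> ring_hom S S" by (rule ring_hom_memI) auto
  obtain h where h: "h \<in> ring_hom T S"
    and hp: "\<And>a b. a \<in> carrier S \<Longrightarrow> b \<in> carrier S \<Longrightarrow> h (pure a b) = a \<otimes>\<^bsub>S\<^esub> b"
    and hc: "\<And>c. c \<in> carrier P \<Longrightarrow> h (I +>\<^bsub>P\<^esub> c) = (\<Oplus>\<^bsub>S\<^esub>z\<in>Poly_Mapping.keys c.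
       add_pow S (Poly_Mapping.lookup c z) (fst z \<otimes>\<^bsub>S\<^esub> snd z))"
    by (rule tensor_lift_ring[OF A.is_cring id id]) auto
  have eq: "tensor_mult S W = h W" if W: "W \<in> carrier T" for W
  proof -
    obtain c where c: "c \<in> carrier P" "W = I +>\<^bsub>P\<^esub> c" using W by (rule T_cases)
    have "(\<Oplus>\<^bsub>S\<^esub>z\<in>Poly_Mapping.keys d. add_pow S (Poly_Mapping.lookup d z) (fst z \<otimes>\<^bsub>S\<^esub> snd z)) = h W"
      if "d \<in> W" for d
    proof -
      from that c obtain i where i: "i \<in> I" "d = i + c"
        by (auto simp: a_r_coset_def' pair_simps)
      have d: "d \<in> carrier P" using i c I.Icarr by auto
      then have "I +>\<^bsub>P\<^esub> d = W" using i c coset_eq_iff[of d c] by simp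
      then show ?thesis using hc[OF d] by simp
    qed
    moreover have "c \<in> W"
      using c P.add.r_one I.additive_subgroup_axioms additive_subgroup.zero_closed
      by (force simp: a_r_coset_def' pair_simps)
    ultimately have "(\<lambda>c. \<Oplus>\<^bsub>S\<^esub>z\<in>Poly_Mapping.keys c.
      add_pow S (Poly_Mapping.lookup c z) (fst z \<otimes>\<^bsub>S\<^esub> snd z)) ` W = {h W}"
      by (auto simp: image_iff)
    then show ?thesis by (simp add: tensor_mult_def induced_def)
  qed
  show "tensor_mult S \<in> ring_hom T S"
    by (rule T.ring_hom_restrict[OF h]) (simp add: eq)
  show "a \<in> carrier S \<Longrightarrow> b \<in> carrier S \<Longrightarrow> tensor_mult S (pure a b) = a \<otimes>\<^bsub>S\<^esub> b"
    by (simp add: eq hp)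
qed

lemma tensor_mult_closed [simp]: "W \<in> carrier T \<Longrightarrow> tensor_mult S W \<in> carrier S"
  by (rule ring_hom_closed[OF tensor_mult_hom])

text \<open>The classical separability element of \<open>S\<close> tensor \<open>S\<close>. It
  squares to itself by applying \<open>separability_idempotent_mult\<close> with
  \<open>W = e\<close>.\<close>

definition separability_idempotent :: "('s \<times> 's \<Rightarrow>\<^sub>0 int) set \<Rightarrow> bool" where
  "separability_idempotent e \<longleftrightarrow> e \<in> carrier T \<and> tensor_mult S e = \<one>\<^bsub>S\<^esub> \<and>
     (\<forall>s\<in>carrier S. pure s \<one>\<^bsub>S\<^esub> \<otimes>\<^bsub>T\<^esub> e = pure \<one>\<^bsub>S\<^esub> s \<otimes>\<^bsub>T\<^esub> e)"

lemma tensor_mult_diff: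
  "x \<in> carrier T \<Longrightarrow> y \<in> carrier T \<Longrightarrow> tensor_mult S (x \<ominus>\<^bsub>T\<^esub> y) = tensor_mult S x \<ominus>\<^bsub>S\<^esub> tensor_mult S y"
proof (rule T.a_group_hom_diff)
  show "tensor_mult S \<in> hom (add_monoid T) (add_monoid S)"
    using tensor_mult_hom by (auto simp: ring_hom_def hom_def)
qed (rule A.abelian_group_axioms)

text \<open>In the presence of \<open>e\<close> the second tensor factor can be moved into the
  first, so multiplication by \<open>e\<close> factors through the product map.\<close>

lemma separability_idempotent_mult:
  assumes e: "separability_idempotent e" and W: "W \<in> carrier T"
  shows "W \<otimes>\<^bsub>T\<^esub> e = pure (tensor_mult S W) \<one>\<^bsub>S\<^esub> \<otimes>\<^bsub>T\<^esub> e"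
proof -
  have eT: "e \<in> carrier T" and es: "\<And>s. s \<in> carrier S \<Longrightarrow> pure s \<one>\<^bsub>S\<^esub> \<otimes>\<^bsub>T\<^esub> e = pure \<one>\<^bsub>S\<^esub> s \<otimes>\<^bsub>T\<^esub> e"
    using e by (auto simp: separability_idempotent_def)
  have pd: "pure (a \<ominus>\<^bsub>S\<^esub> b) \<one>\<^bsub>S\<^esub> = pure a \<one>\<^bsub>S\<^esub> \<ominus>\<^bsub>T\<^esub> pure b \<one>\<^bsub>S\<^esub>" if "a \<in> carrier S" "b \<in> carrier S" for a b
  proof (rule A.a_group_hom_diff[OF _ T.abelian_group_axioms that])
    show "(\<lambda>a. pure a \<one>\<^bsub>S\<^esub>) \<in> hom (add_monoid S) (add_monoid T)"
      using left_hom by (auto simp: ring_hom_def hom_def)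
  qed
  show ?thesis
    using W
  proof (induction rule: tensor_induct)
    case zero
    have "pure \<zero>\<^bsub>S\<^esub> \<one>\<^bsub>S\<^esub> = \<zero>\<^bsub>T\<^esub>"
      by (rule ring_hom_zero[OF left_hom A.ring_axioms T.ring_axioms])
    then show ?case
      using eT ring_hom_zero[OF tensor_mult_hom T.ring_axioms A.ring_axioms] by simp
  next
    case (pure a b)
    have "pure a b \<otimes>\<^bsub>T\<^esub> e = pure a \<one>\<^bsub>S\<^esub> \<otimes>\<^bsub>T\<^esub> (pure \<one>\<^bsub>S\<^esub> b \<otimes>\<^bsub>T\<^esub> e)"
      using pure eT pure_split[of a b] by (simp add: T.m_assoc)
    also have "\<dots> = pure a \<one>\<^bsub>S\<^esub> \<otimes>\<^bsub>T\<^esub> (pure b \<one>\<^bsub>S\<^esub> \<otimes>\<^bsub>T\<^esub> e)"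
      using es[OF pure(2)] by simp
    also have "\<dots> = pure (a \<otimes>\<^bsub>S\<^esub> b) \<one>\<^bsub>S\<^esub> \<otimes>\<^bsub>T\<^esub> e"
      using pure eT by (simp add: pure_mult flip: T.m_assoc)
    finally show ?case using pure by (simp add: tensor_mult_pure)
  next
    case (diff x y)
    then show ?case
      using eT by (simp add: tensor_mult_diff pd) (simp add: T.minus_eq T.l_distr T.l_minus)
  qed
qed

lemma enveloping_module: "module T (enveloping_module S)"
proof (rule moduleI)
  show "cring T" by (rule T.is_cring)
  show "abelian_group (enveloping_module S)"
    by (rule abelian_groupI) (auto simp: enveloping_module_def A.a_ac A.add.l_inv_ex)
qed (auto simp: enveloping_module_def A.r_distr A.l_distr A.m_assoc
  ring_hom_add[OF tensor_mult_hom] ring_hom_mult[OF tensor_mult_hom] ring_hom_one[OF tensor_mult_hom])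

text \<open>The map sending \<open>s\<close> to \<open>(s \<otimes> 1) e\<close> is a section of the
  product map, linear over the tensor ring. The free module has rank one; its only index is the unit
  of \<open>S\<close>, because indices must have the type of the elements of
  \<open>S\<close>.\<close>

lemma separable_if_idempotent:
  assumes e: "separability_idempotent e"
  shows "separable_algebra R S \<beta>"
proof -
  have eT: "e \<in> carrier T" and e1: "tensor_mult S e = \<one>\<^bsub>S\<^esub>"
    using e by (auto simp: separability_idempotent_def)
  let ?J = "{\<one>\<^bsub>S\<^esub>}"
  let ?i = "\<lambda>s. \<lambda>j\<in>?J. pure s \<one>\<^bsub>S\<^esub> \<otimes>\<^bsub>T\<^esub> e"
  let ?q = "\<lambda>f. tensor_mult S (f \<one>\<^bsub>S\<^esub>)"
  have "?i \<in> module_homs T (enveloping_module S) (free_module T ?J)"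
    unfolding module_homs_def
  proof (intro CollectI conjI ballI)
    show "?i \<in> carrier (enveloping_module S) \<rightarrow> carrier (free_module T ?J)"
      using eT by (auto simp: enveloping_module_def free_module_def)
    fix a b assume "a \<in> carrier (enveloping_module S)" "b \<in> carrier (enveloping_module S)"
    then show "?i (a \<oplus>\<^bsub>enveloping_module S\<^esub> b) = ?i a \<oplus>\<^bsub>free_module T ?J\<^esub> ?i b"
      using eT by (auto simp: enveloping_module_def free_module_def pure_add_left T.l_distr fun_eq_iff)
  next
    fix W a assume W: "W \<in> carrier T" and "a \<in> carrier (enveloping_module S)"
    then have a: "a \<in> carrier S" by (simp add: enveloping_module_def)
    have "pure (tensor_mult S W \<otimes>\<^bsub>S\<^esub> a) \<one>\<^bsub>S\<^esub> \<otimes>\<^bsub>T\<^esub> e = pure a \<one>\<^bsub>S\<^esub> \<otimes>\<^bsub>T\<^esub> (pure (tensor_mult S W) \<one>\<^bsub>S\<^esub> \<otimes>\<^bsub>T\<^esub> e)"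
      using W a eT by (simp add: pure_mult A.m_comm flip: T.m_assoc)
    also have "\<dots> = W \<otimes>\<^bsub>T\<^esub> (pure a \<one>\<^bsub>S\<^esub> \<otimes>\<^bsub>T\<^esub> e)"
      using W a eT by (simp add: T.m_lcomm flip: separability_idempotent_mult[OF e W])
    finally show "?i (W \<odot>\<^bsub>enveloping_module S\<^esub> a) = W \<odot>\<^bsub>free_module T ?J\<^esub> ?i a"
      by (simp add: enveloping_module_def free_module_def restrict_def fun_eq_iff)
  qed
  moreover have "?q \<in> module_homs T (free_module T ?J) (enveloping_module S)"
    by (auto simp: module_homs_def enveloping_module_def free_module_def PiE_iff
      ring_hom_add[OF tensor_mult_hom] ring_hom_mult[OF tensor_mult_hom])
  moreover have "?q (?i a) = a" if "a \<in> carrier (enveloping_module S)" for a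
    using that eT e1
    by (simp add: enveloping_module_def ring_hom_mult[OF tensor_mult_hom] tensor_mult_pure)
  ultimately show ?thesis
    unfolding separable_algebra_def projective_module_def using enveloping_module by blast
qed

text \<open>Let \<open>i\<close> and \<open>q\<close> exhibit \<open>S\<close> as a summand of a
  free module. The coordinates of \<open>i 1\<close> are killed by the kernel of the product map,
  because this kernel acts as zero on \<open>S\<close>. Combining them with the images under
  \<open>q\<close> of the basis vectors gives the required element.\<close>

lemma idempotent_if_separable:
  assumes "separable_algebra R S \<beta>"
  obtains e where "separability_idempotent e"
proof -
  let ?M = "enveloping_module S"
  obtain J :: "'s set" and i q where
    i: "i \<in> module_homs T ?M (free_module T J)" and q: "q \<in> module_homs T (free_module T J) ?M"
    and qi: "\<And>a. a \<in> carrier ?M \<Longrightarrow> q (i a) = a"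
    using assms unfolding separable_algebra_def projective_module_def by blast
  let ?F = "free_module T J"
  have M: "carrier ?M = carrier S" "\<And>W a. W \<odot>\<^bsub>?M\<^esub> a = tensor_mult S W \<otimes>\<^bsub>S\<^esub> a" "add ?M = add S"
    by (simp_all add: enveloping_module_def)
  have iM: "i (W \<odot>\<^bsub>?M\<^esub> a) = W \<odot>\<^bsub>?F\<^esub> i a" if "W \<in> carrier T" "a \<in> carrier S" for W a
    using i that by (auto simp: module_homs_def M(1))
  have iF: "i a \<in> carrier ?F" if "a \<in> carrier S" for a
    using i that by (auto simp: module_homs_def M(1))
  have qF: "q f \<in> carrier S" if "f \<in> carrier ?F" for f
    using q that by (auto simp: module_homs_def M(1))
  have qadd: "q (f \<oplus>\<^bsub>?F\<^esub> g) = q f \<oplus>\<^bsub>S\<^esub> q g" if "f \<in> carrier ?F" "g \<in> carrier ?F" for f g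
    using q that by (auto simp: module_homs_def M)
  have qM: "q (W \<odot>\<^bsub>?F\<^esub> f) = tensor_mult S W \<otimes>\<^bsub>S\<^esub> q f" if "W \<in> carrier T" "f \<in> carrier ?F" for W f
    using q that by (auto simp: module_homs_def M)
  have FJ: "f j \<in> carrier T" if "f \<in> carrier ?F" "j \<in> J" for f j
    using that by (auto simp: free_module_def)
  let ?ker = "{z \<in> carrier T. tensor_mult S z = \<zero>\<^bsub>S\<^esub>}"
  \<comment> \<open>An element killed by the kernel satisfies
    \<open>(s \<otimes> 1) e = (1 \<otimes> s) e\<close>, since
    \<open>s \<otimes> 1 - 1 \<otimes> s\<close> lies in the kernel.\<close>
  let ?ann = "\<lambda>W. W \<in> carrier T \<and> (\<forall>z\<in>?ker. z \<otimes>\<^bsub>T\<^esub> W = \<zero>\<^bsub>T\<^esub>)"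
  have main: "\<exists>e. ?ann e \<and> tensor_mult S e = q f"
    if "finite K" "f \<in> carrier ?F" "{j \<in> J. f j \<noteq> \<zero>\<^bsub>T\<^esub>} \<subseteq> K" "\<And>j. j \<in> J \<Longrightarrow> ?ann (f j)" for K f
    using that
  proof (induction K arbitrary: f)
    case empty
    then have "f = \<zero>\<^bsub>T\<^esub> \<odot>\<^bsub>?F\<^esub> f"
      by (auto simp: free_module_def fun_eq_iff restrict_def PiE_iff extensional_def)
    then have "q f = \<zero>\<^bsub>S\<^esub>"
      using qM[of "\<zero>\<^bsub>T\<^esub>" f] empty qF[of f] ring_hom_zero[OF tensor_mult_hom T.ring_axioms A.ring_axioms] by simp
    then show ?case
      using ring_hom_zero[OF tensor_mult_hom T.ring_axioms A.ring_axioms]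
      by (intro exI[of _ "\<zero>\<^bsub>T\<^esub>"]) auto
  next
    case (insert k K)
    show ?case
    proof (cases "k \<in> J")
      case False
      then show ?thesis using insert.IH[of f] insert.prems by fastforce
    next
      case True
      \<comment> \<open>Coordinate \<open>k\<close> is split off: \<open>f\<close> is
        \<open>f'\<close> plus the multiple of the basis vector \<open>d\<close> by
        \<open>f k\<close>.\<close>
      define f' where "f' = (\<lambda>j\<in>J. if j = k then \<zero>\<^bsub>T\<^esub> else f j)"
      define d where "d = (\<lambda>j\<in>J. if j = k then \<one>\<^bsub>T\<^esub> else \<zero>\<^bsub>T\<^esub>)"
      have fin: "finite {j \<in> J. f j \<noteq> \<zero>\<^bsub>T\<^esub>}"
        using insert.prems insert.hyps finite_subset by blast
      have "finite {j \<in> J. f' j \<noteq> \<zero>\<^bsub>T\<^esub>}"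
        by (rule finite_subset[OF _ fin]) (auto simp: f'_def)
      moreover have "f' \<in> J \<rightarrow>\<^sub>E carrier T"
        using FJ[OF insert.prems(1)] by (auto simp: f'_def)
      ultimately have fF: "f' \<in> carrier ?F"
        unfolding free_module_def partial_object.simps by blast
      have "finite {j \<in> J. d j \<noteq> \<zero>\<^bsub>T\<^esub>}"
        by (rule finite_subset[of _ "{k}"]) (auto simp: d_def)
      moreover have "d \<in> J \<rightarrow>\<^sub>E carrier T"
        by (auto simp: d_def)
      ultimately have dF: "d \<in> carrier ?F"
        unfolding free_module_def partial_object.simps by blast
      have fk: "f k \<in> carrier T" using FJ insert.prems(1) True by blast
      have "\<exists>e. ?ann e \<and> tensor_mult S e = q f'"
        by (rule insert.IH[OF fF]) (use insert.prems(2) insert.prems(3) in \<open>auto simp: f'_def\<close>)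
      then obtain e where e: "?ann e" "tensor_mult S e = q f'" by blast
      define g where "g = f k \<odot>\<^bsub>?F\<^esub> d"
      have g: "g = (\<lambda>j\<in>J. if j = k then f k else \<zero>\<^bsub>T\<^esub>)"
        using fk by (auto simp: g_def d_def free_module_def fun_eq_iff)
      have "finite {j \<in> J. g j \<noteq> \<zero>\<^bsub>T\<^esub>}"
        by (rule finite_subset[of _ "{k}"]) (auto simp: g)
      moreover have "g \<in> J \<rightarrow>\<^sub>E carrier T"
        using fk by (auto simp: g)
      ultimately have gF: "g \<in> carrier ?F"
        unfolding free_module_def partial_object.simps by blast
      have "f \<in> extensional J"
        using insert.prems(1) by (simp add: free_module_def PiE_iff)
      have "f = f' \<oplus>\<^bsub>?F\<^esub> g"
      proof
        fix j
        show "f j = (f' \<oplus>\<^bsub>?F\<^esub> g) j"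
          using fk FJ[OF insert.prems(1), of j] extensional_arb[OF \<open>f \<in> extensional J\<close>, of j]
          by (cases "j \<in> J") (simp_all add: free_module_def f'_def g)
      qed
      then have qf: "q f = q f' \<oplus>\<^bsub>S\<^esub> tensor_mult S (f k) \<otimes>\<^bsub>S\<^esub> q d"
        using qadd[OF fF gF] qM[OF fk dF] unfolding g_def by metis
      \<comment> \<open>The element \<open>q d\<close> is lifted along the first tensor factor, so
        that the product map returns exactly the contribution of coordinate
        \<open>k\<close>.\<close>
      let ?e = "e \<oplus>\<^bsub>T\<^esub> f k \<otimes>\<^bsub>T\<^esub> pure (q d) \<one>\<^bsub>S\<^esub>"
      have qd: "q d \<in> carrier S" using qF dF by blast
      have "tensor_mult S ?e = q f"
        using e fk qd qf by (simp add: ring_hom_add[OF tensor_mult_hom] ring_hom_mult[OF tensor_mult_hom] tensor_mult_pure)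
      moreover have "?ann ?e"
        using e(1) fk qd insert.prems(3)[OF True] by (auto simp: T.r_distr simp flip: T.m_assoc)
      ultimately show ?thesis by blast
    qed
  qed
  have i1: "i \<one>\<^bsub>S\<^esub> \<in> carrier ?F" by (rule iF) simp
  have "\<exists>e. ?ann e \<and> tensor_mult S e = q (i \<one>\<^bsub>S\<^esub>)"
  proof (rule main[of "{j \<in> J. i \<one>\<^bsub>S\<^esub> j \<noteq> \<zero>\<^bsub>T\<^esub>}"])
    show "finite {j \<in> J. i \<one>\<^bsub>S\<^esub> j \<noteq> \<zero>\<^bsub>T\<^esub>}"
      using i1 by (simp add: free_module_def)
    fix j assume j: "j \<in> J"
    have "z \<otimes>\<^bsub>T\<^esub> i \<one>\<^bsub>S\<^esub> j = \<zero>\<^bsub>T\<^esub>" if z: "z \<in> ?ker" for z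
    proof -
      \<comment> \<open>Both \<open>z\<close> and 0 act on \<open>S\<close> through their value
        under the product map, which is 0 in either case, and \<open>i\<close> is linear.\<close>
      have "z \<odot>\<^bsub>?F\<^esub> i \<one>\<^bsub>S\<^esub> = \<zero>\<^bsub>T\<^esub> \<odot>\<^bsub>?F\<^esub> i \<one>\<^bsub>S\<^esub>"
        using iM[of z "\<one>\<^bsub>S\<^esub>"] iM[of "\<zero>\<^bsub>T\<^esub>" "\<one>\<^bsub>S\<^esub>"] z
          ring_hom_zero[OF tensor_mult_hom T.ring_axioms A.ring_axioms] by (simp add: M(2))
      from fun_cong[OF this, of j] show ?thesis
        using j FJ[OF i1 j] by (simp add: free_module_def)
    qed
    with FJ[OF i1 j] show "?ann (i \<one>\<^bsub>S\<^esub> j)" by blast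
  qed (use i1 in auto)
  then obtain e where e: "?ann e" and "tensor_mult S e = q (i \<one>\<^bsub>S\<^esub>)"
    by (elim exE conjE) blast
  moreover have "q (i \<one>\<^bsub>S\<^esub>) = \<one>\<^bsub>S\<^esub>"
    by (rule qi) (simp add: M(1))
  ultimately have e1: "tensor_mult S e = \<one>\<^bsub>S\<^esub>"
    by (simp only:)
  have eT: "e \<in> carrier T"
    using e by blast
  have "pure s \<one>\<^bsub>S\<^esub> \<otimes>\<^bsub>T\<^esub> e = pure \<one>\<^bsub>S\<^esub> s \<otimes>\<^bsub>T\<^esub> e" if s: "s \<in> carrier S" for s
  proof -
    have "pure s \<one>\<^bsub>S\<^esub> \<ominus>\<^bsub>T\<^esub> pure \<one>\<^bsub>S\<^esub> s \<in> ?ker"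
      using s tensor_mult_diff[of "pure s \<one>\<^bsub>S\<^esub>" "pure \<one>\<^bsub>S\<^esub> s"]
      by (simp add: tensor_mult_pure A.minus_eq A.r_neg)
    then have "(pure s \<one>\<^bsub>S\<^esub> \<ominus>\<^bsub>T\<^esub> pure \<one>\<^bsub>S\<^esub> s) \<otimes>\<^bsub>T\<^esub> e = \<zero>\<^bsub>T\<^esub>"
      using e by blast
    then have "pure s \<one>\<^bsub>S\<^esub> \<otimes>\<^bsub>T\<^esub> e \<oplus>\<^bsub>T\<^esub> (\<ominus>\<^bsub>T\<^esub> (pure \<one>\<^bsub>S\<^esub> s)) \<otimes>\<^bsub>T\<^esub> e = \<zero>\<^bsub>T\<^esub>"
      using s eT by (simp only: T.minus_eq T.l_distr pure_closed A.one_closed T.a_inv_closed)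
    then have "pure s \<one>\<^bsub>S\<^esub> \<otimes>\<^bsub>T\<^esub> e \<ominus>\<^bsub>T\<^esub> pure \<one>\<^bsub>S\<^esub> s \<otimes>\<^bsub>T\<^esub> e = \<zero>\<^bsub>T\<^esub>"
      using s eT by (simp only: T.minus_eq T.l_minus pure_closed A.one_closed)
    then show ?thesis
      by (rule iffD1[OF T.r_right_minus_eq, rotated 2]) (use s eT in \<open>simp_all only: pure_closed A.one_closed T.m_closed\<close>)
  qed
  then have "separability_idempotent e"
    unfolding separability_idempotent_def using eT e1 by blast
  then show thesis by (rule that)
qed

end

section \<open>Algebras generated by a root of a unit\<close>

lemma (in abelian_monoid) finsum_induct:
  assumes "finite A" "f \<in> A \<rightarrow> carrier G" "Q \<zero>"
    and "\<And>x y. x \<in> carrier G \<Longrightarrow> y \<in> carrier G \<Longrightarrow> Q x \<Longrightarrow> Q y \<Longrightarrow> Q (x \<oplus> y)"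
    and "\<And>i. i \<in> A \<Longrightarrow> Q (f i)"
  shows "Q (finsum G f A)"
  using assms(1,2,5)
proof (induction A)
  case (insert i A)
  then have f: "f \<in> A \<rightarrow> carrier G" "f i \<in> carrier G" by auto
  have "Q (f i \<oplus> finsum G f A)"
    using insert f by (intro assms(4)) auto
  then show ?case using insert f by simp
qed (simp add: assms(3))

lemma (in abelian_group) a_hom_finsum:
  assumes h: "h \<in> hom (add_monoid G) (add_monoid C)" and C: "abelian_group C"
    and f: "f \<in> A \<rightarrow> carrier G"
  shows "h (finsum G f A) = finsum C (\<lambda>i. h (f i)) A"
proof -
  interpret C: abelian_group C by fact
  interpret group_hom "add_monoid G" "add_monoid C" h
    by (intro group_hom.intro group_hom_axioms.intro a_group C.a_group h)
  have hc: "h x \<in> carrier C" if "x \<in> carrier G" for x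
    using hom_closed that by simp
  have h0: "h \<zero> = \<zero>\<^bsub>C\<^esub>" using hom_one by simp
  show ?thesis
  proof (cases "finite A")
    case True
    then show ?thesis using f
    proof (induction A)
      case (insert i A)
      then have f: "f \<in> A \<rightarrow> carrier G" "f i \<in> carrier G" by auto
      then have "(\<lambda>i. h (f i)) \<in> A \<rightarrow> carrier C" using hc by auto
      then show ?case using insert f hc hom_mult[of "f i" "finsum G f A"] by simp
    qed (simp add: h0)
  qed (simp add: h0)
qed

definition lin :: "('s, 'm) ring_scheme \<Rightarrow> ('r \<Rightarrow> 's) \<Rightarrow> nat \<Rightarrow> 's \<Rightarrow> (nat \<Rightarrow> 'r) \<Rightarrow> 's" where
  "lin S b p a r = (\<Oplus>\<^bsub>S\<^esub>i\<in>{..<p}. b (r i) \<otimes>\<^bsub>S\<^esub> a [^]\<^bsub>S\<^esub> i)"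

text \<open>The powers of \<open>a\<close> below \<open>p\<close> form an \<open>R\<close>-basis.
  Coefficient families are total functions, so only their values below \<open>p\<close> carry
  information and comparisons are limited to these.\<close>

definition power_basis :: "('r, 'l) ring_scheme \<Rightarrow> ('s, 'm) ring_scheme \<Rightarrow> ('r \<Rightarrow> 's) \<Rightarrow> nat \<Rightarrow> 's \<Rightarrow> bool" where
  "power_basis R S b p a \<longleftrightarrow>
     (\<forall>s\<in>carrier S. \<exists>r\<in>{..<p} \<rightarrow> carrier R. s = lin S b p a r) \<and>
     (\<forall>r\<in>{..<p} \<rightarrow> carrier R. lin S b p a r = \<zero>\<^bsub>S\<^esub> \<longrightarrow> (\<forall>i<p. r i = \<zero>\<^bsub>R\<^esub>))"

text \<open>The relation for \<open>a\<close> without independence of its powers: this is the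
  setting for targets of maps and for spans inside a larger ring.\<close>

locale power_alg = R: cring R + S: cring S
  for R :: "('r, 'l) ring_scheme" and S :: "('s, 'm) ring_scheme" +
  fixes b :: "'r \<Rightarrow> 's" and p :: nat and u :: 'r and a :: 's
  assumes b_hom: "b \<in> ring_hom R S" and p_gt_1: "1 < p"
    and u_closed: "u \<in> carrier R" and a_closed: "a \<in> carrier S"
    and a_pow: "a [^]\<^bsub>S\<^esub> p = b u"
begin

lemmas b_simps = ring_hom_closed[OF b_hom] ring_hom_add[OF b_hom] ring_hom_mult[OF b_hom]
  ring_hom_one[OF b_hom] ring_hom_zero[OF b_hom R.ring_axioms S.ring_axioms]

declare a_closed [simp] u_closed [simp] b_simps [simp]

abbreviation "L \<equiv> lin S b p a"
abbreviation "Co \<equiv> {..<p} \<rightarrow> carrier R"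

lemma Co_mem [simp]: "r \<in> Co \<Longrightarrow> i < p \<Longrightarrow> r i \<in> carrier R"
  by auto

lemma term_closed: "r \<in> Co \<Longrightarrow> (\<lambda>i. b (r i) \<otimes>\<^bsub>S\<^esub> a [^]\<^bsub>S\<^esub> i) \<in> {..<p} \<rightarrow> carrier S"
  by (auto simp: Pi_iff)

lemma lin_closed [simp]: "r \<in> Co \<Longrightarrow> L r \<in> carrier S"
  unfolding lin_def by (rule S.finsum_closed) (rule term_closed)

lemma lin_cong: "r' \<in> Co \<Longrightarrow> (\<And>i. i < p \<Longrightarrow> r i = r' i) \<Longrightarrow> L r = L r'"
  unfolding lin_def by (rule S.finsum_cong') (auto simp: Pi_iff)

lemma lin_add: "r \<in> Co \<Longrightarrow> r' \<in> Co \<Longrightarrow> L (\<lambda>i. r i \<oplus>\<^bsub>R\<^esub> r' i) = L r \<oplus>\<^bsub>S\<^esub> L r'"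
  unfolding lin_def S.finsum_addf[OF term_closed term_closed, symmetric]
  by (rule S.finsum_cong') (auto simp: Pi_iff S.l_distr)

lemma lin_smult: "c \<in> carrier R \<Longrightarrow> r \<in> Co \<Longrightarrow> L (\<lambda>i. c \<otimes>\<^bsub>R\<^esub> r i) = b c \<otimes>\<^bsub>S\<^esub> L r"
  unfolding lin_def S.finsum_rdistr[OF finite_lessThan ring_hom_closed[OF b_hom] term_closed]
  by (rule S.finsum_cong') (auto simp: Pi_iff S.m_assoc)

lemma lin_zero: "L (\<lambda>i. \<zero>\<^bsub>R\<^esub>) = \<zero>\<^bsub>S\<^esub>"
  unfolding lin_def by (rule trans[OF S.finsum_cong' S.finsum_zero]) auto

lemma lin_single:
  assumes "k < p" "c \<in> carrier R"
  shows "L (\<lambda>i. if i = k then c else \<zero>\<^bsub>R\<^esub>) = b c \<otimes>\<^bsub>S\<^esub> a [^]\<^bsub>S\<^esub> k"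
proof -
  have "L (\<lambda>i. if i = k then c else \<zero>\<^bsub>R\<^esub>) =
    (\<Oplus>\<^bsub>S\<^esub>i\<in>{..<p}. if k = i then b c \<otimes>\<^bsub>S\<^esub> a [^]\<^bsub>S\<^esub> i else \<zero>\<^bsub>S\<^esub>)"
    unfolding lin_def by (rule S.finsum_cong') (use assms in auto)
  also have "\<dots> = b c \<otimes>\<^bsub>S\<^esub> a [^]\<^bsub>S\<^esub> k"
    by (rule S.finsum_singleton[of k "{..<p}" "\<lambda>i. b c \<otimes>\<^bsub>S\<^esub> a [^]\<^bsub>S\<^esub> i"]) (use assms in auto)
  finally show ?thesis .
qed

text \<open>Multiplication by \<open>a\<close> on coefficient families: the coefficient of
  \<open>a^(p-1)\<close> wraps around to degree 0 and picks up the factor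
  \<open>u = a^p\<close>.\<close>

definition shift :: "(nat \<Rightarrow> 'r) \<Rightarrow> nat \<Rightarrow> 'r" where
  "shift r = (\<lambda>i. if i = 0 then u \<otimes>\<^bsub>R\<^esub> r (p - 1) else r (i - 1))"

lemma shift_closed: "r \<in> Co \<Longrightarrow> shift r \<in> Co"
  using p_gt_1 by (auto simp: shift_def Pi_iff)

lemma lin_shift:
  assumes r: "r \<in> Co"
  shows "L (shift r) = a \<otimes>\<^bsub>S\<^esub> L r"
proof -
  obtain n where p: "p = Suc (Suc n)"
    using p_gt_1 by (metis One_nat_def Suc_lessE less_imp_Suc_add)
  have set: "{..<p} = {..Suc n}" using p by auto
  have rc: "r i \<in> carrier R" if "i \<le> Suc n" for i using r that p by auto
  have sh: "shift r 0 = u \<otimes>\<^bsub>R\<^esub> r (Suc n)" "shift r (Suc i) = r i" for i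
    unfolding shift_def by (simp_all add: p)
  have shc: "shift r i \<in> carrier R" if "i \<le> Suc n" for i
    using shift_closed[OF r] that p by auto
  have "L (shift r) = (\<Oplus>\<^bsub>S\<^esub>i\<in>{..n}. b (r i) \<otimes>\<^bsub>S\<^esub> a [^]\<^bsub>S\<^esub> Suc i) \<oplus>\<^bsub>S\<^esub> b (u \<otimes>\<^bsub>R\<^esub> r (Suc n))"
    unfolding lin_def set
    by (subst S.finsum_Suc2) (use rc shc in \<open>auto simp: sh\<close>)
  also have "(\<Oplus>\<^bsub>S\<^esub>i\<in>{..n}. b (r i) \<otimes>\<^bsub>S\<^esub> a [^]\<^bsub>S\<^esub> Suc i) =
      (\<Oplus>\<^bsub>S\<^esub>i\<in>{..n}. a \<otimes>\<^bsub>S\<^esub> (b (r i) \<otimes>\<^bsub>S\<^esub> a [^]\<^bsub>S\<^esub> i))"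
    by (rule S.finsum_cong') (use rc in \<open>auto simp: S.m_ac\<close>)
  also have "b (u \<otimes>\<^bsub>R\<^esub> r (Suc n)) = a \<otimes>\<^bsub>S\<^esub> (b (r (Suc n)) \<otimes>\<^bsub>S\<^esub> a [^]\<^bsub>S\<^esub> Suc n)"
    using rc[of "Suc n"] by (simp add: p S.m_ac flip: a_pow)
  also have "(\<Oplus>\<^bsub>S\<^esub>i\<in>{..n}. a \<otimes>\<^bsub>S\<^esub> (b (r i) \<otimes>\<^bsub>S\<^esub> a [^]\<^bsub>S\<^esub> i)) \<oplus>\<^bsub>S\<^esub> a \<otimes>\<^bsub>S\<^esub> (b (r (Suc n)) \<otimes>\<^bsub>S\<^esub> a [^]\<^bsub>S\<^esub> Suc n)
    = (\<Oplus>\<^bsub>S\<^esub>i\<in>{..Suc n}. a \<otimes>\<^bsub>S\<^esub> (b (r i) \<otimes>\<^bsub>S\<^esub> a [^]\<^bsub>S\<^esub> i))"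
    by (subst S.finsum_Suc) (use rc in \<open>auto simp: S.a_comm Pi_iff simp del: S.nat_pow_Suc\<close>)
  also have "\<dots> = a \<otimes>\<^bsub>S\<^esub> L r"
    unfolding lin_def set by (rule S.finsum_rdistr[symmetric]) (use rc in auto)
  finally show ?thesis .
qed

text \<open>The subring generated by the base and \<open>a\<close>; the powers below
  \<open>p\<close> suffice because \<open>shift\<close> folds the higher ones back. In the tensor
  product it becomes the carrier of the Harrison product.\<close>

definition span :: "'s set" where "span = L ` Co"

lemma span_I: "r \<in> Co \<Longrightarrow> L r \<in> span"
  by (simp add: span_def)

lemma span_closed: "x \<in> span \<Longrightarrow> x \<in> carrier S"
  by (auto simp: span_def)

lemma span_add: "x \<in> span \<Longrightarrow> y \<in> span \<Longrightarrow> x \<oplus>\<^bsub>S\<^esub> y \<in> span"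
  by (auto simp: span_def simp flip: lin_add intro!: imageI R.a_closed)

lemma span_smult: "c \<in> carrier R \<Longrightarrow> x \<in> span \<Longrightarrow> b c \<otimes>\<^bsub>S\<^esub> x \<in> span"
  by (auto simp: span_def simp flip: lin_smult intro!: imageI R.m_closed)

lemma span_power: "k < p \<Longrightarrow> c \<in> carrier R \<Longrightarrow> b c \<otimes>\<^bsub>S\<^esub> a [^]\<^bsub>S\<^esub> k \<in> span"
  by (auto simp: span_def simp flip: lin_single intro!: imageI)

lemma span_base: "c \<in> carrier R \<Longrightarrow> b c \<in> span"
  using span_power[of 0 c] p_gt_1 by simp

lemma span_gen: "a \<in> span"
  using span_power[of 1 "\<one>\<^bsub>R\<^esub>"] p_gt_1 by simp

lemma span_gen_mult: "x \<in> span \<Longrightarrow> a [^]\<^bsub>S\<^esub> (i::nat) \<otimes>\<^bsub>S\<^esub> x \<in> span"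
proof (induction i)
  case (Suc i)
  then obtain r where "r \<in> Co" "a [^]\<^bsub>S\<^esub> i \<otimes>\<^bsub>S\<^esub> x = L r" by (auto simp: span_def)
  moreover have "a [^]\<^bsub>S\<^esub> Suc i \<otimes>\<^bsub>S\<^esub> x = a \<otimes>\<^bsub>S\<^esub> (a [^]\<^bsub>S\<^esub> i \<otimes>\<^bsub>S\<^esub> x)"
    using span_closed[OF Suc.prems] by (simp add: S.m_ac)
  ultimately show ?case using lin_shift shift_closed span_I by metis
qed (simp add: span_closed)

lemma span_mult:
  assumes "x \<in> span" "y \<in> span"
  shows "x \<otimes>\<^bsub>S\<^esub> y \<in> span"
proof -
  obtain r where r: "r \<in> Co" "x = L r" using assms by (auto simp: span_def)
  have "L r \<otimes>\<^bsub>S\<^esub> y \<in> span"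
    unfolding lin_def
  proof (rule S.finsum_induct[OF finite_lessThan term_closed[OF r(1)]])
    show "\<zero>\<^bsub>S\<^esub> \<otimes>\<^bsub>S\<^esub> y \<in> span"
      using span_base[of "\<zero>\<^bsub>R\<^esub>"] span_closed[OF assms(2)] by simp
  next
    fix v w assume "v \<in> carrier S" "w \<in> carrier S" "v \<otimes>\<^bsub>S\<^esub> y \<in> span" "w \<otimes>\<^bsub>S\<^esub> y \<in> span"
    then show "(v \<oplus>\<^bsub>S\<^esub> w) \<otimes>\<^bsub>S\<^esub> y \<in> span"
      using span_add span_closed[OF assms(2)] by (simp add: S.l_distr)
  next
    fix i assume "i \<in> {..<p}"
    then show "b (r i) \<otimes>\<^bsub>S\<^esub> a [^]\<^bsub>S\<^esub> i \<otimes>\<^bsub>S\<^esub> y \<in> span"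
      using span_smult[OF _ span_gen_mult[OF assms(2)], of "r i" i] r span_closed[OF assms(2)]
      by (simp add: S.m_assoc)
  qed
  then show ?thesis by (simp add: r)
qed

lemma span_neg: "x \<in> span \<Longrightarrow> \<ominus>\<^bsub>S\<^esub> x \<in> span"
proof -
  assume x: "x \<in> span"
  have "b (\<ominus>\<^bsub>R\<^esub> \<one>\<^bsub>R\<^esub>) \<oplus>\<^bsub>S\<^esub> \<one>\<^bsub>S\<^esub> = \<zero>\<^bsub>S\<^esub>"
    using ring_hom_add[OF b_hom, of "\<ominus>\<^bsub>R\<^esub> \<one>\<^bsub>R\<^esub>" "\<one>\<^bsub>R\<^esub>"] by (simp add: R.l_neg)
  then have "b (\<ominus>\<^bsub>R\<^esub> \<one>\<^bsub>R\<^esub>) = \<ominus>\<^bsub>S\<^esub> \<one>\<^bsub>S\<^esub>"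
    using S.minus_equality[of "b (\<ominus>\<^bsub>R\<^esub> \<one>\<^bsub>R\<^esub>)" "\<one>\<^bsub>S\<^esub>"] by simp
  then have "b (\<ominus>\<^bsub>R\<^esub> \<one>\<^bsub>R\<^esub>) \<otimes>\<^bsub>S\<^esub> x = \<ominus>\<^bsub>S\<^esub> x"
    using span_closed[OF x] by (simp add: S.l_minus)
  then show ?thesis using span_smult[of "\<ominus>\<^bsub>R\<^esub> \<one>\<^bsub>R\<^esub>" x] x by simp
qed

lemma span_cring: "cring (S\<lparr>carrier := span\<rparr>)"
proof -
  have "subcring span S"
  proof (rule S.subcringI')
    show "subring span S"
      by (rule S.subringI) (auto simp: span_closed span_neg span_add span_mult
        intro: span_base[of "\<one>\<^bsub>R\<^esub>", simplified])
  qed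
  then show ?thesis using S.subcring_iff span_closed by blast
qed

text \<open>Serves two purposes: with \<open>c\<close> the value of a character it describes the
  group action, with \<open>c\<close> a unit it describes a change of generator.\<close>

lemma lin_scale:
  assumes c: "c \<in> carrier R" and r: "r \<in> Co"
  shows "lin S b p (b c \<otimes>\<^bsub>S\<^esub> a) r = L (\<lambda>i. c [^]\<^bsub>R\<^esub> i \<otimes>\<^bsub>R\<^esub> r i)"
proof -
  have "b (c [^]\<^bsub>R\<^esub> i) = b c [^]\<^bsub>S\<^esub> i" for i :: nat
    using c by (induction i) auto
  then show ?thesis
    unfolding lin_def
    by (intro S.finsum_cong') (use c r in \<open>auto simp: Pi_iff S.nat_pow_distrib S.m_ac\<close>)
qed

end

lemma (in power_alg) lin_hom:
  assumes f: "f \<in> ring_hom S S'" and S': "cring S'" and fb: "\<And>r. r \<in> carrier R \<Longrightarrow> f (b r) = b' r"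
    and r: "r \<in> Co"
  shows "f (L r) = lin S' b' p (f a) r"
proof -
  interpret f: ring_hom_cring S S' f
    by (rule ring_hom_cringI[OF S.is_cring S' f])
  have "b' x \<in> carrier S'" if "x \<in> carrier R" for x
    using fb[OF that, symmetric] that by simp
  then show ?thesis
    unfolding lin_def using r
    by (subst f.hom_finsum) (auto simp: Pi_iff fb intro!: f.S.finsum_cong')
qed

locale power_basis_alg = power_alg R S b p u a
  for R :: "('r, 'l) ring_scheme" and S :: "('s, 'm) ring_scheme"
    and b :: "'r \<Rightarrow> 's" and p :: nat and u :: 'r and a :: 's +
  assumes basis: "power_basis R S b p a"
begin

lemma lin_eqD:
  assumes "r \<in> Co" "r' \<in> Co" "L r = L r'" "i < p"
  shows "r i = r' i"
proof -
  let ?n = "\<lambda>i. (\<ominus>\<^bsub>R\<^esub> \<one>\<^bsub>R\<^esub>) \<otimes>\<^bsub>R\<^esub> r' i"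
  have n: "?n \<in> Co" using assms by auto
  have "L (\<lambda>i. ?n i \<oplus>\<^bsub>R\<^esub> r' i) = L (\<lambda>i. \<zero>\<^bsub>R\<^esub>)"
    by (rule lin_cong) (use assms(2) in \<open>auto simp: Pi_iff R.l_minus R.l_neg\<close>)
  then have "L ?n \<oplus>\<^bsub>S\<^esub> L r' = \<zero>\<^bsub>S\<^esub>"
    using lin_add[OF n assms(2)] lin_zero by simp
  then have "L (\<lambda>i. ?n i \<oplus>\<^bsub>R\<^esub> r i) = \<zero>\<^bsub>S\<^esub>"
    using lin_add[OF n assms(1)] assms(3) by simp
  moreover have "(\<lambda>i. ?n i \<oplus>\<^bsub>R\<^esub> r i) \<in> Co" using assms by auto
  ultimately have "?n i \<oplus>\<^bsub>R\<^esub> r i = \<zero>\<^bsub>R\<^esub>"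
    using basis assms(4) unfolding power_basis_def by blast
  then have "\<ominus>\<^bsub>R\<^esub> (r' i) \<oplus>\<^bsub>R\<^esub> r i = \<zero>\<^bsub>R\<^esub>"
    using assms by (auto simp: Pi_iff R.l_minus)
  then have "\<ominus>\<^bsub>R\<^esub> r i = \<ominus>\<^bsub>R\<^esub> r' i"
    using assms R.minus_equality[of "\<ominus>\<^bsub>R\<^esub> (r' i)" "r i"] by (auto simp: Pi_iff)
  then show ?thesis
    using assms by (auto simp: Pi_iff R.a_inv_inj dest: inj_onD[OF R.a_inv_inj])
qed

definition coef :: "'s \<Rightarrow> nat \<Rightarrow> 'r" where
  "coef s = (SOME r. r \<in> Co \<and> s = L r)"

lemma coef:
  assumes "s \<in> carrier S"
  shows coef_closed: "coef s \<in> Co" and lin_coef: "L (coef s) = s"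
proof -
  have "\<exists>r. r \<in> Co \<and> s = L r"
    using basis assms unfolding power_basis_def by blast
  then have "coef s \<in> Co \<and> s = L (coef s)"
    unfolding coef_def by (rule someI_ex)
  then show "coef s \<in> Co" "L (coef s) = s" by auto
qed

lemma coef_closed' [simp]: "s \<in> carrier S \<Longrightarrow> i < p \<Longrightarrow> coef s i \<in> carrier R"
  using coef_closed by auto

lemma coef_lin: "r \<in> Co \<Longrightarrow> i < p \<Longrightarrow> coef (L r) i = r i"
  by (rule lin_eqD) (auto intro: coef lin_closed)

lemma coef_add:
  assumes "s \<in> carrier S" "s' \<in> carrier S" "i < p"
  shows "coef (s \<oplus>\<^bsub>S\<^esub> s') i = coef s i \<oplus>\<^bsub>R\<^esub> coef s' i"
  using coef_lin[of "\<lambda>i. coef s i \<oplus>\<^bsub>R\<^esub> coef s' i" i] assms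
  by (auto simp: lin_add coef lin_coef)

lemma coef_smult:
  assumes "s \<in> carrier S" "c \<in> carrier R" "i < p"
  shows "coef (b c \<otimes>\<^bsub>S\<^esub> s) i = c \<otimes>\<^bsub>R\<^esub> coef s i"
  using coef_lin[of "\<lambda>i. c \<otimes>\<^bsub>R\<^esub> coef s i" i] assms
  by (auto simp: lin_smult coef lin_coef)

lemma coef_power:
  assumes "c \<in> carrier R" "k < p" "i < p"
  shows "coef (b c \<otimes>\<^bsub>S\<^esub> a [^]\<^bsub>S\<^esub> k) i = (if i = k then c else \<zero>\<^bsub>R\<^esub>)"
  using coef_lin[of "\<lambda>i. if i = k then c else \<zero>\<^bsub>R\<^esub>" i] lin_single[of k c] assms by auto

lemma base_inj: "inj_on b (carrier R)"
proof (rule inj_onI)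
  fix x y assume xy: "x \<in> carrier R" "y \<in> carrier R" "b x = b y"
  then show "x = y"
    using coef_power[of x 0 0] coef_power[of y 0 0] p_gt_1 by simp
qed

text \<open>An algebra with such a basis is \<open>R[T]/(T^p - u)\<close>, so a map out of it
  amounts to a choice of a \<open>p\<close>-th root of \<open>u\<close> in the target.\<close>

lemma lift:
  assumes S': "power_alg R S' b' p u a'"
  obtains f where "f \<in> ring_hom S S'" "\<And>r. r \<in> Co \<Longrightarrow> f (L r) = lin S' b' p a' r"
    "\<And>r. r \<in> carrier R \<Longrightarrow> f (b r) = b' r" "f a = a'"
proof -
  interpret S': power_alg R S' b' p u a' by fact
  define f where "f s = S'.L (coef s)" for s
  have fL: "f (L r) = S'.L r" if "r \<in> Co" for r
    unfolding f_def by (rule S'.lin_cong) (use that in \<open>auto simp: coef_lin\<close>)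
  have fc: "f s \<in> carrier S'" if "s \<in> carrier S" for s
    using that by (simp add: f_def coef)
  have fadd: "f (s \<oplus>\<^bsub>S\<^esub> t) = f s \<oplus>\<^bsub>S'\<^esub> f t" if s: "s \<in> carrier S" and t: "t \<in> carrier S" for s t
  proof -
    note c = coef_closed[OF s] coef_closed[OF t]
    have "(\<lambda>i. coef s i \<oplus>\<^bsub>R\<^esub> coef t i) \<in> Co" using s t by auto
    from fL[OF this] show ?thesis
      unfolding lin_add[OF c] S'.lin_add[OF c] lin_coef[OF s] lin_coef[OF t] by (simp only: f_def)
  qed
  have fsm: "f (b c \<otimes>\<^bsub>S\<^esub> s) = b' c \<otimes>\<^bsub>S'\<^esub> f s" if s: "s \<in> carrier S" and c: "c \<in> carrier R" for s c
  proof -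
    have "(\<lambda>i. c \<otimes>\<^bsub>R\<^esub> coef s i) \<in> Co" using s c by auto
    from fL[OF this] show ?thesis
      unfolding lin_smult[OF c coef_closed[OF s]] S'.lin_smult[OF c coef_closed[OF s]] lin_coef[OF s]
      by (simp only: f_def)
  qed
  \<comment> \<open>Multiplication by the generator is the same \<open>shift\<close> on coefficients
    in both algebras. General multiplicativity is built up from this case through powers and linear
    combinations.\<close>
  have fa: "f (a \<otimes>\<^bsub>S\<^esub> s) = a' \<otimes>\<^bsub>S'\<^esub> f s" if s: "s \<in> carrier S" for s
    using fL[OF shift_closed[OF coef_closed[OF s]]] S'.lin_shift[OF coef_closed[OF s]]
    unfolding lin_shift[OF coef_closed[OF s]] lin_coef[OF s] by (simp only: f_def)
  have fpow: "f (a [^]\<^bsub>S\<^esub> i \<otimes>\<^bsub>S\<^esub> s) = a' [^]\<^bsub>S'\<^esub> i \<otimes>\<^bsub>S'\<^esub> f s" if "s \<in> carrier S" for s and i :: nat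
  proof (induction i)
    case (Suc i)
    have "a [^]\<^bsub>S\<^esub> Suc i \<otimes>\<^bsub>S\<^esub> s = a \<otimes>\<^bsub>S\<^esub> (a [^]\<^bsub>S\<^esub> i \<otimes>\<^bsub>S\<^esub> s)"
      using that by (simp add: S.m_ac)
    with Suc that fc show ?case by (simp add: fa S'.S.m_ac)
  qed (use that fc in simp)
  have fb: "f (b c) = b' c" if "c \<in> carrier R" for c
    using fL[of "\<lambda>i. if i = 0 then c else \<zero>\<^bsub>R\<^esub>"] that p_gt_1 lin_single[of 0 c] S'.lin_single[of 0 c] by auto
  have f1: "f \<one>\<^bsub>S\<^esub> = \<one>\<^bsub>S'\<^esub>"
    using fb[of "\<one>\<^bsub>R\<^esub>"] by simp
  have fpow': "f (a [^]\<^bsub>S\<^esub> i) = a' [^]\<^bsub>S'\<^esub> i" for i :: nat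
    using fpow[of "\<one>\<^bsub>S\<^esub>" i] f1 by simp
  have fm: "f (s \<otimes>\<^bsub>S\<^esub> t) = f s \<otimes>\<^bsub>S'\<^esub> f t" if s: "s \<in> carrier S" and t: "t \<in> carrier S" for s t
  proof -
    have "f (L (coef s) \<otimes>\<^bsub>S\<^esub> t) = f (L (coef s)) \<otimes>\<^bsub>S'\<^esub> f t"
      unfolding lin_def
    proof (rule S.finsum_induct[OF finite_lessThan term_closed[OF coef_closed[OF s]]])
      have f0: "f \<zero>\<^bsub>S\<^esub> = \<zero>\<^bsub>S'\<^esub>" using fb[of "\<zero>\<^bsub>R\<^esub>"] by simp
      show "f (\<zero>\<^bsub>S\<^esub> \<otimes>\<^bsub>S\<^esub> t) = f \<zero>\<^bsub>S\<^esub> \<otimes>\<^bsub>S'\<^esub> f t"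
        using t fc by (simp add: f0)
    next
      fix v w assume "v \<in> carrier S" "w \<in> carrier S" "f (v \<otimes>\<^bsub>S\<^esub> t) = f v \<otimes>\<^bsub>S'\<^esub> f t" "f (w \<otimes>\<^bsub>S\<^esub> t) = f w \<otimes>\<^bsub>S'\<^esub> f t"
      then show "f ((v \<oplus>\<^bsub>S\<^esub> w) \<otimes>\<^bsub>S\<^esub> t) = f (v \<oplus>\<^bsub>S\<^esub> w) \<otimes>\<^bsub>S'\<^esub> f t"
        using t fc by (simp add: S.l_distr fadd S'.S.l_distr)
    next
      fix i assume "i \<in> {..<p}"
      then have c: "coef s i \<in> carrier R" using s by simp
      show "f (b (coef s i) \<otimes>\<^bsub>S\<^esub> a [^]\<^bsub>S\<^esub> i \<otimes>\<^bsub>S\<^esub> t) = f (b (coef s i) \<otimes>\<^bsub>S\<^esub> a [^]\<^bsub>S\<^esub> i) \<otimes>\<^bsub>S'\<^esub> f t"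
        using c t fc by (simp add: S.m_assoc fsm fpow fpow' S'.S.m_assoc)
    qed
    then show ?thesis using s by (simp add: lin_coef)
  qed
  show thesis
  proof (rule that[of f])
    show "f \<in> ring_hom S S'"
      by (rule ring_hom_memI) (use fc fadd fm f1 in auto)
    show "f a = a'" using fpow'[of 1] by simp
  qed (use fL fb in auto)
qed

end

section \<open>Kummer extensions\<close>

text \<open>The hypotheses shared by the adele ring and all local fields, so that both rows of the
  diagram are instances of one development.\<close>

locale kummer_base = R: cring R + G: group G
  for R :: "('r, 'l) ring_scheme" and G :: "('g, 'm) monoid_scheme" +
  fixes \<iota> :: "'k::field \<Rightarrow> 'r" and p :: nat and \<chi> :: "'g \<Rightarrow> 'k"
  assumes iota: "\<iota> \<in> ring_hom ring_of_type_algebra R"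
    and nontriv: "\<one>\<^bsub>R\<^esub> \<noteq> \<zero>\<^bsub>R\<^esub>"
    and p_prime: "Factorial_Ring.prime p" and p_nonzero: "of_nat p \<noteq> (0::'k)"
    and order: "Coset.order G = p"
    and chi: "\<chi> \<in> hom G scalar_group" and chi_nontriv: "\<exists>g\<in>carrier G. \<chi> g \<noteq> 1"
begin

lemma iota_simps [simp]:
  "\<iota> x \<in> carrier R" "\<iota> (x + y) = \<iota> x \<oplus>\<^bsub>R\<^esub> \<iota> y" "\<iota> (x * y) = \<iota> x \<otimes>\<^bsub>R\<^esub> \<iota> y"
  "\<iota> 1 = \<one>\<^bsub>R\<^esub>" "\<iota> 0 = \<zero>\<^bsub>R\<^esub>"
  using ring_hom_closed[OF iota, of x] ring_hom_add[OF iota, of x y] ring_hom_mult[OF iota, of x y]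
    ring_hom_one[OF iota] ring_hom_zero[OF iota ring_from_type_algebra R.ring_axioms]
  by (simp_all add: ring_of_type_algebra_def)

lemma iota_minus [simp]: "\<iota> (- x) = \<ominus>\<^bsub>R\<^esub> \<iota> x"
  using R.minus_equality[of "\<iota> (- x)" "\<iota> x"] iota_simps(2)[of "- x" x, symmetric] by simp

lemma iota_diff: "\<iota> (x - y) = \<iota> x \<ominus>\<^bsub>R\<^esub> \<iota> y"
  using iota_simps(2)[of x "- y"] by (simp add: R.minus_eq del: iota_simps)

lemma iota_pow [simp]: "\<iota> (x ^ n) = \<iota> x [^]\<^bsub>R\<^esub> n"
  by (induction n) (simp_all add: R.m_comm)

lemma iota_inverse: "x \<noteq> 0 \<Longrightarrow> \<iota> (inverse x) \<otimes>\<^bsub>R\<^esub> \<iota> x = \<one>\<^bsub>R\<^esub>"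
  by (metis iota_simps(3,4) left_inverse)

lemma iota_nonzero: "x \<noteq> 0 \<Longrightarrow> \<iota> x \<noteq> \<zero>\<^bsub>R\<^esub>"
  using iota_inverse[of x] nontriv by auto

lemma iota_sum: "finite A \<Longrightarrow> \<iota> (\<Sum>i\<in>A. f i) = (\<Oplus>\<^bsub>R\<^esub>i\<in>A. \<iota> (f i))"
  by (induction A rule: finite_induct) auto

lemma iota_cancel:
  assumes "x \<noteq> 0" "r \<in> carrier R" "\<iota> x \<otimes>\<^bsub>R\<^esub> r = \<zero>\<^bsub>R\<^esub>"
  shows "r = \<zero>\<^bsub>R\<^esub>"
proof -
  have "\<iota> (inverse x) \<otimes>\<^bsub>R\<^esub> (\<iota> x \<otimes>\<^bsub>R\<^esub> r) = r"
    using assms(1,2) by (simp add: iota_inverse flip: R.m_assoc)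
  with assms(3) show ?thesis by simp
qed

lemma p_gt_1: "1 < p" using p_prime prime_gt_1_nat by blast

lemma chi_mult: "g \<in> carrier G \<Longrightarrow> h \<in> carrier G \<Longrightarrow> \<chi> (g \<otimes>\<^bsub>G\<^esub> h) = \<chi> g * \<chi> h"
  using hom_mult[OF chi, of g h] by (simp add: units_of_def ring_of_type_algebra_def)

lemma chi_nonzero: "g \<in> carrier G \<Longrightarrow> \<chi> g \<noteq> 0"
  using hom_in_carrier[OF chi, of g] by (auto simp: units_of_def Units_def ring_of_type_algebra_def)

lemma chi_one: "\<chi> \<one>\<^bsub>G\<^esub> = 1"
  using chi_mult[of "\<one>\<^bsub>G\<^esub>" "\<one>\<^bsub>G\<^esub>"] chi_nonzero[of "\<one>\<^bsub>G\<^esub>"] by simp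

lemma chi_pow: "g \<in> carrier G \<Longrightarrow> \<chi> (g [^]\<^bsub>G\<^esub> (n::nat)) = \<chi> g ^ n"
  by (induction n) (simp_all add: chi_one chi_mult)

lemma chi_inv: "g \<in> carrier G \<Longrightarrow> \<chi> (inv\<^bsub>G\<^esub> g) = inverse (\<chi> g)"
  using chi_mult[of "inv\<^bsub>G\<^esub> g" g] chi_one inverse_unique[of "\<chi> g" "\<chi> (inv\<^bsub>G\<^esub> g)"]
  by (simp add: mult.commute)

lemma pow_p: "g \<in> carrier G \<Longrightarrow> \<chi> g ^ p = 1"
  using chi_pow[of g p] G.pow_order_eq_1[of g] order chi_one by simp

definition g0 where "g0 = (SOME g. g \<in> carrier G \<and> \<chi> g \<noteq> 1)"

lemma g0: "g0 \<in> carrier G" "\<chi> g0 \<noteq> 1"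
proof -
  have "g0 \<in> carrier G \<and> \<chi> g0 \<noteq> 1"
    unfolding g0_def by (rule someI_ex) (use chi_nontriv in blast)
  then show "g0 \<in> carrier G" "\<chi> g0 \<noteq> 1" by auto
qed

definition \<zeta> where "\<zeta> = \<chi> g0"

lemma zeta_nonzero [simp]: "\<zeta> \<noteq> 0" by (simp add: \<zeta>_def chi_nonzero g0)

lemma zeta_pow_p: "\<zeta> ^ p = 1" by (simp add: \<zeta>_def pow_p g0)

text \<open>As \<open>p\<close> is prime, \<open>k\<close> is invertible modulo \<open>p\<close>,
  and Bezout's identity recovers \<zeta> from its \<open>k\<close>-th power.\<close>

lemma zeta_pow_neq_1: "0 < k \<Longrightarrow> k < p \<Longrightarrow> \<zeta> ^ k \<noteq> 1"
proof
  assume k: "0 < k" "k < p" "\<zeta> ^ k = 1"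
  have "coprime k p"
    using k p_prime by (meson coprime_commute nat_dvd_not_less prime_imp_coprime)
  then obtain x y where "k * x = p * y + 1"
    using bezout_nat[of k p] k by auto
  then have "\<zeta> ^ (k * x) = \<zeta> ^ (p * y) * \<zeta>" by simp
  then show False using k zeta_pow_p g0 by (simp add: power_mult \<zeta>_def)
qed

lemma zeta_pow_eq_iff: "i < p \<Longrightarrow> j < p \<Longrightarrow> \<zeta> ^ i = \<zeta> ^ j \<longleftrightarrow> i = j"
proof (induction i j rule: linorder_wlog)
  case (le i j)
  show ?case
  proof
    assume "\<zeta> ^ i = \<zeta> ^ j"
    then have "\<zeta> ^ i * 1 = \<zeta> ^ i * \<zeta> ^ (j - i)"
      using le power_add[of \<zeta> i "j - i"] by simp
    then have "\<zeta> ^ (j - i) = 1" by simp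
    then show "i = j" using zeta_pow_neq_1[of "j - i"] le by fastforce
  qed simp
qed auto

text \<open>Orthogonality of characters: off the diagonal the ratio is a nontrivial
  \<open>p\<close>-th root of unity, so the geometric sum vanishes.\<close>

lemma zeta_sum:
  assumes "i < p" "j < p"
  shows "(\<Sum>k<p. (\<zeta> ^ i * inverse \<zeta> ^ j) ^ k) = (if i = j then of_nat p else 0)"
proof (cases "i = j")
  case True
  then show ?thesis by (simp flip: power_mult_distrib)
next
  case False
  let ?z = "\<zeta> ^ i * inverse \<zeta> ^ j"
  have "?z \<noteq> 1"
    using zeta_pow_eq_iff[OF assms] False by (simp add: field_simps power_inverse)
  moreover have "?z ^ p = 1"
    using zeta_pow_p by (simp add: power_mult_distrib power_inverse flip: power_mult)
      (simp add: mult.commute[of _ p] power_mult zeta_pow_p)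
  ultimately show ?thesis using False by (simp add: geometric_sum)
qed

definition \<gamma> :: "nat \<Rightarrow> 'g" where "\<gamma> k = g0 [^]\<^bsub>G\<^esub> k"

lemma gamma_closed [simp]: "\<gamma> k \<in> carrier G" by (simp add: \<gamma>_def g0)

lemma chi_gamma [simp]: "\<chi> (\<gamma> k) = \<zeta> ^ k"
  by (simp add: \<gamma>_def chi_pow g0 \<zeta>_def)

text \<open>The character separates the first \<open>p\<close> powers of \<open>g0\<close>, and the
  group has no more than \<open>p\<close> elements.\<close>

lemma gamma_bij: "bij_betw \<gamma> {..<p} (carrier G)"
proof -
  have inj: "inj_on \<gamma> {..<p}"
  proof (rule inj_onI)
    fix i j assume "i \<in> {..<p}" "j \<in> {..<p}" "\<gamma> i = \<gamma> j"
    then show "i = j" using chi_gamma[of i] chi_gamma[of j] zeta_pow_eq_iff[of i j] by simp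
  qed
  have card: "card (carrier G) = p" using order by (simp add: Coset.order_def)
  then have fin: "finite (carrier G)" using p_gt_1 by (metis card.infinite not_one_less_zero)
  have "\<gamma> ` {..<p} = carrier G"
    by (rule card_subset_eq[OF fin]) (auto simp: card_image[OF inj] card)
  then show ?thesis using inj by (simp add: bij_betw_def)
qed

lemma G_finite: "finite (carrier G)"
  using gamma_bij bij_betw_finite by blast

lemma G_cases: "g \<in> carrier G \<Longrightarrow> \<exists>k<p. g = \<gamma> k"
  using gamma_bij by (auto simp: bij_betw_def)

lemma chi_inj: "inj_on \<chi> (carrier G)"
proof (rule inj_onI)
  fix g h assume "g \<in> carrier G" "h \<in> carrier G" "\<chi> g = \<chi> h"
  moreover from this obtain i j where "i < p" "g = \<gamma> i" "j < p" "h = \<gamma> j"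
    using G_cases by blast
  ultimately show "g = h" using zeta_pow_eq_iff[of i j] by simp
qed

text \<open>Extensionality of the action is included because the elements of \<open>BijGroup\<close>
  are extensional functions. Faithfulness, the fixed ring and separability are derived from these
  conditions.\<close>

definition kummer_gen :: "('r, 'g, 's) gext \<Rightarrow> 'r \<Rightarrow> 's \<Rightarrow> bool" where
  "kummer_gen S u a \<longleftrightarrow> cring S \<and> base_map S \<in> ring_hom R S \<and> u \<in> Units R \<and> a \<in> carrier S \<and>
     a [^]\<^bsub>S\<^esub> p = base_map S u \<and> power_basis R S (base_map S) p a \<and>
     (\<forall>g\<in>carrier G. g_action S g \<in> ring_hom S S \<and> g_action S g \<in> extensional (carrier S) \<and>
        (\<forall>r\<in>carrier R. g_action S g (base_map S r) = base_map S r) \<and>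
        g_action S g a = base_map S (\<iota> (\<chi> g)) \<otimes>\<^bsub>S\<^esub> a)"

lemma kummer_gen_basis:
  assumes "kummer_gen S u a"
  shows "power_basis_alg R S (base_map S) p u a"
  using assms p_gt_1 unfolding kummer_gen_def
  by (intro power_basis_alg.intro power_alg.intro power_alg_axioms.intro power_basis_alg_axioms.intro R.is_cring)
     auto

end

lemma (in abelian_monoid) finsum_swap:
  assumes "finite A" "finite B" "\<And>i j. i \<in> A \<Longrightarrow> j \<in> B \<Longrightarrow> f i j \<in> carrier G"
  shows "(\<Oplus>i\<in>A. \<Oplus>j\<in>B. f i j) = (\<Oplus>j\<in>B. \<Oplus>i\<in>A. f i j)"
  using assms(1,3)
proof (induction A)
  case (insert i A)
  then have cl: "(\<lambda>j. f i j) \<in> B \<rightarrow> carrier G" "(\<lambda>j. \<Oplus>i\<in>A. f i j) \<in> B \<rightarrow> carrier G"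
    "(\<lambda>i. \<Oplus>j\<in>B. f i j) \<in> A \<rightarrow> carrier G" "(\<Oplus>j\<in>B. f i j) \<in> carrier G"
    by (auto intro!: finsum_closed)
  have "(\<Oplus>j\<in>B. \<Oplus>i\<in>insert i A. f i j) = (\<Oplus>j\<in>B. f i j \<oplus> (\<Oplus>i\<in>A. f i j))"
    by (rule finsum_cong') (use insert in \<open>auto intro!: finsum_insert finsum_closed\<close>)
  also have "\<dots> = (\<Oplus>j\<in>B. f i j) \<oplus> (\<Oplus>j\<in>B. \<Oplus>i\<in>A. f i j)"
    by (rule finsum_addf) (use cl in auto)
  finally show ?case
    using insert cl by (simp add: finsum_insert)
qed (simp add: finsum_zero)

lemma (in monoid) unit_if_mult_unit:
  assumes "comm_monoid G" "x \<in> carrier G" "y \<in> carrier G" "x \<otimes> y \<in> Units G"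
  shows "x \<in> Units G"
proof -
  interpret comm_monoid G by fact
  let ?i = "y \<otimes> inv (x \<otimes> y)"
  have "x \<otimes> ?i = \<one>"
    using assms by (simp flip: m_assoc)
  moreover have "?i \<otimes> x = x \<otimes> ?i"
    using assms by (intro m_comm) auto
  moreover have "?i \<in> carrier G"
    using assms by auto
  ultimately show ?thesis
    using assms(2) unfolding Units_def by fastforce
qed

section \<open>Kummer algebras are Galois extensions\<close>

locale kummer_algebra = kummer_base R G \<iota> p \<chi>
  for R :: "('r, 'l) ring_scheme" and G :: "('g, 'm) monoid_scheme"
    and \<iota> :: "'k::field \<Rightarrow> 'r" and p :: nat and \<chi> :: "'g \<Rightarrow> 'k" +
  fixes S :: "('r, 'g, 's) gext" and u :: 'r and a :: 's
  assumes kummer: "kummer_gen S u a"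
begin

sublocale A: power_basis_alg R S "base_map S" p u a
  by (rule kummer_gen_basis[OF kummer])

abbreviation "act \<equiv> g_action S"
abbreviation "b \<equiv> base_map S"

lemma act: "g \<in> carrier G \<Longrightarrow> act g \<in> ring_hom S S" "g \<in> carrier G \<Longrightarrow> act g \<in> extensional (carrier S)"
  "g \<in> carrier G \<Longrightarrow> r \<in> carrier R \<Longrightarrow> act g (b r) = b r"
  "g \<in> carrier G \<Longrightarrow> act g a = b (\<iota> (\<chi> g)) \<otimes>\<^bsub>S\<^esub> a"
  and u_unit: "u \<in> Units R"
  using kummer by (auto simp: kummer_gen_def)

lemma act_closed [simp]: "g \<in> carrier G \<Longrightarrow> s \<in> carrier S \<Longrightarrow> act g s \<in> carrier S"
  by (rule ring_hom_closed[OF act(1)])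

lemma act_lin:
  assumes "g \<in> carrier G" "r \<in> A.Co"
  shows "act g (A.L r) = A.L (\<lambda>i. \<iota> (\<chi> g ^ i) \<otimes>\<^bsub>R\<^esub> r i)"
  using A.lin_hom[OF act(1) A.S.is_cring act(3), of g r] A.lin_scale[of "\<iota> (\<chi> g)" r] assms
  by (simp add: act(4))

lemma S_cases:
  assumes "s \<in> carrier S"
  obtains r where "r \<in> A.Co" "s = A.L r"
  using A.coef_closed[OF assms] A.lin_coef[OF assms] by metis

lemma act_mult:
  assumes "g \<in> carrier G" "h \<in> carrier G" "s \<in> carrier S"
  shows "act (g \<otimes>\<^bsub>G\<^esub> h) s = act g (act h s)"
proof -
  obtain r where r: "r \<in> A.Co" "s = A.L r" using assms(3) by (rule S_cases)
  have r': "(\<lambda>i. \<iota> (\<chi> h ^ i) \<otimes>\<^bsub>R\<^esub> r i) \<in> A.Co" using r by auto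
  have "act g (act h s) = A.L (\<lambda>i. \<iota> (\<chi> g ^ i) \<otimes>\<^bsub>R\<^esub> (\<iota> (\<chi> h ^ i) \<otimes>\<^bsub>R\<^esub> r i))"
    using act_lin[OF assms(1) r'] act_lin[OF assms(2) r(1)] r(2) by simp
  also have "\<dots> = A.L (\<lambda>i. \<iota> (\<chi> (g \<otimes>\<^bsub>G\<^esub> h) ^ i) \<otimes>\<^bsub>R\<^esub> r i)"
    by (rule A.lin_cong)
      (use assms r(1) in \<open>auto simp: chi_mult power_mult_distrib R.nat_pow_distrib R.m_assoc\<close>)
  finally show ?thesis
    using act_lin[of "g \<otimes>\<^bsub>G\<^esub> h" r] r assms by simp
qed

lemma act_one:
  assumes "s \<in> carrier S"
  shows "act \<one>\<^bsub>G\<^esub> s = s"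
proof -
  obtain r where r: "r \<in> A.Co" "s = A.L r" using assms by (rule S_cases)
  have "A.L (\<lambda>i. \<iota> (\<chi> \<one>\<^bsub>G\<^esub> ^ i) \<otimes>\<^bsub>R\<^esub> r i) = A.L r"
    by (rule A.lin_cong) (use r in \<open>auto simp: chi_one\<close>)
  then show ?thesis using act_lin[of "\<one>\<^bsub>G\<^esub>" r] r by simp
qed

text \<open>Comparing coefficients gives \<open>(\<zeta>^i - \<zeta>^k) r i = 0\<close>. For
  \<open>i \<noteq> k\<close> the scalar is a nonzero constant and can be cancelled, so only the
  \<open>k\<close>-th term survives.\<close>

lemma isotypic_power:
  assumes s: "s \<in> carrier S" and eig: "act g0 s = b (\<iota> (\<zeta> ^ k)) \<otimes>\<^bsub>S\<^esub> s" and k: "k < p"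
  obtains w where "w \<in> carrier R" "s = b w \<otimes>\<^bsub>S\<^esub> a [^]\<^bsub>S\<^esub> k"
proof -
  obtain r where r: "r \<in> A.Co" "s = A.L r" using s by (rule S_cases)
  have "A.L (\<lambda>i. \<iota> (\<zeta> ^ i) \<otimes>\<^bsub>R\<^esub> r i) = A.L (\<lambda>i. \<iota> (\<zeta> ^ k) \<otimes>\<^bsub>R\<^esub> r i)"
    using act_lin[OF g0(1) r(1)] eig r A.lin_smult[of "\<iota> (\<zeta> ^ k)" r] by (simp add: \<zeta>_def)
  then have eq: "\<iota> (\<zeta> ^ i) \<otimes>\<^bsub>R\<^esub> r i = \<iota> (\<zeta> ^ k) \<otimes>\<^bsub>R\<^esub> r i" if "i < p" for i
    using A.lin_eqD[of "\<lambda>i. \<iota> (\<zeta> ^ i) \<otimes>\<^bsub>R\<^esub> r i" "\<lambda>i. \<iota> (\<zeta> ^ k) \<otimes>\<^bsub>R\<^esub> r i" i] r that by auto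
  have "r i = \<zero>\<^bsub>R\<^esub>" if i: "i < p" "i \<noteq> k" for i
  proof (rule iota_cancel[of "\<zeta> ^ i - \<zeta> ^ k"])
    show "\<zeta> ^ i - \<zeta> ^ k \<noteq> 0" using zeta_pow_eq_iff[of i k] i k by simp
    show "r i \<in> carrier R" using r i by simp
    then show "\<iota> (\<zeta> ^ i - \<zeta> ^ k) \<otimes>\<^bsub>R\<^esub> r i = \<zero>\<^bsub>R\<^esub>"
      using eq[OF i(1)] by (simp add: iota_diff R.minus_eq R.l_distr R.l_minus R.r_neg del: iota_pow)
  qed
  then have "A.L r = A.L (\<lambda>i. if i = k then r k else \<zero>\<^bsub>R\<^esub>)"
    using r k by (intro A.lin_cong) auto
  then show thesis
    using that[of "r k"] A.lin_single[of k "r k"] r k by simp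
qed

lemma gen_unit: "a \<in> Units S"
proof -
  have "b u \<in> Units S"
  proof (rule A.S.unit_if_mult_unit[OF A.S.comm_monoid_axioms, of _ "b (inv\<^bsub>R\<^esub> u)"])
    show "b u \<otimes>\<^bsub>S\<^esub> b (inv\<^bsub>R\<^esub> u) \<in> Units S"
      using ring_hom_mult[OF A.b_hom, of u "inv\<^bsub>R\<^esub> u", symmetric] u_unit by simp
  qed (use u_unit in auto)
  moreover have "a [^]\<^bsub>S\<^esub> p = a \<otimes>\<^bsub>S\<^esub> a [^]\<^bsub>S\<^esub> (p - 1)"
    using A.S.nat_pow_mult[of a 1 "p - 1"] p_gt_1 by simp
  ultimately show ?thesis
    using A.S.unit_if_mult_unit[OF A.S.comm_monoid_axioms, of a "a [^]\<^bsub>S\<^esub> (p - 1)"] A.a_pow by simp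
qed

lemma fixed: "{s \<in> carrier S. \<forall>g\<in>carrier G. act g s = s} = b ` carrier R"
proof
  show "b ` carrier R \<subseteq> {s \<in> carrier S. \<forall>g\<in>carrier G. act g s = s}"
    by (auto simp: act)
  show "{s \<in> carrier S. \<forall>g\<in>carrier G. act g s = s} \<subseteq> b ` carrier R"
  proof safe
    fix s assume s: "s \<in> carrier S" "\<forall>g\<in>carrier G. act g s = s"
    then have "act g0 s = b (\<iota> (\<zeta> ^ 0)) \<otimes>\<^bsub>S\<^esub> s" using g0 by simp
    then obtain w where "w \<in> carrier R" "s = b w \<otimes>\<^bsub>S\<^esub> a [^]\<^bsub>S\<^esub> (0::nat)"
      using isotypic_power[OF s(1), of 0] p_gt_1 by auto
    then show "s \<in> b ` carrier R" by simp
  qed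
qed

lemma faithful: "faithful_action G (carrier S) act"
proof -
  have bij: "act g \<in> Bij (carrier S)" if g: "g \<in> carrier G" for g
  proof -
    have "bij_betw (act g) (carrier S) (carrier S)"
    proof (rule bij_betw_byWitness[where f' = "act (inv\<^bsub>G\<^esub> g)"])
      show "\<forall>s\<in>carrier S. act (inv\<^bsub>G\<^esub> g) (act g s) = s" "\<forall>s\<in>carrier S. act g (act (inv\<^bsub>G\<^esub> g) s) = s"
        using g by (simp_all add: act_one flip: act_mult)
    qed (use g in auto)
    then show ?thesis using act(2)[OF g] by (simp add: Bij_def)
  qed
  have "act \<in> hom G (BijGroup (carrier S))"
  proof (rule homI)
    fix g h assume gh: "g \<in> carrier G" "h \<in> carrier G"
    have "act (g \<otimes>\<^bsub>G\<^esub> h) = compose (carrier S) (act g) (act h)"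
      by (rule extensionalityI[of _ "carrier S"]) (use gh act in \<open>auto simp: act_mult compose_eq\<close>)
    then show "act (g \<otimes>\<^bsub>G\<^esub> h) = act g \<otimes>\<^bsub>BijGroup (carrier S)\<^esub> act h"
      using bij gh by (simp add: BijGroup_def)
  qed (simp add: BijGroup_def bij)
  moreover have "inj_on act (carrier G)"
  proof (rule inj_onI)
    fix g h assume gh: "g \<in> carrier G" "h \<in> carrier G" "act g = act h"
    then have "b (\<iota> (\<chi> g)) \<otimes>\<^bsub>S\<^esub> a [^]\<^bsub>S\<^esub> (1::nat) = b (\<iota> (\<chi> h)) \<otimes>\<^bsub>S\<^esub> a [^]\<^bsub>S\<^esub> (1::nat)"
      using act(4) by simp metis
    then have "\<iota> (\<chi> g) = \<iota> (\<chi> h)"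
      using A.coef_power[of "\<iota> (\<chi> g)" 1 1] A.coef_power[of "\<iota> (\<chi> h)" 1 1] p_gt_1 by simp
    then have "\<iota> (\<chi> g - \<chi> h) = \<zero>\<^bsub>R\<^esub>"
      by (simp add: iota_diff R.minus_eq R.r_neg)
    then have "\<chi> g = \<chi> h" using iota_nonzero[of "\<chi> g - \<chi> h"] by auto
    then show "g = h" using chi_inj gh by (auto dest: inj_onD)
  qed
  ultimately show ?thesis
    by (intro faithful_action.intro group_action.intro group_hom.intro group_hom_axioms.intro
        faithful_action_axioms.intro group_BijGroup G.group_axioms)
qed

text \<open>The separability idempotent is the average of \<open>a^i \<otimes> a^(-i)\<close> over
  \<open>i < p\<close>. Multiplying by \<open>a \<otimes> 1\<close> or by
  \<open>1 \<otimes> a\<close> shifts the summation index in compatible ways, and the sum is cyclic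
  in \<open>i\<close>.\<close>

lemma separable: "separable_algebra R S b"
proof -
  interpret algebra_over R S b
    by unfold_locales (rule A.b_hom)+
  define c where "c = b (\<iota> (inverse (of_nat p)))"
  define d where "d = inv\<^bsub>S\<^esub> a"
  have c: "c \<in> carrier S" by (simp add: c_def)
  have d: "d \<in> carrier S" "a \<otimes>\<^bsub>S\<^esub> d = \<one>\<^bsub>S\<^esub>" using gen_unit by (auto simp: d_def)
  have ad: "a [^]\<^bsub>S\<^esub> i \<otimes>\<^bsub>S\<^esub> d [^]\<^bsub>S\<^esub> i = \<one>\<^bsub>S\<^esub>" for i :: nat
    using d by (simp flip: A.S.nat_pow_distrib)
  define E where "E i = pure (c \<otimes>\<^bsub>S\<^esub> a [^]\<^bsub>S\<^esub> i) (d [^]\<^bsub>S\<^esub> i)" for i :: nat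
  have E [simp]: "E i \<in> carrier T" for i using c d by (simp add: E_def)
  define e where "e = (\<Oplus>\<^bsub>T\<^esub>i\<in>{..<p}. E i)"
  have e: "e \<in> carrier T" unfolding e_def by (rule T.finsum_closed) auto
  \<comment> \<open>The scalar \<open>a^p = u\<close> passes to the other factor, where it cancels
    \<open>d^p\<close>; hence the summands are periodic.\<close>
  have "E p = pure (b u \<otimes>\<^bsub>S\<^esub> c) (d [^]\<^bsub>S\<^esub> p)"
    using c by (simp add: E_def A.a_pow A.S.m_comm)
  also have "\<dots> = pure c (b u \<otimes>\<^bsub>S\<^esub> d [^]\<^bsub>S\<^esub> p)"
    using c d by (intro pure_balanced) auto
  also have "\<dots> = E 0"
    using ad[of p] c by (simp add: E_def A.a_pow)
  finally have Ep: "E p = E 0" .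
  have e_shift: "(\<Oplus>\<^bsub>T\<^esub>i\<in>{..<p}. E (Suc i)) = e"
  proof -
    obtain n where p: "p = Suc n" using p_gt_1 by (cases p) auto
    have "(\<Oplus>\<^bsub>T\<^esub>i\<in>{..Suc n}. E i) = (\<Oplus>\<^bsub>T\<^esub>i\<in>{..n}. E (Suc i)) \<oplus>\<^bsub>T\<^esub> E 0"
      by (rule T.finsum_Suc2) auto
    moreover have "(\<Oplus>\<^bsub>T\<^esub>i\<in>{..Suc n}. E i) = E (Suc n) \<oplus>\<^bsub>T\<^esub> (\<Oplus>\<^bsub>T\<^esub>i\<in>{..n}. E i)"
      by (rule T.finsum_Suc) auto
    ultimately have "(\<Oplus>\<^bsub>T\<^esub>i\<in>{..n}. E (Suc i)) \<oplus>\<^bsub>T\<^esub> E 0 = (\<Oplus>\<^bsub>T\<^esub>i\<in>{..n}. E i) \<oplus>\<^bsub>T\<^esub> E 0"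
      using Ep by (simp add: p T.a_comm)
    then show ?thesis
      by (simp add: e_def p lessThan_Suc_atMost)
  qed
  have shift1: "pure a \<one>\<^bsub>S\<^esub> \<otimes>\<^bsub>T\<^esub> e = pure \<one>\<^bsub>S\<^esub> a \<otimes>\<^bsub>T\<^esub> e"
  proof -
    have "pure a \<one>\<^bsub>S\<^esub> \<otimes>\<^bsub>T\<^esub> e = (\<Oplus>\<^bsub>T\<^esub>i\<in>{..<p}. pure a \<one>\<^bsub>S\<^esub> \<otimes>\<^bsub>T\<^esub> E i)"
      unfolding e_def by (rule T.finsum_rdistr) auto
    also have "\<dots> = (\<Oplus>\<^bsub>T\<^esub>i\<in>{..<p}. pure \<one>\<^bsub>S\<^esub> a \<otimes>\<^bsub>T\<^esub> E (Suc i))"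
    proof (rule T.finsum_cong')
      fix i
      have "a \<otimes>\<^bsub>S\<^esub> d [^]\<^bsub>S\<^esub> Suc i = (a \<otimes>\<^bsub>S\<^esub> d) \<otimes>\<^bsub>S\<^esub> d [^]\<^bsub>S\<^esub> i"
        using d(1) by (simp add: A.S.m_ac)
      then have "a \<otimes>\<^bsub>S\<^esub> d [^]\<^bsub>S\<^esub> Suc i = d [^]\<^bsub>S\<^esub> i" using d by simp
      then show "pure a \<one>\<^bsub>S\<^esub> \<otimes>\<^bsub>T\<^esub> E i = pure \<one>\<^bsub>S\<^esub> a \<otimes>\<^bsub>T\<^esub> E (Suc i)"
        using c d(1) by (simp add: E_def pure_mult A.S.m_ac)
    qed auto
    also have "\<dots> = pure \<one>\<^bsub>S\<^esub> a \<otimes>\<^bsub>T\<^esub> e"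
      unfolding e_shift[symmetric] by (rule T.finsum_rdistr[symmetric]) auto
    finally show ?thesis .
  qed
  have shiftp: "pure (a [^]\<^bsub>S\<^esub> i) \<one>\<^bsub>S\<^esub> \<otimes>\<^bsub>T\<^esub> e = pure \<one>\<^bsub>S\<^esub> (a [^]\<^bsub>S\<^esub> i) \<otimes>\<^bsub>T\<^esub> e" for i :: nat
  proof (induction i)
    case (Suc i)
    have "pure (a [^]\<^bsub>S\<^esub> Suc i) \<one>\<^bsub>S\<^esub> \<otimes>\<^bsub>T\<^esub> e = pure (a [^]\<^bsub>S\<^esub> i) \<one>\<^bsub>S\<^esub> \<otimes>\<^bsub>T\<^esub> (pure a \<one>\<^bsub>S\<^esub> \<otimes>\<^bsub>T\<^esub> e)"
      using e by (simp add: pure_mult flip: T.m_assoc)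
    also have "\<dots> = pure \<one>\<^bsub>S\<^esub> a \<otimes>\<^bsub>T\<^esub> (pure (a [^]\<^bsub>S\<^esub> i) \<one>\<^bsub>S\<^esub> \<otimes>\<^bsub>T\<^esub> e)"
      using e unfolding shift1 by (intro T.m_lcomm) auto
    also have "\<dots> = pure \<one>\<^bsub>S\<^esub> (a [^]\<^bsub>S\<^esub> Suc i) \<otimes>\<^bsub>T\<^esub> e"
      using e unfolding Suc by (simp add: pure_mult A.S.m_comm flip: T.m_assoc)
    finally show ?case .
  qed simp
  have all: "pure s \<one>\<^bsub>S\<^esub> \<otimes>\<^bsub>T\<^esub> e = pure \<one>\<^bsub>S\<^esub> s \<otimes>\<^bsub>T\<^esub> e" if "s \<in> carrier S" for s
  proof -
    obtain r where r: "r \<in> A.Co" "s = A.L r" using \<open>s \<in> carrier S\<close> by (rule S_cases)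
    show ?thesis
      unfolding r(2) lin_def
    proof (rule A.S.finsum_induct[OF finite_lessThan A.term_closed[OF r(1)]])
      have "pure \<zero>\<^bsub>S\<^esub> \<one>\<^bsub>S\<^esub> = pure \<one>\<^bsub>S\<^esub> \<zero>\<^bsub>S\<^esub>"
        using pure_base[of "\<zero>\<^bsub>R\<^esub>"] by simp
      then show "pure \<zero>\<^bsub>S\<^esub> \<one>\<^bsub>S\<^esub> \<otimes>\<^bsub>T\<^esub> e = pure \<one>\<^bsub>S\<^esub> \<zero>\<^bsub>S\<^esub> \<otimes>\<^bsub>T\<^esub> e" by simp
    next
      fix i assume "i \<in> {..<p}"
      then have ri: "r i \<in> carrier R" using r by auto
      have "pure (b (r i) \<otimes>\<^bsub>S\<^esub> a [^]\<^bsub>S\<^esub> i) \<one>\<^bsub>S\<^esub> \<otimes>\<^bsub>T\<^esub> e = pure (b (r i)) \<one>\<^bsub>S\<^esub> \<otimes>\<^bsub>T\<^esub> (pure (a [^]\<^bsub>S\<^esub> i) \<one>\<^bsub>S\<^esub> \<otimes>\<^bsub>T\<^esub> e)"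
        using ri e by (simp add: pure_mult flip: T.m_assoc)
      also have "\<dots> = pure \<one>\<^bsub>S\<^esub> (b (r i) \<otimes>\<^bsub>S\<^esub> a [^]\<^bsub>S\<^esub> i) \<otimes>\<^bsub>T\<^esub> e"
        using ri e unfolding shiftp pure_base[OF ri] by (simp add: pure_mult flip: T.m_assoc)
      finally show "pure (b (r i) \<otimes>\<^bsub>S\<^esub> a [^]\<^bsub>S\<^esub> i) \<one>\<^bsub>S\<^esub> \<otimes>\<^bsub>T\<^esub> e = pure \<one>\<^bsub>S\<^esub> (b (r i) \<otimes>\<^bsub>S\<^esub> a [^]\<^bsub>S\<^esub> i) \<otimes>\<^bsub>T\<^esub> e" .
    qed (use e in \<open>simp add: pure_add_left pure_add_right T.l_distr\<close>)
  qed
  have "tensor_mult S e = (\<Oplus>\<^bsub>S\<^esub>i\<in>{..<p}. tensor_mult S (E i))"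
    unfolding e_def
  proof (rule T.a_hom_finsum)
    show "tensor_mult S \<in> hom (add_monoid T) (add_monoid S)"
      using tensor_mult_hom by (auto simp: ring_hom_def hom_def)
  qed (auto intro: A.S.abelian_group_axioms)
  also have "\<dots> = (\<Oplus>\<^bsub>S\<^esub>i\<in>{..<p}. b (\<iota> (inverse (of_nat p))))"
    by (rule A.S.finsum_cong') (use c d ad in \<open>auto simp: E_def tensor_mult_pure A.S.m_assoc c_def\<close>)
  also have "\<dots> = b (\<Oplus>\<^bsub>R\<^esub>i\<in>{..<p}. \<iota> (inverse (of_nat p)))"
  proof (rule R.a_hom_finsum[symmetric])
    show "b \<in> hom (add_monoid R) (add_monoid S)"
      using A.b_hom by (auto simp: ring_hom_def hom_def)
  qed (auto intro: A.S.abelian_group_axioms)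
  also have "(\<Oplus>\<^bsub>R\<^esub>i\<in>{..<p}. \<iota> (inverse (of_nat p))) = \<iota> (\<Sum>i<p. inverse (of_nat p))"
    by (rule iota_sum[symmetric]) simp
  also have "(\<Sum>i<p. inverse (of_nat p)) = (1::'k)"
    using p_nonzero by simp
  also have "b (\<iota> 1) = \<one>\<^bsub>S\<^esub>"
    by simp
  finally have "separability_idempotent e"
    using e all by (simp add: separability_idempotent_def)
  then show ?thesis by (rule separable_if_idempotent)
qed

lemma galois: "galois_ext R G S"
  unfolding galois_ext_def
proof (intro conjI ballI impI allI)
  fix g assume g: "g \<in> carrier G"
  show "act g \<in> ring_iso S S"
  proof -
    interpret faithful_action G "carrier S" act by (rule faithful)
    show ?thesis
      using act(1)[OF g] bij_prop0[OF g] by (simp add: ring_iso_def Bij_def)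
  qed
  show "act g (b r) = b r" if "r \<in> carrier R" for r
    using act(3)[OF g that] .
  fix h e assume h: "h \<in> carrier G" "g \<noteq> h" and e: "e \<in> carrier S" "e \<otimes>\<^bsub>S\<^esub> e = e \<and> e \<noteq> \<zero>\<^bsub>S\<^esub>"
  \<comment> \<open>The generator itself separates \<open>g\<close> from \<open>h\<close>: equality
    would give \<open>(\<chi> g - \<chi> h) a e = 0\<close> with a unit in front of
    \<open>e\<close>.\<close>
  have "act g a \<otimes>\<^bsub>S\<^esub> e \<noteq> act h a \<otimes>\<^bsub>S\<^esub> e"
  proof
    assume eq: "act g a \<otimes>\<^bsub>S\<^esub> e = act h a \<otimes>\<^bsub>S\<^esub> e"
    let ?d = "\<chi> g - \<chi> h"
    have d: "?d \<noteq> 0" using chi_inj g h by (auto dest: inj_onD)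
    have hz: "b (\<iota> (\<chi> h)) \<otimes>\<^bsub>S\<^esub> (a \<otimes>\<^bsub>S\<^esub> e) \<oplus>\<^bsub>S\<^esub> b (\<iota> ?d) \<otimes>\<^bsub>S\<^esub> (a \<otimes>\<^bsub>S\<^esub> e) = b (\<iota> (\<chi> h)) \<otimes>\<^bsub>S\<^esub> (a \<otimes>\<^bsub>S\<^esub> e)"
    proof -
      have "b (\<iota> (\<chi> h)) \<otimes>\<^bsub>S\<^esub> (a \<otimes>\<^bsub>S\<^esub> e) \<oplus>\<^bsub>S\<^esub> b (\<iota> ?d) \<otimes>\<^bsub>S\<^esub> (a \<otimes>\<^bsub>S\<^esub> e) = b (\<iota> (\<chi> h + ?d)) \<otimes>\<^bsub>S\<^esub> (a \<otimes>\<^bsub>S\<^esub> e)"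
        using e by (simp only: iota_simps A.b_simps A.S.l_distr A.S.m_closed A.a_closed)
      also have "\<dots> = act g a \<otimes>\<^bsub>S\<^esub> e" using e g by (simp add: act(4) A.S.m_assoc)
      finally show ?thesis using eq e h by (simp add: act(4) A.S.m_assoc)
    qed
    then have "b (\<iota> ?d) \<otimes>\<^bsub>S\<^esub> (a \<otimes>\<^bsub>S\<^esub> e) = \<zero>\<^bsub>S\<^esub>"
      using e A.S.add.r_cancel_one'[of "b (\<iota> (\<chi> h)) \<otimes>\<^bsub>S\<^esub> (a \<otimes>\<^bsub>S\<^esub> e)" "b (\<iota> ?d) \<otimes>\<^bsub>S\<^esub> (a \<otimes>\<^bsub>S\<^esub> e)"]
      by (simp add: A.S.a_comm)
    then have "b (\<iota> (inverse ?d)) \<otimes>\<^bsub>S\<^esub> (b (\<iota> ?d) \<otimes>\<^bsub>S\<^esub> (a \<otimes>\<^bsub>S\<^esub> e)) = \<zero>\<^bsub>S\<^esub>" by simp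
    moreover have "b (\<iota> (inverse ?d)) \<otimes>\<^bsub>S\<^esub> b (\<iota> ?d) = \<one>\<^bsub>S\<^esub>"
      using iota_inverse[OF d] by (simp flip: A.b_simps(3))
    ultimately have "a \<otimes>\<^bsub>S\<^esub> e = \<zero>\<^bsub>S\<^esub>"
      using e by (simp flip: A.S.m_assoc)
    then have "inv\<^bsub>S\<^esub> a \<otimes>\<^bsub>S\<^esub> (a \<otimes>\<^bsub>S\<^esub> e) = \<zero>\<^bsub>S\<^esub>" using gen_unit by simp
    then show False using e gen_unit by (simp flip: A.S.m_assoc)
  qed
  then show "\<exists>s\<in>carrier S. act g s \<otimes>\<^bsub>S\<^esub> e \<noteq> act h s \<otimes>\<^bsub>S\<^esub> e" by (rule bexI) simp
qed (use A.b_hom A.base_inj faithful fixed separable G_finite R.is_cring A.S.is_cring in auto)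

text \<open>The \<open>i\<close>-th coefficient is multiplied by \<open>w^i\<close>, which is
  invertible, so the power basis survives the change of generator.\<close>

lemma rescale:
  assumes w: "w \<in> Units R"
  shows "kummer_gen S (w [^]\<^bsub>R\<^esub> p \<otimes>\<^bsub>R\<^esub> u) (b w \<otimes>\<^bsub>S\<^esub> a)"
proof -
  have wc: "w \<in> carrier R" using w by auto
  define v where "v = inv\<^bsub>R\<^esub> w"
  have v: "v \<in> carrier R" "w \<otimes>\<^bsub>R\<^esub> v = \<one>\<^bsub>R\<^esub>" using w by (auto simp: v_def)
  have wv: "w [^]\<^bsub>R\<^esub> i \<otimes>\<^bsub>R\<^esub> (v [^]\<^bsub>R\<^esub> i \<otimes>\<^bsub>R\<^esub> r) = r" "v [^]\<^bsub>R\<^esub> i \<otimes>\<^bsub>R\<^esub> (w [^]\<^bsub>R\<^esub> i \<otimes>\<^bsub>R\<^esub> r) = r"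
    if "r \<in> carrier R" for i :: nat and r
  proof -
    have "w [^]\<^bsub>R\<^esub> i \<otimes>\<^bsub>R\<^esub> v [^]\<^bsub>R\<^esub> i = \<one>\<^bsub>R\<^esub>"
      using v wc by (simp flip: R.nat_pow_distrib)
    then show "w [^]\<^bsub>R\<^esub> i \<otimes>\<^bsub>R\<^esub> (v [^]\<^bsub>R\<^esub> i \<otimes>\<^bsub>R\<^esub> r) = r" "v [^]\<^bsub>R\<^esub> i \<otimes>\<^bsub>R\<^esub> (w [^]\<^bsub>R\<^esub> i \<otimes>\<^bsub>R\<^esub> r) = r"
      using that v wc R.m_assoc[of "w [^]\<^bsub>R\<^esub> i" "v [^]\<^bsub>R\<^esub> i" r]
        R.m_lcomm[of "v [^]\<^bsub>R\<^esub> i" "w [^]\<^bsub>R\<^esub> i" r] by simp_all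
  qed
  have lin_w: "lin S b p (b w \<otimes>\<^bsub>S\<^esub> a) r = A.L (\<lambda>i. w [^]\<^bsub>R\<^esub> i \<otimes>\<^bsub>R\<^esub> r i)" if "r \<in> A.Co" for r
    using A.lin_scale[OF wc that] .
  have "power_basis R S b p (b w \<otimes>\<^bsub>S\<^esub> a)"
    unfolding power_basis_def
  proof (intro conjI ballI impI allI)
    fix s assume "s \<in> carrier S"
    then obtain r where r: "r \<in> A.Co" "s = A.L r" by (rule S_cases)
    let ?r = "\<lambda>i. v [^]\<^bsub>R\<^esub> i \<otimes>\<^bsub>R\<^esub> r i"
    have r': "?r \<in> A.Co" using r v by auto
    have "lin S b p (b w \<otimes>\<^bsub>S\<^esub> a) ?r = s"
      unfolding lin_w[OF r'] r(2) by (rule A.lin_cong) (use r wv in auto)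
    then show "\<exists>r\<in>A.Co. s = lin S b p (b w \<otimes>\<^bsub>S\<^esub> a) r" using r' by metis
  next
    fix r i assume r: "r \<in> A.Co" "lin S b p (b w \<otimes>\<^bsub>S\<^esub> a) r = \<zero>\<^bsub>S\<^esub>" and i: "i < p"
    have "(\<lambda>i. w [^]\<^bsub>R\<^esub> i \<otimes>\<^bsub>R\<^esub> r i) \<in> A.Co" using r wc by auto
    then have "w [^]\<^bsub>R\<^esub> i \<otimes>\<^bsub>R\<^esub> r i = \<zero>\<^bsub>R\<^esub>"
      using A.basis r i lin_w[OF r(1)] unfolding power_basis_def by auto
    then show "r i = \<zero>\<^bsub>R\<^esub>" using wv(2)[of "r i" i] r i v by auto
  qed
  moreover have "(b w \<otimes>\<^bsub>S\<^esub> a) [^]\<^bsub>S\<^esub> p = b (w [^]\<^bsub>R\<^esub> p \<otimes>\<^bsub>R\<^esub> u)"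
  proof -
    have "b (w [^]\<^bsub>R\<^esub> i) = b w [^]\<^bsub>S\<^esub> i" for i :: nat
      using wc by (induction i) auto
    then show ?thesis using wc by (simp add: A.S.nat_pow_distrib A.a_pow)
  qed
  moreover have "w [^]\<^bsub>R\<^esub> p \<otimes>\<^bsub>R\<^esub> u \<in> Units R"
    using R.Units_pow_closed[OF w, of p] u_unit by simp
  moreover have "act g (b w \<otimes>\<^bsub>S\<^esub> a) = b (\<iota> (\<chi> g)) \<otimes>\<^bsub>S\<^esub> (b w \<otimes>\<^bsub>S\<^esub> a)" if "g \<in> carrier G" for g
    using that wc by (simp add: ring_hom_mult[OF act(1)] act A.S.m_lcomm)
  ultimately show ?thesis
    using act A.b_hom wc A.S.is_cring by (auto simp: kummer_gen_def)
qed

text \<open>Both generators lie in the \<chi>-part, which is \<open>R a\<close>; so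
  \<open>c = w a\<close>, and comparing \<open>p\<close>-th powers gives \<open>v\<close>. The
  factor \<open>w\<close> is a unit because it divides the unit \<open>v\<close>.\<close>

lemma gens_differ:
  assumes "kummer_gen S v c"
  obtains w where "w \<in> Units R" "v = w [^]\<^bsub>R\<^esub> p \<otimes>\<^bsub>R\<^esub> u"
proof -
  interpret C: kummer_algebra R G \<iota> p \<chi> S v c
    by unfold_locales fact
  have "act g0 c = b (\<iota> (\<zeta> ^ 1)) \<otimes>\<^bsub>S\<^esub> c"
    using C.act(4)[OF g0(1)] by (simp add: \<zeta>_def)
  then obtain w where w: "w \<in> carrier R" "c = b w \<otimes>\<^bsub>S\<^esub> a"
    using isotypic_power[of c 1] p_gt_1 by auto
  have pow: "b (w [^]\<^bsub>R\<^esub> i) = b w [^]\<^bsub>S\<^esub> i" for i :: nat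
    using w by (induction i) auto
  have "b v = b (w [^]\<^bsub>R\<^esub> p \<otimes>\<^bsub>R\<^esub> u)"
    using C.A.a_pow w by (simp add: A.S.nat_pow_distrib A.a_pow pow)
  then have v: "v = w [^]\<^bsub>R\<^esub> p \<otimes>\<^bsub>R\<^esub> u"
    by (rule inj_onD[OF A.base_inj]) (use w C.A.u_closed in auto)
  have "w [^]\<^bsub>R\<^esub> p \<otimes>\<^bsub>R\<^esub> u = w \<otimes>\<^bsub>R\<^esub> (w [^]\<^bsub>R\<^esub> (p - 1) \<otimes>\<^bsub>R\<^esub> u)"
    using R.nat_pow_mult[of w 1 "p - 1"] p_gt_1 w by (simp flip: R.m_assoc)
  then have "w \<in> Units R"
    using R.unit_if_mult_unit[OF R.comm_monoid_axioms, of w "w [^]\<^bsub>R\<^esub> (p - 1) \<otimes>\<^bsub>R\<^esub> u"] w C.u_unit v by simp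
  with v show thesis by (intro that)
qed

text \<open>The universal property gives maps in both directions that leave coefficients unchanged.
  They are therefore mutually inverse and compatible with the action.\<close>

lemma iso_if_same:
  assumes "kummer_gen S' u a'"
  shows "gext_iso R G S S'"
proof -
  interpret C: kummer_algebra R G \<iota> p \<chi> S' u a'
    by unfold_locales fact
  obtain f where f: "f \<in> ring_hom S S'" "\<And>r. r \<in> A.Co \<Longrightarrow> f (A.L r) = C.A.L r"
    "\<And>r. r \<in> carrier R \<Longrightarrow> f (b r) = C.b r"
    by (rule A.lift[OF C.A.power_alg_axioms]) auto
  obtain f' where f': "f' \<in> ring_hom S' S" "\<And>r. r \<in> A.Co \<Longrightarrow> f' (C.A.L r) = A.L r"
    by (rule C.A.lift[OF A.power_alg_axioms]) auto
  have "bij_betw f (carrier S) (carrier S')"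
  proof (rule bij_betw_byWitness[where f' = f'])
    show "\<forall>s\<in>carrier S. f' (f s) = s"
    proof
      fix s assume "s \<in> carrier S"
      then obtain r where "r \<in> A.Co" "s = A.L r" by (rule S_cases)
      then show "f' (f s) = s" using f f' by simp
    qed
    show "\<forall>s\<in>carrier S'. f (f' s) = s"
    proof
      fix s assume "s \<in> carrier S'"
      then obtain r where "r \<in> A.Co" "s = C.A.L r" by (rule C.S_cases)
      then show "f (f' s) = s" using f f' by simp
    qed
  qed (use ring_hom_closed[OF f(1)] ring_hom_closed[OF f'(1)] in auto)
  then have "f \<in> ring_iso S S'" using f(1) by (simp add: ring_iso_def)
  moreover have "f (act g s) = C.act g (f s)" if g: "g \<in> carrier G" and "s \<in> carrier S" for g s
  proof -
    obtain r where r: "r \<in> A.Co" "s = A.L r" using \<open>s \<in> carrier S\<close> by (rule S_cases)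
    have "(\<lambda>i. \<iota> (\<chi> g ^ i) \<otimes>\<^bsub>R\<^esub> r i) \<in> A.Co" using r by auto
    then show ?thesis using act_lin[OF g r(1)] C.act_lin[OF g r(1)] f(2) r by simp
  qed
  ultimately show ?thesis using f(3) unfolding gext_iso_def by blast
qed

text \<open>An isomorphism controls the new action on the carrier only, so its extensionality is a
  separate hypothesis.\<close>

lemma transport:
  assumes f: "f \<in> ring_iso S S'" and S': "cring S'"
    and fb: "\<And>r. r \<in> carrier R \<Longrightarrow> f (b r) = base_map S' r"
    and fact: "\<And>g s. g \<in> carrier G \<Longrightarrow> s \<in> carrier S \<Longrightarrow> f (act g s) = g_action S' g (f s)"
    and ext: "\<And>g. g \<in> carrier G \<Longrightarrow> g_action S' g \<in> extensional (carrier S')"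
  shows "kummer_gen S' u (f a)"
proof -
  interpret S': cring S' by fact
  have fh: "f \<in> ring_hom S S'" and bij: "bij_betw f (carrier S) (carrier S')"
    using f by (auto simp: ring_iso_def)
  interpret f: ring_hom_cring S S' f
    by (rule ring_hom_cringI[OF A.S.is_cring S' fh])
  have cases: "\<exists>s\<in>carrier S. t = f s" if "t \<in> carrier S'" for t
    using bij that by (auto simp: bij_betw_def)
  have L: "lin S' (base_map S') p (f a) r = f (A.L r)" if "r \<in> A.Co" for r
    by (rule A.lin_hom[OF fh S' fb that, symmetric])
  have bh: "base_map S' \<in> ring_hom R S'"
    by (rule R.ring_hom_restrict[OF ring_hom_trans[OF A.b_hom fh]]) (simp add: fb)
  have "power_basis R S' (base_map S') p (f a)"
    unfolding power_basis_def
  proof (intro conjI ballI impI allI)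
    fix t assume "t \<in> carrier S'"
    then obtain s where s: "s \<in> carrier S" "t = f s" using cases by blast
    then show "\<exists>r\<in>A.Co. t = lin S' (base_map S') p (f a) r"
      using L[OF A.coef_closed[OF s(1)]] A.lin_coef[OF s(1)] A.coef_closed[OF s(1)] by metis
  next
    fix r i assume r: "r \<in> A.Co" "lin S' (base_map S') p (f a) r = \<zero>\<^bsub>S'\<^esub>" and i: "i < p"
    then have "f (A.L r) = f \<zero>\<^bsub>S\<^esub>" using L[OF r(1)] by simp
    then have "A.L r = \<zero>\<^bsub>S\<^esub>"
      by (rule inj_onD[OF bij_betw_imp_inj_on[OF bij]]) (use r in auto)
    then show "r i = \<zero>\<^bsub>R\<^esub>" using A.basis r i unfolding power_basis_def by blast
  qed
  moreover have "f a [^]\<^bsub>S'\<^esub> p = base_map S' u"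
    using f.hom_pow[of a p] fb[of u] by (simp add: A.a_pow)
  moreover have "g_action S' g \<in> ring_hom S' S'" if g: "g \<in> carrier G" for g
  proof (rule ring_hom_memI)
    fix t t' assume "t \<in> carrier S'" "t' \<in> carrier S'"
    then obtain s s' where s: "s \<in> carrier S" "t = f s" "s' \<in> carrier S" "t' = f s'" using cases by metis
    show "g_action S' g (t \<otimes>\<^bsub>S'\<^esub> t') = g_action S' g t \<otimes>\<^bsub>S'\<^esub> g_action S' g t'"
      "g_action S' g (t \<oplus>\<^bsub>S'\<^esub> t') = g_action S' g t \<oplus>\<^bsub>S'\<^esub> g_action S' g t'"
      using s g fact[OF g, of "s \<otimes>\<^bsub>S\<^esub> s'"] fact[OF g, of "s \<oplus>\<^bsub>S\<^esub> s'"]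
      by (simp_all add: ring_hom_mult[OF act(1)] ring_hom_add[OF act(1)] fact[OF g])
    show "g_action S' g t \<in> carrier S'"
      using s g by (simp flip: fact)
  next
    show "g_action S' g \<one>\<^bsub>S'\<^esub> = \<one>\<^bsub>S'\<^esub>"
      using fact[OF g, of "\<one>\<^bsub>S\<^esub>"] g by (simp add: ring_hom_one[OF act(1)])
  qed
  moreover have "g_action S' g (base_map S' r) = base_map S' r" if "g \<in> carrier G" "r \<in> carrier R" for g r
    using fact[OF that(1), of "b r"] that by (simp add: fb act)
  moreover have "g_action S' g (f a) = base_map S' (\<iota> (\<chi> g)) \<otimes>\<^bsub>S'\<^esub> f a" if "g \<in> carrier G" for g
    using fact[OF that, of a] that by (simp add: fb act)
  ultimately show ?thesis
    using S' bh u_unit ext by (simp add: kummer_gen_def)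
qed

end

section \<open>Kummer generators of Galois extensions\<close>

text \<open>If \<open>x\<^sub>i\<close> and \<open>y\<^sub>i\<close> lie in opposite isotypic parts and \<open>\<Sum> x\<^sub>i y\<^sub>i = 1\<close>, then orthogonal
  \<open>e\<^sub>i\<close> give \<open>(\<Sum> e\<^sub>i x\<^sub>i) (\<Sum> e\<^sub>i y\<^sub>i) = \<Sum> e\<^sub>i\<^sup>2 x\<^sub>i y\<^sub>i\<close>. The condition below thus provides an
  invertible element in every isotypic part, as the triviality of the Picard group would.\<close>

definition unit_selection :: "('r, 'l) ring_scheme \<Rightarrow> bool" where
  "unit_selection R \<longleftrightarrow> (\<forall>(n::nat) r. r \<in> {..<n} \<rightarrow> carrier R \<and> (\<Oplus>\<^bsub>R\<^esub>i\<in>{..<n}. r i) = \<one>\<^bsub>R\<^esub> \<longrightarrow>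
     (\<exists>e\<in>{..<n} \<rightarrow> carrier R. (\<forall>i<n. \<forall>j<n. i \<noteq> j \<longrightarrow> e i \<otimes>\<^bsub>R\<^esub> e j = \<zero>\<^bsub>R\<^esub>) \<and>
        (\<Oplus>\<^bsub>R\<^esub>i\<in>{..<n}. e i \<otimes>\<^bsub>R\<^esub> e i \<otimes>\<^bsub>R\<^esub> r i) \<in> Units R))"

lemma (in kummer_base) chi_sum:
  assumes "i < p" "j < p"
  shows "(\<Sum>g\<in>carrier G. \<chi> g ^ i * inverse (\<chi> g) ^ j) = (if i = j then of_nat p else 0)"
proof -
  have "(\<Sum>g\<in>carrier G. \<chi> g ^ i * inverse (\<chi> g) ^ j) = (\<Sum>k<p. \<chi> (\<gamma> k) ^ i * inverse (\<chi> (\<gamma> k)) ^ j)"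
    by (rule sum.reindex_bij_betw[OF gamma_bij, symmetric])
  also have "\<dots> = (\<Sum>k<p. (\<zeta> ^ i * inverse \<zeta> ^ j) ^ k)"
    by (rule sum.cong) (simp_all add: power_mult_distrib power_inverse mult.commute flip: power_mult)
  finally show ?thesis using zeta_sum[OF assms] by simp
qed

text \<open>Orthogonality summed over the characters; it recovers an element from its isotypic
  projections.\<close>

lemma (in kummer_base) chi_sum_powers:
  assumes "g \<in> carrier G"
  shows "(\<Sum>j<p. inverse (\<chi> g) ^ j) = (if g = \<one>\<^bsub>G\<^esub> then of_nat p else 0)"
proof (cases "g = \<one>\<^bsub>G\<^esub>")
  case False
  have "\<chi> g \<noteq> 1"
    using False chi_inj assms chi_one by (metis G.one_closed inj_onD)
  moreover have "inverse (\<chi> g) ^ p = 1"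
    using pow_p[OF assms] by (simp add: power_inverse)
  ultimately show ?thesis
    using False geometric_sum[of "inverse (\<chi> g)" p] by (simp del: power_inverse)
qed (simp add: chi_one)

section \<open>Isotypic parts of an arbitrary Galois extension\<close>

locale galois_algebra = kummer_base R G \<iota> p \<chi>
  for R :: "('r, 'l) ring_scheme" and G :: "('g, 'm) monoid_scheme"
    and \<iota> :: "'k::field \<Rightarrow> 'r" and p :: nat and \<chi> :: "'g \<Rightarrow> 'k" +
  fixes S :: "('r, 'g, 's) gext"
  assumes gal: "galois_ext R G S"
begin

abbreviation "act \<equiv> g_action S"
abbreviation "b \<equiv> base_map S"

sublocale S: cring S using gal by (simp add: galois_ext_def)

lemma b_hom: "b \<in> ring_hom R S" and b_inj: "inj_on b (carrier R)"
  and act_iso: "g \<in> carrier G \<Longrightarrow> act g \<in> ring_iso S S"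
  and act_base: "g \<in> carrier G \<Longrightarrow> r \<in> carrier R \<Longrightarrow> act g (b r) = b r"
  and fixed: "{s \<in> carrier S. \<forall>g\<in>carrier G. act g s = s} = b ` carrier R"
  and separable: "separable_algebra R S b"
  using gal by (auto simp: galois_ext_def)

sublocale act: faithful_action G "carrier S" act
  using gal by (simp add: galois_ext_def)

lemma act_hom: "g \<in> carrier G \<Longrightarrow> act g \<in> ring_hom S S"
  using act_iso by (simp add: ring_iso_def)

lemma act_ext: "g \<in> carrier G \<Longrightarrow> act g \<in> extensional (carrier S)"
  using act.bij_prop0 hom_in_carrier[OF group_hom.homh[OF act.group_hom]]
  by (auto simp: BijGroup_def Bij_def)

lemma act_mult: "g \<in> carrier G \<Longrightarrow> h \<in> carrier G \<Longrightarrow> s \<in> carrier S \<Longrightarrow> act (g \<otimes>\<^bsub>G\<^esub> h) s = act g (act h s)"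
  using act.composition_rule by simp

lemma act_one: "s \<in> carrier S \<Longrightarrow> act \<one>\<^bsub>G\<^esub> s = s"
  using act.id_eq_one by (metis restrict_apply')

lemmas b_simps [simp] = ring_hom_closed[OF b_hom] ring_hom_add[OF b_hom] ring_hom_mult[OF b_hom]
  ring_hom_one[OF b_hom] ring_hom_zero[OF b_hom R.ring_axioms S.ring_axioms]

lemma act_simps [simp]:
  assumes "g \<in> carrier G"
  shows "s \<in> carrier S \<Longrightarrow> act g s \<in> carrier S"
    "s \<in> carrier S \<Longrightarrow> t \<in> carrier S \<Longrightarrow> act g (s \<otimes>\<^bsub>S\<^esub> t) = act g s \<otimes>\<^bsub>S\<^esub> act g t"
    "s \<in> carrier S \<Longrightarrow> t \<in> carrier S \<Longrightarrow> act g (s \<oplus>\<^bsub>S\<^esub> t) = act g s \<oplus>\<^bsub>S\<^esub> act g t"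
    "act g \<one>\<^bsub>S\<^esub> = \<one>\<^bsub>S\<^esub>" "act g \<zero>\<^bsub>S\<^esub> = \<zero>\<^bsub>S\<^esub>"
    "r \<in> carrier R \<Longrightarrow> act g (b r) = b r"
  using ring_hom_closed[OF act_hom] ring_hom_mult[OF act_hom] ring_hom_add[OF act_hom]
    ring_hom_one[OF act_hom] ring_hom_zero[OF act_hom S.ring_axioms S.ring_axioms] assms act_base by auto

lemma act_add_hom: "g \<in> carrier G \<Longrightarrow> act g \<in> hom (add_monoid S) (add_monoid S)"
  by (rule homI) auto

lemma fixed_base:
  assumes "s \<in> carrier S" "\<And>g. g \<in> carrier G \<Longrightarrow> act g s = s"
  obtains r where "r \<in> carrier R" "s = b r"
  using fixed assms by blast

definition B :: "'k \<Rightarrow> 's" where "B x = b (\<iota> x)"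

lemma B_simps [simp]:
  "B x \<in> carrier S" "B (x + y) = B x \<oplus>\<^bsub>S\<^esub> B y" "B (x * y) = B x \<otimes>\<^bsub>S\<^esub> B y" "B 1 = \<one>\<^bsub>S\<^esub>" "B 0 = \<zero>\<^bsub>S\<^esub>"
  "g \<in> carrier G \<Longrightarrow> act g (B x) = B x"
  by (simp_all add: B_def)

lemma B_sum: "finite A \<Longrightarrow> B (\<Sum>i\<in>A. f i) = (\<Oplus>\<^bsub>S\<^esub>i\<in>A. B (f i))"
  by (induction A rule: finite_induct) auto

text \<open>This is \<open>p\<close> times the projection onto the part of \<open>\<chi>^j\<close>;
  the division by \<open>p\<close> is left to the places of use.\<close>

definition proj :: "nat \<Rightarrow> 's \<Rightarrow> 's" where
  "proj j s = (\<Oplus>\<^bsub>S\<^esub>g\<in>carrier G. B (inverse (\<chi> g) ^ j) \<otimes>\<^bsub>S\<^esub> act g s)"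

lemma proj_closed [simp]: "s \<in> carrier S \<Longrightarrow> proj j s \<in> carrier S"
  unfolding proj_def by (rule S.finsum_closed) auto

lemma proj_add:
  assumes "s \<in> carrier S" "t \<in> carrier S"
  shows "proj j (s \<oplus>\<^bsub>S\<^esub> t) = proj j s \<oplus>\<^bsub>S\<^esub> proj j t"
proof -
  have "proj j (s \<oplus>\<^bsub>S\<^esub> t) = (\<Oplus>\<^bsub>S\<^esub>g\<in>carrier G. B (inverse (\<chi> g) ^ j) \<otimes>\<^bsub>S\<^esub> act g s \<oplus>\<^bsub>S\<^esub> B (inverse (\<chi> g) ^ j) \<otimes>\<^bsub>S\<^esub> act g t)"
    unfolding proj_def by (rule S.finsum_cong') (use assms in \<open>auto simp: S.r_distr\<close>)
  also have "\<dots> = proj j s \<oplus>\<^bsub>S\<^esub> proj j t"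
    unfolding proj_def by (rule S.finsum_addf) (use assms in auto)
  finally show ?thesis .
qed

lemma proj_add_hom: "proj j \<in> hom (add_monoid S) (add_monoid S)"
  by (rule homI) (auto simp: proj_add)

text \<open>Applying \<open>h\<close> reindexes the sum over the group by left translation, and the
  character absorbs the translation as a constant factor.\<close>

lemma act_proj:
  assumes h: "h \<in> carrier G" and s: "s \<in> carrier S"
  shows "act h (proj j s) = B (\<chi> h ^ j) \<otimes>\<^bsub>S\<^esub> proj j s"
proof -
  define F where "F g = B (\<chi> h ^ j) \<otimes>\<^bsub>S\<^esub> (B (inverse (\<chi> g) ^ j) \<otimes>\<^bsub>S\<^esub> act g s)" for g
  have "act h (proj j s) = (\<Oplus>\<^bsub>S\<^esub>g\<in>carrier G. act h (B (inverse (\<chi> g) ^ j) \<otimes>\<^bsub>S\<^esub> act g s))"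
    unfolding proj_def
    by (rule S.a_hom_finsum[OF act_add_hom[OF h] S.abelian_group_axioms]) (use s in auto)
  also have "\<dots> = (\<Oplus>\<^bsub>S\<^esub>g\<in>carrier G. F (h \<otimes>\<^bsub>G\<^esub> g))"
  proof (rule S.finsum_cong')
    fix g assume g: "g \<in> carrier G"
    have "\<chi> h ^ j * inverse (\<chi> (h \<otimes>\<^bsub>G\<^esub> g)) ^ j = inverse (\<chi> g) ^ j"
      using chi_nonzero[OF h] g h by (simp add: chi_mult power_mult_distrib power_inverse field_simps)
    then have "B (\<chi> h ^ j) \<otimes>\<^bsub>S\<^esub> B (inverse (\<chi> (h \<otimes>\<^bsub>G\<^esub> g)) ^ j) = B (inverse (\<chi> g) ^ j)"
      by (simp flip: B_simps(3))
    then show "act h (B (inverse (\<chi> g) ^ j) \<otimes>\<^bsub>S\<^esub> act g s) = F (h \<otimes>\<^bsub>G\<^esub> g)"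
      using g h s by (simp add: F_def act_mult flip: S.m_assoc)
  qed (use h s in \<open>auto simp: F_def\<close>)
  also have "\<dots> = (\<Oplus>\<^bsub>S\<^esub>g\<in>(\<lambda>g. h \<otimes>\<^bsub>G\<^esub> g) ` carrier G. F g)"
    by (rule S.finsum_reindex[symmetric]) (use h s G.inj_on_cmult in \<open>auto simp: F_def\<close>)
  also have "(\<lambda>g. h \<otimes>\<^bsub>G\<^esub> g) ` carrier G = carrier G"
    using G.surj_const_mult[OF h] .
  also have "(\<Oplus>\<^bsub>S\<^esub>g\<in>carrier G. F g) = B (\<chi> h ^ j) \<otimes>\<^bsub>S\<^esub> proj j s"
    unfolding proj_def F_def by (rule S.finsum_rdistr[symmetric]) (use s G_finite in auto)
  finally show ?thesis .
qed

lemma sum_proj: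
  assumes s: "s \<in> carrier S"
  shows "(\<Oplus>\<^bsub>S\<^esub>j\<in>{..<p}. proj j s) = B (of_nat p) \<otimes>\<^bsub>S\<^esub> s"
proof -
  have "(\<Oplus>\<^bsub>S\<^esub>j\<in>{..<p}. proj j s) = (\<Oplus>\<^bsub>S\<^esub>g\<in>carrier G. \<Oplus>\<^bsub>S\<^esub>j\<in>{..<p}. B (inverse (\<chi> g) ^ j) \<otimes>\<^bsub>S\<^esub> act g s)"
    unfolding proj_def by (rule S.finsum_swap) (use s G_finite in auto)
  also have "\<dots> = (\<Oplus>\<^bsub>S\<^esub>g\<in>carrier G. if \<one>\<^bsub>G\<^esub> = g then B (of_nat p) \<otimes>\<^bsub>S\<^esub> s else \<zero>\<^bsub>S\<^esub>)"
  proof (rule S.finsum_cong')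
    fix g assume g: "g \<in> carrier G"
    have "(\<Oplus>\<^bsub>S\<^esub>j\<in>{..<p}. B (inverse (\<chi> g) ^ j) \<otimes>\<^bsub>S\<^esub> act g s) = (\<Oplus>\<^bsub>S\<^esub>j\<in>{..<p}. B (inverse (\<chi> g) ^ j)) \<otimes>\<^bsub>S\<^esub> act g s"
      by (rule S.finsum_ldistr[symmetric]) (use s g in auto)
    also have "(\<Oplus>\<^bsub>S\<^esub>j\<in>{..<p}. B (inverse (\<chi> g) ^ j)) = B (if g = \<one>\<^bsub>G\<^esub> then of_nat p else 0)"
      unfolding chi_sum_powers[OF g, symmetric] by (rule B_sum[symmetric]) simp
    finally show "(\<Oplus>\<^bsub>S\<^esub>j\<in>{..<p}. B (inverse (\<chi> g) ^ j) \<otimes>\<^bsub>S\<^esub> act g s) = (if \<one>\<^bsub>G\<^esub> = g then B (of_nat p) \<otimes>\<^bsub>S\<^esub> s else \<zero>\<^bsub>S\<^esub>)"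
      using s g by (auto simp: act_one)
  qed (use s in auto)
  also have "\<dots> = B (of_nat p) \<otimes>\<^bsub>S\<^esub> s"
    by (rule S.finsum_singleton[of _ _ "\<lambda>_. B (of_nat p) \<otimes>\<^bsub>S\<^esub> s"]) (use s G_finite in auto)
  finally show ?thesis .
qed

lemma proj_isotypic:
  assumes s: "s \<in> carrier S" and eig: "\<And>g. g \<in> carrier G \<Longrightarrow> act g s = B (\<chi> g ^ i) \<otimes>\<^bsub>S\<^esub> s"
    and ij: "i < p" "j < p"
  shows "proj j s = (if i = j then B (of_nat p) \<otimes>\<^bsub>S\<^esub> s else \<zero>\<^bsub>S\<^esub>)"
proof -
  have "proj j s = (\<Oplus>\<^bsub>S\<^esub>g\<in>carrier G. B (\<chi> g ^ i * inverse (\<chi> g) ^ j) \<otimes>\<^bsub>S\<^esub> s)"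
    unfolding proj_def by (rule S.finsum_cong') (use s in \<open>auto simp: eig S.m_ac\<close>)
  also have "\<dots> = (\<Oplus>\<^bsub>S\<^esub>g\<in>carrier G. B (\<chi> g ^ i * inverse (\<chi> g) ^ j)) \<otimes>\<^bsub>S\<^esub> s"
    by (rule S.finsum_ldistr[symmetric]) (use s G_finite in \<open>auto simp del: B_simps(3)\<close>)
  also have "(\<Oplus>\<^bsub>S\<^esub>g\<in>carrier G. B (\<chi> g ^ i * inverse (\<chi> g) ^ j)) = B (if i = j then of_nat p else 0)"
    unfolding chi_sum[OF ij, symmetric] by (rule B_sum[symmetric]) (rule G_finite)
  finally show ?thesis using s by simp
qed

text \<open>Applying \<open>g\<close> to the second factor of the separability idempotent and
  multiplying out gives an idempotent of \<open>S\<close> on which \<open>g\<close> and the identity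
  agree. For \<open>g \<noteq> 1\<close> the Galois condition on idempotents forces it to vanish;
  for \<open>g = 1\<close> it is 1.\<close>

lemma dual_basis:
  obtains n :: nat and x y where "x \<in> {..<n} \<rightarrow> carrier S" "y \<in> {..<n} \<rightarrow> carrier S"
    "\<And>g. g \<in> carrier G \<Longrightarrow> (\<Oplus>\<^bsub>S\<^esub>i\<in>{..<n}. x i \<otimes>\<^bsub>S\<^esub> act g (y i)) = (if g = \<one>\<^bsub>G\<^esub> then \<one>\<^bsub>S\<^esub> else \<zero>\<^bsub>S\<^esub>)"
proof -
  interpret algebra_over R S b
    by unfold_locales (rule b_hom)+
  obtain e where e: "separability_idempotent e"
    using idempotent_if_separable[OF separable] .
  then have eT: "e \<in> carrier T" and e1: "tensor_mult S e = \<one>\<^bsub>S\<^esub>"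
    and es: "\<And>s. s \<in> carrier S \<Longrightarrow> pure s \<one>\<^bsub>S\<^esub> \<otimes>\<^bsub>T\<^esub> e = pure \<one>\<^bsub>S\<^esub> s \<otimes>\<^bsub>T\<^esub> e"
    by (auto simp: separability_idempotent_def)
  obtain n :: nat and x y where xy: "x \<in> {..<n} \<rightarrow> carrier S" "y \<in> {..<n} \<rightarrow> carrier S"
    "e = (\<Oplus>\<^bsub>T\<^esub>i\<in>{..<n}. pure (x i) (y i))"
    using tensor_finite_sum[OF eT] .
  have pcl: "(\<lambda>i. pure (x i) (y i)) \<in> {..<n} \<rightarrow> carrier T" using xy(1,2) by (auto simp: Pi_iff)
  have "(\<Oplus>\<^bsub>S\<^esub>i\<in>{..<n}. x i \<otimes>\<^bsub>S\<^esub> act g (y i)) = (if g = \<one>\<^bsub>G\<^esub> then \<one>\<^bsub>S\<^esub> else \<zero>\<^bsub>S\<^esub>)"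
    if g: "g \<in> carrier G" for g
  proof -
    have id: "(\<lambda>s. s) \<in> ring_hom S S" by (rule ring_hom_memI) auto
    obtain \<theta> where th: "\<theta> \<in> ring_hom T S"
      and thp: "\<And>s t. s \<in> carrier S \<Longrightarrow> t \<in> carrier S \<Longrightarrow> \<theta> (pure s t) = s \<otimes>\<^bsub>S\<^esub> act g t"
      by (rule tensor_lift_ring[OF S.is_cring id act_hom[OF g]]) (use g in auto)
    have "\<theta> e = (\<Oplus>\<^bsub>S\<^esub>i\<in>{..<n}. \<theta> (pure (x i) (y i)))"
      unfolding xy(3)
    proof (rule T.a_hom_finsum)
      show "\<theta> \<in> hom (add_monoid T) (add_monoid S)"
        using th by (auto simp: ring_hom_def hom_def)
    qed (use pcl S.abelian_group_axioms in auto)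
    also have "\<dots> = (\<Oplus>\<^bsub>S\<^esub>i\<in>{..<n}. x i \<otimes>\<^bsub>S\<^esub> act g (y i))"
      by (rule S.finsum_cong') (use xy g in \<open>auto simp: thp Pi_iff\<close>)
    finally have sum: "(\<Oplus>\<^bsub>S\<^esub>i\<in>{..<n}. x i \<otimes>\<^bsub>S\<^esub> act g (y i)) = \<theta> e" ..
    have tc: "\<theta> e \<in> carrier S" by (rule ring_hom_closed[OF th eT])
    show ?thesis
    proof (cases "g = \<one>\<^bsub>G\<^esub>")
      case True
      have "tensor_mult S e = (\<Oplus>\<^bsub>S\<^esub>i\<in>{..<n}. tensor_mult S (pure (x i) (y i)))"
        unfolding xy(3)
      proof (rule T.a_hom_finsum)
        show "tensor_mult S \<in> hom (add_monoid T) (add_monoid S)"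
          using tensor_mult_hom by (auto simp: ring_hom_def hom_def)
      qed (use pcl S.abelian_group_axioms in auto)
      also have "\<dots> = (\<Oplus>\<^bsub>S\<^esub>i\<in>{..<n}. x i \<otimes>\<^bsub>S\<^esub> act g (y i))"
        by (rule S.finsum_cong') (use xy True in \<open>auto simp: tensor_mult_pure act_one Pi_iff\<close>)
      finally show ?thesis using True e1 by simp
    next
      case False
      have "e \<otimes>\<^bsub>T\<^esub> e = e"
        using separability_idempotent_mult[OF e eT] e1 eT by (simp add: pure_one)
      then have idem: "\<theta> e \<otimes>\<^bsub>S\<^esub> \<theta> e = \<theta> e"
        using ring_hom_mult[OF th eT eT] by simp
      have "act g s \<otimes>\<^bsub>S\<^esub> \<theta> e = act \<one>\<^bsub>G\<^esub> s \<otimes>\<^bsub>S\<^esub> \<theta> e" if s: "s \<in> carrier S" for s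
        using ring_hom_mult[OF th _ eT, of "pure s \<one>\<^bsub>S\<^esub>"] ring_hom_mult[OF th _ eT, of "pure \<one>\<^bsub>S\<^esub> s"] es[OF s] s g
        by (simp add: thp act_one)
      moreover have "\<theta> e \<noteq> \<zero>\<^bsub>S\<^esub> \<Longrightarrow> \<exists>s\<in>carrier S. act g s \<otimes>\<^bsub>S\<^esub> \<theta> e \<noteq> act \<one>\<^bsub>G\<^esub> s \<otimes>\<^bsub>S\<^esub> \<theta> e"
        using gal g False tc idem unfolding galois_ext_def by blast
      ultimately show ?thesis using sum False by auto
    qed
  qed
  with xy(1,2) show thesis by (rule that)
qed

text \<open>The dual basis is projected to the parts of \<chi> and of its inverse. In the expanded
  sum of products the duality relation leaves only the diagonal \<open>g = h\<close>, with one
  summand 1 for each of the \<open>p\<close> group elements.\<close>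

lemma isotypic_partition:
  obtains n :: nat and a c where "a \<in> {..<n} \<rightarrow> carrier S" "c \<in> {..<n} \<rightarrow> carrier S"
    "\<And>i g. i < n \<Longrightarrow> g \<in> carrier G \<Longrightarrow> act g (a i) = B (\<chi> g) \<otimes>\<^bsub>S\<^esub> a i"
    "\<And>i g. i < n \<Longrightarrow> g \<in> carrier G \<Longrightarrow> act g (c i) = B (inverse (\<chi> g)) \<otimes>\<^bsub>S\<^esub> c i"
    "(\<Oplus>\<^bsub>S\<^esub>i\<in>{..<n}. a i \<otimes>\<^bsub>S\<^esub> c i) = B (of_nat p)"
proof -
  obtain n :: nat and x y where xy: "x \<in> {..<n} \<rightarrow> carrier S" "y \<in> {..<n} \<rightarrow> carrier S"
    and dual: "\<And>g. g \<in> carrier G \<Longrightarrow> (\<Oplus>\<^bsub>S\<^esub>i\<in>{..<n}. x i \<otimes>\<^bsub>S\<^esub> act g (y i)) = (if g = \<one>\<^bsub>G\<^esub> then \<one>\<^bsub>S\<^esub> else \<zero>\<^bsub>S\<^esub>)"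
    by (rule dual_basis) (rule that)
  have xi: "x i \<in> carrier S" "y i \<in> carrier S" if "i < n" for i using xy that by auto
  \<comment> \<open>Translating the duality relation by \<open>g\<close> turns it into orthogonality
    for pairs of group elements.\<close>
  have dual2: "(\<Oplus>\<^bsub>S\<^esub>i\<in>{..<n}. act g (x i) \<otimes>\<^bsub>S\<^esub> act h (y i)) = (if g = h then \<one>\<^bsub>S\<^esub> else \<zero>\<^bsub>S\<^esub>)"
    if g: "g \<in> carrier G" and h: "h \<in> carrier G" for g h
  proof -
    have k: "inv\<^bsub>G\<^esub> g \<otimes>\<^bsub>G\<^esub> h \<in> carrier G" using g h by simp
    have "act g (\<Oplus>\<^bsub>S\<^esub>i\<in>{..<n}. x i \<otimes>\<^bsub>S\<^esub> act (inv\<^bsub>G\<^esub> g \<otimes>\<^bsub>G\<^esub> h) (y i)) =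
      (\<Oplus>\<^bsub>S\<^esub>i\<in>{..<n}. act g (x i \<otimes>\<^bsub>S\<^esub> act (inv\<^bsub>G\<^esub> g \<otimes>\<^bsub>G\<^esub> h) (y i)))"
      by (rule S.a_hom_finsum[OF act_add_hom[OF g] S.abelian_group_axioms]) (use xi k in auto)
    also have "\<dots> = (\<Oplus>\<^bsub>S\<^esub>i\<in>{..<n}. act g (x i) \<otimes>\<^bsub>S\<^esub> act h (y i))"
    proof (rule S.finsum_cong')
      fix i assume "i \<in> {..<n}"
      moreover have "act g (act (inv\<^bsub>G\<^esub> g \<otimes>\<^bsub>G\<^esub> h) (y i)) = act h (y i)" if "y i \<in> carrier S"
        using g h k that by (simp flip: act_mult G.m_assoc)
      ultimately show "act g (x i \<otimes>\<^bsub>S\<^esub> act (inv\<^bsub>G\<^esub> g \<otimes>\<^bsub>G\<^esub> h) (y i)) = act g (x i) \<otimes>\<^bsub>S\<^esub> act h (y i)"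
        using xi k g by simp
    qed (use xi g h in auto)
    finally have "(\<Oplus>\<^bsub>S\<^esub>i\<in>{..<n}. act g (x i) \<otimes>\<^bsub>S\<^esub> act h (y i)) =
      act g (if inv\<^bsub>G\<^esub> g \<otimes>\<^bsub>G\<^esub> h = \<one>\<^bsub>G\<^esub> then \<one>\<^bsub>S\<^esub> else \<zero>\<^bsub>S\<^esub>)"
      unfolding dual[OF k] by (rule sym)
    moreover have "inv\<^bsub>G\<^esub> g \<otimes>\<^bsub>G\<^esub> h = \<one>\<^bsub>G\<^esub> \<longleftrightarrow> g = h"
      using g h by (metis G.inv_closed G.inv_equality G.inv_inv G.l_inv)
    ultimately show ?thesis
      using act_simps(4,5)[OF g] by (simp only: if_distrib[of "act g"])
  qed
  \<comment> \<open>The inverse character is written as the power \<open>p - 1\<close>, since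
    \<open>proj\<close> takes natural exponents.\<close>
  let ?a = "\<lambda>i. proj 1 (x i)" and ?c = "\<lambda>i. proj (p - 1) (y i)"
  have inv_pow: "\<chi> g ^ (p - 1) = inverse (\<chi> g)" "inverse (\<chi> g) ^ (p - 1) = \<chi> g" if "g \<in> carrier G" for g
  proof -
    have "\<chi> g * \<chi> g ^ (p - 1) = 1"
      using pow_p[OF that] p_gt_1 by (simp flip: power_Suc)
    then show "\<chi> g ^ (p - 1) = inverse (\<chi> g)"
      by (simp add: inverse_unique)
    then show "inverse (\<chi> g) ^ (p - 1) = \<chi> g"
      by (simp add: power_inverse)
  qed
  have "(\<Oplus>\<^bsub>S\<^esub>i\<in>{..<n}. ?a i \<otimes>\<^bsub>S\<^esub> ?c i) = (\<Oplus>\<^bsub>S\<^esub>i\<in>{..<n}. \<Oplus>\<^bsub>S\<^esub>g\<in>carrier G. \<Oplus>\<^bsub>S\<^esub>h\<in>carrier G.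
      B (inverse (\<chi> g) * \<chi> h) \<otimes>\<^bsub>S\<^esub> (act g (x i) \<otimes>\<^bsub>S\<^esub> act h (y i)))"
  proof (rule S.finsum_cong')
    fix i assume "i \<in> {..<n}"
    then have xyi: "x i \<in> carrier S" "y i \<in> carrier S" using xi by auto
    have "?a i \<otimes>\<^bsub>S\<^esub> ?c i = (\<Oplus>\<^bsub>S\<^esub>g\<in>carrier G. B (inverse (\<chi> g) ^ 1) \<otimes>\<^bsub>S\<^esub> act g (x i) \<otimes>\<^bsub>S\<^esub> ?c i)"
      by (subst (1) proj_def) (rule S.finsum_ldistr, use xyi G_finite in auto)
    also have "\<dots> = (\<Oplus>\<^bsub>S\<^esub>g\<in>carrier G. \<Oplus>\<^bsub>S\<^esub>h\<in>carrier G.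
      B (inverse (\<chi> g) * \<chi> h) \<otimes>\<^bsub>S\<^esub> (act g (x i) \<otimes>\<^bsub>S\<^esub> act h (y i)))"
    proof (rule S.finsum_cong')
      fix g assume g: "g \<in> carrier G"
      have "B (inverse (\<chi> g) ^ 1) \<otimes>\<^bsub>S\<^esub> act g (x i) \<otimes>\<^bsub>S\<^esub> ?c i =
        (\<Oplus>\<^bsub>S\<^esub>h\<in>carrier G. B (inverse (\<chi> g) ^ 1) \<otimes>\<^bsub>S\<^esub> act g (x i) \<otimes>\<^bsub>S\<^esub> (B (inverse (\<chi> h) ^ (p - 1)) \<otimes>\<^bsub>S\<^esub> act h (y i)))"
        unfolding proj_def by (rule S.finsum_rdistr) (use xyi g G_finite in auto)
      also have "\<dots> = (\<Oplus>\<^bsub>S\<^esub>h\<in>carrier G. B (inverse (\<chi> g) * \<chi> h) \<otimes>\<^bsub>S\<^esub> (act g (x i) \<otimes>\<^bsub>S\<^esub> act h (y i)))"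
        by (rule S.finsum_cong') (use xyi g in \<open>auto simp: inv_pow S.m_ac simp del: One_nat_def power_inverse\<close>)
      finally show "B (inverse (\<chi> g) ^ 1) \<otimes>\<^bsub>S\<^esub> act g (x i) \<otimes>\<^bsub>S\<^esub> ?c i = \<dots>" .
    qed (use xyi in \<open>auto intro!: S.finsum_closed\<close>)
    finally show "?a i \<otimes>\<^bsub>S\<^esub> ?c i = \<dots>" .
  qed (use xi in \<open>auto intro!: S.finsum_closed\<close>)
  also have "\<dots> = (\<Oplus>\<^bsub>S\<^esub>g\<in>carrier G. \<Oplus>\<^bsub>S\<^esub>i\<in>{..<n}. \<Oplus>\<^bsub>S\<^esub>h\<in>carrier G.
      B (inverse (\<chi> g) * \<chi> h) \<otimes>\<^bsub>S\<^esub> (act g (x i) \<otimes>\<^bsub>S\<^esub> act h (y i)))"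
    by (rule S.finsum_swap) (use xi G_finite in \<open>auto intro!: S.finsum_closed\<close>)
  also have "\<dots> = (\<Oplus>\<^bsub>S\<^esub>g\<in>carrier G. \<one>\<^bsub>S\<^esub>)"
  proof (rule S.finsum_cong')
    fix g assume g: "g \<in> carrier G"
    have "(\<Oplus>\<^bsub>S\<^esub>i\<in>{..<n}. \<Oplus>\<^bsub>S\<^esub>h\<in>carrier G. B (inverse (\<chi> g) * \<chi> h) \<otimes>\<^bsub>S\<^esub> (act g (x i) \<otimes>\<^bsub>S\<^esub> act h (y i))) =
      (\<Oplus>\<^bsub>S\<^esub>h\<in>carrier G. \<Oplus>\<^bsub>S\<^esub>i\<in>{..<n}. B (inverse (\<chi> g) * \<chi> h) \<otimes>\<^bsub>S\<^esub> (act g (x i) \<otimes>\<^bsub>S\<^esub> act h (y i)))"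
      by (rule S.finsum_swap) (use xi g G_finite in auto)
    also have "\<dots> = (\<Oplus>\<^bsub>S\<^esub>h\<in>carrier G. if g = h then \<one>\<^bsub>S\<^esub> else \<zero>\<^bsub>S\<^esub>)"
    proof (rule S.finsum_cong')
      fix h assume h: "h \<in> carrier G"
      have "(\<Oplus>\<^bsub>S\<^esub>i\<in>{..<n}. B (inverse (\<chi> g) * \<chi> h) \<otimes>\<^bsub>S\<^esub> (act g (x i) \<otimes>\<^bsub>S\<^esub> act h (y i))) =
        B (inverse (\<chi> g) * \<chi> h) \<otimes>\<^bsub>S\<^esub> (\<Oplus>\<^bsub>S\<^esub>i\<in>{..<n}. act g (x i) \<otimes>\<^bsub>S\<^esub> act h (y i))"
        by (rule S.finsum_rdistr[symmetric]) (use xi g h in \<open>auto simp del: B_simps(3)\<close>)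
      then show "(\<Oplus>\<^bsub>S\<^esub>i\<in>{..<n}. B (inverse (\<chi> g) * \<chi> h) \<otimes>\<^bsub>S\<^esub> (act g (x i) \<otimes>\<^bsub>S\<^esub> act h (y i))) =
        (if g = h then \<one>\<^bsub>S\<^esub> else \<zero>\<^bsub>S\<^esub>)"
        using dual2[OF g h] chi_nonzero[OF g] by (auto simp del: B_simps(3))
    qed auto
    also have "\<dots> = \<one>\<^bsub>S\<^esub>"
      by (rule S.finsum_singleton[of _ _ "\<lambda>_. \<one>\<^bsub>S\<^esub>"]) (use g G_finite in auto)
    finally show "(\<Oplus>\<^bsub>S\<^esub>i\<in>{..<n}. \<Oplus>\<^bsub>S\<^esub>h\<in>carrier G. B (inverse (\<chi> g) * \<chi> h) \<otimes>\<^bsub>S\<^esub> (act g (x i) \<otimes>\<^bsub>S\<^esub> act h (y i))) = \<one>\<^bsub>S\<^esub>" .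
  qed auto
  also have "\<dots> = B (\<Sum>g\<in>carrier G. 1)"
    by (subst B_sum[OF G_finite]) simp
  also have "(\<Sum>g\<in>carrier G. 1::'k) = of_nat p"
    using order by (simp add: Coset.order_def)
  finally have sum: "(\<Oplus>\<^bsub>S\<^esub>i\<in>{..<n}. ?a i \<otimes>\<^bsub>S\<^esub> ?c i) = B (of_nat p)" .
  show thesis
  proof (rule that[OF _ _ _ _ sum])
    fix i g assume "i < n" and g: "g \<in> carrier G"
    then show "act g (?a i) = B (\<chi> g) \<otimes>\<^bsub>S\<^esub> ?a i" "act g (?c i) = B (inverse (\<chi> g)) \<otimes>\<^bsub>S\<^esub> ?c i"
      using act_proj[OF g, of "x i" 1] act_proj[OF g, of "y i" "p - 1"] xi inv_pow[OF g] by (auto simp del: One_nat_def power_inverse)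
  qed (use xi in auto)
qed

lemma kummer_gen_exists:
  assumes sel: "unit_selection R"
  obtains u a where "kummer_gen S u a"
proof -
  obtain n :: nat and x y where xy: "x \<in> {..<n} \<rightarrow> carrier S" "y \<in> {..<n} \<rightarrow> carrier S"
    and actx: "\<And>i g. i < n \<Longrightarrow> g \<in> carrier G \<Longrightarrow> act g (x i) = B (\<chi> g) \<otimes>\<^bsub>S\<^esub> x i"
    and acty: "\<And>i g. i < n \<Longrightarrow> g \<in> carrier G \<Longrightarrow> act g (y i) = B (inverse (\<chi> g)) \<otimes>\<^bsub>S\<^esub> y i"
    and sum: "(\<Oplus>\<^bsub>S\<^esub>i\<in>{..<n}. x i \<otimes>\<^bsub>S\<^esub> y i) = B (of_nat p)"
    by (rule isotypic_partition) (rule that)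
  have xi: "x i \<in> carrier S" "y i \<in> carrier S" if "i < n" for i using xy that by auto
  have Binv: "B (inverse z) \<otimes>\<^bsub>S\<^esub> B z = \<one>\<^bsub>S\<^esub>" if "z \<noteq> 0" for z
    using that by (simp flip: B_simps(3))
  \<comment> \<open>The characters of the two factors cancel, so their product is fixed by the group
    and comes from \<open>R\<close>.\<close>
  have "\<exists>r\<in>carrier R. x i \<otimes>\<^bsub>S\<^esub> y i = b r" if i: "i < n" for i
  proof -
    have "act g (x i \<otimes>\<^bsub>S\<^esub> y i) = x i \<otimes>\<^bsub>S\<^esub> y i" if g: "g \<in> carrier G" for g
    proof -
      have "act g (x i \<otimes>\<^bsub>S\<^esub> y i) = (B (inverse (\<chi> g)) \<otimes>\<^bsub>S\<^esub> B (\<chi> g)) \<otimes>\<^bsub>S\<^esub> (x i \<otimes>\<^bsub>S\<^esub> y i)"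
        using xi[OF i] g by (simp add: actx[OF i g] acty[OF i g] S.m_ac)
      then show ?thesis using xi[OF i] chi_nonzero[OF g] by (simp add: Binv)
    qed
    then show ?thesis using fixed_base[of "x i \<otimes>\<^bsub>S\<^esub> y i"] xi[OF i] by (metis S.m_closed)
  qed
  then obtain r where r: "\<And>i. i < n \<Longrightarrow> r i \<in> carrier R" "\<And>i. i < n \<Longrightarrow> x i \<otimes>\<^bsub>S\<^esub> y i = b (r i)"
    by metis
  have b_add: "b \<in> hom (add_monoid R) (add_monoid S)"
    using b_hom by (auto simp: ring_hom_def hom_def)
  have bsum: "b (\<Oplus>\<^bsub>R\<^esub>i\<in>{..<n}. f i) = (\<Oplus>\<^bsub>S\<^esub>i\<in>{..<n}. b (f i))" if "f \<in> {..<n} \<rightarrow> carrier R" for f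
    by (rule R.a_hom_finsum[OF b_add S.abelian_group_axioms that])
  have "b (\<Oplus>\<^bsub>R\<^esub>i\<in>{..<n}. r i) = b (\<iota> (of_nat p))"
    using sum by (subst bsum) (use r xi in \<open>auto simp: B_def intro!: S.finsum_cong' elim!: trans[rotated]\<close>)
  then have rsum: "(\<Oplus>\<^bsub>R\<^esub>i\<in>{..<n}. r i) = \<iota> (of_nat p)"
    by (rule inj_onD[OF b_inj]) (use r in \<open>auto intro!: R.finsum_closed\<close>)
  \<comment> \<open>Unit selection speaks about families with sum 1, so the family is first divided
    by \<open>p\<close>.\<close>
  let ?q = "\<iota> (inverse (of_nat p))"
  have "(\<Oplus>\<^bsub>R\<^esub>i\<in>{..<n}. ?q \<otimes>\<^bsub>R\<^esub> r i) = ?q \<otimes>\<^bsub>R\<^esub> (\<Oplus>\<^bsub>R\<^esub>i\<in>{..<n}. r i)"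
    by (rule R.finsum_rdistr[symmetric]) (use r in auto)
  also have "\<dots> = \<one>\<^bsub>R\<^esub>" unfolding rsum by (rule iota_inverse[OF p_nonzero])
  finally have q1: "(\<Oplus>\<^bsub>R\<^esub>i\<in>{..<n}. ?q \<otimes>\<^bsub>R\<^esub> r i) = \<one>\<^bsub>R\<^esub>" .
  have "(\<lambda>i. ?q \<otimes>\<^bsub>R\<^esub> r i) \<in> {..<n} \<rightarrow> carrier R" using r by auto
  from sel[unfolded unit_selection_def, rule_format, OF conjI[OF this q1]]
  obtain e where e: "e \<in> {..<n} \<rightarrow> carrier R"
    "\<And>i j. i < n \<Longrightarrow> j < n \<Longrightarrow> i \<noteq> j \<Longrightarrow> e i \<otimes>\<^bsub>R\<^esub> e j = \<zero>\<^bsub>R\<^esub>"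
    "(\<Oplus>\<^bsub>R\<^esub>i\<in>{..<n}. e i \<otimes>\<^bsub>R\<^esub> e i \<otimes>\<^bsub>R\<^esub> (?q \<otimes>\<^bsub>R\<^esub> r i)) \<in> Units R"
    by (elim bexE conjE) simp
  have ei: "e i \<in> carrier R" if "i < n" for i using e that by auto
  define w where "w = (\<Oplus>\<^bsub>R\<^esub>i\<in>{..<n}. e i \<otimes>\<^bsub>R\<^esub> e i \<otimes>\<^bsub>R\<^esub> r i)"
  have wc: "w \<in> carrier R" unfolding w_def using ei r by (auto intro!: R.finsum_closed)
  have "(\<Oplus>\<^bsub>R\<^esub>i\<in>{..<n}. e i \<otimes>\<^bsub>R\<^esub> e i \<otimes>\<^bsub>R\<^esub> (?q \<otimes>\<^bsub>R\<^esub> r i)) = (\<Oplus>\<^bsub>R\<^esub>i\<in>{..<n}. ?q \<otimes>\<^bsub>R\<^esub> (e i \<otimes>\<^bsub>R\<^esub> e i \<otimes>\<^bsub>R\<^esub> r i))"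
    by (rule R.finsum_cong') (use ei r in \<open>auto simp: R.m_ac\<close>)
  also have "\<dots> = ?q \<otimes>\<^bsub>R\<^esub> w"
    unfolding w_def by (rule R.finsum_rdistr[symmetric]) (use ei r in auto)
  finally have "w \<otimes>\<^bsub>R\<^esub> ?q \<in> Units R" using e(3) wc by (simp add: R.m_comm)
  then have w: "w \<in> Units R" by (rule R.unit_if_mult_unit[OF R.comm_monoid_axioms wc, rotated]) simp
  \<comment> \<open>Orthogonality of the \<open>e i\<close> kills all mixed products, so
    \<open>a\<close> times \<open>c\<close> is the image of the unit \<open>w\<close>. Thus
    \<open>a\<close> is a unit of the \<chi>-part.\<close>
  define a where "a = (\<Oplus>\<^bsub>S\<^esub>i\<in>{..<n}. b (e i) \<otimes>\<^bsub>S\<^esub> x i)"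
  define c where "c = (\<Oplus>\<^bsub>S\<^esub>i\<in>{..<n}. b (e i) \<otimes>\<^bsub>S\<^esub> y i)"
  have ac: "a \<in> carrier S" "c \<in> carrier S"
    unfolding a_def c_def using ei xi by (auto intro!: S.finsum_closed)
  have "a \<otimes>\<^bsub>S\<^esub> c = (\<Oplus>\<^bsub>S\<^esub>i\<in>{..<n}. b (e i) \<otimes>\<^bsub>S\<^esub> x i \<otimes>\<^bsub>S\<^esub> c)"
    unfolding a_def by (rule S.finsum_ldistr) (use ei xi ac in auto)
  also have "\<dots> = (\<Oplus>\<^bsub>S\<^esub>i\<in>{..<n}. b (e i \<otimes>\<^bsub>R\<^esub> e i \<otimes>\<^bsub>R\<^esub> r i))"
  proof (rule S.finsum_cong')
    fix i assume "i \<in> {..<n}"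
    then have i: "i < n" by simp
    have "b (e i) \<otimes>\<^bsub>S\<^esub> x i \<otimes>\<^bsub>S\<^esub> c = (\<Oplus>\<^bsub>S\<^esub>j\<in>{..<n}. b (e i) \<otimes>\<^bsub>S\<^esub> x i \<otimes>\<^bsub>S\<^esub> (b (e j) \<otimes>\<^bsub>S\<^esub> y j))"
      unfolding c_def by (rule S.finsum_rdistr) (use ei xi i in auto)
    also have "\<dots> = (\<Oplus>\<^bsub>S\<^esub>j\<in>{..<n}. if i = j then b (e i \<otimes>\<^bsub>R\<^esub> e i \<otimes>\<^bsub>R\<^esub> r i) else \<zero>\<^bsub>S\<^esub>)"
    proof (rule S.finsum_cong')
      fix j assume "j \<in> {..<n}"
      then have j: "j < n" by simp
      have "b (e i) \<otimes>\<^bsub>S\<^esub> x i \<otimes>\<^bsub>S\<^esub> (b (e j) \<otimes>\<^bsub>S\<^esub> y j) = b (e i \<otimes>\<^bsub>R\<^esub> e j) \<otimes>\<^bsub>S\<^esub> (x i \<otimes>\<^bsub>S\<^esub> y j)"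
        using ei xi i j by (simp add: S.m_ac)
      also have "\<dots> = (if i = j then b (e i \<otimes>\<^bsub>R\<^esub> e i \<otimes>\<^bsub>R\<^esub> r i) else \<zero>\<^bsub>S\<^esub>)"
        using e(2)[OF i j] ei r xi i j by (auto simp del: b_simps(3)) (simp add: r(2))
      finally show "b (e i) \<otimes>\<^bsub>S\<^esub> x i \<otimes>\<^bsub>S\<^esub> (b (e j) \<otimes>\<^bsub>S\<^esub> y j) = (if i = j then b (e i \<otimes>\<^bsub>R\<^esub> e i \<otimes>\<^bsub>R\<^esub> r i) else \<zero>\<^bsub>S\<^esub>)" .
    qed (use ei r i in auto)
    also have "\<dots> = b (e i \<otimes>\<^bsub>R\<^esub> e i \<otimes>\<^bsub>R\<^esub> r i)"
      by (rule S.finsum_singleton[of _ _ "\<lambda>_. b (e i \<otimes>\<^bsub>R\<^esub> e i \<otimes>\<^bsub>R\<^esub> r i)"]) (use ei r i in auto)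
    finally show "b (e i) \<otimes>\<^bsub>S\<^esub> x i \<otimes>\<^bsub>S\<^esub> c = b (e i \<otimes>\<^bsub>R\<^esub> e i \<otimes>\<^bsub>R\<^esub> r i)" .
  qed (use ei r in auto)
  also have "\<dots> = b w"
    unfolding w_def by (rule bsum[symmetric]) (use ei r in auto)
  finally have acw: "a \<otimes>\<^bsub>S\<^esub> c = b w" .
  have b_unit: "b v \<in> Units S" if "v \<in> Units R" for v
  proof (rule S.unit_if_mult_unit[OF S.comm_monoid_axioms, of _ "b (inv\<^bsub>R\<^esub> v)"])
    show "b v \<otimes>\<^bsub>S\<^esub> b (inv\<^bsub>R\<^esub> v) \<in> Units S"
      using that ring_hom_mult[OF b_hom, of v "inv\<^bsub>R\<^esub> v", symmetric] R.Units_closed[OF that] by simp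
  qed (use that in auto)
  have a_unit: "a \<in> Units S"
    using S.unit_if_mult_unit[OF S.comm_monoid_axioms ac] b_unit[OF w] acw by simp
  have act_a: "act g a = B (\<chi> g) \<otimes>\<^bsub>S\<^esub> a" if g: "g \<in> carrier G" for g
  proof -
    have "act g a = (\<Oplus>\<^bsub>S\<^esub>i\<in>{..<n}. act g (b (e i) \<otimes>\<^bsub>S\<^esub> x i))"
      unfolding a_def by (rule S.a_hom_finsum[OF act_add_hom[OF g] S.abelian_group_axioms]) (use ei xi in auto)
    also have "\<dots> = (\<Oplus>\<^bsub>S\<^esub>i\<in>{..<n}. B (\<chi> g) \<otimes>\<^bsub>S\<^esub> (b (e i) \<otimes>\<^bsub>S\<^esub> x i))"
      by (rule S.finsum_cong') (use ei xi g in \<open>auto simp: actx S.m_lcomm\<close>)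
    also have "\<dots> = B (\<chi> g) \<otimes>\<^bsub>S\<^esub> a"
      unfolding a_def by (rule S.finsum_rdistr[symmetric]) (use ei xi in auto)
    finally show ?thesis .
  qed
  have Bpow: "B (z ^ k) = B z [^]\<^bsub>S\<^esub> k" for z and k :: nat
    by (induction k) (simp_all add: S.m_comm)
  have act_pow: "act g (s [^]\<^bsub>S\<^esub> k) = act g s [^]\<^bsub>S\<^esub> k" if "g \<in> carrier G" "s \<in> carrier S" for g s and k :: nat
    using that by (induction k) simp_all
  have act_apow: "act g (a [^]\<^bsub>S\<^esub> k) = B (\<chi> g ^ k) \<otimes>\<^bsub>S\<^esub> a [^]\<^bsub>S\<^esub> k" if "g \<in> carrier G" for g and k :: nat
    using that ac by (simp add: act_pow act_a Bpow S.nat_pow_distrib)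
  define d where "d = inv\<^bsub>S\<^esub> a"
  have d: "d \<in> carrier S" "a \<otimes>\<^bsub>S\<^esub> d = \<one>\<^bsub>S\<^esub>" using a_unit by (auto simp: d_def)
  have ad: "a [^]\<^bsub>S\<^esub> k \<otimes>\<^bsub>S\<^esub> d [^]\<^bsub>S\<^esub> k = \<one>\<^bsub>S\<^esub>" for k :: nat
    using ac d by (simp flip: S.nat_pow_distrib)
  have act_d: "act g (d [^]\<^bsub>S\<^esub> k) = B (inverse (\<chi> g) ^ k) \<otimes>\<^bsub>S\<^esub> d [^]\<^bsub>S\<^esub> k" if g: "g \<in> carrier G" for g and k :: nat
  proof -
    let ?D = "d [^]\<^bsub>S\<^esub> k" and ?A = "a [^]\<^bsub>S\<^esub> k"
    have cl: "?D \<in> carrier S" "?A \<in> carrier S" "act g ?D \<in> carrier S" using ac d g by auto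
    have "act g ?A \<otimes>\<^bsub>S\<^esub> act g ?D = \<one>\<^bsub>S\<^esub>"
      using ad[of k] cl g by (simp flip: act_simps(2))
    then have "B (\<chi> g ^ k) \<otimes>\<^bsub>S\<^esub> ?A \<otimes>\<^bsub>S\<^esub> act g ?D = \<one>\<^bsub>S\<^esub>"
      using act_apow[OF g] by simp
    then have "B (inverse (\<chi> g) ^ k) \<otimes>\<^bsub>S\<^esub> ?D \<otimes>\<^bsub>S\<^esub> (B (\<chi> g ^ k) \<otimes>\<^bsub>S\<^esub> ?A \<otimes>\<^bsub>S\<^esub> act g ?D) = B (inverse (\<chi> g) ^ k) \<otimes>\<^bsub>S\<^esub> ?D"
      using cl by simp
    moreover have "B (inverse (\<chi> g) ^ k) \<otimes>\<^bsub>S\<^esub> ?D \<otimes>\<^bsub>S\<^esub> (B (\<chi> g ^ k) \<otimes>\<^bsub>S\<^esub> ?A \<otimes>\<^bsub>S\<^esub> act g ?D) =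
      (B (inverse (\<chi> g) ^ k) \<otimes>\<^bsub>S\<^esub> B (\<chi> g ^ k)) \<otimes>\<^bsub>S\<^esub> ((?A \<otimes>\<^bsub>S\<^esub> ?D) \<otimes>\<^bsub>S\<^esub> act g ?D)"
      using cl by (simp add: S.m_ac)
    moreover have "B (inverse (\<chi> g) ^ k) \<otimes>\<^bsub>S\<^esub> B (\<chi> g ^ k) = \<one>\<^bsub>S\<^esub>"
      using Binv[of "\<chi> g ^ k"] chi_nonzero[OF g] by (simp add: power_inverse)
    ultimately show ?thesis using cl ad by simp
  qed
  obtain u where u: "u \<in> carrier R" "a [^]\<^bsub>S\<^esub> p = b u"
  proof (rule fixed_base)
    show "act g (a [^]\<^bsub>S\<^esub> p) = a [^]\<^bsub>S\<^esub> p" if "g \<in> carrier G" for g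
      using act_apow[OF that, of p] pow_p[OF that] ac by simp
  qed (use ac in auto)
  \<comment> \<open>The inverse generator supplies the inverse of \<open>u\<close>: its
    \<open>p\<close>-th power is fixed by the group as well.\<close>
  obtain u' where u': "u' \<in> carrier R" "d [^]\<^bsub>S\<^esub> p = b u'"
  proof (rule fixed_base)
    show "act g (d [^]\<^bsub>S\<^esub> p) = d [^]\<^bsub>S\<^esub> p" if "g \<in> carrier G" for g
      using act_d[OF that, of p] pow_p[OF that] d by (simp add: power_inverse)
  qed (use d in auto)
  have "b (u \<otimes>\<^bsub>R\<^esub> u') = b \<one>\<^bsub>R\<^esub>"
    using ad[of p] u u' by simp
  then have "u \<otimes>\<^bsub>R\<^esub> u' = \<one>\<^bsub>R\<^esub>"
    by (rule inj_onD[OF b_inj]) (use u u' in auto)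
  then have u_unit: "u \<in> Units R"
    using R.unit_if_mult_unit[OF R.comm_monoid_axioms u(1) u'(1)] by simp
  have "power_basis R S b p a"
    unfolding power_basis_def
  proof (intro conjI ballI impI allI)
    fix s assume s: "s \<in> carrier S"
    \<comment> \<open>The \<open>k\<close>-th coefficient of \<open>s\<close>, up to the factor
      \<open>p\<close>, is \<open>proj k s\<close> divided by \<open>a^k\<close>; this quotient is
      fixed by the group.\<close>
    have "\<exists>r\<in>carrier R. proj k s \<otimes>\<^bsub>S\<^esub> d [^]\<^bsub>S\<^esub> k = b r" for k
    proof -
      have "act g (proj k s \<otimes>\<^bsub>S\<^esub> d [^]\<^bsub>S\<^esub> k) = proj k s \<otimes>\<^bsub>S\<^esub> d [^]\<^bsub>S\<^esub> k" if g: "g \<in> carrier G" for g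
      proof -
        have "act g (proj k s \<otimes>\<^bsub>S\<^esub> d [^]\<^bsub>S\<^esub> k) =
          (B (inverse (\<chi> g) ^ k) \<otimes>\<^bsub>S\<^esub> B (\<chi> g ^ k)) \<otimes>\<^bsub>S\<^esub> (proj k s \<otimes>\<^bsub>S\<^esub> d [^]\<^bsub>S\<^esub> k)"
          using g s d by (simp add: act_proj act_d S.m_ac)
        moreover have "B (inverse (\<chi> g) ^ k) \<otimes>\<^bsub>S\<^esub> B (\<chi> g ^ k) = \<one>\<^bsub>S\<^esub>"
          using Binv[of "\<chi> g ^ k"] chi_nonzero[OF g] by (simp add: power_inverse)
        ultimately show ?thesis using s d by simp
      qed
      then show ?thesis
        using fixed_base[of "proj k s \<otimes>\<^bsub>S\<^esub> d [^]\<^bsub>S\<^esub> k"] s d by (metis S.m_closed S.nat_pow_closed proj_closed)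
    qed
    then obtain t where t: "\<And>k. t k \<in> carrier R" "\<And>k. proj k s \<otimes>\<^bsub>S\<^esub> d [^]\<^bsub>S\<^esub> k = b (t k)" by metis
    have pk: "proj k s = b (t k) \<otimes>\<^bsub>S\<^esub> a [^]\<^bsub>S\<^esub> k" for k
    proof -
      have "b (t k) \<otimes>\<^bsub>S\<^esub> a [^]\<^bsub>S\<^esub> k = proj k s \<otimes>\<^bsub>S\<^esub> (a [^]\<^bsub>S\<^esub> k \<otimes>\<^bsub>S\<^esub> d [^]\<^bsub>S\<^esub> k)"
        using s d ac by (simp add: S.m_ac flip: t(2))
      then show ?thesis using s ad by simp
    qed
    have "lin S b p a (\<lambda>k. ?q \<otimes>\<^bsub>R\<^esub> t k) = (\<Oplus>\<^bsub>S\<^esub>k\<in>{..<p}. b ?q \<otimes>\<^bsub>S\<^esub> proj k s)"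
      unfolding lin_def by (rule S.finsum_cong') (use t s ac in \<open>auto simp: S.m_assoc simp flip: pk\<close>)
    also have "\<dots> = b ?q \<otimes>\<^bsub>S\<^esub> (\<Oplus>\<^bsub>S\<^esub>k\<in>{..<p}. proj k s)"
      by (rule S.finsum_rdistr[symmetric]) (use s in auto)
    also have "\<dots> = s"
      using sum_proj[OF s] s Binv[OF p_nonzero] by (simp add: B_def flip: S.m_assoc)
    finally show "\<exists>r\<in>{..<p} \<rightarrow> carrier R. s = lin S b p a r"
      using t by (intro bexI[of _ "\<lambda>k. ?q \<otimes>\<^bsub>R\<^esub> t k"]) auto
  next
    fix t j assume t: "t \<in> {..<p} \<rightarrow> carrier R" "lin S b p a t = \<zero>\<^bsub>S\<^esub>" and j: "j < p"
    have ti: "t i \<in> carrier R" if "i < p" for i using t that by auto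
    \<comment> \<open>Applying \<open>proj j\<close> isolates the \<open>j\<close>-th term, in which
      everything but the coefficient is invertible.\<close>
    have "proj j (lin S b p a t) = (\<Oplus>\<^bsub>S\<^esub>i\<in>{..<p}. proj j (b (t i) \<otimes>\<^bsub>S\<^esub> a [^]\<^bsub>S\<^esub> i))"
      unfolding lin_def by (rule S.a_hom_finsum[OF proj_add_hom S.abelian_group_axioms]) (use ti ac in auto)
    also have "\<dots> = (\<Oplus>\<^bsub>S\<^esub>i\<in>{..<p}. if j = i then B (of_nat p) \<otimes>\<^bsub>S\<^esub> (b (t i) \<otimes>\<^bsub>S\<^esub> a [^]\<^bsub>S\<^esub> i) else \<zero>\<^bsub>S\<^esub>)"
    proof (rule S.finsum_cong')
      fix i assume "i \<in> {..<p}"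
      then have i: "i < p" by simp
      have "act g (b (t i) \<otimes>\<^bsub>S\<^esub> a [^]\<^bsub>S\<^esub> i) = B (\<chi> g ^ i) \<otimes>\<^bsub>S\<^esub> (b (t i) \<otimes>\<^bsub>S\<^esub> a [^]\<^bsub>S\<^esub> i)" if "g \<in> carrier G" for g
        using that ti[OF i] ac by (simp add: act_apow S.m_lcomm)
      then have "proj j (b (t i) \<otimes>\<^bsub>S\<^esub> a [^]\<^bsub>S\<^esub> i) = (if i = j then B (of_nat p) \<otimes>\<^bsub>S\<^esub> (b (t i) \<otimes>\<^bsub>S\<^esub> a [^]\<^bsub>S\<^esub> i) else \<zero>\<^bsub>S\<^esub>)"
        using ti[OF i] ac i j by (intro proj_isotypic) auto
      then show "proj j (b (t i) \<otimes>\<^bsub>S\<^esub> a [^]\<^bsub>S\<^esub> i) = (if j = i then B (of_nat p) \<otimes>\<^bsub>S\<^esub> (b (t i) \<otimes>\<^bsub>S\<^esub> a [^]\<^bsub>S\<^esub> i) else \<zero>\<^bsub>S\<^esub>)"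
        by auto
    qed (use ti ac in auto)
    also have "\<dots> = B (of_nat p) \<otimes>\<^bsub>S\<^esub> (b (t j) \<otimes>\<^bsub>S\<^esub> a [^]\<^bsub>S\<^esub> j)"
      by (rule S.finsum_singleton[of j "{..<p}" "\<lambda>i. B (of_nat p) \<otimes>\<^bsub>S\<^esub> (b (t i) \<otimes>\<^bsub>S\<^esub> a [^]\<^bsub>S\<^esub> i)"]) (use ti ac j in auto)
    finally have "B (of_nat p) \<otimes>\<^bsub>S\<^esub> (b (t j) \<otimes>\<^bsub>S\<^esub> a [^]\<^bsub>S\<^esub> j) = \<zero>\<^bsub>S\<^esub>"
      using t(2) proj_isotypic[of "\<zero>\<^bsub>S\<^esub>" j j] j by simp
    then have "B (of_nat p) \<otimes>\<^bsub>S\<^esub> (b (t j) \<otimes>\<^bsub>S\<^esub> a [^]\<^bsub>S\<^esub> j) \<otimes>\<^bsub>S\<^esub> d [^]\<^bsub>S\<^esub> j = \<zero>\<^bsub>S\<^esub>"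
      using d by simp
    moreover have "B (of_nat p) \<otimes>\<^bsub>S\<^esub> (b (t j) \<otimes>\<^bsub>S\<^esub> a [^]\<^bsub>S\<^esub> j) \<otimes>\<^bsub>S\<^esub> d [^]\<^bsub>S\<^esub> j = b (\<iota> (of_nat p) \<otimes>\<^bsub>R\<^esub> t j) \<otimes>\<^bsub>S\<^esub> (a [^]\<^bsub>S\<^esub> j \<otimes>\<^bsub>S\<^esub> d [^]\<^bsub>S\<^esub> j)"
      using d ac ti[OF j] by (simp add: B_def S.m_assoc)
    ultimately have "b (\<iota> (of_nat p) \<otimes>\<^bsub>R\<^esub> t j) = b \<zero>\<^bsub>R\<^esub>"
      using ad ti[OF j] by simp
    then have "\<iota> (of_nat p) \<otimes>\<^bsub>R\<^esub> t j = \<zero>\<^bsub>R\<^esub>"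
      by (rule inj_onD[OF b_inj]) (use ti[OF j] in auto)
    then show "t j = \<zero>\<^bsub>R\<^esub>" using iota_cancel[OF p_nonzero ti[OF j]] by simp
  qed
  then have "kummer_gen S u a"
    using u u_unit ac b_hom S.is_cring act_hom act_ext act_a
    by (auto simp: kummer_gen_def B_def)
  then show thesis by (rule that)
qed

end

text \<open>\<open>ring.extend\<close> adds fields and thereby changes the record type, so agreement
  of the underlying rings has to be stated field by field.\<close>

definition same_ring :: "('s, 'm) ring_scheme \<Rightarrow> ('s, 'n) ring_scheme \<Rightarrow> bool" where
  "same_ring S S' \<longleftrightarrow> carrier S = carrier S' \<and> monoid.mult S = monoid.mult S' \<and>
     \<one>\<^bsub>S\<^esub> = \<one>\<^bsub>S'\<^esub> \<and> \<zero>\<^bsub>S\<^esub> = \<zero>\<^bsub>S'\<^esub> \<and> add S = add S'"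

lemma same_ring_extend: "same_ring (ring.extend S m) S"
  by (simp add: same_ring_def ring.defs)

lemma same_ring_cring:
  assumes "same_ring S S'" "cring S'"
  shows "cring S"
proof -
  interpret cring S' by fact
  show ?thesis
    by (rule cringI; (rule abelian_groupI comm_monoidI)?)
      (use assms(1) in \<open>auto simp: same_ring_def m_assoc a_assoc l_distr intro: m_comm a_comm add.l_inv_ex\<close>)
qed

lemma same_ring_lin: "same_ring S S' \<Longrightarrow> lin S = lin S'"
  unfolding same_ring_def by (intro ext) (simp add: lin_def finsum_def finprod_def nat_pow_def)

lemma same_ring_pow: "same_ring S S' \<Longrightarrow> x [^]\<^bsub>S\<^esub> (n::nat) = x [^]\<^bsub>S'\<^esub> n"
  by (simp add: same_ring_def nat_pow_def)

lemma same_ring_hom: "same_ring S S' \<Longrightarrow> ring_hom A S = ring_hom A S'" "same_ring S S' \<Longrightarrow> ring_hom S A = ring_hom S' A"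
  by (simp_all add: same_ring_def ring_hom_def)

lemma same_ring_power_basis: "same_ring S S' \<Longrightarrow> power_basis R S b p a = power_basis R S' b p a"
  unfolding power_basis_def by (simp only: same_ring_lin) (simp add: same_ring_def)

section \<open>Generators of the explicit Kummer extension and of base changes\<close>

context kummer_base
begin

text \<open>Ring identities can be proved in \<open>S'\<close>, where the ring locales are
  interpreted; \<open>S\<close> contributes only the structure map and the action.\<close>

lemma kummer_genI:
  assumes same: "same_ring S S'" and S': "power_basis_alg R S' (base_map S) p u a"
    and u: "u \<in> Units R"
    and "\<And>g. g \<in> carrier G \<Longrightarrow> g_action S g \<in> ring_hom S' S'"
    and "\<And>g. g \<in> carrier G \<Longrightarrow> g_action S g \<in> extensional (carrier S')"
    and "\<And>g r. g \<in> carrier G \<Longrightarrow> r \<in> carrier R \<Longrightarrow> g_action S g (base_map S r) = base_map S r"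
    and "\<And>g. g \<in> carrier G \<Longrightarrow> g_action S g a = base_map S (\<iota> (\<chi> g)) \<otimes>\<^bsub>S'\<^esub> a"
  shows "kummer_gen S u a"
proof -
  interpret power_basis_alg R S' "base_map S" p u a by fact
  show ?thesis
    unfolding kummer_gen_def same_ring_pow[OF same] same_ring_hom[OF same] same_ring_power_basis[OF same]
    using same_ring_cring[OF same S.is_cring] b_hom u a_pow basis assms same
    by (auto simp: same_ring_def)
qed

text \<open>The generator is the class of \<open>T\<close>. Higher powers reduce through
  \<open>T^p = u\<close>, and independence is a degree argument because \<open>T^p - u\<close> is
  monic.\<close>

lemma kummer_ext_gen:
  assumes u: "u \<in> Units R"
  obtains a where "kummer_gen (kummer_ext R \<iota> \<chi> p u) u a"
proof -
  define P where "P = UP R"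
  interpret U: UP_cring R P by unfold_locales (simp add: P_def)
  define f where "f = up_ring.monom P \<one>\<^bsub>R\<^esub> p \<ominus>\<^bsub>P\<^esub> up_ring.monom P u 0"
  define J where "J = PIdl\<^bsub>P\<^esub> f"
  define subst where "subst g = UnivPoly.eval R P (\<lambda>a. up_ring.monom P a 0) (up_ring.monom P (\<iota> (\<chi> g)) 1)" for g
  define Q where "Q = P Quot J"
  have uc: "u \<in> carrier R" using u by auto
  have fP: "f \<in> carrier P" using uc by (simp add: f_def)
  interpret J: ideal J P unfolding J_def by (rule U.P.cgenideal_ideal[OF fP])
  interpret Q: cring Q unfolding Q_def by (rule J.quotient_is_cring[OF U.P.is_cring])
  define q where "q h = J +>\<^bsub>P\<^esub> h" for h
  have q_hom: "q \<in> ring_hom P Q" unfolding Q_def q_def by (rule J.rcos_ring_hom)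
  interpret q: ring_hom_cring P Q q
    by (rule ring_hom_cringI[OF U.P.is_cring Q.is_cring q_hom])
  have q_eq: "q h = q h' \<longleftrightarrow> h \<ominus>\<^bsub>P\<^esub> h' \<in> J" if "h \<in> carrier P" "h' \<in> carrier P" for h h'
    using U.P.quotient_eq_iff_same_a_r_cos[OF J.is_ideal that] by (simp add: q_def)
  have Q_cases: "\<exists>h\<in>carrier P. C = q h" if "C \<in> carrier Q" for C
    using that by (auto simp: Q_def q_def FactRing_def A_RCOSETS_def')
  have c_hom: "(\<lambda>r. up_ring.monom P r 0) \<in> ring_hom R P" by (rule U.const_ring_hom)
  define b where "b r = q (up_ring.monom P r 0)" for r
  have b_hom: "b \<in> ring_hom R Q"
    using ring_hom_trans[OF c_hom q_hom] by (simp add: comp_def b_def[abs_def])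
  define a where "a = q (up_ring.monom P \<one>\<^bsub>R\<^esub> 1)"
  have a: "a \<in> carrier Q" by (simp add: a_def)
  have X_pow: "up_ring.monom P \<one>\<^bsub>R\<^esub> 1 [^]\<^bsub>P\<^esub> n = up_ring.monom P \<one>\<^bsub>R\<^esub> n" for n :: nat
    using U.monom_pow[of "\<one>\<^bsub>R\<^esub>" 1 n] by simp
  have a_pow': "a [^]\<^bsub>Q\<^esub> n = q (up_ring.monom P \<one>\<^bsub>R\<^esub> n)" for n :: nat
    unfolding a_def X_pow[of n, symmetric] by (rule q.hom_pow[symmetric]) simp
  have "q (up_ring.monom P \<one>\<^bsub>R\<^esub> p) = q (up_ring.monom P u 0)"
    using q_eq[of "up_ring.monom P \<one>\<^bsub>R\<^esub> p" "up_ring.monom P u 0"] U.P.cgenideal_self[OF fP] uc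
    by (simp add: J_def f_def)
  then have ap: "a [^]\<^bsub>Q\<^esub> p = b u" by (simp add: a_pow' b_def)
  interpret A: power_alg R Q b p u a
    by unfold_locales (use b_hom p_gt_1 uc a ap in auto)
  have monom_split: "q (up_ring.monom P r i) = b r \<otimes>\<^bsub>Q\<^esub> a [^]\<^bsub>Q\<^esub> i" if "r \<in> carrier R" for r i
  proof -
    have "up_ring.monom P r i = up_ring.monom P r 0 \<otimes>\<^bsub>P\<^esub> up_ring.monom P \<one>\<^bsub>R\<^esub> i"
      using U.monom_mult[of r "\<one>\<^bsub>R\<^esub>" 0 i] that by simp
    then show ?thesis using that by (simp add: b_def a_pow')
  qed
  have span: "q h \<in> A.span" if h: "h \<in> carrier P" for h
  proof -
    have "q (\<Oplus>\<^bsub>P\<^esub>i\<in>{..deg R h}. up_ring.monom P (up_ring.coeff P h i) i) \<in> A.span"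
    proof (rule U.P.finsum_induct)
      show "q \<zero>\<^bsub>P\<^esub> \<in> A.span" using A.span_base[of "\<zero>\<^bsub>R\<^esub>"] by simp
      fix i :: nat
      have "a [^]\<^bsub>Q\<^esub> i \<in> A.span"
        using A.span_gen_mult[OF A.span_base[of "\<one>\<^bsub>R\<^esub>"], of i] a by simp
      then show "q (up_ring.monom P (up_ring.coeff P h i) i) \<in> A.span"
        using h by (simp add: monom_split A.span_smult)
    qed (use h in \<open>auto simp: A.span_add\<close>)
    then show ?thesis using U.up_repr[OF h] by simp
  qed
  have lin_q: "A.L r = q (\<Oplus>\<^bsub>P\<^esub>i\<in>{..<p}. up_ring.monom P (r i) i)" if r: "r \<in> A.Co" for r
  proof -
    have "(\<lambda>i. up_ring.monom P (r i) i) \<in> {..<p} \<rightarrow> carrier P" using r by auto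
    then have "q (\<Oplus>\<^bsub>P\<^esub>i\<in>{..<p}. up_ring.monom P (r i) i) = (\<Oplus>\<^bsub>Q\<^esub>i\<in>{..<p}. q (up_ring.monom P (r i) i))"
      by (simp add: comp_def)
    also have "\<dots> = A.L r"
      unfolding lin_def by (rule Q.finsum_cong') (use r a in \<open>auto simp: monom_split\<close>)
    finally show ?thesis ..
  qed
  have basis: "power_basis R Q b p a"
    unfolding power_basis_def
  proof (intro conjI ballI impI allI)
    fix C assume "C \<in> carrier Q"
    then obtain h where "h \<in> carrier P" "C = q h" using Q_cases by blast
    then have "C \<in> A.span" using span by simp
    then show "\<exists>r\<in>A.Co. C = A.L r" by (auto simp: A.span_def)
  next
    fix r k assume r: "r \<in> A.Co" "A.L r = \<zero>\<^bsub>Q\<^esub>" and k: "k < p"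
    define F where "F = (\<Oplus>\<^bsub>P\<^esub>i\<in>{..<p}. up_ring.monom P (r i) i)"
    have Fm: "(\<lambda>i. up_ring.monom P (r i) i) \<in> {..<p} \<rightarrow> carrier P" using r by auto
    then have FP: "F \<in> carrier P" unfolding F_def by (rule U.P.finsum_closed)
    have Fc: "up_ring.coeff P F n = (if n < p then r n else \<zero>\<^bsub>R\<^esub>)" for n
    proof -
      have "up_ring.coeff P F n = (\<Oplus>\<^bsub>R\<^esub>i\<in>{..<p}. up_ring.coeff P (up_ring.monom P (r i) i) n)"
        unfolding F_def by (rule U.coeff_finsum[OF finite_lessThan Fm])
      also have "\<dots> = (\<Oplus>\<^bsub>R\<^esub>i\<in>{..<p}. if n = i then r i else \<zero>\<^bsub>R\<^esub>)"
        by (rule R.finsum_cong') (use r in auto)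
      also have "\<dots> = (if n < p then r n else \<zero>\<^bsub>R\<^esub>)"
      proof (cases "n < p")
        case True
        then show ?thesis using R.finsum_singleton[of n "{..<p}" r] r by auto
      next
        case False
        then have "(\<Oplus>\<^bsub>R\<^esub>i\<in>{..<p}. if n = i then r i else \<zero>\<^bsub>R\<^esub>) = (\<Oplus>\<^bsub>R\<^esub>i\<in>{..<p}. \<zero>\<^bsub>R\<^esub>)"
          by (intro R.finsum_cong') auto
        then show ?thesis using False by simp
      qed
      finally show ?thesis .
    qed
    have "q F = q \<zero>\<^bsub>P\<^esub>" using r lin_q[OF r(1)] by (simp add: F_def)
    then have "F \<in> J" using q_eq[OF FP U.P.zero_closed] FP by (simp add: U.P.minus_eq)
    then obtain h where h: "h \<in> carrier P" "F = h \<otimes>\<^bsub>P\<^esub> f" unfolding J_def cgenideal_def by blast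
    \<comment> \<open>In degrees from \<open>p\<close> on, multiplication by \<open>T^p - u\<close>
      exposes the coefficients of \<open>h\<close>, shifted by \<open>p\<close>.\<close>
    have hf: "up_ring.coeff P (h \<otimes>\<^bsub>P\<^esub> f) (n + p) = up_ring.coeff P h n \<oplus>\<^bsub>R\<^esub> \<ominus>\<^bsub>R\<^esub> (u \<otimes>\<^bsub>R\<^esub> up_ring.coeff P h (n + p))" for n
    proof -
      have "h \<otimes>\<^bsub>P\<^esub> f = up_ring.monom P \<one>\<^bsub>R\<^esub> p \<otimes>\<^bsub>P\<^esub> h \<ominus>\<^bsub>P\<^esub> up_ring.monom P u 0 \<otimes>\<^bsub>P\<^esub> h"
        using h(1) uc by (simp add: f_def U.P.minus_eq U.P.r_distr U.P.r_minus U.P.m_comm)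
      then show ?thesis
        using h(1) uc U.coeff_monom_mult[of "\<one>\<^bsub>R\<^esub>" h p n] U.coeff_monom_mult[of u h 0 "n + p"]
        by (simp add: U.P.minus_eq)
    qed
    have "h = \<zero>\<^bsub>P\<^esub>"
    proof (rule ccontr)
      assume h0: "h \<noteq> \<zero>\<^bsub>P\<^esub>"
      \<comment> \<open>In this degree the term with \<open>u\<close> drops out because
        \<open>p > 0\<close>. The leading coefficient of \<open>h\<close> would then be a
        coefficient of \<open>F\<close> in a degree at least \<open>p\<close>, where
        \<open>F\<close> has none.\<close>
      have "up_ring.coeff P h (deg R h + p) = \<zero>\<^bsub>R\<^esub>"
        using U.deg_aboveD[of h "deg R h + p"] h(1) p_gt_1 by simp
      then have "up_ring.coeff P F (deg R h + p) = up_ring.coeff P h (deg R h)"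
        unfolding h(2) hf using h(1) uc by simp
      then show False using U.lcoeff_nonzero[OF h0 h(1)] Fc by simp
    qed
    then have "F = \<zero>\<^bsub>P\<^esub>" using h fP by simp
    then show "r k = \<zero>\<^bsub>R\<^esub>" using Fc[of k] k by simp
  qed
  interpret pre: UP_pre_univ_prop R P "\<lambda>r. up_ring.monom P r 0" P
    by (rule UP_pre_univ_propI[OF R.is_cring U.P.is_cring c_hom], simp add: P_def)
  have s_hom: "subst g \<in> ring_hom P P" for g
    unfolding subst_def by (rule pre.eval_ring_hom) simp
  have s_const: "subst g (up_ring.monom P r 0) = up_ring.monom P r 0" if "r \<in> carrier R" for g r
    unfolding subst_def by (rule pre.eval_const) (use that in auto)
  have s_X: "subst g (up_ring.monom P \<one>\<^bsub>R\<^esub> 1) = up_ring.monom P (\<iota> (\<chi> g)) 1" for g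
    unfolding subst_def by (rule pre.eval_monom1) simp
  have s_closed: "subst g h \<in> carrier P" if "h \<in> carrier P" for g h
    by (rule ring_hom_closed[OF s_hom that])
  have s_cring: "ring_hom_cring P P (subst g)" for g
    by (rule ring_hom_cringI[OF U.P.is_cring U.P.is_cring s_hom])
  have s_f: "subst g f = f" if g: "g \<in> carrier G" for g
  proof -
    interpret s: ring_hom_cring P P "subst g" by (rule s_cring)
    have "subst g (up_ring.monom P \<one>\<^bsub>R\<^esub> p) = subst g (up_ring.monom P \<one>\<^bsub>R\<^esub> 1 [^]\<^bsub>P\<^esub> p)"
      by (simp only: X_pow)
    also have "\<dots> = subst g (up_ring.monom P \<one>\<^bsub>R\<^esub> 1) [^]\<^bsub>P\<^esub> p"
      by (rule s.hom_pow) simp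
    also have "\<dots> = up_ring.monom P (\<iota> (\<chi> g)) 1 [^]\<^bsub>P\<^esub> p"
      by (simp only: s_X)
    also have "\<dots> = up_ring.monom P \<one>\<^bsub>R\<^esub> p"
      using U.monom_pow[of "\<iota> (\<chi> g)" 1 p] pow_p[OF g] by (simp flip: iota_pow)
    finally show ?thesis using uc by (simp add: f_def U.P.minus_eq s_const)
  qed
  \<comment> \<open>Having an inverse substitution turns stability of the ideal into equality with
    its image, so that images of cosets are whole cosets.\<close>
  have s_inv: "subst g (subst (inv\<^bsub>G\<^esub> g) h) = h" if g: "g \<in> carrier G" and h: "h \<in> carrier P" for g h
  proof -
    interpret s: ring_hom_cring P P "subst g" by (rule s_cring)
    have comp: "ring_hom_cring P P (\<lambda>h. subst g (subst (inv\<^bsub>G\<^esub> g) h))"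
      using ring_hom_trans[OF s_hom[of "inv\<^bsub>G\<^esub> g"] s_hom[of g]]
      by (intro ring_hom_cringI[OF U.P.is_cring U.P.is_cring]) (simp add: comp_def)
    have "up_ring.monom P (\<iota> (\<chi> (inv\<^bsub>G\<^esub> g))) 1 = up_ring.monom P (\<iota> (\<chi> (inv\<^bsub>G\<^esub> g))) 0 \<otimes>\<^bsub>P\<^esub> up_ring.monom P \<one>\<^bsub>R\<^esub> 1"
      using U.monom_mult[of "\<iota> (\<chi> (inv\<^bsub>G\<^esub> g))" "\<one>\<^bsub>R\<^esub>" 0 1] by simp
    then have "subst g (up_ring.monom P (\<iota> (\<chi> (inv\<^bsub>G\<^esub> g))) 1) =
      up_ring.monom P (\<iota> (\<chi> (inv\<^bsub>G\<^esub> g))) 0 \<otimes>\<^bsub>P\<^esub> up_ring.monom P (\<iota> (\<chi> g)) 1"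
      using s_X[of g] by (simp add: s_const)
    also have "\<dots> = up_ring.monom P (\<iota> (inverse (\<chi> g)) \<otimes>\<^bsub>R\<^esub> \<iota> (\<chi> g)) 1"
      using U.monom_mult[of "\<iota> (\<chi> (inv\<^bsub>G\<^esub> g))" "\<iota> (\<chi> g)" 0 1] g by (simp add: chi_inv)
    also have "\<dots> = up_ring.monom P \<one>\<^bsub>R\<^esub> 1"
      using iota_inverse chi_nonzero[OF g] by simp
    finally have X: "subst g (subst (inv\<^bsub>G\<^esub> g) (up_ring.monom P \<one>\<^bsub>R\<^esub> 1)) = up_ring.monom P \<one>\<^bsub>R\<^esub> 1"
      using s_X[of "inv\<^bsub>G\<^esub> g"] by simp
    have idr: "ring_hom_cring P P (\<lambda>h. h)"
      by (intro ring_hom_cringI[OF U.P.is_cring U.P.is_cring] ring_hom_memI) auto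
    show ?thesis
      by (rule pre.UP_hom_unique[OF comp _ _ idr, of "up_ring.monom P \<one>\<^bsub>R\<^esub> 1"])
        (use X h in \<open>auto simp: s_const\<close>)
  qed
  have s_J: "subst g h \<in> J" if "h \<in> J" "g \<in> carrier G" for g h
  proof -
    interpret s: ring_hom_cring P P "subst g" by (rule s_cring)
    from that(1) obtain k where k: "k \<in> carrier P" "h = k \<otimes>\<^bsub>P\<^esub> f" unfolding J_def cgenideal_def by blast
    have "subst g h = subst g k \<otimes>\<^bsub>P\<^esub> f"
      using s.hom_mult[OF k(1) fP] s_f[OF that(2)] by (simp only: k(2))
    then show ?thesis using s_closed[OF k(1)] unfolding J_def cgenideal_def by blast
  qed
  have s_img: "subst g ` J = J" if g: "g \<in> carrier G" for g
  proof
    show "J \<subseteq> subst g ` J"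
    proof
      fix h assume h: "h \<in> J"
      then have "h = subst g (subst (inv\<^bsub>G\<^esub> g) h)" using s_inv[OF g] J.Icarr by simp
      then show "h \<in> subst g ` J" using s_J[OF h, of "inv\<^bsub>G\<^esub> g"] g by blast
    qed
  qed (use s_J g in blast)
  have act_q: "subst g ` q h = q (subst g h)" if g: "g \<in> carrier G" and h: "h \<in> carrier P" for g h
  proof -
    interpret s: ring_hom_cring P P "subst g" by (rule s_cring)
    have cos: "q k = (\<lambda>i. i \<oplus>\<^bsub>P\<^esub> k) ` J" for k by (auto simp: q_def a_r_coset_def')
    have "subst g ` (\<lambda>i. i \<oplus>\<^bsub>P\<^esub> h) ` J = (\<lambda>i. i \<oplus>\<^bsub>P\<^esub> subst g h) ` subst g ` J"
      unfolding image_image by (rule image_cong) (use h J.Icarr in auto)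
    then show ?thesis unfolding cos s_img[OF g] .
  qed
  let ?S = "kummer_ext R \<iota> \<chi> p u"
  have S_eq: "?S = ring.extend Q (gext.fields b (\<lambda>g. \<lambda>C\<in>carrier Q. subst g ` C))"
    unfolding kummer_ext_def Let_def b_def[abs_def] q_def Q_def J_def f_def P_def subst_def[abs_def] ..
  have S_base: "base_map ?S = b" and S_act: "g_action ?S = (\<lambda>g. \<lambda>C\<in>carrier Q. subst g ` C)"
    unfolding S_eq by (simp_all add: ring.defs gext.defs)
  have act: "g_action ?S g (q h) = q (subst g h)" if "g \<in> carrier G" "h \<in> carrier P" for g h
    using that act_q by (simp add: S_act)
  have "kummer_gen ?S u a"
  proof (rule kummer_genI[of _ Q])
    show "same_ring ?S Q" unfolding S_eq by (rule same_ring_extend)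
    show "power_basis_alg R Q (base_map ?S) p u a"
      unfolding S_base using A.power_alg_axioms basis by (intro power_basis_alg.intro power_basis_alg_axioms.intro)
    fix g assume g: "g \<in> carrier G"
    interpret s: ring_hom_cring P P "subst g" by (rule s_cring)
    show "g_action ?S g \<in> ring_hom Q Q"
    proof (rule ring_hom_memI)
      fix C D assume "C \<in> carrier Q" "D \<in> carrier Q"
      then obtain h k where hk: "h \<in> carrier P" "C = q h" "k \<in> carrier P" "D = q k" using Q_cases by metis
      show "g_action ?S g C \<in> carrier Q" using hk g s_closed by (simp add: act)
      show "g_action ?S g (C \<otimes>\<^bsub>Q\<^esub> D) = g_action ?S g C \<otimes>\<^bsub>Q\<^esub> g_action ?S g D"
        "g_action ?S g (C \<oplus>\<^bsub>Q\<^esub> D) = g_action ?S g C \<oplus>\<^bsub>Q\<^esub> g_action ?S g D"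
        using hk g act[OF g, of "h \<otimes>\<^bsub>P\<^esub> k"] act[OF g, of "h \<oplus>\<^bsub>P\<^esub> k"] s_closed by (simp_all add: act)
    next
      show "g_action ?S g \<one>\<^bsub>Q\<^esub> = \<one>\<^bsub>Q\<^esub>"
        using act[OF g, of "\<one>\<^bsub>P\<^esub>"] by simp
    qed
    show "g_action ?S g \<in> extensional (carrier Q)" by (simp add: S_act)
    show "g_action ?S g (base_map ?S r) = base_map ?S r" if "r \<in> carrier R" for r
      using act[OF g, of "up_ring.monom P r 0"] that by (simp add: S_base b_def s_const)
    show "g_action ?S g a = base_map ?S (\<iota> (\<chi> g)) \<otimes>\<^bsub>Q\<^esub> a"
      using act[OF g, of "up_ring.monom P \<one>\<^bsub>R\<^esub> 1"] s_X[of g] monom_split[of "\<iota> (\<chi> g)" 1] a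
      by (simp add: S_base a_def)
  qed (rule u)
  then show thesis by (rule that)
qed

end

context kummer_algebra
begin

text \<open>The generator is \<open>a \<otimes> 1\<close>. Its powers stay independent because the
  coefficient functions of \<open>S\<close> extend to the tensor product.\<close>

lemma base_change_gen:
  assumes B: "kummer_base B G \<iota>' p \<chi>" and psi: "\<psi> \<in> ring_hom R B" and psi_iota: "\<And>x. \<psi> (\<iota> x) = \<iota>' x"
  obtains c where "kummer_base.kummer_gen B G \<iota>' p \<chi> (base_change R S B \<psi>) (\<psi> u) c"
proof -
  interpret B: kummer_base B G \<iota>' p \<chi> by fact
  interpret algebra_pair R S B b \<psi>
    by unfold_locales (rule A.b_hom psi)+
  let ?S = "base_change R S B \<psi>"
  let ?b = "pure \<one>\<^bsub>S\<^esub>"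
  define c where "c = pure a \<one>\<^bsub>B\<^esub>"
  have c: "c \<in> carrier T" by (simp add: c_def)
  have c_pow: "c [^]\<^bsub>T\<^esub> n = pure (a [^]\<^bsub>S\<^esub> n) \<one>\<^bsub>B\<^esub>" for n :: nat
    by (induction n) (simp_all add: pure_one c_def pure_mult)
  have cp: "c [^]\<^bsub>T\<^esub> p = ?b (\<psi> u)"
    by (simp add: c_pow A.a_pow pure_base)
  interpret C: power_alg B T ?b p "\<psi> u" c
    by unfold_locales (use right_hom p_gt_1 c cp in auto)
  have basis: "power_basis B T ?b p c"
    unfolding power_basis_def
  proof (intro conjI ballI impI allI)
    have "W \<in> C.span" if "W \<in> carrier T" for W
      using that
    proof (induction rule: tensor_induct)
      case zero
      show ?case using C.span_base[of "\<zero>\<^bsub>B\<^esub>"] by simp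
    next
      case (pure s y)
      have "pure s \<one>\<^bsub>B\<^esub> \<in> C.span"
      proof -
        obtain r where r: "r \<in> A.Co" "s = A.L r" using pure(1) by (rule S_cases)
        show ?thesis
          unfolding r(2) lin_def
        proof (rule A.S.finsum_induct[OF finite_lessThan A.term_closed[OF r(1)]])
          show "pure \<zero>\<^bsub>S\<^esub> \<one>\<^bsub>B\<^esub> \<in> C.span"
            using ring_hom_zero[OF left_hom A.S.ring_axioms T.ring_axioms] C.span_base[of "\<zero>\<^bsub>B\<^esub>"] by simp
        next
          fix i assume "i \<in> {..<p}"
          then have i: "i < p" "r i \<in> carrier R" using r by auto
          have "pure (b (r i) \<otimes>\<^bsub>S\<^esub> a [^]\<^bsub>S\<^esub> i) \<one>\<^bsub>B\<^esub> = pure (b (r i)) \<one>\<^bsub>B\<^esub> \<otimes>\<^bsub>T\<^esub> pure (a [^]\<^bsub>S\<^esub> i) \<one>\<^bsub>B\<^esub>"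
            using i by (simp add: pure_mult)
          also have "\<dots> = ?b (\<psi> (r i)) \<otimes>\<^bsub>T\<^esub> c [^]\<^bsub>T\<^esub> i"
            using i by (simp add: pure_base c_pow)
          finally show "pure (b (r i) \<otimes>\<^bsub>S\<^esub> a [^]\<^bsub>S\<^esub> i) \<one>\<^bsub>B\<^esub> \<in> C.span"
            using C.span_power[OF i(1), of "\<psi> (r i)"] i(2) by simp
        qed (simp add: pure_add_left C.span_add)
      qed
      then show ?case
        using C.span_smult[OF pure(2)] pure_split[OF pure] pure
          T.m_comm[of "pure s \<one>\<^bsub>B\<^esub>" "pure \<one>\<^bsub>S\<^esub> y"] by simp
    next
      case (diff x y)
      then show ?case by (simp add: T.minus_eq C.span_add C.span_neg)
    qed
    then show "\<exists>r\<in>C.Co. W = C.L r" if "W \<in> carrier T" for W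
      using that by (auto simp: C.span_def)
  next
    fix r k assume r: "r \<in> C.Co" "C.L r = \<zero>\<^bsub>T\<^esub>" and k: "k < p"
    \<comment> \<open>The \<open>k\<close>-th coefficient functional after base change; it is
      balanced because \<open>A.coef\<close> is \<open>R\<close>-linear.\<close>
    obtain h where h: "h \<in> hom (add_monoid T) (add_monoid B)"
      and hp: "\<And>s y. s \<in> carrier S \<Longrightarrow> y \<in> carrier B \<Longrightarrow> h (pure s y) = \<psi> (A.coef s k) \<otimes>\<^bsub>B\<^esub> y"
    proof (rule tensor_lift[OF B.R.abelian_group_axioms, of "\<lambda>s y. \<psi> (A.coef s k) \<otimes>\<^bsub>B\<^esub> y"])
      fix x s y assume "x \<in> carrier R" "s \<in> carrier S" "y \<in> carrier B"
      then show "\<psi> (A.coef (b x \<otimes>\<^bsub>S\<^esub> s) k) \<otimes>\<^bsub>B\<^esub> y = \<psi> (A.coef s k) \<otimes>\<^bsub>B\<^esub> (\<psi> x \<otimes>\<^bsub>B\<^esub> y)"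
        using k by (simp add: A.coef_smult ring_hom_mult[OF psi] B.R.m_ac)
    qed (use k in \<open>auto simp: A.coef_add ring_hom_add[OF psi] B.R.l_distr B.R.r_distr\<close>)
    have rc: "r i \<in> carrier B" if "i < p" for i using r that by auto
    have "h (C.L r) = (\<Oplus>\<^bsub>B\<^esub>i\<in>{..<p}. h (?b (r i) \<otimes>\<^bsub>T\<^esub> c [^]\<^bsub>T\<^esub> i))"
      unfolding lin_def by (rule T.a_hom_finsum[OF h B.R.abelian_group_axioms]) (use rc c in auto)
    also have "\<dots> = (\<Oplus>\<^bsub>B\<^esub>i\<in>{..<p}. if k = i then r i else \<zero>\<^bsub>B\<^esub>)"
    proof (rule B.R.finsum_cong')
      fix i assume "i \<in> {..<p}"
      then have i: "i < p" by simp
      have "h (?b (r i) \<otimes>\<^bsub>T\<^esub> c [^]\<^bsub>T\<^esub> i) = \<psi> (A.coef (b \<one>\<^bsub>R\<^esub> \<otimes>\<^bsub>S\<^esub> a [^]\<^bsub>S\<^esub> i) k) \<otimes>\<^bsub>B\<^esub> r i"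
        using i rc by (simp add: c_pow pure_mult hp)
      also have "\<dots> = (if k = i then r i else \<zero>\<^bsub>B\<^esub>)"
        using i k rc by (subst A.coef_power)
          (auto simp: ring_hom_one[OF psi] ring_hom_zero[OF psi R.ring_axioms B.R.ring_axioms])
      finally show "h (?b (r i) \<otimes>\<^bsub>T\<^esub> c [^]\<^bsub>T\<^esub> i) = (if k = i then r i else \<zero>\<^bsub>B\<^esub>)" .
    qed (use rc in auto)
    also have "\<dots> = r k"
      by (rule B.R.finsum_singleton) (use k rc in auto)
    finally have "r k = h \<zero>\<^bsub>T\<^esub>" using r by simp
    also have "h \<zero>\<^bsub>T\<^esub> = \<zero>\<^bsub>B\<^esub>"
      using T.a_hom_finsum[OF h B.R.abelian_group_axioms, of "\<lambda>_. \<zero>\<^bsub>T\<^esub>" "{}"] by simp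
    finally show "r k = \<zero>\<^bsub>B\<^esub>" .
  qed
  have S_base: "base_map ?S = ?b" and S_act: "g_action ?S = (\<lambda>g. \<lambda>C\<in>carrier T. twist (act g) ` C)"
    and S_same: "same_ring ?S T"
    by (simp_all add: base_change_def Let_def ring.defs gext.defs twist_def[abs_def] same_ring_def)
  have "B.kummer_gen ?S (\<psi> u) c"
  proof (rule B.kummer_genI[OF S_same])
    show "power_basis_alg B T (base_map ?S) p (\<psi> u) c"
      unfolding S_base using C.power_alg_axioms basis by (intro power_basis_alg.intro power_basis_alg_axioms.intro)
    have "\<psi> u \<otimes>\<^bsub>B\<^esub> \<psi> (inv\<^bsub>R\<^esub> u) = \<one>\<^bsub>B\<^esub>"
      using ring_hom_mult[OF psi, of u "inv\<^bsub>R\<^esub> u"] ring_hom_one[OF psi] u_unit by simp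
    then show "\<psi> u \<in> Units B"
      using B.R.unit_if_mult_unit[OF B.R.comm_monoid_axioms, of "\<psi> u" "\<psi> (inv\<^bsub>R\<^esub> u)"] u_unit by simp
    fix g assume g: "g \<in> carrier G"
    obtain h where h: "h \<in> ring_hom T T"
      "\<And>d. d \<in> carrier P \<Longrightarrow> twist (act g) d \<in> carrier P \<and> h (I +>\<^bsub>P\<^esub> d) = I +>\<^bsub>P\<^esub> twist (act g) d"
      "\<And>s y. s \<in> carrier S \<Longrightarrow> y \<in> carrier B \<Longrightarrow> h (pure s y) = pure (act g s) y"
      by (rule twist_hom[OF act(1)[OF g] act(3)[OF g]]) auto
    \<comment> \<open>The action was defined by images of whole cosets. Since \<open>act g\<close>
      is invertible, it agrees with the induced ring map.\<close>
    have eq: "g_action ?S g W = h W" if W: "W \<in> carrier T" for W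
    proof -
      obtain d where d: "d \<in> carrier P" "W = I +>\<^bsub>P\<^esub> d" using W by (rule T_cases)
      have "twist (act g) ` (I +>\<^bsub>P\<^esub> d) = I +>\<^bsub>P\<^esub> twist (act g) d"
      proof (rule twist_image[where \<sigma>' = "act (inv\<^bsub>G\<^esub> g)"])
        show "act g (act (inv\<^bsub>G\<^esub> g) s) = s" if "s \<in> carrier S" for s
          using g that by (simp add: act_one flip: act_mult)
      qed (use g act d in auto)
      then show ?thesis using d h(2)[OF d(1)] W by (simp add: S_act)
    qed
    show "g_action ?S g \<in> ring_hom T T"
      by (rule T.ring_hom_restrict[OF h(1)]) (simp add: eq)
    show "g_action ?S g \<in> extensional (carrier T)" by (simp add: S_act)
    show "g_action ?S g (base_map ?S y) = base_map ?S y" if "y \<in> carrier B" for y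
      using that g by (simp add: S_base eq h(3) ring_hom_one[OF act(1)])
    show "g_action ?S g c = base_map ?S (\<iota>' (\<chi> g)) \<otimes>\<^bsub>T\<^esub> c"
      using g by (simp add: S_base c eq) (simp add: c_def h(3) act(4) pure_mult pure_balanced psi_iota flip: psi_iota)
  qed
  then show thesis by (rule that)
qed

text \<open>Renaming elements moves the algebra onto another type. This is how an explicit quotient
  enters the universe over which isomorphism classes are formed.\<close>

lemma copy_gen:
  fixes f :: "'s \<Rightarrow> 't"
  assumes inj: "inj_on f (carrier S)"
  obtains S' :: "('r, 'g, 't) gext" where "kummer_gen S' u (f a)"
proof -
  define h where "h = inv_into (carrier S) f"
  have h: "h (f s) = s" if "s \<in> carrier S" for s
    using inj that by (simp add: h_def)
  define S' :: "('r, 'g, 't) gext" where "S' = \<lparr>carrier = f ` carrier S,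
     monoid.mult = (\<lambda>x y. f (h x \<otimes>\<^bsub>S\<^esub> h y)), one = f \<one>\<^bsub>S\<^esub>, ring.zero = f \<zero>\<^bsub>S\<^esub>,
     add = (\<lambda>x y. f (h x \<oplus>\<^bsub>S\<^esub> h y)), base_map = f \<circ> b,
     g_action = (\<lambda>g. \<lambda>x\<in>f ` carrier S. f (act g (h x)))\<rparr>"
  have iso: "f \<in> ring_iso S S'"
    by (rule ring_iso_memI) (use inj in \<open>auto simp: S'_def h bij_betw_def\<close>)
  have "cring S'"
    using A.S.ring_iso_imp_img_cring[OF iso] by (simp add: S'_def)
  then have "kummer_gen S' u (f a)"
    by (rule transport[OF iso]) (auto simp: S'_def h)
  then show thesis by (rule that)
qed

end

section \<open>The Harrison product of Kummer extensions\<close>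

context kummer_base
begin

definition \<psi> :: "nat \<Rightarrow> 'g \<Rightarrow> 'k" where
  "\<psi> i = (\<lambda>g\<in>carrier G. \<chi> g ^ i)"

text \<open>The polynomial \<open>T^p - 1\<close> has at most \<open>p\<close> roots in a field, and
  the powers of \<zeta> already provide \<open>p\<close>.\<close>

lemma roots_of_unity: "{z::'k. z ^ p = 1} = (\<lambda>i. \<zeta> ^ i) ` {..<p}"
proof (rule card_subset_eq[symmetric])
  let ?f = "Polynomial.monom (1::'k) p - 1"
  have roots: "{z::'k. z ^ p = 1} = {z. poly ?f z = 0}" by (simp add: poly_monom)
  have "Polynomial.coeff ?f p = 1" using p_gt_1 by simp
  then have "?f \<noteq> 0" by (metis coeff_0 zero_neq_one)
  have "degree ?f \<le> p"
    by (rule degree_diff_le) (simp_all add: degree_monom_le)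
  then have le: "card {z::'k. z ^ p = 1} \<le> p"
    using card_poly_roots_bound[OF \<open>?f \<noteq> 0\<close>] roots by simp
  show fin: "finite {z::'k. z ^ p = 1}"
    unfolding roots by (rule poly_roots_finite[OF \<open>?f \<noteq> 0\<close>])
  show sub: "(\<lambda>i. \<zeta> ^ i) ` {..<p} \<subseteq> {z::'k. z ^ p = 1}"
    by (auto simp: zeta_pow_p simp flip: power_mult) (simp add: mult.commute[of _ p] power_mult zeta_pow_p)
  have "card ((\<lambda>i. \<zeta> ^ i) ` {..<p}) = p"
    using zeta_pow_eq_iff by (subst card_image) (auto intro!: inj_onI)
  then show "card ((\<lambda>i. \<zeta> ^ i) ` {..<p}) = card {z::'k. z ^ p = 1}"
    using le card_mono[OF fin sub] by simp
qed

lemma scalar_carrier: "z \<in> carrier (scalar_group :: 'k monoid) \<longleftrightarrow> z \<noteq> 0"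
  by (auto simp: units_of_def Units_def ring_of_type_algebra_def intro!: exI[of _ "inverse z"])

lemma psi_inj: "inj_on \<psi> {..<p}"
proof (rule inj_onI)
  fix i j assume ij: "i \<in> {..<p}" "j \<in> {..<p}" "\<psi> i = \<psi> j"
  from fun_cong[OF ij(3), of g0] show "i = j"
    using ij(1,2) g0 zeta_pow_eq_iff[of i j] by (simp add: \<psi>_def \<zeta>_def)
qed

text \<open>A character is determined by its value at the generator \<open>g0\<close>, which is a
  \<open>p\<close>-th root of unity and hence a power of \<zeta>.\<close>

lemma characters_eq: "characters G p = \<psi> ` {..<p}"
proof
  show "\<psi> ` {..<p} \<subseteq> characters G p"
  proof safe
    fix i
    have "\<psi> i \<in> hom G scalar_group"
    proof (rule homI)
      fix g assume "g \<in> carrier G"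
      then show "\<psi> i g \<in> carrier scalar_group"
        unfolding scalar_carrier by (simp add: \<psi>_def chi_nonzero)
    qed (simp add: \<psi>_def units_of_def ring_of_type_algebra_def chi_mult power_mult_distrib)
    moreover have "\<psi> i g ^ p = 1" if "g \<in> carrier G" for g
      using pow_p[OF that] that by (simp add: \<psi>_def flip: power_mult) (simp add: mult.commute[of _ p] power_mult)
    ultimately show "\<psi> i \<in> characters G p"
      by (auto simp: characters_def \<psi>_def)
  qed
  show "characters G p \<subseteq> \<psi> ` {..<p}"
  proof
    fix \<rho> :: "'g \<Rightarrow> 'k" assume r: "\<rho> \<in> characters G p"
    then have hom: "\<rho> \<in> hom G scalar_group" and ext: "\<rho> \<in> extensional (carrier G)" and "\<rho> g0 ^ p = 1"
      using g0 by (auto simp: characters_def)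
    then obtain i where i: "i < p" "\<rho> g0 = \<zeta> ^ i" using roots_of_unity by blast
    have mult: "\<rho> (g \<otimes>\<^bsub>G\<^esub> h) = \<rho> g * \<rho> h" if "g \<in> carrier G" "h \<in> carrier G" for g h
      using hom_mult[OF hom that] by (simp add: units_of_def ring_of_type_algebra_def)
    have nz: "\<rho> \<one>\<^bsub>G\<^esub> \<noteq> 0"
      using hom_in_carrier[OF hom, of "\<one>\<^bsub>G\<^esub>"] by (auto simp: units_of_def Units_def ring_of_type_algebra_def)
    have one: "\<rho> \<one>\<^bsub>G\<^esub> = 1" using mult[of "\<one>\<^bsub>G\<^esub>" "\<one>\<^bsub>G\<^esub>"] nz by simp
    have pow: "\<rho> (\<gamma> k) = \<rho> g0 ^ k" for k
      unfolding \<gamma>_def by (induction k) (simp_all add: one mult g0)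
    have "\<rho> = \<psi> i"
    proof (rule extensionalityI[OF ext])
      fix g assume g: "g \<in> carrier G"
      then obtain k where "g = \<gamma> k" using G_cases by blast
      then show "\<rho> g = \<psi> i g" by (simp add: pow i \<psi>_def flip: power_mult) (simp add: mult.commute)
    qed (simp add: \<psi>_def)
    then show "\<rho> \<in> \<psi> ` {..<p}" using i by simp
  qed
qed

end

lemma (in kummer_algebra) isotypic_eq:
  assumes "i < p"
  shows "isotypic \<iota> G S (\<psi> i) = {b r \<otimes>\<^bsub>S\<^esub> a [^]\<^bsub>S\<^esub> i | r. r \<in> carrier R}"
proof (intro equalityI subsetI)
  fix s assume "s \<in> isotypic \<iota> G S (\<psi> i)"
  then have "s \<in> carrier S" "act g0 s = b (\<iota> (\<zeta> ^ i)) \<otimes>\<^bsub>S\<^esub> s"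
    using g0 by (auto simp: isotypic_def \<psi>_def \<zeta>_def)
  then show "s \<in> {b r \<otimes>\<^bsub>S\<^esub> a [^]\<^bsub>S\<^esub> i | r. r \<in> carrier R}"
    using isotypic_power[OF _ _ assms, of s] by blast
next
  fix s assume "s \<in> {b r \<otimes>\<^bsub>S\<^esub> a [^]\<^bsub>S\<^esub> i | r. r \<in> carrier R}"
  then obtain r where r: "r \<in> carrier R" "s = b r \<otimes>\<^bsub>S\<^esub> a [^]\<^bsub>S\<^esub> i" by blast
  have "act g s = b (\<iota> (\<psi> i g)) \<otimes>\<^bsub>S\<^esub> s" if g: "g \<in> carrier G" for g
  proof -
    have "act g (a [^]\<^bsub>S\<^esub> n) = b (\<iota> (\<chi> g ^ n)) \<otimes>\<^bsub>S\<^esub> a [^]\<^bsub>S\<^esub> n" for n :: nat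
      by (induction n) (use g in \<open>simp_all add: ring_hom_one[OF act(1)] ring_hom_mult[OF act(1)] act A.S.m_ac\<close>)
    then show ?thesis using r g by (simp add: ring_hom_mult[OF act(1)] act \<psi>_def A.S.m_lcomm)
  qed
  with r show "s \<in> isotypic \<iota> G S (\<psi> i)" by (simp add: isotypic_def)
qed

locale kummer_algebra_pair = S1: kummer_algebra R G \<iota> p \<chi> S1 u a + S2: kummer_algebra R G \<iota> p \<chi> S2 v c
  for R :: "('r, 'l) ring_scheme" and G :: "('g, 'm) monoid_scheme"
    and \<iota> :: "'k::field \<Rightarrow> 'r" and p :: nat and \<chi> :: "'g \<Rightarrow> 'k"
    and S1 :: "('r, 'g, 's) gext" and u :: 'r and a :: 's
    and S2 :: "('r, 'g, 't) gext" and v :: 'r and c :: 't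
begin

sublocale algebra_pair R S1 S2 "base_map S1" "base_map S2"
  by unfold_locales (rule S1.A.b_hom S2.A.b_hom)+

abbreviation "b1 \<equiv> base_map S1"
abbreviation "b2 \<equiv> base_map S2"

definition base where "base r = pure (b1 r) \<one>\<^bsub>S2\<^esub>"
definition w where "w = pure a c"

lemma base_hom: "base \<in> ring_hom R T"
  using ring_hom_trans[OF S1.A.b_hom left_hom] by (simp add: base_def[abs_def] comp_def)

lemma base_eq: "r \<in> carrier R \<Longrightarrow> base r = pure \<one>\<^bsub>S1\<^esub> (b2 r)"
  by (simp add: base_def pure_base)

lemma w_closed [simp]: "w \<in> carrier T" by (simp add: w_def)

lemma w_pow: "w [^]\<^bsub>T\<^esub> n = pure (a [^]\<^bsub>S1\<^esub> n) (c [^]\<^bsub>S2\<^esub> n)" for n :: nat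
  by (induction n) (simp_all add: pure_one w_def pure_mult)

sublocale C: power_alg R T base p "u \<otimes>\<^bsub>R\<^esub> v" w
proof unfold_locales
  have "w [^]\<^bsub>T\<^esub> p = pure (b1 u) \<one>\<^bsub>S2\<^esub> \<otimes>\<^bsub>T\<^esub> pure \<one>\<^bsub>S1\<^esub> (b2 v)"
    by (simp add: w_pow S1.A.a_pow S2.A.a_pow pure_mult)
  then show "w [^]\<^bsub>T\<^esub> p = base (u \<otimes>\<^bsub>R\<^esub> v)"
    by (simp add: ring_hom_mult[OF base_hom] base_eq[of v]) (simp add: base_def)
qed (use base_hom S1.p_gt_1 in auto)

lemma term_eq:
  assumes "x \<in> carrier R" "y \<in> carrier R"
  shows "pure (b1 x \<otimes>\<^bsub>S1\<^esub> a [^]\<^bsub>S1\<^esub> i) (b2 y \<otimes>\<^bsub>S2\<^esub> c [^]\<^bsub>S2\<^esub> i) = base (x \<otimes>\<^bsub>R\<^esub> y) \<otimes>\<^bsub>T\<^esub> w [^]\<^bsub>T\<^esub> (i::nat)"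
proof -
  have "pure (b1 x \<otimes>\<^bsub>S1\<^esub> a [^]\<^bsub>S1\<^esub> i) (b2 y \<otimes>\<^bsub>S2\<^esub> c [^]\<^bsub>S2\<^esub> i) = pure (b1 x) (b2 y) \<otimes>\<^bsub>T\<^esub> w [^]\<^bsub>T\<^esub> i"
    using assms by (simp add: w_pow pure_mult)
  also have "pure (b1 x) (b2 y) = base (x \<otimes>\<^bsub>R\<^esub> y)"
    using assms by (simp add: ring_hom_mult[OF base_hom] base_eq[of y]) (simp add: base_def pure_mult)
  finally show ?thesis .
qed

definition comp where
  "comp \<rho> = generate (add_monoid T)
     {pure x y | x y. x \<in> isotypic \<iota> G S1 \<rho> \<and> y \<in> isotypic \<iota> G S2 \<rho>}"

text \<open>Pure tensors of isotypic elements are already multiples of \<open>w^i\<close> by base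
  scalars, as scalars from both factors collect in the base. Passing to the generated subgroup
  therefore adds nothing.\<close>

lemma comp_eq:
  assumes i: "i < p"
  shows "comp (S1.\<psi> i) = {base r \<otimes>\<^bsub>T\<^esub> w [^]\<^bsub>T\<^esub> i | r. r \<in> carrier R}" (is "_ = ?H")
proof
  show "comp (S1.\<psi> i) \<subseteq> ?H"
    unfolding comp_def
  proof (rule group.generate_subgroup_incl[OF T.a_group])
    show "{pure x y | x y. x \<in> isotypic \<iota> G S1 (S1.\<psi> i) \<and> y \<in> isotypic \<iota> G S2 (S1.\<psi> i)} \<subseteq> ?H"
    proof
      fix z assume "z \<in> {pure x y | x y. x \<in> isotypic \<iota> G S1 (S1.\<psi> i) \<and> y \<in> isotypic \<iota> G S2 (S1.\<psi> i)}"
      then obtain x y where "x \<in> carrier R" "y \<in> carrier R"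
        "z = pure (b1 x \<otimes>\<^bsub>S1\<^esub> a [^]\<^bsub>S1\<^esub> i) (b2 y \<otimes>\<^bsub>S2\<^esub> c [^]\<^bsub>S2\<^esub> i)"
        unfolding S1.isotypic_eq[OF i] S2.isotypic_eq[OF i] by blast
      then show "z \<in> ?H" using term_eq[of x y i] S1.R.m_closed by blast
    qed
    show "subgroup ?H (add_monoid T)"
    proof (rule group.subgroupI[OF T.a_group])
      show "?H \<subseteq> carrier (add_monoid T)" by auto
      show "?H \<noteq> {}" by auto
      fix x assume "x \<in> ?H"
      then obtain r where r: "r \<in> carrier R" "x = base r \<otimes>\<^bsub>T\<^esub> w [^]\<^bsub>T\<^esub> i" by blast
      have "inv\<^bsub>add_monoid T\<^esub> x = \<ominus>\<^bsub>T\<^esub> x" by (simp add: a_inv_def)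
      also have "\<dots> = base (\<ominus>\<^bsub>R\<^esub> r) \<otimes>\<^bsub>T\<^esub> w [^]\<^bsub>T\<^esub> i"
      proof -
        interpret ring_hom_cring R T base
          by (rule ring_hom_cringI[OF S1.R.is_cring T.is_cring base_hom])
        show ?thesis using r by (simp add: T.l_minus)
      qed
      finally show "inv\<^bsub>add_monoid T\<^esub> x \<in> ?H" using r by blast
    next
      fix x y assume "x \<in> ?H" "y \<in> ?H"
      then obtain r s where rs: "r \<in> carrier R" "x = base r \<otimes>\<^bsub>T\<^esub> w [^]\<^bsub>T\<^esub> i" "s \<in> carrier R" "y = base s \<otimes>\<^bsub>T\<^esub> w [^]\<^bsub>T\<^esub> i" by blast
      then have "x \<otimes>\<^bsub>add_monoid T\<^esub> y = base (r \<oplus>\<^bsub>R\<^esub> s) \<otimes>\<^bsub>T\<^esub> w [^]\<^bsub>T\<^esub> i"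
        by (simp add: T.l_distr)
      then show "x \<otimes>\<^bsub>add_monoid T\<^esub> y \<in> ?H" using rs by blast
    qed
  qed
  show "?H \<subseteq> comp (S1.\<psi> i)"
  proof
    fix x assume "x \<in> ?H"
    then obtain r where r: "r \<in> carrier R" "x = base r \<otimes>\<^bsub>T\<^esub> w [^]\<^bsub>T\<^esub> i" by blast
    then have "x = pure (b1 r \<otimes>\<^bsub>S1\<^esub> a [^]\<^bsub>S1\<^esub> i) (b2 \<one>\<^bsub>R\<^esub> \<otimes>\<^bsub>S2\<^esub> c [^]\<^bsub>S2\<^esub> i)"
      using term_eq[of r "\<one>\<^bsub>R\<^esub>" i] by simp
    then have "x \<in> {pure x y | x y. x \<in> isotypic \<iota> G S1 (S1.\<psi> i) \<and> y \<in> isotypic \<iota> G S2 (S1.\<psi> i)}"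
      unfolding S1.isotypic_eq[OF i] S2.isotypic_eq[OF i] using r S1.R.one_closed by blast
    then show "x \<in> comp (S1.\<psi> i)" unfolding comp_def by (rule generate.incl)
  qed
qed

abbreviation "chars \<equiv> characters G p :: ('g \<Rightarrow> 'k) set"

lemma comp_closed: "\<rho> \<in> chars \<Longrightarrow> comp \<rho> \<subseteq> carrier T"
  unfolding S1.characters_eq by (auto simp: comp_eq)

lemma chars_sum:
  assumes "f \<in> chars \<rightarrow> carrier T"
  shows "(\<Oplus>\<^bsub>T\<^esub>\<rho>\<in>chars. f \<rho>) = (\<Oplus>\<^bsub>T\<^esub>i\<in>{..<p}. f (S1.\<psi> i))"
  using assms unfolding S1.characters_eq by (intro T.finsum_reindex S1.psi_inj)

text \<open>Each character contributes the multiples of one power of \<open>w\<close>, so together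
  they make up the algebra generated by \<open>w\<close>.\<close>

lemma sums_eq: "{\<Oplus>\<^bsub>T\<^esub>\<rho>\<in>chars. f \<rho> | f. f \<in> Pi chars comp} = C.span"
proof (intro equalityI subsetI)
  fix z assume "z \<in> {\<Oplus>\<^bsub>T\<^esub>\<rho>\<in>chars. f \<rho> | f. f \<in> Pi chars comp}"
  then obtain f where f: "f \<in> Pi chars comp" "z = (\<Oplus>\<^bsub>T\<^esub>\<rho>\<in>chars. f \<rho>)" by blast
  have "\<exists>r. r \<in> carrier R \<and> f (S1.\<psi> i) = base r \<otimes>\<^bsub>T\<^esub> w [^]\<^bsub>T\<^esub> i" if "i < p" for i
    using f(1) comp_eq[OF that] that unfolding S1.characters_eq by blast
  then obtain r where r: "\<And>i. i < p \<Longrightarrow> r i \<in> carrier R \<and> f (S1.\<psi> i) = base (r i) \<otimes>\<^bsub>T\<^esub> w [^]\<^bsub>T\<^esub> i"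
    by metis
  have "z = (\<Oplus>\<^bsub>T\<^esub>i\<in>{..<p}. f (S1.\<psi> i))"
    unfolding f(2) by (rule chars_sum) (use f(1) comp_closed in blast)
  also have "\<dots> = C.L r"
    unfolding lin_def by (rule T.finsum_cong') (use r in auto)
  finally show "z \<in> C.span" using r by (auto intro: C.span_I)
next
  fix z assume "z \<in> C.span"
  then obtain r where r: "r \<in> C.Co" "z = C.L r" by (auto simp: C.span_def)
  define f where "f \<rho> = (let i = inv_into {..<p} S1.\<psi> \<rho> in base (r i) \<otimes>\<^bsub>T\<^esub> w [^]\<^bsub>T\<^esub> i)" for \<rho>
  have f: "f (S1.\<psi> i) = base (r i) \<otimes>\<^bsub>T\<^esub> w [^]\<^bsub>T\<^esub> i" if "i < p" for i
    using that S1.psi_inj by (simp add: f_def Let_def)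
  have "f (S1.\<psi> i) \<in> comp (S1.\<psi> i)" if "i < p" for i
    unfolding comp_eq[OF that] f[OF that] using r that by blast
  then have fPi: "f \<in> Pi chars comp"
    unfolding S1.characters_eq by auto
  have "(\<Oplus>\<^bsub>T\<^esub>\<rho>\<in>chars. f \<rho>) = (\<Oplus>\<^bsub>T\<^esub>i\<in>{..<p}. f (S1.\<psi> i))"
    by (rule chars_sum) (use fPi comp_closed in blast)
  also have "\<dots> = z"
    unfolding r(2) lin_def by (rule T.finsum_cong') (use r f in auto)
  finally show "z \<in> {\<Oplus>\<^bsub>T\<^esub>\<rho>\<in>chars. f \<rho> | f. f \<in> Pi chars comp}" using fPi by blast
qed

text \<open>The ring operations are inherited from the tensor product. The work lies in the
  independence of the powers of \<open>w\<close> and in the action, whose definition by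
  \<open>THE\<close> needs a value that does not depend on the chosen decomposition.\<close>

lemma product_gen: "S1.kummer_gen (harrison_product R \<iota> G p S1 S2) (u \<otimes>\<^bsub>R\<^esub> v) w"
proof -
  let ?S = "harrison_product R \<iota> G p S1 S2"
  let ?T = "T\<lparr>carrier := C.span\<rparr>"
  define yact where "yact g z = (THE y. \<exists>f \<in> Pi chars comp.
     z = (\<Oplus>\<^bsub>T\<^esub>\<rho>\<in>chars. f \<rho>) \<and> y = (\<Oplus>\<^bsub>T\<^esub>\<rho>\<in>chars. base (\<iota> (\<rho> g)) \<otimes>\<^bsub>T\<^esub> f \<rho>))" for g z
  have S_eq: "?S = ring.extend ?T (gext.fields base (\<lambda>g. \<lambda>z\<in>C.span. yact g z))"
    unfolding harrison_product_def Let_def base_def[symmetric] comp_def[symmetric] sums_eq yact_def ..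
  have S_same: "same_ring ?S ?T" unfolding S_eq by (rule same_ring_extend)
  have S_base: "base_map ?S = base" and S_act: "g_action ?S = (\<lambda>g. \<lambda>z\<in>C.span. yact g z)"
    unfolding S_eq by (simp_all add: ring.defs gext.defs)
  interpret T': cring ?T by (rule C.span_cring)
  have base': "base \<in> ring_hom R ?T"
    using base_hom C.span_base by (auto simp: ring_hom_def)
  have pow': "w [^]\<^bsub>?T\<^esub> n = w [^]\<^bsub>T\<^esub> n" for n :: nat by (simp add: nat_pow_def)
  interpret C': power_alg R ?T base p "u \<otimes>\<^bsub>R\<^esub> v" w
    by unfold_locales (use base' S1.p_gt_1 C.span_gen C.a_pow in \<open>auto simp: pow'\<close>)
  have incl: "(\<lambda>x. x) \<in> ring_hom ?T T"
    by (rule ring_hom_memI) (auto simp: C.span_closed)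
  have L': "C'.L r = C.L r" if "r \<in> C.Co" for r
    using C'.lin_hom[OF incl T.is_cring, of base r] that by simp
  have coef_zero: "r k = \<zero>\<^bsub>R\<^esub>" if r: "r \<in> C.Co" "C.L r = \<zero>\<^bsub>T\<^esub>" and k: "k < p" for r k
  proof -
    \<comment> \<open>The functional multiplies the \<open>k\<close>-th coefficients of the two
      factors; it sends \<open>w^i\<close> to 1 for \<open>i = k\<close> and to 0 for other
      \<open>i < p\<close>.\<close>
    obtain h where h: "h \<in> hom (add_monoid T) (add_monoid R)"
      and hp: "\<And>s t. s \<in> carrier S1 \<Longrightarrow> t \<in> carrier S2 \<Longrightarrow> h (pure s t) = S1.A.coef s k \<otimes>\<^bsub>R\<^esub> S2.A.coef t k"
    proof (rule tensor_lift[OF S1.R.abelian_group_axioms, of "\<lambda>s t. S1.A.coef s k \<otimes>\<^bsub>R\<^esub> S2.A.coef t k"])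
      fix x s t assume "x \<in> carrier R" "s \<in> carrier S1" "t \<in> carrier S2"
      then show "S1.A.coef (b1 x \<otimes>\<^bsub>S1\<^esub> s) k \<otimes>\<^bsub>R\<^esub> S2.A.coef t k = S1.A.coef s k \<otimes>\<^bsub>R\<^esub> S2.A.coef (b2 x \<otimes>\<^bsub>S2\<^esub> t) k"
        using k by (simp add: S1.A.coef_smult S2.A.coef_smult S1.R.m_ac)
    qed (use k in \<open>auto simp: S1.A.coef_add S2.A.coef_add S1.R.l_distr S1.R.r_distr\<close>)
    have rc: "r i \<in> carrier R" if "i < p" for i using r that by auto
    have "h (C.L r) = (\<Oplus>\<^bsub>R\<^esub>i\<in>{..<p}. h (base (r i) \<otimes>\<^bsub>T\<^esub> w [^]\<^bsub>T\<^esub> i))"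
      unfolding lin_def by (rule T.a_hom_finsum[OF h S1.R.abelian_group_axioms]) (use rc in auto)
    also have "\<dots> = (\<Oplus>\<^bsub>R\<^esub>i\<in>{..<p}. if k = i then r i else \<zero>\<^bsub>R\<^esub>)"
    proof (rule S1.R.finsum_cong')
      fix i assume "i \<in> {..<p}"
      then have i: "i < p" by simp
      have "base (r i) \<otimes>\<^bsub>T\<^esub> w [^]\<^bsub>T\<^esub> i = pure (b1 (r i) \<otimes>\<^bsub>S1\<^esub> a [^]\<^bsub>S1\<^esub> i) (b2 \<one>\<^bsub>R\<^esub> \<otimes>\<^bsub>S2\<^esub> c [^]\<^bsub>S2\<^esub> i)"
        using term_eq[of "r i" "\<one>\<^bsub>R\<^esub>" i] rc[OF i] by simp
      then have "h (base (r i) \<otimes>\<^bsub>T\<^esub> w [^]\<^bsub>T\<^esub> i) =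
        S1.A.coef (b1 (r i) \<otimes>\<^bsub>S1\<^esub> a [^]\<^bsub>S1\<^esub> i) k \<otimes>\<^bsub>R\<^esub> S2.A.coef (b2 \<one>\<^bsub>R\<^esub> \<otimes>\<^bsub>S2\<^esub> c [^]\<^bsub>S2\<^esub> i) k"
        using i rc[OF i] by (simp only: hp S1.A.b_simps S2.A.b_simps S1.A.S.m_closed S2.A.S.m_closed
          S1.A.S.nat_pow_closed S2.A.S.nat_pow_closed S1.A.a_closed S2.A.a_closed S1.R.one_closed S2.A.S.one_closed)
      also have "\<dots> = (if k = i then r i else \<zero>\<^bsub>R\<^esub>)"
        unfolding S1.A.coef_power[OF rc[OF i] i k] S2.A.coef_power[OF S1.R.one_closed i k]
        using rc[OF i] by simp
      finally show "h (base (r i) \<otimes>\<^bsub>T\<^esub> w [^]\<^bsub>T\<^esub> i) = (if k = i then r i else \<zero>\<^bsub>R\<^esub>)" .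
    qed (use rc in auto)
    also have "\<dots> = r k"
      by (rule S1.R.finsum_singleton) (use k rc in auto)
    finally have "r k = h \<zero>\<^bsub>T\<^esub>" using r by simp
    also have "h \<zero>\<^bsub>T\<^esub> = \<zero>\<^bsub>R\<^esub>"
      using T.a_hom_finsum[OF h S1.R.abelian_group_axioms, of "\<lambda>_. \<zero>\<^bsub>T\<^esub>" "{}"] by simp
    finally show ?thesis .
  qed
  have basis: "power_basis R ?T base p w"
    unfolding power_basis_def
  proof (intro conjI ballI impI allI)
    fix z assume "z \<in> carrier ?T"
    then have "z \<in> C.span" by simp
    then obtain r where r: "r \<in> C.Co" "z = C.L r" unfolding C.span_def by blast
    then show "\<exists>r\<in>C.Co. z = C'.L r" using L'[OF r(1)] by metis
  next
    fix r k assume "r \<in> C.Co" "C'.L r = \<zero>\<^bsub>?T\<^esub>" "k < p"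
    then show "r k = \<zero>\<^bsub>R\<^esub>" using coef_zero[of r k] by (simp add: L')
  qed
  show ?thesis
  proof (rule S1.kummer_genI[OF S_same])
    show "power_basis_alg R ?T (base_map ?S) p (u \<otimes>\<^bsub>R\<^esub> v) w"
      unfolding S_base using C'.power_alg_axioms basis by (intro power_basis_alg.intro power_basis_alg_axioms.intro)
    show "u \<otimes>\<^bsub>R\<^esub> v \<in> Units R" using S1.u_unit S2.u_unit by simp
    fix g assume g: "g \<in> carrier G"
    \<comment> \<open>Acting on the first factor alone is a ring endomorphism of the whole tensor
      product. On each isotypic summand it is multiplication by the character value.\<close>
    obtain \<tau> where tau: "\<tau> \<in> ring_hom T T"
      "\<And>s t. s \<in> carrier S1 \<Longrightarrow> t \<in> carrier S2 \<Longrightarrow> \<tau> (pure s t) = pure (S1.act g s) t"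
      by (rule twist_hom[OF S1.act(1)[OF g] S1.act(3)[OF g]]) auto
    have tau_base: "\<tau> (base r) = base r" if "r \<in> carrier R" for r
      using that g by (simp add: base_def tau S1.act)
    have tau_w: "\<tau> w = base (\<iota> (\<chi> g)) \<otimes>\<^bsub>T\<^esub> w"
      using g by (simp add: w_def tau S1.act(4)) (simp add: base_def pure_mult)
    interpret tau: ring_hom_cring T T \<tau>
      by (rule ring_hom_cringI[OF T.is_cring T.is_cring tau(1)])
    have base_pow: "base (x [^]\<^bsub>R\<^esub> n) = base x [^]\<^bsub>T\<^esub> n" if "x \<in> carrier R" for x and n :: nat
      using that by (induction n) auto
    have tau_comp: "\<tau> z = base (\<iota> (\<rho> g)) \<otimes>\<^bsub>T\<^esub> z" if rho: "\<rho> \<in> chars" and z: "z \<in> comp \<rho>" for \<rho> z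
    proof -
      obtain i where i: "i < p" "\<rho> = S1.\<psi> i" using rho unfolding S1.characters_eq by blast
      then obtain r where r: "r \<in> carrier R" "z = base r \<otimes>\<^bsub>T\<^esub> w [^]\<^bsub>T\<^esub> i" using z comp_eq[OF i(1)] by blast
      have "\<rho> g = \<chi> g ^ i" using i(2) g by (simp add: S1.\<psi>_def)
      then show ?thesis using r by (simp add: tau_base tau_w T.nat_pow_distrib base_pow T.m_lcomm)
    qed
    have tau_sum: "\<tau> (\<Oplus>\<^bsub>T\<^esub>\<rho>\<in>chars. f \<rho>) = (\<Oplus>\<^bsub>T\<^esub>\<rho>\<in>chars. base (\<iota> (\<rho> g)) \<otimes>\<^bsub>T\<^esub> f \<rho>)" if f: "f \<in> Pi chars comp" for f
    proof -
      have fc: "f \<rho> \<in> carrier T" if "\<rho> \<in> chars" for \<rho> using f that comp_closed by blast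
      have "\<tau> (\<Oplus>\<^bsub>T\<^esub>\<rho>\<in>chars. f \<rho>) = (\<Oplus>\<^bsub>T\<^esub>\<rho>\<in>chars. \<tau> (f \<rho>))"
        using tau.hom_finsum[of f chars] fc by (simp add: comp_def Pi_iff)
      also have "\<dots> = (\<Oplus>\<^bsub>T\<^esub>\<rho>\<in>chars. base (\<iota> (\<rho> g)) \<otimes>\<^bsub>T\<^esub> f \<rho>)"
      proof (rule T.finsum_cong'[OF refl])
        fix \<rho> assume "\<rho> \<in> chars"
        then show "\<tau> (f \<rho>) = base (\<iota> (\<rho> g)) \<otimes>\<^bsub>T\<^esub> f \<rho>"
          using tau_comp f by (simp add: Pi_iff)
      qed (use fc in auto)
      finally show ?thesis .
    qed
    \<comment> \<open>Every decomposition of \<open>z\<close> yields \<tau> of \<open>z\<close>, so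
      the described element is unique.\<close>
    have yact: "yact g z = \<tau> z" if z: "z \<in> C.span" for z
      unfolding yact_def
    proof (rule the_equality)
      from z obtain f where f: "f \<in> Pi chars comp" "z = (\<Oplus>\<^bsub>T\<^esub>\<rho>\<in>chars. f \<rho>)" unfolding sums_eq[symmetric] by blast
      then show "\<exists>f\<in>Pi chars comp. z = (\<Oplus>\<^bsub>T\<^esub>\<rho>\<in>chars. f \<rho>) \<and> \<tau> z = (\<Oplus>\<^bsub>T\<^esub>\<rho>\<in>chars. base (\<iota> (\<rho> g)) \<otimes>\<^bsub>T\<^esub> f \<rho>)"
        using tau_sum by blast
    next
      fix y assume "\<exists>f\<in>Pi chars comp. z = (\<Oplus>\<^bsub>T\<^esub>\<rho>\<in>chars. f \<rho>) \<and> y = (\<Oplus>\<^bsub>T\<^esub>\<rho>\<in>chars. base (\<iota> (\<rho> g)) \<otimes>\<^bsub>T\<^esub> f \<rho>)"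
      then show "y = \<tau> z" using tau_sum by auto
    qed
    have tau_span: "\<tau> z \<in> C.span" if "z \<in> C.span" for z
    proof -
      from that obtain r where r: "r \<in> C.Co" "z = C.L r" by (auto simp: C.span_def)
      have "\<tau> z = C.L (\<lambda>i. \<iota> (\<chi> g) [^]\<^bsub>R\<^esub> i \<otimes>\<^bsub>R\<^esub> r i)"
        using C.lin_hom[OF tau(1) T.is_cring tau_base r(1)] C.lin_scale[of "\<iota> (\<chi> g)" r] r by (simp add: tau_w)
      then show ?thesis using r by (auto intro!: C.span_I)
    qed
    have act_eq: "g_action ?S g z = \<tau> z" if "z \<in> C.span" for z
      using that by (simp add: S_act yact)
    show "g_action ?S g \<in> ring_hom ?T ?T"
      by (rule ring_hom_memI) (use C.span_base[of "\<one>\<^bsub>R\<^esub>"] in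
        \<open>auto simp: act_eq tau_span C.span_closed C.span_mult C.span_add\<close>)
    show "g_action ?S g \<in> extensional (carrier ?T)" by (simp add: S_act)
    show "g_action ?S g (base_map ?S r) = base_map ?S r" if "r \<in> carrier R" for r
      using that C.span_base by (simp add: S_base act_eq tau_base)
    show "g_action ?S g w = base_map ?S (\<iota> (\<chi> g)) \<otimes>\<^bsub>?T\<^esub> w"
      using C.span_gen by (simp add: S_base act_eq tau_w)
  qed
qed

end

section \<open>Units modulo powers and the Harrison group\<close>

context cring
begin

lemma units_comm: "comm_group (units_of R)"
  by (rule units_comm_group)

lemma unit_powers_subgroup: "subgroup (unit_powers R p) (units_of R)"
proof -
  interpret U: comm_group "units_of R" by (rule units_comm)
  have eq: "unit_powers R p = (\<lambda>u. u [^]\<^bsub>units_of R\<^esub> p) ` carrier (units_of R)"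
    unfolding unit_powers_def units_of_carrier by (rule image_cong) (simp_all add: units_of_pow)
  show ?thesis
    unfolding eq
  proof (rule U.subgroupI)
    fix x assume "x \<in> (\<lambda>u. u [^]\<^bsub>units_of R\<^esub> p) ` carrier (units_of R)"
    then obtain u where "u \<in> carrier (units_of R)" "x = u [^]\<^bsub>units_of R\<^esub> p" by blast
    then show "inv\<^bsub>units_of R\<^esub> x \<in> (\<lambda>u. u [^]\<^bsub>units_of R\<^esub> p) ` carrier (units_of R)"
      by (intro image_eqI[of _ _ "inv\<^bsub>units_of R\<^esub> u"]) (simp_all add: U.nat_pow_inv)
  next
    fix x y assume "x \<in> (\<lambda>u. u [^]\<^bsub>units_of R\<^esub> p) ` carrier (units_of R)"
      "y \<in> (\<lambda>u. u [^]\<^bsub>units_of R\<^esub> p) ` carrier (units_of R)"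
    then obtain u v where "u \<in> carrier (units_of R)" "x = u [^]\<^bsub>units_of R\<^esub> p"
      "v \<in> carrier (units_of R)" "y = v [^]\<^bsub>units_of R\<^esub> p" by blast
    then show "x \<otimes>\<^bsub>units_of R\<^esub> y \<in> (\<lambda>u. u [^]\<^bsub>units_of R\<^esub> p) ` carrier (units_of R)"
      by (intro image_eqI[of _ _ "u \<otimes>\<^bsub>units_of R\<^esub> v"]) (simp_all add: U.nat_pow_distrib)
  qed auto
qed

lemma unit_powers_normal: "unit_powers R p \<lhd> units_of R"
  by (rule comm_group.subgroup_imp_normal[OF units_comm unit_powers_subgroup])

lemma unit_classes_comm_group: "comm_group (unit_classes R p)"
  unfolding unit_classes_def by (rule comm_group.abelian_FactGroup[OF units_comm unit_powers_subgroup])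

lemma unit_class_mem:
  "v \<in> unit_class R p u \<longleftrightarrow> (\<exists>w\<in>Units R. v = w [^] p \<otimes> u)"
  by (auto simp: unit_class_def r_coset_def unit_powers_def units_of_mult)

lemma unit_class_eq_iff:
  assumes "u \<in> Units R" "v \<in> Units R"
  shows "unit_class R p u = unit_class R p v \<longleftrightarrow> (\<exists>w\<in>Units R. v = w [^] p \<otimes> u)"
proof -
  interpret U: comm_group "units_of R" by (rule units_comm)
  have "v \<in> unit_class R p v"
    unfolding unit_class_def using U.rcos_self[of v] unit_powers_subgroup assms by (simp add: units_of_carrier)
  moreover have "unit_class R p u = unit_class R p v" if "v \<in> unit_class R p u"
    using U.repr_independence[OF that[unfolded unit_class_def] _ unit_powers_subgroup] assms
    by (simp add: unit_class_def units_of_carrier)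
  ultimately show ?thesis unfolding unit_class_mem[symmetric] by metis
qed

lemma unit_classes_carrier: "carrier (unit_classes R p) = unit_class R p ` Units R"
  by (auto simp: unit_classes_def unit_class_def FactGroup_def RCOSETS_def units_of_carrier)

lemma unit_class_mult:
  assumes "u \<in> Units R" "v \<in> Units R"
  shows "unit_class R p u \<otimes>\<^bsub>unit_classes R p\<^esub> unit_class R p v = unit_class R p (u \<otimes> v)"
  using normal.rcos_sum[OF unit_powers_normal, of u v] assms
  by (simp add: unit_classes_def unit_class_def FactGroup_def units_of_carrier units_of_mult)

lemma induced_unit_class:
  assumes u: "u \<in> Units R"
    and f: "\<And>v w. v \<in> Units R \<Longrightarrow> w \<in> Units R \<Longrightarrow> f (w [^] p \<otimes> v) = f v"
  shows "induced f (unit_class R p u) = f u"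
proof -
  have "u \<in> unit_class R p u"
    using unit_class_eq_iff[OF u u] unit_class_mem by blast
  moreover have "f ` unit_class R p u = (\<lambda>_. f u) ` unit_class R p u"
    by (rule image_cong) (use f[OF u] in \<open>auto simp: unit_class_mem\<close>)
  ultimately have "f ` unit_class R p u = {f u}"
    by (simp only: image_constant)
  then show ?thesis by (simp add: induced_def)
qed

lemma class_function_units:
  assumes f: "\<And>v w. v \<in> Units R \<Longrightarrow> w \<in> Units R \<Longrightarrow> f (w [^] p \<otimes> v) = f v"
  shows "class_function (carrier (unit_classes R p)) f"
  unfolding class_function_def unit_classes_carrier by (auto simp: unit_class_mem f)

text \<open>The kernel is expressed through the fibres of \<open>f\<close>, so that \<open>H\<close>
  may be a mere multiplicative structure. This lets the Harrison group inherit its axioms from the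
  units.\<close>

lemma induced_iso:
  assumes closed: "\<And>u. u \<in> Units R \<Longrightarrow> f u \<in> carrier H"
    and surj: "\<And>y. y \<in> carrier H \<Longrightarrow> \<exists>u\<in>Units R. f u = y"
    and mult: "\<And>u v. u \<in> Units R \<Longrightarrow> v \<in> Units R \<Longrightarrow> f (u \<otimes> v) = f u \<otimes>\<^bsub>H\<^esub> f v"
    and ker: "\<And>u v. u \<in> Units R \<Longrightarrow> v \<in> Units R \<Longrightarrow> f u = f v \<longleftrightarrow> (\<exists>w\<in>Units R. v = w [^] p \<otimes> u)"
  shows "induced f \<in> iso (unit_classes R p) H"
proof -
  have inv: "f (w [^] p \<otimes> v) = f v" if "v \<in> Units R" "w \<in> Units R" for v w
    using ker[of v "w [^] p \<otimes> v"] that by (auto simp: Units_pow_closed)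
  note ind = induced_unit_class[OF _ inv]
  show ?thesis
    unfolding iso_def
  proof (intro CollectI conjI)
    show "induced f \<in> hom (unit_classes R p) H"
      by (rule homI) (auto simp: unit_classes_carrier ind closed unit_class_mult mult)
    show "bij_betw (induced f) (carrier (unit_classes R p)) (carrier H)"
      unfolding bij_betw_def
    proof
      show "inj_on (induced f) (carrier (unit_classes R p))"
      proof (rule inj_onI)
        fix x y assume "x \<in> carrier (unit_classes R p)" "y \<in> carrier (unit_classes R p)"
          and eq: "induced f x = induced f y"
        then obtain u v where uv: "u \<in> Units R" "x = unit_class R p u" "v \<in> Units R" "y = unit_class R p v"
          unfolding unit_classes_carrier by blast
        then have "f u = f v" using eq ind by simp
        then show "x = y" using ker unit_class_eq_iff uv by simp
      qed
      show "induced f ` carrier (unit_classes R p) = carrier H"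
        using surj by (auto simp: unit_classes_carrier ind closed image_iff) (metis ind)
    qed
  qed
qed

end

section \<open>Classes of Kummer algebras and the group they form\<close>

context kummer_base
begin

text \<open>The class is described by the existence of a generator with \<open>p\<close>-th power
  \<open>u\<close>, not by an isomorphism to a chosen model. A single algebra can then be seen to
  belong to the classes of two units.\<close>

definition kclass :: "'r \<Rightarrow> ('r, 'g, 's) gclass" where
  "kclass u = {S. \<exists>a. kummer_gen S u a}"

lemma kummer_algebraI: "kummer_gen S u a \<Longrightarrow> kummer_algebra R G \<iota> p \<chi> S u a"
  by unfold_locales

text \<open>The generator is pulled back along the inverse isomorphism; extensionality of the action
  on \<open>S\<close> comes from its being an action in the sense of
  \<open>galois_ext\<close>.\<close>

lemma gext_iso_transport:
  assumes T: "kummer_gen T u a" and S: "galois_ext R G S" and iso: "gext_iso R G S T"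
  obtains c where "kummer_gen S u c"
proof -
  interpret T: kummer_algebra R G \<iota> p \<chi> T u a by (rule kummer_algebraI[OF T])
  interpret S: galois_algebra R G \<iota> p \<chi> S by unfold_locales (rule S)
  obtain f where f: "f \<in> ring_iso S T" "\<And>r. r \<in> carrier R \<Longrightarrow> f (S.b r) = T.b r"
    "\<And>g s. g \<in> carrier G \<Longrightarrow> s \<in> carrier S \<Longrightarrow> f (S.act g s) = T.act g (f s)"
    using iso unfolding gext_iso_def by blast
  let ?f = "inv_into (carrier S) f"
  have bij: "bij_betw f (carrier S) (carrier T)" using f(1) by (simp add: ring_iso_def)
  have ff: "?f (f s) = s" if "s \<in> carrier S" for s
    using bij that by (simp add: bij_betw_inv_into_left)
  have "kummer_gen S u (?f a)"
  proof (rule T.transport)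
    show "?f \<in> ring_iso T S" by (rule ring_iso_set_sym[OF S.S.ring_axioms f(1)])
    show "cring S" by (rule S.S.is_cring)
    show "?f (T.b r) = S.b r" if "r \<in> carrier R" for r
      using ff[of "S.b r"] f(2)[OF that] that by simp
    show "S.act g \<in> extensional (carrier S)" if "g \<in> carrier G" for g
      using S.act_ext[OF that] .
    fix g t assume g: "g \<in> carrier G" and t: "t \<in> carrier T"
    then obtain s where s: "s \<in> carrier S" "t = f s" using bij by (auto simp: bij_betw_def)
    show "?f (T.act g t) = S.act g (?f t)"
      using ff[of "S.act g s"] ff[OF s(1)] f(3)[OF g s(1)] g s by simp
  qed
  then show thesis by (rule that)
qed

lemma harrison_class_eq:
  assumes "kummer_gen T u a"
  shows "(harrison_class R G T :: ('r, 'g, 's) gclass) = kclass u"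
proof (intro equalityI subsetI)
  fix S :: "('r, 'g, ('r, 's) universe) gext" assume "S \<in> harrison_class R G T"
  then have "galois_ext R G S" "gext_iso R G S T" by (simp_all add: harrison_class_def)
  then obtain c where "kummer_gen S u c" by (rule gext_iso_transport[OF assms])
  then show "S \<in> kclass u" unfolding kclass_def by blast
next
  fix S :: "('r, 'g, ('r, 's) universe) gext" assume "S \<in> kclass u"
  then obtain c where "kummer_gen S u c" unfolding kclass_def by blast
  then interpret S: kummer_algebra R G \<iota> p \<chi> S u c by (rule kummer_algebraI)
  show "S \<in> harrison_class R G T"
    using S.galois S.iso_if_same[OF assms] by (simp add: harrison_class_def)
qed

lemma kclass_kummer:
  assumes "u \<in> Units R"
  shows "harrison_class R G (kummer_ext R \<iota> \<chi> p u) = kclass u"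
  by (rule kummer_ext_gen[OF assms]) (rule harrison_class_eq)

lemma kclass_nonempty:
  assumes "u \<in> Units R"
  obtains S :: "('r, 'g, ('r, 's) universe) gext" and a where "kummer_gen S u a" "S \<in> kclass u"
proof -
  obtain a where a: "kummer_gen (kummer_ext R \<iota> \<chi> p u) u a" using kummer_ext_gen[OF assms] .
  then interpret K: kummer_algebra R G \<iota> p \<chi> "kummer_ext R \<iota> \<chi> p u" u a by (rule kummer_algebraI)
  obtain S :: "('r, 'g, ('r, 's) universe) gext" where "kummer_gen S u (Inr a)"
    by (rule K.copy_gen[of Inr]) auto
  then show thesis by (intro that) (auto simp: kclass_def)
qed

text \<open>Equal classes share a member, since classes are nonempty, and its two generators differ
  by a unit factor. Conversely, rescaling by a unit and by its inverse gives both
  inclusions.\<close>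

lemma kclass_eq_iff:
  assumes u: "u \<in> Units R" and v: "v \<in> Units R"
  shows "(kclass u :: ('r, 'g, 's) gclass) = kclass v \<longleftrightarrow> (\<exists>w\<in>Units R. v = w [^]\<^bsub>R\<^esub> p \<otimes>\<^bsub>R\<^esub> u)"
proof
  assume eq: "(kclass u :: ('r, 'g, 's) gclass) = kclass v"
  obtain S :: "('r, 'g, ('r, 's) universe) gext" and a where S: "kummer_gen S u a" "S \<in> kclass u"
    using kclass_nonempty[OF u] .
  then obtain c where c: "kummer_gen S v c" using eq unfolding kclass_def by blast
  interpret S: kummer_algebra R G \<iota> p \<chi> S u a by (rule kummer_algebraI[OF S(1)])
  show "\<exists>w\<in>Units R. v = w [^]\<^bsub>R\<^esub> p \<otimes>\<^bsub>R\<^esub> u"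
    using S.gens_differ[OF c] by blast
next
  have sub: "kclass u' \<subseteq> (kclass (w [^]\<^bsub>R\<^esub> p \<otimes>\<^bsub>R\<^esub> u') :: ('r, 'g, 's) gclass)" if "w \<in> Units R" for w u'
  proof
    fix S :: "('r, 'g, ('r, 's) universe) gext" assume "S \<in> kclass u'"
    then obtain a where "kummer_gen S u' a" unfolding kclass_def by blast
    then interpret S: kummer_algebra R G \<iota> p \<chi> S u' a by (rule kummer_algebraI)
    show "S \<in> kclass (w [^]\<^bsub>R\<^esub> p \<otimes>\<^bsub>R\<^esub> u')" using S.rescale[OF that] unfolding kclass_def by blast
  qed
  assume "\<exists>w\<in>Units R. v = w [^]\<^bsub>R\<^esub> p \<otimes>\<^bsub>R\<^esub> u"
  then obtain w where w: "w \<in> Units R" "v = w [^]\<^bsub>R\<^esub> p \<otimes>\<^bsub>R\<^esub> u" by blast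
  let ?x = "inv\<^bsub>R\<^esub> w"
  have "?x [^]\<^bsub>R\<^esub> p \<otimes>\<^bsub>R\<^esub> v = (?x \<otimes>\<^bsub>R\<^esub> w) [^]\<^bsub>R\<^esub> p \<otimes>\<^bsub>R\<^esub> u"
    using w u R.Units_closed[OF w(1)] R.Units_closed[OF u] by (simp only: R.nat_pow_distrib R.m_assoc R.Units_inv_closed R.nat_pow_closed)
  then have "?x [^]\<^bsub>R\<^esub> p \<otimes>\<^bsub>R\<^esub> v = u" using w(1) R.Units_closed[OF u] by simp
  with sub[OF w(1), of u] sub[of ?x v] w show "(kclass u :: ('r, 'g, 's) gclass) = kclass v" by auto
qed

text \<open>Every Galois extension has a Kummer generator by unit selection, and every unit is
  realised inside the universe by a copy of the explicit extension.\<close>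

lemma harrison_classes_eq:
  assumes "unit_selection R"
  shows "(harrison_classes R G :: ('r, 'g, 's) gclass set) = kclass ` Units R"
proof (intro equalityI subsetI)
  fix A :: "('r, 'g, 's) gclass" assume "A \<in> harrison_classes R G"
  then obtain S :: "('r, 'g, ('r, 's) universe) gext" where S: "galois_ext R G S" "A = harrison_class R G S"
    by (auto simp: harrison_classes_def)
  interpret S: galois_algebra R G \<iota> p \<chi> S by unfold_locales (rule S)
  obtain u a where "kummer_gen S u a" using S.kummer_gen_exists[OF assms] .
  then show "A \<in> kclass ` Units R"
    using harrison_class_eq[of S u a] S(2) by (auto simp: kummer_gen_def)
next
  fix A :: "('r, 'g, 's) gclass" assume "A \<in> kclass ` Units R"
  then obtain u where u: "u \<in> Units R" "A = kclass u" by blast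
  obtain S :: "('r, 'g, ('r, 's) universe) gext" and a where S: "kummer_gen S u a" "S \<in> kclass u"
    using kclass_nonempty[OF u(1)] .
  interpret S: kummer_algebra R G \<iota> p \<chi> S u a by (rule kummer_algebraI[OF S(1)])
  show "A \<in> harrison_classes R G"
    unfolding harrison_classes_def u(2) harrison_class_eq[OF S(1), symmetric] using S.galois by blast
qed

text \<open>All pairs of members have products with a generator over \<open>u\<close> times
  \<open>v\<close>, so the union that defines the product is taken over equal sets.\<close>

lemma harrison_mult_eq:
  assumes u: "u \<in> Units R" and v: "v \<in> Units R"
  shows "harrison_mult R \<iota> G p (kclass u :: ('r, 'g, 's) gclass) (kclass v) = kclass (u \<otimes>\<^bsub>R\<^esub> v)"
proof -
  have prod: "harrison_class R G (harrison_product R \<iota> G p S1 S2) = (kclass (u \<otimes>\<^bsub>R\<^esub> v) :: ('r, 'g, 's) gclass)"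
    if S1: "S1 \<in> (kclass u :: ('r, 'g, 's) gclass)" and S2: "S2 \<in> (kclass v :: ('r, 'g, 's) gclass)" for S1 S2
  proof -
    obtain a c where ac: "kummer_gen S1 u a" "kummer_gen S2 v c" using S1 S2 unfolding kclass_def by blast
    interpret kummer_algebra_pair R G \<iota> p \<chi> S1 u a S2 v c
      by (intro kummer_algebra_pair.intro kummer_algebraI ac)
    show ?thesis by (rule harrison_class_eq[OF product_gen])
  qed
  moreover obtain S1 :: "('r, 'g, ('r, 's) universe) gext" and a where "S1 \<in> kclass u" using kclass_nonempty[OF u] .
  moreover obtain S2 :: "('r, 'g, ('r, 's) universe) gext" and a where "S2 \<in> kclass v" using kclass_nonempty[OF v] .
  ultimately show ?thesis unfolding harrison_mult_def by blast
qed

theorem harrison_iso: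
  assumes sel: "unit_selection R"
  defines "H \<equiv> harrison_group R \<iota> G p :: ('r, 'g, 's) gclass monoid"
  defines "kum \<equiv> \<lambda>u. harrison_class R G (kummer_ext R \<iota> \<chi> p u) :: ('r, 'g, 's) gclass"
  shows "comm_group H" and "class_function (carrier (unit_classes R p)) kum"
    and "induced kum \<in> iso (unit_classes R p) H"
    and "\<And>u. u \<in> Units R \<Longrightarrow> induced kum (unit_class R p u) = kclass u"
    and "carrier H = kclass ` Units R"
proof -
  have kum: "kum u = kclass u" if "u \<in> Units R" for u
    using kclass_kummer[OF that] by (simp add: kum_def)
  show carrier: "carrier H = kclass ` Units R"
    by (simp add: H_def harrison_group_def harrison_classes_eq[OF sel])
  have mult: "kclass u \<otimes>\<^bsub>H\<^esub> kclass v = kclass (u \<otimes>\<^bsub>R\<^esub> v)" if "u \<in> Units R" "v \<in> Units R" for u v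
    using harrison_mult_eq[OF that] by (simp add: H_def harrison_group_def)
  have ker: "kum u = kum v \<longleftrightarrow> (\<exists>w\<in>Units R. v = w [^]\<^bsub>R\<^esub> p \<otimes>\<^bsub>R\<^esub> u)" if "u \<in> Units R" "v \<in> Units R" for u v
    using kclass_eq_iff[OF that] kum that by simp
  show iso: "induced kum \<in> iso (unit_classes R p) H"
  proof (rule R.induced_iso[OF _ _ _ ker])
    show "kum u \<in> carrier H" if "u \<in> Units R" for u using that by (simp add: kum carrier)
    show "\<exists>u\<in>Units R. kum u = y" if "y \<in> carrier H" for y using that kum by (auto simp: carrier)
    show "kum (u \<otimes>\<^bsub>R\<^esub> v) = kum u \<otimes>\<^bsub>H\<^esub> kum v" if "u \<in> Units R" "v \<in> Units R" for u v
      using that by (simp add: kum mult)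
  qed
  have inv: "kum (w [^]\<^bsub>R\<^esub> p \<otimes>\<^bsub>R\<^esub> v) = kum v" if "v \<in> Units R" "w \<in> Units R" for v w
    using ker[of v "w [^]\<^bsub>R\<^esub> p \<otimes>\<^bsub>R\<^esub> v"] that by (auto simp: R.Units_pow_closed)
  show "class_function (carrier (unit_classes R p)) kum"
    by (rule R.class_function_units) (rule inv)
  show ind: "induced kum (unit_class R p u) = kclass u" if "u \<in> Units R" for u
    using R.induced_unit_class[OF that inv] kum[OF that] by simp
  have unit1: "\<one>\<^bsub>R\<^esub> \<in> Units R" by simp
  \<comment> \<open>The unit was defined by description. Multiplying another candidate by the class
    of 1 shows that there is only one.\<close>
  have one: "\<one>\<^bsub>H\<^esub> = kclass \<one>\<^bsub>R\<^esub>"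
  proof -
    have "(THE E. E \<in> harrison_classes R G \<and>
      (\<forall>A\<in>harrison_classes R G. harrison_mult R \<iota> G p E A = A \<and> harrison_mult R \<iota> G p A E = A)) = (kclass \<one>\<^bsub>R\<^esub> :: ('r, 'g, 's) gclass)"
      unfolding harrison_classes_eq[OF sel]
    proof (rule the_equality)
      show "kclass \<one>\<^bsub>R\<^esub> \<in> kclass ` Units R \<and>
        (\<forall>A\<in>kclass ` Units R. harrison_mult R \<iota> G p (kclass \<one>\<^bsub>R\<^esub>) A = A \<and> harrison_mult R \<iota> G p A (kclass \<one>\<^bsub>R\<^esub>) = A)"
        by (auto simp: harrison_mult_eq)
    next
      fix E :: "('r, 'g, 's) gclass"
      assume E: "E \<in> kclass ` Units R \<and>
        (\<forall>A\<in>kclass ` Units R. harrison_mult R \<iota> G p E A = A \<and> harrison_mult R \<iota> G p A E = A)"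
      then obtain u where u: "u \<in> Units R" "E = kclass u" by blast
      have "harrison_mult R \<iota> G p E (kclass \<one>\<^bsub>R\<^esub>) = kclass \<one>\<^bsub>R\<^esub>" using E unit1 by blast
      then show "E = kclass \<one>\<^bsub>R\<^esub>"
        unfolding u(2) harrison_mult_eq[OF u(1) unit1] using R.Units_closed[OF u(1)] by simp
    qed
    then show ?thesis by (simp add: H_def harrison_group_def)
  qed
  interpret U: comm_group "unit_classes R p" by (rule R.unit_classes_comm_group)
  interpret Un: comm_group "units_of R" by (rule R.units_comm)
  have "\<one>\<^bsub>unit_classes R p\<^esub> = unit_class R p \<one>\<^bsub>R\<^esub>"
    unfolding unit_classes_def FactGroup_def unit_class_def
    using Un.coset_mult_one[of "unit_powers R p"] subgroup.subset[OF R.unit_powers_subgroup] by (simp add: units_of_one)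
  then have "induced kum \<one>\<^bsub>unit_classes R p\<^esub> = \<one>\<^bsub>H\<^esub>"
    using ind[OF unit1] one by simp
  \<comment> \<open>A bijection that respects products carries the group axioms over, as the units
    correspond.\<close>
  then show "comm_group H"
    using U.iso_imp_img_comm_group[OF iso] by simp
qed

end

section \<open>Rings modelled on types\<close>

lemma ring_of_type_simps [simp]:
  "carrier ring_of_type_algebra = UNIV" "x \<otimes>\<^bsub>ring_of_type_algebra\<^esub> y = x * y"
  "x \<oplus>\<^bsub>ring_of_type_algebra\<^esub> y = x + y" "\<one>\<^bsub>ring_of_type_algebra\<^esub> = 1" "\<zero>\<^bsub>ring_of_type_algebra\<^esub> = 0"
  by (simp_all add: ring_of_type_algebra_def)

text \<open>A record ring that is a copy of a type. Calculations take place in the type, with its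
  arithmetic, and are transferred along \<open>h\<close>.\<close>

locale type_model =
  fixes S :: "('s, 'm) ring_scheme" and h :: "'x::comm_ring_1 \<Rightarrow> 's"
  assumes bij: "bij_betw h UNIV (carrier S)"
    and h_add: "h (x + y) = h x \<oplus>\<^bsub>S\<^esub> h y" and h_mult: "h (x * y) = h x \<otimes>\<^bsub>S\<^esub> h y"
    and h_one: "h 1 = \<one>\<^bsub>S\<^esub>" and h_zero: "h 0 = \<zero>\<^bsub>S\<^esub>"
begin

lemma h_iso: "h \<in> ring_iso ring_of_type_algebra S"
  by (rule ring_iso_memI) (use bij in \<open>auto simp: h_add h_mult h_one bij_betw_def\<close>)

sublocale S: cring S
  using cring.ring_iso_imp_img_cring[OF cring_from_type_algebra h_iso] by (simp add: h_zero)

lemma h_closed [simp]: "h x \<in> carrier S"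
  using bij by (auto simp: bij_betw_def)

lemma h_eq_iff [simp]: "h x = h y \<longleftrightarrow> x = y"
  using bij by (auto simp: bij_betw_def inj_on_def)

lemma h_cases: "s \<in> carrier S \<Longrightarrow> \<exists>x. s = h x"
  using bij by (auto simp: bij_betw_def)

lemma h_pow: "h (x ^ n) = h x [^]\<^bsub>S\<^esub> n"
  by (induction n) (simp_all add: h_one h_mult S.m_comm)

lemma h_unit: "h x \<in> Units S \<longleftrightarrow> x dvd 1"
proof
  assume "h x \<in> Units S"
  then obtain s where "s \<in> carrier S" "h x \<otimes>\<^bsub>S\<^esub> s = \<one>\<^bsub>S\<^esub>" by (auto simp: Units_def)
  then obtain y where "h (x * y) = h 1" using h_cases by (auto simp: h_mult h_one)
  then show "x dvd 1" by (metis dvdI h_eq_iff)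
next
  assume "x dvd 1"
  then obtain y where "1 = x * y" by (auto elim: dvdE)
  then have "h x \<otimes>\<^bsub>S\<^esub> h y = \<one>\<^bsub>S\<^esub>" "h y \<otimes>\<^bsub>S\<^esub> h x = \<one>\<^bsub>S\<^esub>"
    by (simp_all add: h_one mult.commute flip: h_mult)
  then show "h x \<in> Units S" by (auto simp: Units_def)
qed

end

section \<open>Completion of a local ring with principal maximal ideal\<close>

lemma (in cring) principal_prod:
  assumes "a \<in> carrier R" "b \<in> carrier R"
  shows "ideal_prod R (PIdl a) (PIdl b) = PIdl (a \<otimes> b)"
proof (intro equalityI subsetI)
  fix x assume "x \<in> ideal_prod R (PIdl a) (PIdl b)"
  then show "x \<in> PIdl (a \<otimes> b)"
  proof (induction rule: ideal_prod.induct)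
    case (prod i j)
    then obtain y z where yz: "y \<in> carrier R" "i = y \<otimes> a" "z \<in> carrier R" "j = z \<otimes> b"
      unfolding cgenideal_def by blast
    then have "i \<otimes> j = (y \<otimes> z) \<otimes> (a \<otimes> b)" using assms by (simp add: m_ac)
    then show ?case unfolding cgenideal_def using yz by blast
  next
    case (sum y z)
    then show ?case
      using additive_subgroup.a_closed[OF ideal.axioms(1)[OF cgenideal_ideal]] assms by simp
  qed
next
  fix x assume "x \<in> PIdl (a \<otimes> b)"
  then obtain y where y: "y \<in> carrier R" "x = (y \<otimes> a) \<otimes> b"
    using assms unfolding cgenideal_def by (auto simp: m_assoc)
  then have "y \<otimes> a \<in> PIdl a" unfolding cgenideal_def by blast
  then show "x \<in> ideal_prod R (PIdl a) (PIdl b)"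
    unfolding y(2) by (rule ideal_prod.prod) (rule cgenideal_self[OF assms(2)])
qed

lemma (in cring) principal_power:
  assumes "t \<in> carrier R"
  shows "PIdl t [^]\<^bsub>ideals_set R\<^esub> (n::nat) = PIdl (t [^] n)"
proof (induction n)
  case 0
  have "PIdl \<one> = carrier R" unfolding cgenideal_def by force
  then show ?case by (simp add: nat_pow_def ideals_set_def)
next
  case (Suc n)
  have "PIdl t [^]\<^bsub>ideals_set R\<^esub> (Suc n) = ideal_prod R (PIdl t [^]\<^bsub>ideals_set R\<^esub> n) (PIdl t)"
    by (simp add: nat_pow_def ideals_set_def)
  also have "\<dots> = PIdl (t [^] Suc n)"
    unfolding Suc using principal_prod[of "t [^] n" t] assms by simp
  finally show ?case .
qed

text \<open>What the geometry has to supply for the power series description: constants representing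
  all residues, a generator \<open>t\<close> of the maximal ideal, and nonvanishing powers of
  \<open>t\<close>, which keep coefficients of all degrees visible.\<close>

locale uniformized = R: cring R
  for R :: "('r, 'l) ring_scheme" +
  fixes \<kappa> :: "'k::field \<Rightarrow> 'r" and t :: 'r
  assumes kappa: "\<kappa> \<in> ring_hom ring_of_type_algebra R"
    and t [simp]: "t \<in> carrier R"
    and nonunits: "nonunits R = PIdl\<^bsub>R\<^esub> t"
    and residue: "r \<in> carrier R \<Longrightarrow> \<exists>c. r \<ominus>\<^bsub>R\<^esub> \<kappa> c \<in> PIdl\<^bsub>R\<^esub> t"
    and not_nilpotent: "t [^]\<^bsub>R\<^esub> (n::nat) \<noteq> \<zero>\<^bsub>R\<^esub>"
begin

lemma kappa_simps [simp]:
  "\<kappa> x \<in> carrier R" "\<kappa> (x + y) = \<kappa> x \<oplus>\<^bsub>R\<^esub> \<kappa> y" "\<kappa> (x * y) = \<kappa> x \<otimes>\<^bsub>R\<^esub> \<kappa> y"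
  "\<kappa> 1 = \<one>\<^bsub>R\<^esub>" "\<kappa> 0 = \<zero>\<^bsub>R\<^esub>"
  using ring_hom_closed[OF kappa, of x] ring_hom_add[OF kappa, of x y] ring_hom_mult[OF kappa, of x y]
    ring_hom_one[OF kappa] ring_hom_zero[OF kappa ring_from_type_algebra R.ring_axioms]
  by simp_all

definition M :: "nat \<Rightarrow> 'r set" where "M n = PIdl\<^bsub>R\<^esub> (t [^]\<^bsub>R\<^esub> n)"

lemma M_eq: "nonunits R [^]\<^bsub>ideals_set R\<^esub> n = M n"
  unfolding nonunits M_def by (rule R.principal_power[OF t])

lemma M_ideal: "ideal (M n) R"
  unfolding M_def by (rule R.cgenideal_ideal) simp

lemma M_iff: "x \<in> M n \<longleftrightarrow> (\<exists>z\<in>carrier R. x = t [^]\<^bsub>R\<^esub> n \<otimes>\<^bsub>R\<^esub> z)"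
  unfolding M_def cgenideal_def by (auto simp: R.m_comm)

text \<open>Congruence modulo \<open>t^n\<close> with an explicit witness, as a computable
  substitute for equality of cosets.\<close>

definition cong :: "nat \<Rightarrow> 'r \<Rightarrow> 'r \<Rightarrow> bool" where
  "cong n x y \<longleftrightarrow> x \<in> carrier R \<and> y \<in> carrier R \<and> (\<exists>z\<in>carrier R. x = y \<oplus>\<^bsub>R\<^esub> t [^]\<^bsub>R\<^esub> n \<otimes>\<^bsub>R\<^esub> z)"

definition q :: "nat \<Rightarrow> 'r \<Rightarrow> 'r set" where "q n x = M n +>\<^bsub>R\<^esub> x"

lemma q_eq_iff:
  assumes "x \<in> carrier R" "y \<in> carrier R"
  shows "q n x = q n y \<longleftrightarrow> cong n x y"
proof -
  have "x \<ominus>\<^bsub>R\<^esub> y = t [^]\<^bsub>R\<^esub> n \<otimes>\<^bsub>R\<^esub> z \<longleftrightarrow> x = y \<oplus>\<^bsub>R\<^esub> t [^]\<^bsub>R\<^esub> n \<otimes>\<^bsub>R\<^esub> z" if "z \<in> carrier R" for z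
  proof -
    have "x = y \<oplus>\<^bsub>R\<^esub> (x \<ominus>\<^bsub>R\<^esub> y)" "(y \<oplus>\<^bsub>R\<^esub> t [^]\<^bsub>R\<^esub> n \<otimes>\<^bsub>R\<^esub> z) \<ominus>\<^bsub>R\<^esub> y = t [^]\<^bsub>R\<^esub> n \<otimes>\<^bsub>R\<^esub> z"
      using assms that by (simp_all add: R.minus_eq R.a_ac R.r_neg R.r_neg1 R.r_neg2)
    then show ?thesis by metis
  qed
  then show ?thesis
    unfolding q_def R.quotient_eq_iff_same_a_r_cos[OF M_ideal assms, symmetric] M_iff cong_def
    using assms by blast
qed

lemma q_mem: "y \<in> carrier R \<Longrightarrow> x \<in> q n y \<longleftrightarrow> cong n x y"
proof -
  assume y: "y \<in> carrier R"
  have "x \<in> q n y \<longleftrightarrow> (\<exists>z\<in>carrier R. x = t [^]\<^bsub>R\<^esub> n \<otimes>\<^bsub>R\<^esub> z \<oplus>\<^bsub>R\<^esub> y)"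
    unfolding q_def a_r_coset_def' UN_iff singleton_iff Bex_def M_iff by blast
  also have "\<dots> \<longleftrightarrow> cong n x y"
    using y by (auto simp: cong_def R.a_comm)
  finally show ?thesis .
qed

lemma cong_refl: "x \<in> carrier R \<Longrightarrow> cong n x x"
  by (auto simp: cong_def intro!: bexI[of _ "\<zero>\<^bsub>R\<^esub>"])

lemma cong_sym: "cong n x y \<Longrightarrow> cong n y x"
  using q_eq_iff by (metis cong_def)

lemma cong_trans: "cong n x y \<Longrightarrow> cong n y z \<Longrightarrow> cong n x z"
  using q_eq_iff by (metis cong_def)

lemma cong_closed: "cong n x y \<Longrightarrow> x \<in> carrier R" "cong n x y \<Longrightarrow> y \<in> carrier R"
  by (auto simp: cong_def)

lemma cong_add: "cong n x y \<Longrightarrow> cong n x' y' \<Longrightarrow> cong n (x \<oplus>\<^bsub>R\<^esub> x') (y \<oplus>\<^bsub>R\<^esub> y')"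
  unfolding cong_def
proof (elim conjE bexE, intro conjI)
  fix z z' assume z: "x \<in> carrier R" "y \<in> carrier R" "x' \<in> carrier R" "y' \<in> carrier R" "z \<in> carrier R" "z' \<in> carrier R"
    "x = y \<oplus>\<^bsub>R\<^esub> t [^]\<^bsub>R\<^esub> n \<otimes>\<^bsub>R\<^esub> z" "x' = y' \<oplus>\<^bsub>R\<^esub> t [^]\<^bsub>R\<^esub> n \<otimes>\<^bsub>R\<^esub> z'"
  then have "x \<oplus>\<^bsub>R\<^esub> x' = y \<oplus>\<^bsub>R\<^esub> y' \<oplus>\<^bsub>R\<^esub> t [^]\<^bsub>R\<^esub> n \<otimes>\<^bsub>R\<^esub> (z \<oplus>\<^bsub>R\<^esub> z')"
    by (simp add: R.r_distr R.a_ac)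
  then show "\<exists>z\<in>carrier R. x \<oplus>\<^bsub>R\<^esub> x' = y \<oplus>\<^bsub>R\<^esub> y' \<oplus>\<^bsub>R\<^esub> t [^]\<^bsub>R\<^esub> n \<otimes>\<^bsub>R\<^esub> z" by (rule bexI) (use z(1-6) in simp)
qed auto

lemma cong_mult_left: "cong n x y \<Longrightarrow> r \<in> carrier R \<Longrightarrow> cong n (r \<otimes>\<^bsub>R\<^esub> x) (r \<otimes>\<^bsub>R\<^esub> y)"
  unfolding cong_def
proof (elim conjE bexE, intro conjI)
  fix z assume z: "x \<in> carrier R" "y \<in> carrier R" "r \<in> carrier R" "z \<in> carrier R" "x = y \<oplus>\<^bsub>R\<^esub> t [^]\<^bsub>R\<^esub> n \<otimes>\<^bsub>R\<^esub> z"
  then have "r \<otimes>\<^bsub>R\<^esub> x = r \<otimes>\<^bsub>R\<^esub> y \<oplus>\<^bsub>R\<^esub> t [^]\<^bsub>R\<^esub> n \<otimes>\<^bsub>R\<^esub> (r \<otimes>\<^bsub>R\<^esub> z)"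
    by (simp add: R.r_distr R.m_lcomm)
  then show "\<exists>z\<in>carrier R. r \<otimes>\<^bsub>R\<^esub> x = r \<otimes>\<^bsub>R\<^esub> y \<oplus>\<^bsub>R\<^esub> t [^]\<^bsub>R\<^esub> n \<otimes>\<^bsub>R\<^esub> z" by (rule bexI) (use z(1-4) in simp)
qed auto

lemma cong_t: "cong n x y \<Longrightarrow> cong (Suc n) (t \<otimes>\<^bsub>R\<^esub> x) (t \<otimes>\<^bsub>R\<^esub> y)"
  unfolding cong_def
proof (elim conjE bexE, intro conjI)
  fix z assume z: "x \<in> carrier R" "y \<in> carrier R" "z \<in> carrier R" "x = y \<oplus>\<^bsub>R\<^esub> t [^]\<^bsub>R\<^esub> n \<otimes>\<^bsub>R\<^esub> z"
  then have "t \<otimes>\<^bsub>R\<^esub> x = t \<otimes>\<^bsub>R\<^esub> y \<oplus>\<^bsub>R\<^esub> t [^]\<^bsub>R\<^esub> Suc n \<otimes>\<^bsub>R\<^esub> z"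
    by (simp add: R.r_distr R.m_ac)
  then show "\<exists>z\<in>carrier R. t \<otimes>\<^bsub>R\<^esub> x = t \<otimes>\<^bsub>R\<^esub> y \<oplus>\<^bsub>R\<^esub> t [^]\<^bsub>R\<^esub> Suc n \<otimes>\<^bsub>R\<^esub> z" by (rule bexI) (use z(1-3) in simp)
qed auto

lemma cong_Suc: "cong (Suc n) x y \<Longrightarrow> cong n x y"
  unfolding cong_def
proof (elim conjE bexE, intro conjI)
  fix z assume z: "x \<in> carrier R" "y \<in> carrier R" "z \<in> carrier R" "x = y \<oplus>\<^bsub>R\<^esub> t [^]\<^bsub>R\<^esub> Suc n \<otimes>\<^bsub>R\<^esub> z"
  then have "x = y \<oplus>\<^bsub>R\<^esub> t [^]\<^bsub>R\<^esub> n \<otimes>\<^bsub>R\<^esub> (t \<otimes>\<^bsub>R\<^esub> z)"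
    by (simp add: R.m_assoc)
  then show "\<exists>z\<in>carrier R. x = y \<oplus>\<^bsub>R\<^esub> t [^]\<^bsub>R\<^esub> n \<otimes>\<^bsub>R\<^esub> z" by (rule bexI) (use z(1-3) in simp)
qed auto

lemma cong_0: "x \<in> carrier R \<Longrightarrow> y \<in> carrier R \<Longrightarrow> cong 0 x y"
  unfolding cong_def
  by (auto intro!: bexI[of _ "x \<ominus>\<^bsub>R\<^esub> y"] simp: R.minus_eq R.a_ac R.r_neg R.r_neg1 R.r_neg2)

text \<open>The series truncated below degree \<open>n\<close> and evaluated at \<open>t\<close>.
  The Horner form peels coefficients off the front, matching \<open>fps_shift\<close>.\<close>

primrec \<tau> :: "nat \<Rightarrow> 'k fps \<Rightarrow> 'r" where
  "\<tau> 0 F = \<zero>\<^bsub>R\<^esub>"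
| "\<tau> (Suc n) F = \<kappa> (F $ 0) \<oplus>\<^bsub>R\<^esub> t \<otimes>\<^bsub>R\<^esub> \<tau> n (fps_shift 1 F)"

lemma tau_closed [simp]: "\<tau> n F \<in> carrier R"
  by (induction n arbitrary: F) auto

lemma tau_add: "\<tau> n (F + G) = \<tau> n F \<oplus>\<^bsub>R\<^esub> \<tau> n G"
  by (induction n arbitrary: F G) (simp_all add: fps_shift_add R.r_distr R.a_ac)

lemma tau_zero [simp]: "\<tau> n 0 = \<zero>\<^bsub>R\<^esub>"
  by (induction n) auto

lemma tau_const: "\<tau> (Suc n) (fps_const c) = \<kappa> c"
  by (simp add: fps_shift_fps_const)

lemma tau_const_mult: "\<tau> n (fps_const c * F) = \<kappa> c \<otimes>\<^bsub>R\<^esub> \<tau> n F"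
proof (induction n arbitrary: F)
  case (Suc n)
  have "fps_shift 1 (fps_const c * F) = fps_const c * fps_shift 1 F"
    by (rule fps_ext) simp
  then show ?case using Suc by (simp add: R.r_distr R.m_lcomm)
qed simp

lemma tau_Suc_end: "\<tau> (Suc n) F = \<tau> n F \<oplus>\<^bsub>R\<^esub> \<kappa> (F $ n) \<otimes>\<^bsub>R\<^esub> t [^]\<^bsub>R\<^esub> n"
proof (induction n arbitrary: F)
  case (Suc n)
  have "\<tau> (Suc n) (fps_shift 1 F) = \<tau> n (fps_shift 1 F) \<oplus>\<^bsub>R\<^esub> \<kappa> (F $ Suc n) \<otimes>\<^bsub>R\<^esub> t [^]\<^bsub>R\<^esub> n"
    using Suc[of "fps_shift 1 F"] by (simp del: \<tau>.simps)
  then have "\<tau> (Suc (Suc n)) F = \<kappa> (F $ 0) \<oplus>\<^bsub>R\<^esub> t \<otimes>\<^bsub>R\<^esub> (\<tau> n (fps_shift 1 F) \<oplus>\<^bsub>R\<^esub> \<kappa> (F $ Suc n) \<otimes>\<^bsub>R\<^esub> t [^]\<^bsub>R\<^esub> n)"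
    by (simp only: \<tau>.simps(2)[of "Suc n" F])
  also have "\<dots> = \<tau> (Suc n) F \<oplus>\<^bsub>R\<^esub> \<kappa> (F $ Suc n) \<otimes>\<^bsub>R\<^esub> t [^]\<^bsub>R\<^esub> Suc n"
    by (simp add: R.r_distr R.a_assoc R.m_ac)
  finally show ?case .
qed simp

lemma tau_cong: "cong n (\<tau> (Suc n) F) (\<tau> n F)"
  unfolding cong_def tau_Suc_end by (auto intro!: bexI[of _ "\<kappa> (F $ n)"] simp: R.m_comm)

lemma fps_split: "F = fps_const (F $ 0) + fps_X * fps_shift 1 F" for F :: "'k fps"
  by (rule fps_ext) simp

lemma tau_X: "\<tau> (Suc n) (fps_X * F) = t \<otimes>\<^bsub>R\<^esub> \<tau> n F"
proof -
  have "fps_shift 1 (fps_X * F) = F" by (rule fps_ext) simp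
  then show ?thesis by simp
qed

text \<open>Split off the constant term of \<open>F\<close>. The remaining product carries a factor
  \<open>t\<close>, which turns the inductive congruence modulo \<open>t^n\<close> into one modulo
  \<open>t^(n+1)\<close>.\<close>

lemma tau_mult: "cong n (\<tau> n (F * G)) (\<tau> n F \<otimes>\<^bsub>R\<^esub> \<tau> n G)"
proof (induction n arbitrary: F G)
  case 0
  then show ?case by (simp add: cong_refl)
next
  case (Suc n)
  let ?F = "fps_shift 1 F" and ?G = "fps_shift 1 G"
  have "F * G = fps_const (F $ 0) * G + fps_X * (?F * G)"
    by (subst fps_split[of F]) (simp add: algebra_simps)
  then have "\<tau> (Suc n) (F * G) = \<kappa> (F $ 0) \<otimes>\<^bsub>R\<^esub> \<tau> (Suc n) G \<oplus>\<^bsub>R\<^esub> t \<otimes>\<^bsub>R\<^esub> \<tau> n (?F * G)"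
    by (simp only: tau_add tau_const_mult tau_X)
  moreover have "cong (Suc n) (t \<otimes>\<^bsub>R\<^esub> \<tau> n (?F * G)) (t \<otimes>\<^bsub>R\<^esub> (\<tau> n ?F \<otimes>\<^bsub>R\<^esub> \<tau> (Suc n) G))"
    by (rule cong_t, rule cong_trans[OF Suc], rule cong_mult_left[OF cong_sym[OF tau_cong]]) simp
  ultimately have "cong (Suc n) (\<tau> (Suc n) (F * G))
    (\<kappa> (F $ 0) \<otimes>\<^bsub>R\<^esub> \<tau> (Suc n) G \<oplus>\<^bsub>R\<^esub> t \<otimes>\<^bsub>R\<^esub> (\<tau> n ?F \<otimes>\<^bsub>R\<^esub> \<tau> (Suc n) G))"
    using cong_add[OF cong_refl[of "\<kappa> (F $ 0) \<otimes>\<^bsub>R\<^esub> \<tau> (Suc n) G" "Suc n"]] by simp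
  moreover have "\<kappa> (F $ 0) \<otimes>\<^bsub>R\<^esub> \<tau> (Suc n) G \<oplus>\<^bsub>R\<^esub> t \<otimes>\<^bsub>R\<^esub> (\<tau> n ?F \<otimes>\<^bsub>R\<^esub> \<tau> (Suc n) G) = \<tau> (Suc n) F \<otimes>\<^bsub>R\<^esub> \<tau> (Suc n) G"
    unfolding \<tau>.simps(2)[of n F] by (simp add: R.l_distr R.m_assoc del: \<tau>.simps)
  ultimately show ?case by simp
qed

text \<open>If \<open>t^n = t^(n+1) s\<close>, then \<open>t^n (1 - t s) = 0\<close>. As
  \<open>1 - t s\<close> lies outside the maximal ideal it is a unit, and \<open>t^n\<close> would
  vanish.\<close>

lemma t_pow_notin: "t [^]\<^bsub>R\<^esub> n \<notin> M (Suc n)"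
proof
  assume "t [^]\<^bsub>R\<^esub> n \<in> M (Suc n)"
  then obtain s where s: "s \<in> carrier R" "t [^]\<^bsub>R\<^esub> n = t [^]\<^bsub>R\<^esub> Suc n \<otimes>\<^bsub>R\<^esub> s" by (auto simp: M_iff)
  let ?x = "\<one>\<^bsub>R\<^esub> \<ominus>\<^bsub>R\<^esub> t \<otimes>\<^bsub>R\<^esub> s"
  interpret m: ideal "PIdl\<^bsub>R\<^esub> t" R by (rule R.cgenideal_ideal[OF t])
  have ts: "t \<otimes>\<^bsub>R\<^esub> s \<in> PIdl\<^bsub>R\<^esub> t" by (rule m.I_r_closed[OF R.cgenideal_self[OF t] s(1)])
  have "?x \<notin> PIdl\<^bsub>R\<^esub> t"
  proof
    assume "?x \<in> PIdl\<^bsub>R\<^esub> t"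
    then have "?x \<oplus>\<^bsub>R\<^esub> t \<otimes>\<^bsub>R\<^esub> s \<in> PIdl\<^bsub>R\<^esub> t" using ts by simp
    moreover have "?x \<oplus>\<^bsub>R\<^esub> t \<otimes>\<^bsub>R\<^esub> s = \<one>\<^bsub>R\<^esub>" using s by (simp add: R.minus_eq R.a_assoc R.l_neg)
    ultimately show False using nonunits by (auto simp: nonunits_def)
  qed
  then have x: "?x \<in> Units R"
    using s(1) unfolding nonunits[symmetric] nonunits_def by simp
  have "t [^]\<^bsub>R\<^esub> n \<otimes>\<^bsub>R\<^esub> ?x = t [^]\<^bsub>R\<^esub> n \<ominus>\<^bsub>R\<^esub> t [^]\<^bsub>R\<^esub> Suc n \<otimes>\<^bsub>R\<^esub> s"
    using s(1) by (simp add: R.minus_eq R.r_distr R.r_minus R.m_assoc)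
  also have "\<dots> = \<zero>\<^bsub>R\<^esub>"
    unfolding s(2)[symmetric] by (simp add: R.minus_eq R.r_neg)
  finally have "t [^]\<^bsub>R\<^esub> n \<otimes>\<^bsub>R\<^esub> ?x \<otimes>\<^bsub>R\<^esub> inv\<^bsub>R\<^esub> ?x = \<zero>\<^bsub>R\<^esub>" using x by simp
  then have "t [^]\<^bsub>R\<^esub> n = \<zero>\<^bsub>R\<^esub>"
    using x R.Units_closed[OF x] by (simp only: R.m_assoc R.nat_pow_closed t R.Units_inv_closed R.Units_r_inv R.r_one)
  then show False using not_nilpotent by simp
qed

section \<open>The completion as a power series ring\<close>

abbreviation "A \<equiv> adic_completion R (nonunits R)"

definition \<Phi> :: "'k fps \<Rightarrow> nat \<Rightarrow> 'r set" where "\<Phi> F = (\<lambda>n. q n (\<tau> n F))"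

lemma quot_carrier: "carrier (R Quot M n) = q n ` carrier R"
  by (auto simp: FactRing_def A_RCOSETS_def' q_def)

lemma A_carrier: "\<alpha> \<in> carrier A \<longleftrightarrow> (\<forall>n. \<alpha> n \<in> q n ` carrier R) \<and> (\<forall>n. \<alpha> (Suc n) \<subseteq> \<alpha> n)"
  by (simp add: adic_completion_def Let_def M_eq quot_carrier)

lemma A_ops: "(\<alpha> \<otimes>\<^bsub>A\<^esub> \<beta>) n = \<alpha> n \<otimes>\<^bsub>R Quot M n\<^esub> \<beta> n" "(\<alpha> \<oplus>\<^bsub>A\<^esub> \<beta>) n = \<alpha> n \<oplus>\<^bsub>R Quot M n\<^esub> \<beta> n"
  "\<one>\<^bsub>A\<^esub> n = \<one>\<^bsub>R Quot M n\<^esub>" "\<zero>\<^bsub>A\<^esub> n = \<zero>\<^bsub>R Quot M n\<^esub>"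
  by (simp_all add: adic_completion_def Let_def M_eq)

lemma q_hom: "q n \<in> ring_hom R (R Quot M n)"
  using ideal.rcos_ring_hom[OF M_ideal, of n] by (simp add: q_def[abs_def])

lemma Phi_closed: "\<Phi> F \<in> carrier A"
proof -
  have "q (Suc n) (\<tau> (Suc n) F) \<subseteq> q n (\<tau> n F)" for n
    using cong_trans[OF cong_Suc tau_cong] by (auto simp: q_mem simp del: \<tau>.simps)
  then show ?thesis by (auto simp: A_carrier \<Phi>_def)
qed

lemma Phi_add: "\<Phi> (F + G) = \<Phi> F \<oplus>\<^bsub>A\<^esub> \<Phi> G"
  by (rule ext) (simp add: \<Phi>_def A_ops tau_add ring_hom_add[OF q_hom])

lemma Phi_mult: "\<Phi> (F * G) = \<Phi> F \<otimes>\<^bsub>A\<^esub> \<Phi> G"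
proof
  fix n
  have "q n (\<tau> n (F * G)) = q n (\<tau> n F \<otimes>\<^bsub>R\<^esub> \<tau> n G)"
    using tau_mult[of n F G] by (simp add: q_eq_iff)
  then show "\<Phi> (F * G) n = (\<Phi> F \<otimes>\<^bsub>A\<^esub> \<Phi> G) n"
    by (simp add: \<Phi>_def A_ops ring_hom_mult[OF q_hom])
qed

lemma Phi_const: "\<Phi> (fps_const c) n = q n (\<kappa> c)"
proof (cases n)
  case 0
  then show ?thesis by (simp add: \<Phi>_def q_eq_iff cong_0)
next
  case (Suc m)
  then show ?thesis by (simp only: \<Phi>_def tau_const)
qed

lemma Phi_one: "\<Phi> 1 = \<one>\<^bsub>A\<^esub>"
  using Phi_const[of 1] by (intro ext) (simp add: A_ops ring_hom_one[OF q_hom])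

lemma Phi_zero: "\<Phi> 0 = \<zero>\<^bsub>A\<^esub>"
  using Phi_const[of 0] ring_hom_zero[OF q_hom R.ring_axioms ideal.quotient_is_ring[OF M_ideal]]
  by (intro ext) (simp add: A_ops)

text \<open>At the first degree \<open>k\<close> where the series differ, comparison modulo
  \<open>t^(k+1)\<close> would put a unit multiple of \<open>t^k\<close> into the ideal of
  \<open>t^(k+1)\<close>.\<close>

lemma Phi_inj: "\<Phi> F = \<Phi> G \<Longrightarrow> F = G"
proof (rule ccontr)
  assume eq: "\<Phi> F = \<Phi> G" and "F \<noteq> G"
  define H where "H = F - G"
  have nz: "H \<noteq> 0" using \<open>F \<noteq> G\<close> by (simp add: H_def)
  define k where "k = subdegree H"
  have tau_low: "\<tau> n E = \<zero>\<^bsub>R\<^esub>" if "\<forall>i<n. E $ i = 0" for n and E :: "'k fps"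
    using that by (induction n) (simp_all add: tau_Suc_end del: \<tau>.simps(2))
  have tauH: "\<tau> (Suc k) H = \<kappa> (H $ k) \<otimes>\<^bsub>R\<^esub> t [^]\<^bsub>R\<^esub> k"
  proof -
    have "\<tau> k H = \<zero>\<^bsub>R\<^esub>" by (rule tau_low) (unfold k_def, blast intro: nth_less_subdegree_zero)
    then show ?thesis unfolding tau_Suc_end by simp
  qed
  have "cong (Suc k) (\<tau> (Suc k) F) (\<tau> (Suc k) G)"
    using fun_cong[OF eq, of "Suc k"] by (simp add: \<Phi>_def q_eq_iff del: \<tau>.simps)
  moreover have "\<tau> (Suc k) F = \<tau> (Suc k) G \<oplus>\<^bsub>R\<^esub> \<tau> (Suc k) H"
    using tau_add[of "Suc k" G H] by (simp add: H_def del: \<tau>.simps)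
  ultimately obtain z where z: "z \<in> carrier R" "\<tau> (Suc k) G \<oplus>\<^bsub>R\<^esub> \<tau> (Suc k) H = \<tau> (Suc k) G \<oplus>\<^bsub>R\<^esub> t [^]\<^bsub>R\<^esub> Suc k \<otimes>\<^bsub>R\<^esub> z"
    by (auto simp: cong_def simp del: \<tau>.simps)
  then have "\<tau> (Suc k) H = t [^]\<^bsub>R\<^esub> Suc k \<otimes>\<^bsub>R\<^esub> z"
    by (simp del: \<tau>.simps)
  then have e: "\<kappa> (H $ k) \<otimes>\<^bsub>R\<^esub> t [^]\<^bsub>R\<^esub> k = t [^]\<^bsub>R\<^esub> Suc k \<otimes>\<^bsub>R\<^esub> z" using tauH by simp
  have c: "H $ k \<noteq> 0" using nz by (simp add: k_def)
  let ?i = "\<kappa> (inverse (H $ k))"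
  have "?i \<otimes>\<^bsub>R\<^esub> \<kappa> (H $ k) = \<one>\<^bsub>R\<^esub>"
    using c by (metis kappa_simps(3,4) left_inverse)
  then have "t [^]\<^bsub>R\<^esub> k = ?i \<otimes>\<^bsub>R\<^esub> (\<kappa> (H $ k) \<otimes>\<^bsub>R\<^esub> t [^]\<^bsub>R\<^esub> k)"
    by (simp flip: R.m_assoc)
  also have "\<dots> = t [^]\<^bsub>R\<^esub> Suc k \<otimes>\<^bsub>R\<^esub> (?i \<otimes>\<^bsub>R\<^esub> z)"
    unfolding e using z by (simp add: R.m_lcomm)
  finally have "t [^]\<^bsub>R\<^esub> k \<in> M (Suc k)"
    unfolding M_iff by (rule bexI) (use z(1) in simp)
  then show False using t_pow_notin by blast
qed

text \<open>Digits are found one at a time: the error of a partial sum is \<open>t^n z\<close>, and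
  the residue of \<open>z\<close> is the next coefficient.\<close>

lemma Phi_surj:
  assumes "\<alpha> \<in> carrier A"
  obtains F where "\<alpha> = \<Phi> F"
proof -
  have "\<exists>r\<in>carrier R. \<alpha> n = q n r" for n using assms unfolding A_carrier by blast
  then obtain r where r: "\<And>n. r n \<in> carrier R" "\<And>n. \<alpha> n = q n (r n)" by metis
  have step: "cong n (r (Suc n)) (r n)" for n
  proof -
    have "r (Suc n) \<in> \<alpha> (Suc n)" using r by (simp add: q_mem cong_refl)
    then have "r (Suc n) \<in> q n (r n)" using assms r(2)[of n] unfolding A_carrier by blast
    then show ?thesis using r by (simp add: q_mem)
  qed
  \<comment> \<open>The digit following the partial sum \<open>x\<close>. It has the stated property
    only if \<open>x\<close> is correct modulo \<open>t^n\<close>, which \<open>rx\<close>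
    establishes along the recursion.\<close>
  define d where "d n x = (SOME c. cong (Suc n) (r (Suc n)) (x \<oplus>\<^bsub>R\<^esub> \<kappa> c \<otimes>\<^bsub>R\<^esub> t [^]\<^bsub>R\<^esub> n))" for n x
  define x where "x = rec_nat \<zero>\<^bsub>R\<^esub> (\<lambda>n x. x \<oplus>\<^bsub>R\<^esub> \<kappa> (d n x) \<otimes>\<^bsub>R\<^esub> t [^]\<^bsub>R\<^esub> n)"
  have x0: "x 0 = \<zero>\<^bsub>R\<^esub>" and xS: "x (Suc n) = x n \<oplus>\<^bsub>R\<^esub> \<kappa> (d n (x n)) \<otimes>\<^bsub>R\<^esub> t [^]\<^bsub>R\<^esub> n" for n
    by (simp_all add: x_def)
  have rx: "cong n (r n) (x n)" for n
  proof (induction n)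
    case 0
    then show ?case using r by (simp add: cong_0 x0)
  next
    case (Suc n)
    then obtain z where z: "x n \<in> carrier R" "z \<in> carrier R" "r (Suc n) = x n \<oplus>\<^bsub>R\<^esub> t [^]\<^bsub>R\<^esub> n \<otimes>\<^bsub>R\<^esub> z"
      using cong_trans[OF step Suc] by (auto simp: cong_def)
    obtain c where "z \<ominus>\<^bsub>R\<^esub> \<kappa> c \<in> M 1" using residue[OF z(2)] by (auto simp: M_def)
    then obtain y where y: "y \<in> carrier R" "z \<ominus>\<^bsub>R\<^esub> \<kappa> c = t \<otimes>\<^bsub>R\<^esub> y" by (auto simp: M_iff)
    have "z = \<kappa> c \<oplus>\<^bsub>R\<^esub> (z \<ominus>\<^bsub>R\<^esub> \<kappa> c)" using z by (simp add: R.minus_eq R.a_lcomm R.r_neg)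
    then have zc: "z = \<kappa> c \<oplus>\<^bsub>R\<^esub> t \<otimes>\<^bsub>R\<^esub> y" using y by simp
    have "r (Suc n) = x n \<oplus>\<^bsub>R\<^esub> \<kappa> c \<otimes>\<^bsub>R\<^esub> t [^]\<^bsub>R\<^esub> n \<oplus>\<^bsub>R\<^esub> t [^]\<^bsub>R\<^esub> Suc n \<otimes>\<^bsub>R\<^esub> y"
      unfolding z(3) zc using y z(1) by (simp add: R.r_distr R.m_ac R.a_assoc)
    then have "cong (Suc n) (r (Suc n)) (x n \<oplus>\<^bsub>R\<^esub> \<kappa> c \<otimes>\<^bsub>R\<^esub> t [^]\<^bsub>R\<^esub> n)"
      unfolding cong_def using y z(1) r by (intro conjI bexI[of _ y]) auto
    then show ?case unfolding xS d_def by (rule someI)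
  qed
  define F where "F = Abs_fps (\<lambda>n. d n (x n))"
  have F: "F $ n = d n (x n)" for n by (simp add: F_def)
  have xt: "x n = \<tau> n F" for n
  proof (induction n)
    case 0
    show ?case unfolding x0 \<tau>.simps(1) ..
  next
    case (Suc n)
    show ?case unfolding xS tau_Suc_end F Suc[symmetric] ..
  qed
  have "\<alpha> = \<Phi> F"
  proof
    fix n
    have "q n (r n) = q n (\<tau> n F)"
      unfolding q_eq_iff[OF r(1) tau_closed] using rx[of n] unfolding xt .
    then show "\<alpha> n = \<Phi> F n" unfolding r(2)[of n] \<Phi>_def .
  qed
  then show thesis by (rule that)
qed

sublocale A: type_model A \<Phi>
proof
  have "range \<Phi> = carrier A"
  proof (intro equalityI subsetI)
    fix \<alpha> assume "\<alpha> \<in> carrier A"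
    then show "\<alpha> \<in> range \<Phi>" by (rule Phi_surj) (rule range_eqI)
  qed (use Phi_closed in blast)
  moreover have "inj \<Phi>" by (rule injI) (rule Phi_inj)
  ultimately show "bij_betw \<Phi> UNIV (carrier A)" unfolding bij_betw_def by blast
qed (simp_all only: Phi_add Phi_mult Phi_one Phi_zero)

lemma to_completion_const: "to_completion R (nonunits R) (\<kappa> c) = \<Phi> (fps_const c)"
  by (rule ext) (simp add: to_completion_def M_eq Phi_const q_def)

end

section \<open>Fraction fields of power series rings\<close>

locale fps_model = type_model A \<Phi>
  for A :: "('a, 'm) ring_scheme" and \<Phi> :: "'k::field fps \<Rightarrow> 'a"
begin

lemma nonunits_A: "nonunits A = PIdl\<^bsub>A\<^esub> (\<Phi> fps_X)"
proof -
  have "\<Phi> F \<in> nonunits A \<longleftrightarrow> \<Phi> F \<in> PIdl\<^bsub>A\<^esub> (\<Phi> fps_X)" for F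
  proof -
    have "\<Phi> F \<in> nonunits A \<longleftrightarrow> F $ 0 = 0"
      by (simp add: nonunits_def h_unit fps_is_unit_iff)
    also have "\<dots> \<longleftrightarrow> (\<exists>G. F = G * fps_X)"
    proof
      assume "F $ 0 = 0"
      then have "F = fps_shift 1 F * fps_X" by (intro fps_ext) simp
      then show "\<exists>G. F = G * fps_X" by blast
    qed auto
    also have "\<dots> \<longleftrightarrow> \<Phi> F \<in> PIdl\<^bsub>A\<^esub> (\<Phi> fps_X)"
    proof
      assume "\<exists>G. F = G * fps_X"
      then show "\<Phi> F \<in> PIdl\<^bsub>A\<^esub> (\<Phi> fps_X)" using h_mult h_closed unfolding cgenideal_def by blast
    next
      assume "\<Phi> F \<in> PIdl\<^bsub>A\<^esub> (\<Phi> fps_X)"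
      then obtain x where "x \<in> carrier A" "\<Phi> F = x \<otimes>\<^bsub>A\<^esub> \<Phi> fps_X" unfolding cgenideal_def by blast
      then obtain G where "\<Phi> F = \<Phi> (G * fps_X)" using h_cases h_mult by metis
      then show "\<exists>G. F = G * fps_X" unfolding h_eq_iff by blast
    qed
    finally show ?thesis .
  qed
  moreover have "nonunits A \<subseteq> carrier A" by (auto simp: nonunits_def)
  moreover have "PIdl\<^bsub>A\<^esub> (\<Phi> fps_X) \<subseteq> carrier A" by (auto simp: cgenideal_def)
  ultimately show ?thesis using h_cases by blast
qed

lemma nonunits_power: "\<Phi> F \<in> nonunits A [^]\<^bsub>ideals_set A\<^esub> n \<longleftrightarrow> fps_X ^ n dvd F"
proof -
  have "\<Phi> F \<in> nonunits A [^]\<^bsub>ideals_set A\<^esub> n \<longleftrightarrow> (\<exists>G. \<Phi> F = \<Phi> G \<otimes>\<^bsub>A\<^esub> \<Phi> (fps_X ^ n))"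
  proof -
    have "nonunits A [^]\<^bsub>ideals_set A\<^esub> n = PIdl\<^bsub>A\<^esub> (\<Phi> (fps_X ^ n))"
      unfolding nonunits_A S.principal_power[OF h_closed] h_pow[symmetric] ..
    then show ?thesis unfolding cgenideal_def using h_cases h_closed by blast
  qed
  then show ?thesis by (auto simp: dvd_def mult.commute simp flip: h_mult)
qed

lemma dvr_order_eq: "F \<noteq> 0 \<Longrightarrow> dvr_order A (\<Phi> F) = subdegree F"
  unfolding dvr_order_def nonunits_power
  by (rule Greatest_equality) (simp_all add: fps_dvd_iff)

text \<open>An element of \<open>fraction_field\<close> is the set of all pairs that represent one
  fraction; here it is the fraction equal to the Laurent series \<open>F\<close>.\<close>

definition \<Psi> :: "'k fls \<Rightarrow> ('a \<times> 'a) set" where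
  "\<Psi> F = {(\<Phi> c, \<Phi> d) | c d. d \<noteq> 0 \<and> fps_to_fls c = F * fps_to_fls d}"

abbreviation "K \<equiv> fraction_field A"

lemma fraction_eq:
  assumes "b \<noteq> 0"
  shows "fraction A (\<Phi> a) (\<Phi> b) = \<Psi> (fps_to_fls a / fps_to_fls b)"
proof -
  have "\<Phi> a \<otimes>\<^bsub>A\<^esub> \<Phi> d = \<Phi> c \<otimes>\<^bsub>A\<^esub> \<Phi> b \<longleftrightarrow> fps_to_fls c = fps_to_fls a / fps_to_fls b * fps_to_fls d" for c d
  proof -
    have "\<Phi> a \<otimes>\<^bsub>A\<^esub> \<Phi> d = \<Phi> c \<otimes>\<^bsub>A\<^esub> \<Phi> b \<longleftrightarrow> a * d = c * b" by (simp flip: h_mult)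
    also have "\<dots> \<longleftrightarrow> fps_to_fls a * fps_to_fls d = fps_to_fls c * fps_to_fls b"
      by (simp flip: fls_times_fps_to_fls)
    also have "\<dots> \<longleftrightarrow> fps_to_fls c = fps_to_fls a / fps_to_fls b * fps_to_fls d"
      using assms by (auto simp: field_simps)
    finally show ?thesis .
  qed
  note eq = this
  show ?thesis
  proof (intro equalityI subrelI)
    fix x y assume xy: "(x, y) \<in> fraction A (\<Phi> a) (\<Phi> b)"
    then have "x \<in> carrier A" "y \<in> carrier A" by (auto simp: fraction_def)
    then obtain c d where cd: "x = \<Phi> c" "y = \<Phi> d" using h_cases by meson
    with xy have "d \<noteq> 0" "\<Phi> a \<otimes>\<^bsub>A\<^esub> \<Phi> d = \<Phi> c \<otimes>\<^bsub>A\<^esub> \<Phi> b" by (auto simp: fraction_def h_zero)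
    then show "(x, y) \<in> \<Psi> (fps_to_fls a / fps_to_fls b)"
      unfolding cd eq \<Psi>_def by blast
  next
    fix x y assume "(x, y) \<in> \<Psi> (fps_to_fls a / fps_to_fls b)"
    then obtain c d where "x = \<Phi> c" "y = \<Phi> d" "d \<noteq> 0" "\<Phi> a \<otimes>\<^bsub>A\<^esub> \<Phi> d = \<Phi> c \<otimes>\<^bsub>A\<^esub> \<Phi> b"
      unfolding \<Psi>_def eq by blast
    then show "(x, y) \<in> fraction A (\<Phi> a) (\<Phi> b)" by (simp add: fraction_def flip: h_zero)
  qed
qed

text \<open>A power of \<open>fls_X\<close> clears the pole; its exponent is 0 when there is
  none.\<close>

lemma fls_quotient: "\<exists>a b. b \<noteq> 0 \<and> F = fps_to_fls a / fps_to_fls b" for F :: "'k fls"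
proof (cases "F = 0")
  case True
  then show ?thesis by (intro exI[of _ 0] exI[of _ 1]) simp
next
  case False
  let ?n = "nat (- fls_subdegree F)"
  let ?G = "fls_X ^ ?n * F"
  have "0 \<le> fls_subdegree ?G" using False by simp
  then have "fps_to_fls (fls_regpart ?G) = ?G" by (rule fls_regpart_to_fls_trivial)
  moreover have "F = ?G / fls_X ^ ?n"
    by (rule nonzero_mult_div_cancel_left[symmetric]) simp
  moreover have "fps_to_fls (fps_X ^ ?n) = (fls_X ^ ?n :: 'k fls)"
    by (simp add: fps_to_fls_power)
  ultimately have "F = fps_to_fls (fls_regpart ?G) / fps_to_fls (fps_X ^ ?n)" by (simp only:)
  moreover have "fps_X ^ ?n \<noteq> (0::'k fps)" by simp
  ultimately show ?thesis by blast
qed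

lemma Psi_nonempty: "\<exists>a b. b \<noteq> 0 \<and> (\<Phi> a, \<Phi> b) \<in> \<Psi> F \<and> F = fps_to_fls a / fps_to_fls b"
proof -
  obtain a b :: "'k fps" where "b \<noteq> 0" "F = fps_to_fls a / fps_to_fls b" using fls_quotient by blast
  then show ?thesis by (intro exI[of _ a] exI[of _ b]) (auto simp: \<Psi>_def)
qed

lemma Psi_mem: "(x, y) \<in> \<Psi> F \<Longrightarrow> \<exists>a b. x = \<Phi> a \<and> y = \<Phi> b \<and> b \<noteq> 0 \<and> F = fps_to_fls a / fps_to_fls b"
  unfolding \<Psi>_def by (auto simp: field_simps)

lemma K_carrier: "carrier K = range \<Psi>"
proof
  show "carrier K \<subseteq> range \<Psi>"
  proof
    fix P assume "P \<in> carrier K"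
    then obtain x y where xy: "x \<in> carrier A" "y \<in> carrier A" "y \<noteq> \<zero>\<^bsub>A\<^esub>" "P = fraction A x y"
      by (auto simp: fraction_field_def)
    then obtain a b where "x = \<Phi> a" "y = \<Phi> b" using h_cases by metis
    with xy have "P = \<Psi> (fps_to_fls a / fps_to_fls b)" using fraction_eq[of b a] h_zero by auto
    then show "P \<in> range \<Psi>" by blast
  qed
  show "range \<Psi> \<subseteq> carrier K"
  proof (rule image_subsetI)
    fix F :: "'k fls"
    obtain a b where ab: "b \<noteq> 0" "F = fps_to_fls a / fps_to_fls b" using fls_quotient by blast
    have "\<Psi> F = fraction A (\<Phi> a) (\<Phi> b)" unfolding ab(2) fraction_eq[OF ab(1)] ..
    moreover have "\<Phi> b \<in> carrier A - {\<zero>\<^bsub>A\<^esub>}" using ab(1) by (simp flip: h_zero)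
    ultimately show "\<Psi> F \<in> carrier K"
      unfolding fraction_field_def partial_object.select_convs using h_closed by blast
  qed
qed

lemma Psi_inj: "\<Psi> F = \<Psi> G \<Longrightarrow> F = G"
proof -
  assume eq: "\<Psi> F = \<Psi> G"
  obtain a b where ab: "(\<Phi> a, \<Phi> b) \<in> \<Psi> F" "F = fps_to_fls a / fps_to_fls b"
    using Psi_nonempty by blast
  obtain c d where "\<Phi> a = \<Phi> c" "\<Phi> b = \<Phi> d" "G = fps_to_fls c / fps_to_fls d"
    using Psi_mem[OF ab(1)[unfolded eq]] by blast
  then show "F = G" using ab(2) by simp
qed

text \<open>The operations of \<open>fraction_field\<close> are unions over representatives, which
  collapse once all members are shown equal.\<close>

lemma union_const: "P \<noteq> {} \<Longrightarrow> (\<And>x y. (x, y) \<in> P \<Longrightarrow> f x y = C) \<Longrightarrow> (\<Union>(x, y)\<in>P. f x y) = C"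
  by fast

lemma Psi_mult: "\<Psi> (F * G) = \<Psi> F \<otimes>\<^bsub>K\<^esub> \<Psi> G"
proof -
  have "(\<Union>(a, b)\<in>\<Psi> F. \<Union>(c, d)\<in>\<Psi> G. fraction A (a \<otimes>\<^bsub>A\<^esub> c) (b \<otimes>\<^bsub>A\<^esub> d)) = \<Psi> (F * G)"
  proof (intro union_const)
    show "\<Psi> F \<noteq> {}" "\<Psi> G \<noteq> {}" using Psi_nonempty[of F] Psi_nonempty[of G] by blast+
    fix x y x' y' assume "(x, y) \<in> \<Psi> F" "(x', y') \<in> \<Psi> G"
    then obtain a b c d where "x = \<Phi> a" "y = \<Phi> b" "b \<noteq> 0" "F = fps_to_fls a / fps_to_fls b"
      "x' = \<Phi> c" "y' = \<Phi> d" "d \<noteq> 0" "G = fps_to_fls c / fps_to_fls d"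
      using Psi_mem by meson
    then show "fraction A (x \<otimes>\<^bsub>A\<^esub> x') (y \<otimes>\<^bsub>A\<^esub> y') = \<Psi> (F * G)"
      using fraction_eq[of "b * d" "a * c"] by (simp add: fls_times_fps_to_fls flip: h_mult)
  qed
  then show ?thesis by (simp add: fraction_field_def)
qed

lemma Psi_add: "\<Psi> (F + G) = \<Psi> F \<oplus>\<^bsub>K\<^esub> \<Psi> G"
proof -
  have "(\<Union>(a, b)\<in>\<Psi> F. \<Union>(c, d)\<in>\<Psi> G. fraction A ((a \<otimes>\<^bsub>A\<^esub> d) \<oplus>\<^bsub>A\<^esub> (c \<otimes>\<^bsub>A\<^esub> b)) (b \<otimes>\<^bsub>A\<^esub> d)) = \<Psi> (F + G)"
  proof (intro union_const)
    show "\<Psi> F \<noteq> {}" "\<Psi> G \<noteq> {}" using Psi_nonempty[of F] Psi_nonempty[of G] by blast+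
    fix x y x' y' assume "(x, y) \<in> \<Psi> F" "(x', y') \<in> \<Psi> G"
    then obtain a b c d where *: "x = \<Phi> a" "y = \<Phi> b" "b \<noteq> 0" "F = fps_to_fls a / fps_to_fls b"
      "x' = \<Phi> c" "y' = \<Phi> d" "d \<noteq> 0" "G = fps_to_fls c / fps_to_fls d"
      using Psi_mem by meson
    have "F + G = fps_to_fls (a * d + c * b) / fps_to_fls (b * d)"
      using * by (simp add: fls_times_fps_to_fls add_frac_eq)
    then show "fraction A ((x \<otimes>\<^bsub>A\<^esub> y') \<oplus>\<^bsub>A\<^esub> (x' \<otimes>\<^bsub>A\<^esub> y)) (y \<otimes>\<^bsub>A\<^esub> y') = \<Psi> (F + G)"
      using fraction_eq[of "b * d" "a * d + c * b"] * by (simp flip: h_mult h_add)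
  qed
  then show ?thesis by (simp add: fraction_field_def)
qed

sublocale K: type_model K \<Psi>
proof
  show "bij_betw \<Psi> UNIV (carrier K)"
    unfolding bij_betw_def K_carrier using Psi_inj by (auto simp: inj_on_def)
  show "\<Psi> 1 = \<one>\<^bsub>K\<^esub>" using fraction_eq[of 1 1] by (simp add: fraction_field_def h_one)
  show "\<Psi> 0 = \<zero>\<^bsub>K\<^esub>" using fraction_eq[of 1 0] by (simp add: fraction_field_def h_one h_zero)
qed (simp_all add: Psi_add Psi_mult)

lemma to_fraction_eq: "to_fraction A (\<Phi> a) = \<Psi> (fps_to_fls a)"
  using fraction_eq[of 1 a] by (simp add: to_fraction_def h_one)

lemma dvr_valuation_eq:
  assumes "F \<noteq> 0"
  shows "dvr_valuation A (\<Psi> F) = fls_subdegree F"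
  unfolding dvr_valuation_def
proof (rule the_equality)
  have val: "int (dvr_order A (\<Phi> a)) - int (dvr_order A (\<Phi> b)) = fls_subdegree (fps_to_fls a / fps_to_fls b)"
    if "a \<noteq> 0" "b \<noteq> 0" for a b
  proof -
    have "fls_subdegree (fps_to_fls a / fps_to_fls b * fps_to_fls b) =
      fls_subdegree (fps_to_fls a / fps_to_fls b) + fls_subdegree (fps_to_fls b)"
      using that by (intro fls_subdegree_mult) auto
    then show ?thesis using that by (simp add: dvr_order_eq fls_subdegree_fls_to_fps)
  qed
  obtain a b where ab: "b \<noteq> 0" "F = fps_to_fls a / fps_to_fls b" using fls_quotient by blast
  with assms have "a \<noteq> 0" by auto
  show "\<exists>x y. x \<in> carrier A - {\<zero>\<^bsub>A\<^esub>} \<and> y \<in> carrier A - {\<zero>\<^bsub>A\<^esub>} \<and>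
     \<Psi> F = fraction A x y \<and> fls_subdegree F = int (dvr_order A x) - int (dvr_order A y)"
    using ab \<open>a \<noteq> 0\<close> fraction_eq[OF ab(1)] val[OF \<open>a \<noteq> 0\<close> ab(1)]
    by (intro exI[of _ "\<Phi> a"] exI[of _ "\<Phi> b"]) (simp flip: h_zero)
  fix z assume "\<exists>x y. x \<in> carrier A - {\<zero>\<^bsub>A\<^esub>} \<and> y \<in> carrier A - {\<zero>\<^bsub>A\<^esub>} \<and>
     \<Psi> F = fraction A x y \<and> z = int (dvr_order A x) - int (dvr_order A y)"
  then obtain x y where xy: "x \<in> carrier A" "x \<noteq> \<zero>\<^bsub>A\<^esub>" "y \<in> carrier A" "y \<noteq> \<zero>\<^bsub>A\<^esub>"
    "\<Psi> F = fraction A x y" "z = int (dvr_order A x) - int (dvr_order A y)" by blast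
  then obtain c d where cd: "x = \<Phi> c" "y = \<Phi> d" using h_cases by metis
  then have "c \<noteq> 0" "d \<noteq> 0" using xy h_zero by auto
  then have "F = fps_to_fls c / fps_to_fls d" using fraction_eq[of d c] xy(5) cd Psi_inj by simp
  then show "z = fls_subdegree F" using val[OF \<open>c \<noteq> 0\<close> \<open>d \<noteq> 0\<close>] xy(6) cd by simp
qed

end

section \<open>Roots of power series\<close>

text \<open>Hensel lifting one coefficient at a time, starting from a root of the constant term in
  the algebraically closed field. The derivative \<open>p c^(p-1)\<close> is nonzero.\<close>

lemma fps_root_exists:
  fixes U :: "'k::alg_closed_field fps"
  assumes p: "of_nat p \<noteq> (0::'k)" and U: "U $ 0 \<noteq> 0"
  shows "\<exists>W. W ^ p = U"
proof -
  have "p > 0" using p by (cases p) auto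
  have "\<exists>c. c ^ p = U $ 0"
    using nth_root_exists[of p "U $ 0"] \<open>p > 0\<close> by auto
  then obtain c where c: "c ^ p = U $ 0" by blast
  then have c0: "c \<noteq> 0" using U \<open>p > 0\<close> by (auto simp: power_0_left)
  define Q where "Q n W \<longleftrightarrow> fps_X ^ Suc n dvd W ^ p - U \<and> W $ 0 = c" for n W
  have step: "\<exists>W'. Q (Suc n) W' \<and> fps_X ^ Suc n dvd W' - W" if Q: "Q n W" for n W
  proof -
    obtain E where E: "W ^ p - U = fps_X ^ Suc n * E" using Q by (auto simp: Q_def dvd_def)
    \<comment> \<open>Solves \<open>E $ 0 + p c^(p-1) x = 0\<close>, the condition on the correction
      in degree \<open>n + 1\<close>.\<close>
    define x where "x = - (E $ 0) / (of_nat p * c ^ (p - 1))"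
    define Y where "Y = fps_X ^ Suc n * fps_const x"
    \<comment> \<open>Binomial expansion to first order. The remainder is divisible by
      \<open>Y^2\<close>, so it does not affect degree \<open>n + 1\<close>.\<close>
    obtain Z where Z: "(W + Y) ^ p = W ^ p + of_nat p * W ^ (p - 1) * Y + Y ^ 2 * Z"
    proof -
      have "\<exists>Z. (W + Y) ^ m = W ^ m + of_nat m * W ^ (m - 1) * Y + Y ^ 2 * Z" for m
      proof (induction m)
        case (Suc m)
        then obtain Z where Z: "(W + Y) ^ m = W ^ m + of_nat m * W ^ (m - 1) * Y + Y ^ 2 * Z" by blast
        have "of_nat m * W ^ (m - 1) * W = of_nat m * W ^ m"
          by (cases m) (simp_all add: algebra_simps)
        then have "(W + Y) ^ Suc m = W ^ Suc m + of_nat (Suc m) * W ^ (Suc m - 1) * Y + Y ^ 2 * (of_nat m * W ^ (m - 1) + Z * (W + Y))"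
          unfolding power_Suc Z by (simp add: algebra_simps power2_eq_square)
        then show ?case by blast
      qed (auto intro!: exI[of _ 0])
      then show thesis using that by blast
    qed
    have "(W + Y) ^ p - U = fps_X ^ Suc n * (E + of_nat p * W ^ (p - 1) * fps_const x + fps_X ^ Suc n * fps_const x ^ 2 * Z)"
      unfolding Z using E by (simp add: Y_def algebra_simps power2_eq_square)
    moreover have "(E + of_nat p * W ^ (p - 1) * fps_const x + fps_X ^ Suc n * fps_const x ^ 2 * Z) $ 0 = 0"
    proof -
      have "(W ^ (p - 1)) $ 0 = c ^ (p - 1)" using Q by (simp add: Q_def fps_power_zeroth)
      then have "(of_nat p * W ^ (p - 1) * fps_const x) $ 0 = of_nat p * c ^ (p - 1) * x"
        by (simp add: fps_mult_nth_0)
      also have "\<dots> = - (E $ 0)" using p c0 by (simp add: x_def)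
      finally show ?thesis by (simp add: fps_mult_nth_0)
    qed
    moreover have "fps_X dvd G" if "G $ 0 = 0" for G :: "'k fps"
    proof -
      have "G = fps_X * fps_shift 1 G" using that by (intro fps_ext) simp
      then show ?thesis by (metis dvdI)
    qed
    ultimately have "fps_X ^ Suc n * fps_X dvd (W + Y) ^ p - U"
      by (metis mult_dvd_mono dvd_refl)
    then have "Q (Suc n) (W + Y)"
      using Q by (simp add: Q_def Y_def mult.commute)
    moreover have "fps_X ^ Suc n dvd W + Y - W" by (simp add: Y_def)
    ultimately show ?thesis by blast
  qed
  have "Q 0 (fps_const c)"
  proof -
    have "(fps_const c ^ p - U) $ 0 = 0" using c by (simp add: fps_const_power)
    then have "fps_const c ^ p - U = fps_X * fps_shift 1 (fps_const c ^ p - U)" by (intro fps_ext) simp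
    then have "fps_X dvd fps_const c ^ p - U" by (metis dvdI)
    then show ?thesis by (simp add: Q_def)
  qed
  then obtain W where W: "\<And>n. Q n (W n)" "\<And>n. fps_X ^ Suc n dvd W (Suc n) - W n"
    using dependent_nat_choice[of Q "\<lambda>n W W'. fps_X ^ Suc n dvd W' - W"] step by blast
  \<comment> \<open>The diagonal limit: from stage \<open>n\<close> on, the coefficients up to
    degree \<open>n\<close> no longer change.\<close>
  define V where "V = Abs_fps (\<lambda>n. W n $ n)"
  have low: "G $ i = 0" if "fps_X ^ n dvd G" "i < n" for G :: "'k fps" and i n
    using that by (auto simp: dvd_def fps_X_power_mult_nth)
  have stable: "W (n + j) $ i = W n $ i" if "i \<le> n" for n j i
    using low[OF W(2), of i "n + _"] that
    by (induction j) (auto simp: add_Suc_right dest!: spec)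
  have VW: "V $ i = W n $ i" if "i \<le> n" for i n
    using stable[of i i "n - i"] that by (simp add: V_def)
  have "(V ^ p) $ n = U $ n" for n
  proof -
    have pow: "(V ^ m) $ i = (W n ^ m) $ i" if "i \<le> n" for m i
      using that
    proof (induction m arbitrary: i)
      case (Suc m)
      have "V $ j * (V ^ m) $ (i - j) = W n $ j * (W n ^ m) $ (i - j)" if "j \<in> {0..i}" for j
        using that Suc VW[of j n] by simp
      then show ?case unfolding power_Suc fps_mult_nth by (rule sum.cong[OF refl])
    qed simp
    have "(W n ^ p - U) $ n = 0" using W(1)[of n] unfolding Q_def
      by (intro low[of "Suc n"]) simp_all
    then show ?thesis using pow[of n p] by simp
  qed
  then have "V ^ p = U" by (rule fps_ext)
  then show ?thesis ..
qed

section \<open>Homogeneous forms\<close>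

lemma poly_mapping_update_eq:
  fixes f :: "'a \<Rightarrow>\<^sub>0 'b::monoid_add"
  assumes "k \<notin> Poly_Mapping.keys f"
  shows "Poly_Mapping.update k c f = f + Poly_Mapping.single k c"
  using assms by (intro poly_mapping_eqI) (auto simp: lookup_update lookup_add lookup_single in_keys_iff when_def)

lemma mv_eval_superset:
  assumes "finite M" "Poly_Mapping.keys f \<subseteq> M"
  shows "mv_eval f v = (\<Sum>m\<in>M. Poly_Mapping.lookup f m * (\<Prod>i\<in>UNIV. v i ^ Poly_Mapping.lookup m i))"
  unfolding mv_eval_def using assms by (intro sum.mono_neutral_left) (auto simp: in_keys_iff)

lemma mv_eval_add: "mv_eval (f + g) v = mv_eval f v + mv_eval g v"
proof -
  let ?M = "Poly_Mapping.keys f \<union> Poly_Mapping.keys g"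
  have fin: "finite ?M" by simp
  show ?thesis
    unfolding mv_eval_superset[OF fin keys_add] mv_eval_superset[OF fin Un_upper1] mv_eval_superset[OF fin Un_upper2]
    by (simp add: lookup_add distrib_right sum.distrib)
qed

lemma mv_eval_single: "mv_eval (Poly_Mapping.single m c) v = c * (\<Prod>i\<in>UNIV. v i ^ Poly_Mapping.lookup m i)"
  by (subst mv_eval_superset[of "{m}"]) (auto simp: lookup_single)

lemma mv_eval_zero [simp]: "mv_eval 0 v = 0"
  by (simp add: mv_eval_def)

lemma mv_eval_single_mult:
  "mv_eval (Poly_Mapping.single m c * g) v = mv_eval (Poly_Mapping.single m c) v * mv_eval g v"
proof (induction g rule: update_induct)
  case (update g k d)
  have "mv_eval (Poly_Mapping.single m c * Poly_Mapping.single k d) v =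
    mv_eval (Poly_Mapping.single m c) v * mv_eval (Poly_Mapping.single k d) v"
    by (simp add: mult_single mv_eval_single lookup_add power_add prod.distrib)
  with update show ?case
    by (simp add: poly_mapping_update_eq distrib_left mv_eval_add)
qed simp

lemma mv_eval_mult: "mv_eval (f * g) v = mv_eval f v * mv_eval g v"
proof (induction f rule: update_induct)
  case (update f k d)
  then show ?case
    by (simp add: poly_mapping_update_eq distrib_right mv_eval_add mv_eval_single_mult)
qed simp

text \<open>Forms are treated as functions on coordinate vectors, since only their values enter; the
  zero function has every degree.\<close>

definition forms :: "nat \<Rightarrow> (('n::finite \<Rightarrow> 'k::field) \<Rightarrow> 'k) set" where
  "forms d = mv_eval ` {f. homogeneous d f}"

lemma forms_add:
  assumes "\<phi> \<in> forms d" "\<psi> \<in> forms d"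
  shows "(\<lambda>v. \<phi> v + \<psi> v) \<in> forms d"
proof -
  obtain f g where fg: "\<phi> = mv_eval f" "homogeneous d f" "\<psi> = mv_eval g" "homogeneous d g"
    using assms by (auto simp: forms_def)
  then have "homogeneous d (f + g)"
    using keys_add[of f g] by (auto simp: homogeneous_def)
  moreover have "(\<lambda>v. \<phi> v + \<psi> v) = mv_eval (f + g)" using fg by (auto simp: mv_eval_add)
  ultimately show ?thesis by (auto simp: forms_def)
qed

lemma forms_mult:
  assumes "\<phi> \<in> forms d" "\<psi> \<in> forms e"
  shows "(\<lambda>v. \<phi> v * \<psi> v) \<in> forms (d + e)"
proof -
  obtain f g where fg: "\<phi> = mv_eval f" "homogeneous d f" "\<psi> = mv_eval g" "homogeneous e g"
    using assms by (auto simp: forms_def)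
  then have "homogeneous (d + e) (f * g)"
    using keys_mult[of f g] by (fastforce simp: homogeneous_def lookup_add sum.distrib)
  moreover have "(\<lambda>v. \<phi> v * \<psi> v) = mv_eval (f * g)" using fg by (auto simp: mv_eval_mult)
  ultimately show ?thesis by (auto simp: forms_def)
qed

lemma forms_monomial: "(\<lambda>v. c * (\<Prod>i\<in>UNIV. v i ^ Poly_Mapping.lookup m i)) \<in> forms (\<Sum>i\<in>UNIV. Poly_Mapping.lookup m i)"
proof -
  have "homogeneous (\<Sum>i\<in>UNIV. Poly_Mapping.lookup m i) (Poly_Mapping.single m c)"
    by (auto simp: homogeneous_def)
  then show ?thesis unfolding forms_def mv_eval_single[symmetric, abs_def] by blast
qed

lemma forms_const: "(\<lambda>_. c) \<in> forms 0"
  using forms_monomial[of c 0] by simp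

lemma forms_coord: "(\<lambda>v. v j) \<in> (forms 1 :: (('n::finite \<Rightarrow> 'k::field) \<Rightarrow> 'k) set)"
proof -
  have "(\<Prod>i\<in>UNIV. v i ^ Poly_Mapping.lookup (Poly_Mapping.single j 1) i) = v j" for v :: "'n \<Rightarrow> 'k::field"
  proof -
    have "(\<Prod>i\<in>UNIV. v i ^ Poly_Mapping.lookup (Poly_Mapping.single j 1) i) = (\<Prod>i\<in>UNIV. if i = j then v i else 1)"
      by (intro prod.cong) (auto simp: lookup_single when_def)
    then show ?thesis by simp
  qed
  moreover have "(\<Sum>i\<in>UNIV. Poly_Mapping.lookup (Poly_Mapping.single j (1::nat)) i) = 1"
    by (simp add: lookup_single when_def)
  ultimately show ?thesis using forms_monomial[of "1::'k" "Poly_Mapping.single j 1"] by (simp only: mult_1)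
qed

lemma forms_coord_power: "(\<lambda>v. v j ^ d) \<in> forms d"
proof (induction d)
  case 0
  show ?case using forms_const[of 1] by simp
next
  case (Suc d)
  show ?case using forms_mult[OF forms_coord[of j] Suc] by simp
qed

lemma forms_induct [consumes 1, case_names zero monomial add]:
  assumes "\<phi> \<in> forms d" and "P (\<lambda>_. 0)"
    and mon: "\<And>c m. (\<Sum>i\<in>UNIV. Poly_Mapping.lookup m i) = d \<Longrightarrow> P (\<lambda>v. c * (\<Prod>i\<in>UNIV. v i ^ Poly_Mapping.lookup m i))"
    and add: "\<And>\<phi> \<psi>. \<phi> \<in> forms d \<Longrightarrow> \<psi> \<in> forms d \<Longrightarrow> P \<phi> \<Longrightarrow> P \<psi> \<Longrightarrow> P (\<lambda>v. \<phi> v + \<psi> v)"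
  shows "P \<phi>"
proof -
  obtain f where f: "\<phi> = mv_eval f" "homogeneous d f" using assms(1) by (auto simp: forms_def)
  have "homogeneous d f \<Longrightarrow> P (mv_eval f)"
  proof (induction f rule: update_induct)
    case const
    have "mv_eval (0::('a, 'b) mvpoly) = (\<lambda>_. 0)" by auto
    then show ?case using assms(2) by simp
  next
    case (update f k c)
    have f: "homogeneous d f" and k: "(\<Sum>i\<in>UNIV. Poly_Mapping.lookup k i) = d"
      using update by (auto simp: homogeneous_def keys_update)
    have "P (\<lambda>v. mv_eval f v + c * (\<Prod>i\<in>UNIV. v i ^ Poly_Mapping.lookup k i))"
      using forms_monomial[of c k] f update.IH[OF f] mon[OF k] unfolding k
      by (intro add) (auto simp: forms_def)
    moreover have "mv_eval (Poly_Mapping.update k c f) = (\<lambda>v. mv_eval f v + c * (\<Prod>i\<in>UNIV. v i ^ Poly_Mapping.lookup k i))"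
      using update by (auto simp: poly_mapping_update_eq mv_eval_add mv_eval_single)
    ultimately show ?case by simp
  qed
  then show ?thesis using f by simp
qed

lemma forms_scale: "\<phi> \<in> forms d \<Longrightarrow> \<phi> (\<lambda>i. c * v i) = c ^ d * \<phi> v"
proof (induction \<phi> rule: forms_induct)
  case (monomial b m)
  have "(\<Prod>i\<in>UNIV. (c * v i) ^ Poly_Mapping.lookup m i) = c ^ d * (\<Prod>i\<in>UNIV. v i ^ Poly_Mapping.lookup m i)"
    unfolding monomial[symmetric] by (simp add: power_mult_distrib prod.distrib power_sum)
  then show ?case by simp
qed (simp_all add: distrib_left)

section \<open>The local ring at a point\<close>

text \<open>The index \<open>i0\<close> of a nonvanishing coordinate fixes the affine chart used
  near \<open>x\<close>.\<close>

locale projective_point =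
  fixes \<X> :: "('n::finite, 'k::field) ppoint set" and x :: "('n, 'k) ppoint" and a :: "'n \<Rightarrow> 'k" and i0 :: 'n
  assumes subset: "\<X> \<subseteq> proj_space" and x: "x \<in> \<X>" and xa: "x = proj_point a" and a: "a i0 \<noteq> 0"
begin

lemma point_rep: "y \<in> \<X> \<Longrightarrow> \<exists>b. b \<in> y \<and> y = proj_point b \<and> (\<exists>i. b i \<noteq> 0)"
proof -
  assume "y \<in> \<X>"
  then obtain b where b: "y = proj_point b" "\<exists>i. b i \<noteq> 0" using subset unfolding proj_space_def by blast
  have "b \<in> proj_point b" unfolding proj_point_def by (auto intro!: exI[of _ 1])
  then show ?thesis using b by blast
qed

lemma a_mem: "a \<in> x"
  unfolding xa proj_point_def by (auto intro!: exI[of _ 1])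

lemma same_point:
  assumes "y \<in> \<X>" "v \<in> y" "w \<in> y"
  shows "\<exists>c. c \<noteq> 0 \<and> w = (\<lambda>i. c * v i)"
proof -
  obtain b where "y = proj_point b" using point_rep[OF assms(1)] by blast
  then obtain c d where "c \<noteq> 0" "v = (\<lambda>i. c * b i)" "d \<noteq> 0" "w = (\<lambda>i. d * b i)"
    using assms by (auto simp: proj_point_def)
  then show ?thesis by (intro exI[of _ "d / c"]) auto
qed

lemma form_nonzero:
  assumes "y \<in> \<X>" "v \<in> y" "w \<in> y" "\<phi> \<in> forms d" "\<phi> v \<noteq> 0"
  shows "\<phi> w \<noteq> 0"
  using same_point[OF assms(1-3)] forms_scale[OF assms(4)] assms(5) by auto

lemma form_quotient:
  assumes "y \<in> \<X>" "v \<in> y" "w \<in> y" "\<phi> \<in> forms d" "\<psi> \<in> forms d"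
  shows "\<phi> w / \<psi> w = \<phi> v / \<psi> v"
  using same_point[OF assms(1-3)] forms_scale[OF assms(4)] forms_scale[OF assms(5)] by auto

text \<open>One of the equations of the complement fails at \<open>x\<close>; its form cuts out a
  smaller neighbourhood, so open sets can be traded for single forms.\<close>

lemma nbhd_form:
  assumes "open_nbhd \<X> x U"
  shows "\<exists>d s. s \<in> forms d \<and> s a \<noteq> 0 \<and> (\<forall>y\<in>\<X>. \<forall>v\<in>y. s v \<noteq> 0 \<longrightarrow> y \<in> U)"
proof -
  obtain F where F: "x \<in> U" "\<forall>f\<in>F. \<exists>d. homogeneous d f" "U = \<X> - zero_locus F"
    using assms by (auto simp: open_nbhd_def zariski_closed_def)
  then obtain f v where f: "f \<in> F" "v \<in> x" "mv_eval f v \<noteq> 0"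
    using x subset by (auto simp: zero_locus_def)
  obtain d where d: "homogeneous d f" using F f by blast
  then have form: "mv_eval f \<in> forms d" by (auto simp: forms_def)
  have "mv_eval f a \<noteq> 0" by (rule form_nonzero[OF x f(2) a_mem form f(3)])
  moreover have "y \<in> U" if "y \<in> \<X>" "v \<in> y" "mv_eval f v \<noteq> 0" for y v
    using that F(3) f(1) by (auto simp: zero_locus_def)
  ultimately show ?thesis using form by blast
qed

lemma form_nbhd:
  assumes "s \<in> forms d" "s a \<noteq> 0"
  shows "open_nbhd \<X> x {y \<in> \<X>. \<forall>v\<in>y. s v \<noteq> 0}"
proof -
  obtain f where f: "s = mv_eval f" "homogeneous d f" using assms by (auto simp: forms_def)
  have "y \<notin> zero_locus {f} \<longleftrightarrow> (\<forall>v\<in>y. s v \<noteq> 0)" if y: "y \<in> \<X>" for y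
  proof -
    have "y \<notin> zero_locus {f} \<longleftrightarrow> (\<exists>v\<in>y. s v \<noteq> 0)" using y subset f by (auto simp: zero_locus_def)
    also have "\<dots> \<longleftrightarrow> (\<forall>v\<in>y. s v \<noteq> 0)"
      using point_rep[OF y] form_nonzero[OF y _ _ assms(1)] by blast
    finally show ?thesis .
  qed
  then have "{y \<in> \<X>. \<forall>v\<in>y. s v \<noteq> 0} = \<X> - zero_locus {f}" by blast
  moreover have "zariski_closed (zero_locus {f})" unfolding zariski_closed_def using f by (intro exI[of _ "{f}"]) auto
  moreover have "\<forall>v\<in>x. s v \<noteq> 0" using form_nonzero[OF x a_mem _ assms] by blast
  ultimately show ?thesis using x by (auto simp: open_nbhd_def)
qed

definition vanishes :: "(('n, 'k) ppoint \<Rightarrow> 'k) \<Rightarrow> bool" where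
  "vanishes f \<longleftrightarrow> (\<exists>d s. s \<in> forms d \<and> s a \<noteq> 0 \<and> (\<forall>y\<in>\<X>. \<forall>v\<in>y. s v \<noteq> 0 \<longrightarrow> f y = 0))"

text \<open>The neighbourhood is absorbed into the denominator: the quotient is valid wherever
  \<open>h\<close> does not vanish.\<close>

definition represents :: "(('n, 'k) ppoint \<Rightarrow> 'k) \<Rightarrow> nat \<Rightarrow> (('n \<Rightarrow> 'k) \<Rightarrow> 'k) \<Rightarrow> (('n \<Rightarrow> 'k) \<Rightarrow> 'k) \<Rightarrow> bool" where
  "represents f d g h \<longleftrightarrow> g \<in> forms d \<and> h \<in> forms d \<and> h a \<noteq> 0 \<and> (\<forall>y\<in>\<X>. \<forall>v\<in>y. h v \<noteq> 0 \<longrightarrow> f y = g v / h v)"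

text \<open>Multiplying numerator and denominator by a form that vanishes off the given open set
  removes the open set from the description.\<close>

lemma regular_iff: "regular_at \<X> x f \<longleftrightarrow> (\<exists>d g h. represents f d g h)"
proof
  assume "regular_at \<X> x f"
  then obtain U d g h where U: "open_nbhd \<X> x U" "homogeneous d g" "homogeneous d h"
    "\<forall>y\<in>U. \<forall>v\<in>y. mv_eval h v \<noteq> 0 \<and> f y = mv_eval g v / mv_eval h v"
    unfolding regular_at_def by blast
  obtain e s where s: "s \<in> forms e" "s a \<noteq> 0" "\<forall>y\<in>\<X>. \<forall>v\<in>y. s v \<noteq> 0 \<longrightarrow> y \<in> U"
    using nbhd_form[OF U(1)] by blast
  have "mv_eval g \<in> forms d" "mv_eval h \<in> forms d" using U by (auto simp: forms_def)
  moreover have "mv_eval h a \<noteq> 0" using s x a_mem U(4) by blast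
  moreover have "f y = (mv_eval g v * s v) / (mv_eval h v * s v)"
    if "y \<in> \<X>" "v \<in> y" "mv_eval h v * s v \<noteq> 0" for y v
    using U(4) s(3) that by auto
  ultimately have "represents f (d + e) (\<lambda>v. mv_eval g v * s v) (\<lambda>v. mv_eval h v * s v)"
    using s(1,2) by (auto simp: represents_def forms_mult)
  then show "\<exists>d g h. represents f d g h" by blast
next
  assume "\<exists>d g h. represents f d g h"
  then obtain d g h where f: "g \<in> forms d" "h \<in> forms d" "h a \<noteq> 0" "\<forall>y\<in>\<X>. \<forall>v\<in>y. h v \<noteq> 0 \<longrightarrow> f y = g v / h v"
    unfolding represents_def by blast
  then obtain g' h' where gh: "g = mv_eval g'" "homogeneous d g'" "h = mv_eval h'" "homogeneous d h'"
    by (auto simp: forms_def)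
  have "\<forall>y\<in>{y \<in> \<X>. \<forall>v\<in>y. h v \<noteq> 0}. \<forall>v\<in>y. mv_eval h' v \<noteq> 0 \<and> f y = mv_eval g' v / mv_eval h' v"
    using f(4) unfolding gh by simp
  then show "regular_at \<X> x f"
    unfolding regular_at_def using form_nbhd[OF f(2,3)] gh(2,4) by blast
qed

abbreviation "O\<^sub>x \<equiv> regular_ring \<X> x"
abbreviation "N\<^sub>x \<equiv> vanishing_germs \<X> x"
abbreviation "R\<^sub>x \<equiv> local_ring \<X> x"

lemma vanishing_iff: "f \<in> N\<^sub>x \<longleftrightarrow> regular_at \<X> x f \<and> vanishes f"
proof -
  have "(\<exists>U. open_nbhd \<X> x U \<and> (\<forall>y\<in>U. f y = 0)) \<longleftrightarrow> vanishes f"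
  proof
    assume "\<exists>U. open_nbhd \<X> x U \<and> (\<forall>y\<in>U. f y = 0)"
    then show "vanishes f" unfolding vanishes_def using nbhd_form by meson
  next
    assume "vanishes f"
    then obtain d s where s: "s \<in> forms d" "s a \<noteq> 0" "\<forall>y\<in>\<X>. \<forall>v\<in>y. s v \<noteq> 0 \<longrightarrow> f y = 0"
      unfolding vanishes_def by blast
    have "f y = 0" if "y \<in> \<X>" "\<forall>v\<in>y. s v \<noteq> 0" for y
      using that s(3) point_rep[OF that(1)] by blast
    then show "\<exists>U. open_nbhd \<X> x U \<and> (\<forall>y\<in>U. f y = 0)" using form_nbhd[OF s(1,2)] by blast
  qed
  then show ?thesis by (simp add: vanishing_germs_def)
qed

lemma regular_const: "regular_at \<X> x (\<lambda>_. c)"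
proof -
  have "represents (\<lambda>_. c) 0 (\<lambda>_. c) (\<lambda>_. 1)" by (simp add: represents_def forms_const)
  then show ?thesis unfolding regular_iff by blast
qed

lemma regular_mult:
  assumes "regular_at \<X> x f" "regular_at \<X> x f'"
  shows "regular_at \<X> x (\<lambda>y. f y * f' y)"
proof -
  obtain d g h d' g' h' where "represents f d g h" "represents f' d' g' h'"
    using assms unfolding regular_iff by blast
  then have "represents (\<lambda>y. f y * f' y) (d + d') (\<lambda>v. g v * g' v) (\<lambda>v. h v * h' v)"
    by (simp add: represents_def forms_mult)
  then show ?thesis unfolding regular_iff by blast
qed

lemma regular_add:
  assumes "regular_at \<X> x f" "regular_at \<X> x f'"
  shows "regular_at \<X> x (\<lambda>y. f y + f' y)"
proof -
  obtain d g h d' g' h' where r: "represents f d g h" "represents f' d' g' h'"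
    using assms unfolding regular_iff by blast
  then have "(\<lambda>v. g v * h' v + h v * g' v) \<in> forms (d + d')"
    by (intro forms_add forms_mult) (auto simp: represents_def)
  moreover have "(\<lambda>v. h v * h' v) \<in> forms (d + d')" using r by (intro forms_mult) (auto simp: represents_def)
  moreover have "f y + f' y = (g v * h' v + h v * g' v) / (h v * h' v)"
    if "y \<in> \<X>" "v \<in> y" "h v * h' v \<noteq> 0" for y v
    using r that by (auto simp: represents_def add_frac_eq mult.commute[of "h v" "g' v"])
  ultimately have "represents (\<lambda>y. f y + f' y) (d + d') (\<lambda>v. g v * h' v + h v * g' v) (\<lambda>v. h v * h' v)"
    using r by (auto simp: represents_def)
  then show ?thesis unfolding regular_iff by blast
qed

lemma regular_inverse:
  assumes "regular_at \<X> x f" "f x \<noteq> 0"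
  shows "regular_at \<X> x (\<lambda>y. inverse (f y))" "vanishes (\<lambda>y. f y * inverse (f y) - 1)"
proof -
  obtain d g h where r: "represents f d g h" using assms unfolding regular_iff by blast
  then have "g a \<noteq> 0" using assms(2) x a_mem by (force simp: represents_def)
  have f: "g \<in> forms d" "h \<in> forms d" "h a \<noteq> 0" "\<And>y v. y \<in> \<X> \<Longrightarrow> v \<in> y \<Longrightarrow> h v \<noteq> 0 \<Longrightarrow> f y = g v / h v"
    using r by (auto simp: represents_def)
  \<comment> \<open>The inverse is written with denominator \<open>g h\<close>, which vanishes
    wherever either form does, so that the quotient for \<open>f\<close> is valid on the same
    set.\<close>
  have "represents (\<lambda>y. inverse (f y)) (d + d) (\<lambda>v. h v * h v) (\<lambda>v. g v * h v)"
    unfolding represents_def using f \<open>g a \<noteq> 0\<close> by (auto intro!: forms_mult)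
  then show "regular_at \<X> x (\<lambda>y. inverse (f y))" unfolding regular_iff by blast
  have "f y * inverse (f y) - 1 = 0" if "y \<in> \<X>" "v \<in> y" "g v * h v \<noteq> 0" for y v
    using f(4)[OF that(1,2)] that(3) by simp
  moreover have "(\<lambda>v. g v * h v) \<in> forms (d + d)" using f by (intro forms_mult)
  ultimately show "vanishes (\<lambda>y. f y * inverse (f y) - 1)"
    unfolding vanishes_def using f(3) \<open>g a \<noteq> 0\<close> by (intro exI[of _ "d + d"] exI[of _ "\<lambda>v. g v * h v"]) auto
qed

lemma vanishes_zero: "vanishes (\<lambda>_. 0)"
  unfolding vanishes_def by (intro exI[of _ 0] exI[of _ "\<lambda>_. 1"]) (simp add: forms_const)

lemma vanishes_add: "vanishes f \<Longrightarrow> vanishes g \<Longrightarrow> vanishes (\<lambda>y. f y + g y)"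
proof -
  assume "vanishes f" "vanishes g"
  then obtain d s e r where s: "s \<in> forms d" "s a \<noteq> 0" "\<forall>y\<in>\<X>. \<forall>v\<in>y. s v \<noteq> 0 \<longrightarrow> f y = 0"
    and r: "r \<in> forms e" "r a \<noteq> 0" "\<forall>y\<in>\<X>. \<forall>v\<in>y. r v \<noteq> 0 \<longrightarrow> g y = 0"
    unfolding vanishes_def by blast
  have "(\<lambda>v. s v * r v) \<in> forms (d + e)" using s r by (intro forms_mult)
  moreover have "f y + g y = 0" if "y \<in> \<X>" "v \<in> y" "s v * r v \<noteq> 0" for y v
  proof -
    have "f y = 0" "g y = 0" using s(3) r(3) that by auto
    then show ?thesis by simp
  qed
  ultimately show ?thesis unfolding vanishes_def using s(2) r(2)
    by (intro exI[of _ "d + e"] exI[of _ "\<lambda>v. s v * r v"]) auto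
qed

lemma vanishes_mult: "vanishes f \<Longrightarrow> vanishes (\<lambda>y. g y * f y)"
  unfolding vanishes_def by fastforce

lemma vanishes_at: "vanishes f \<Longrightarrow> f x = 0"
  unfolding vanishes_def using x a_mem by blast

section \<open>The local ring and its maximal ideal\<close>

lemma O_simps [simp]:
  "f \<in> carrier O\<^sub>x \<longleftrightarrow> regular_at \<X> x f" "f \<otimes>\<^bsub>O\<^sub>x\<^esub> g = (\<lambda>y. f y * g y)" "f \<oplus>\<^bsub>O\<^sub>x\<^esub> g = (\<lambda>y. f y + g y)"
  "\<one>\<^bsub>O\<^sub>x\<^esub> = (\<lambda>_. 1)" "\<zero>\<^bsub>O\<^sub>x\<^esub> = (\<lambda>_. 0)"
  by (simp_all add: regular_ring_def)

sublocale O: cring "O\<^sub>x"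
proof (rule cringI)
  have "\<exists>g\<in>carrier O\<^sub>x. g \<oplus>\<^bsub>O\<^sub>x\<^esub> f = \<zero>\<^bsub>O\<^sub>x\<^esub>" if "f \<in> carrier O\<^sub>x" for f
    using regular_mult[OF regular_const[of "-1"], of f] that by (intro bexI[of _ "\<lambda>y. - 1 * f y"]) simp_all
  then show "abelian_group O\<^sub>x"
    by (intro abelian_groupI) (assumption | simp add: regular_add regular_const ac_simps)+
  show "Group.comm_monoid O\<^sub>x"
    by (intro comm_monoidI) (simp_all add: regular_mult regular_const ac_simps)
qed (simp add: distrib_right)

lemma O_minus: "regular_at \<X> x f \<Longrightarrow> \<ominus>\<^bsub>O\<^sub>x\<^esub> f = (\<lambda>y. - f y)"
  using regular_mult[OF regular_const[of "-1"], of f] by (intro O.minus_equality) simp_all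

lemma O_diff: "regular_at \<X> x f \<Longrightarrow> regular_at \<X> x g \<Longrightarrow> f \<ominus>\<^bsub>O\<^sub>x\<^esub> g = (\<lambda>y. f y - g y)"
  by (simp add: O.minus_eq O_minus)

sublocale N: ideal "N\<^sub>x" "O\<^sub>x"
proof (rule idealI[OF O.ring_axioms])
  show "subgroup N\<^sub>x (add_monoid O\<^sub>x)"
  proof (rule O.add.subgroupI)
    show "N\<^sub>x \<subseteq> carrier (O\<^sub>x)" using vanishing_iff by auto
    show "N\<^sub>x \<noteq> {}" using vanishing_iff vanishes_zero regular_const by blast
    fix f assume "f \<in> N\<^sub>x"
    then have f: "regular_at \<X> x f" "vanishes f" using vanishing_iff by auto
    have "\<ominus>\<^bsub>O\<^sub>x\<^esub> f = (\<lambda>y. - 1 * f y)" using O_minus[OF f(1)] by simp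
    then show "\<ominus>\<^bsub>O\<^sub>x\<^esub> f \<in> N\<^sub>x"
      unfolding vanishing_iff using regular_mult[OF regular_const[of "-1"] f(1)] vanishes_mult[OF f(2), of "\<lambda>_. - 1"] by simp
  next
    fix f g assume "f \<in> N\<^sub>x" "g \<in> N\<^sub>x"
    then show "f \<oplus>\<^bsub>O\<^sub>x\<^esub> g \<in> N\<^sub>x" unfolding vanishing_iff by (simp add: regular_add vanishes_add)
  qed
  fix f g assume fg: "f \<in> N\<^sub>x" "g \<in> carrier O\<^sub>x"
  then show "g \<otimes>\<^bsub>O\<^sub>x\<^esub> f \<in> N\<^sub>x" unfolding vanishing_iff by (simp add: regular_mult vanishes_mult)
  then show "f \<otimes>\<^bsub>O\<^sub>x\<^esub> g \<in> N\<^sub>x" using fg by (simp add: mult.commute)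
qed

definition germ :: "(('n, 'k) ppoint \<Rightarrow> 'k) \<Rightarrow> ('n, 'k) germ" where
  "germ f = N\<^sub>x +>\<^bsub>O\<^sub>x\<^esub> f"

sublocale R: cring "R\<^sub>x"
  unfolding local_ring_def by (rule N.quotient_is_cring[OF O.is_cring])

lemma R_carrier: "carrier R\<^sub>x = germ ` {f. regular_at \<X> x f}"
  by (auto simp: local_ring_def FactRing_def A_RCOSETS_def' germ_def)

lemma germ_closed [simp]: "regular_at \<X> x f \<Longrightarrow> germ f \<in> carrier R\<^sub>x"
  by (simp add: R_carrier)

lemma germ_hom: "germ \<in> ring_hom O\<^sub>x R\<^sub>x"
  using N.rcos_ring_hom by (simp add: germ_def[abs_def] local_ring_def)

lemma germ_simps:
  "regular_at \<X> x f \<Longrightarrow> regular_at \<X> x g \<Longrightarrow> germ f \<otimes>\<^bsub>R\<^sub>x\<^esub> germ g = germ (\<lambda>y. f y * g y)"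
  "regular_at \<X> x f \<Longrightarrow> regular_at \<X> x g \<Longrightarrow> germ f \<oplus>\<^bsub>R\<^sub>x\<^esub> germ g = germ (\<lambda>y. f y + g y)"
  "\<one>\<^bsub>R\<^sub>x\<^esub> = germ (\<lambda>_. 1)" "\<zero>\<^bsub>R\<^sub>x\<^esub> = germ (\<lambda>_. 0)"
  using ring_hom_mult[OF germ_hom, of f g] ring_hom_add[OF germ_hom, of f g] ring_hom_one[OF germ_hom]
    ring_hom_zero[OF germ_hom O.ring_axioms R.ring_axioms] by simp_all

lemma germ_minus: "regular_at \<X> x f \<Longrightarrow> \<ominus>\<^bsub>R\<^sub>x\<^esub> germ f = germ (\<lambda>y. - f y)"
  using regular_mult[OF regular_const[of "-1"], of f] by (intro R.minus_equality) (simp_all add: germ_simps)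

lemma germ_diff:
  "regular_at \<X> x f \<Longrightarrow> regular_at \<X> x g \<Longrightarrow> germ f \<ominus>\<^bsub>R\<^sub>x\<^esub> germ g = germ (\<lambda>y. f y - g y)"
  using regular_mult[OF regular_const[of "-1"], of g] by (simp add: R.minus_eq germ_minus germ_simps)

lemma germ_eq_iff:
  assumes "regular_at \<X> x f" "regular_at \<X> x g"
  shows "germ f = germ g \<longleftrightarrow> vanishes (\<lambda>y. f y - g y)"
proof -
  have "germ f = germ g \<longleftrightarrow> f \<ominus>\<^bsub>O\<^sub>x\<^esub> g \<in> N\<^sub>x"
    unfolding germ_def using O.quotient_eq_iff_same_a_r_cos[OF N.ideal_axioms, of f g] assms by simp
  moreover have "regular_at \<X> x (\<lambda>y. f y - g y)"
    using regular_add[OF assms(1) regular_mult[OF regular_const[of "-1"] assms(2)]] by simp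
  ultimately show ?thesis using O_diff[OF assms] vanishing_iff by simp
qed

text \<open>A regular function not vanishing at \<open>x\<close> has a regular inverse near
  \<open>x\<close>; conversely the value at \<open>x\<close> depends only on the germ.\<close>

lemma germ_unit: 
  assumes f: "regular_at \<X> x f"
  shows "germ f \<in> Units R\<^sub>x \<longleftrightarrow> f x \<noteq> 0"
proof
  assume "germ f \<in> Units R\<^sub>x"
  then obtain r where "r \<in> carrier R\<^sub>x" "germ f \<otimes>\<^bsub>R\<^sub>x\<^esub> r = \<one>\<^bsub>R\<^sub>x\<^esub>" by (auto simp: Units_def)
  then obtain g where g: "regular_at \<X> x g" "germ f \<otimes>\<^bsub>R\<^sub>x\<^esub> germ g = \<one>\<^bsub>R\<^sub>x\<^esub>" by (auto simp: R_carrier)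
  then have "vanishes (\<lambda>y. f y * g y - 1)"
    using f by (simp add: germ_simps germ_eq_iff regular_mult regular_const)
  then have "f x * g x - 1 = 0" by (rule vanishes_at)
  then show "f x \<noteq> 0" by auto
next
  assume nz: "f x \<noteq> 0"
  let ?g = "\<lambda>y. inverse (f y)"
  have g: "regular_at \<X> x ?g" by (rule regular_inverse[OF f nz])
  have "germ f \<otimes>\<^bsub>R\<^sub>x\<^esub> germ ?g = \<one>\<^bsub>R\<^sub>x\<^esub>"
    using f g regular_inverse(2)[OF f nz] by (simp add: germ_simps germ_eq_iff regular_mult regular_const)
  then show "germ f \<in> Units R\<^sub>x"
    using f g R.m_comm[of "germ f" "germ ?g"] by (auto simp: Units_def intro!: bexI[of _ "germ ?g"])
qed

lemma nonunits_eq: "nonunits R\<^sub>x = germ ` {f. regular_at \<X> x f \<and> f x = 0}"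
  unfolding nonunits_def R_carrier using germ_unit by auto

abbreviation "m\<^sub>x \<equiv> nonunits R\<^sub>x"

lemma germ_nonunit: "regular_at \<X> x f \<Longrightarrow> germ f \<in> m\<^sub>x \<longleftrightarrow> f x = 0"
  using germ_unit by (simp add: nonunits_def)

sublocale m: ideal "m\<^sub>x" "R\<^sub>x"
proof (rule idealI[OF R.ring_axioms])
  show "subgroup m\<^sub>x (add_monoid R\<^sub>x)"
  proof (rule R.add.subgroupI)
    show "m\<^sub>x \<subseteq> carrier R\<^sub>x" by (auto simp: nonunits_def)
    show "m\<^sub>x \<noteq> {}" using germ_nonunit[OF regular_const[of 0]] by auto
    fix r assume "r \<in> m\<^sub>x"
    then obtain f where f: "regular_at \<X> x f" "f x = 0" "r = germ f" by (auto simp: nonunits_eq)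
    then show "\<ominus>\<^bsub>R\<^sub>x\<^esub> r \<in> m\<^sub>x"
      using regular_mult[OF regular_const[of "-1"] f(1)] by (simp add: germ_minus germ_nonunit)
  next
    fix r s assume "r \<in> m\<^sub>x" "s \<in> m\<^sub>x"
    then obtain f g where "regular_at \<X> x f" "f x = 0" "r = germ f" "regular_at \<X> x g" "g x = 0" "s = germ g"
      by (auto simp: nonunits_eq)
    then show "r \<oplus>\<^bsub>R\<^sub>x\<^esub> s \<in> m\<^sub>x" by (simp add: germ_simps germ_nonunit regular_add)
  qed
  fix r s assume rs: "r \<in> m\<^sub>x" "s \<in> carrier R\<^sub>x"
  then obtain f g where "regular_at \<X> x f" "f x = 0" "r = germ f" "regular_at \<X> x g" "s = germ g"
    by (auto simp: nonunits_eq R_carrier)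
  then show "s \<otimes>\<^bsub>R\<^sub>x\<^esub> r \<in> m\<^sub>x" by (simp add: germ_simps germ_nonunit regular_mult)
  moreover have "r \<in> carrier R\<^sub>x" using rs by (simp add: nonunits_def)
  ultimately show "r \<otimes>\<^bsub>R\<^sub>x\<^esub> s \<in> m\<^sub>x" using rs R.m_comm[of r s] by simp
qed

lemma const_germ_eq: "const_germ \<X> x c = germ (\<lambda>_. c)"
  by (simp add: const_germ_def germ_def)

lemma const_germ_hom: "const_germ \<X> x \<in> ring_hom ring_of_type_algebra R\<^sub>x"
  by (rule ring_hom_memI) (simp_all add: const_germ_eq germ_simps regular_const)

lemma residue: "r \<in> carrier R\<^sub>x \<Longrightarrow> \<exists>c. r \<ominus>\<^bsub>R\<^sub>x\<^esub> const_germ \<X> x c \<in> m\<^sub>x"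
proof -
  assume "r \<in> carrier R\<^sub>x"
  then obtain f where f: "regular_at \<X> x f" "r = germ f" by (auto simp: R_carrier)
  have "regular_at \<X> x (\<lambda>y. f y - f x)"
    using regular_add[OF f(1) regular_const[of "- f x"]] by simp
  then show ?thesis using f
    by (intro exI[of _ "f x"]) (simp add: const_germ_eq germ_diff regular_const germ_nonunit)
qed

text \<open>A power of a field-valued function vanishes only where the function does. This turns
  \<open>t \<noteq> 0\<close> into non-nilpotence of the uniformizer.\<close>

lemma reduced: "r \<in> carrier R\<^sub>x \<Longrightarrow> r [^]\<^bsub>R\<^sub>x\<^esub> (n::nat) = \<zero>\<^bsub>R\<^sub>x\<^esub> \<Longrightarrow> r = \<zero>\<^bsub>R\<^sub>x\<^esub>"
proof -
  assume r: "r \<in> carrier R\<^sub>x" "r [^]\<^bsub>R\<^sub>x\<^esub> n = \<zero>\<^bsub>R\<^sub>x\<^esub>"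
  then obtain f where f: "regular_at \<X> x f" "r = germ f" by (auto simp: R_carrier)
  have pow: "regular_at \<X> x (\<lambda>y. f y ^ m) \<and> germ f [^]\<^bsub>R\<^sub>x\<^esub> m = germ (\<lambda>y. f y ^ m)" for m
    using f by (induction m) (simp_all add: germ_simps regular_const regular_mult mult.commute)
  then have "vanishes (\<lambda>y. f y ^ n)"
    using r f germ_eq_iff[of "\<lambda>y. f y ^ n" "\<lambda>_. 0"] by (simp add: germ_simps regular_const)
  then have "vanishes f" unfolding vanishes_def by simp blast
  then show ?thesis using f by (simp add: germ_simps germ_eq_iff regular_const)
qed

end

section \<open>Uniformizers\<close>

text \<open>One step of Nakayama's lemma. The error \<open>s\<close> in the square of
  \<open>m\<close> is \<open>\<mu> w + e\<close> with \<mu> in \<open>m\<close> and \<open>e\<close>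
  in the ideal of \<open>S\<close>. Hence \<open>(1 - \<mu>) w\<close> lies in that ideal, and
  \<open>1 - \<mu>\<close> is a unit.\<close>

lemma (in cring) nakayama_remove:
  assumes m: "ideal m R" "\<And>\<mu>. \<mu> \<in> m \<Longrightarrow> \<one> \<ominus> \<mu> \<in> Units R"
    and S: "S \<subseteq> carrier R" "w \<in> carrier R" "m = Idl (insert w S)"
    and w: "w = r \<otimes> t \<oplus> s" "r \<in> carrier R" "t \<in> S" "s \<in> ideal_prod R m m"
  shows "m = Idl S"
proof -
  interpret m: ideal m R by fact
  interpret E: ideal "Idl S" R by (rule genideal_ideal[OF S(1)])
  have dec: "\<exists>r\<in>carrier R. \<exists>e\<in>Idl S. j = r \<otimes> w \<oplus> e" if "j \<in> m" for j
  proof -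
    have "ideal (PIdl w <+>\<^bsub>R\<^esub> Idl S) R"
      by (rule add_ideals[OF cgenideal_ideal[OF S(2)] E.ideal_axioms])
    moreover have "insert w S \<subseteq> PIdl w <+>\<^bsub>R\<^esub> Idl S"
    proof -
      have "w \<oplus> \<zero> \<in> PIdl w <+>\<^bsub>R\<^esub> Idl S"
        unfolding set_add_def' using cgenideal_self[OF S(2)] E.zero_closed by blast
      moreover have "e \<in> PIdl w <+>\<^bsub>R\<^esub> Idl S" if "e \<in> S" for e
      proof -
        have "\<zero> \<in> PIdl w" by (rule additive_subgroup.zero_closed[OF ideal.axioms(1)[OF cgenideal_ideal[OF S(2)]]])
        then have "\<zero> \<oplus> e \<in> PIdl w <+>\<^bsub>R\<^esub> Idl S" unfolding set_add_def' using genideal_self[OF S(1)] that by blast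
        then show ?thesis using S(1) that by (simp add: subset_iff)
      qed
      ultimately show ?thesis using S by auto
    qed
    ultimately have "m \<subseteq> PIdl w <+>\<^bsub>R\<^esub> Idl S" unfolding S(3) by (rule genideal_minimal)
    then show ?thesis using that unfolding set_add_def' cgenideal_def by blast
  qed
  have "\<exists>\<mu>\<in>m. \<exists>e\<in>Idl S. s = \<mu> \<otimes> w \<oplus> e"
    using w(4)
  proof (induction rule: ideal_prod.induct)
    case (prod i j)
    obtain q e where e: "q \<in> carrier R" "e \<in> Idl S" "j = q \<otimes> w \<oplus> e" using dec[OF prod(2)] by blast
    have i: "i \<in> carrier R" using prod(1) m.a_subset by blast
    have "i \<otimes> j = (i \<otimes> q) \<otimes> w \<oplus> i \<otimes> e"
      unfolding e(3) using e(1,2) i S(2) E.a_subset by (simp add: r_distr m_assoc subset_iff)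
    moreover have "i \<otimes> q \<in> m" "i \<otimes> e \<in> Idl S"
      using m.I_r_closed[OF prod(1) e(1)] E.I_l_closed[OF e(2) i] by auto
    ultimately show ?case by blast
  next
    case (sum s1 s2)
    then obtain q1 e1 q2 e2 where e: "q1 \<in> m" "e1 \<in> Idl S" "s1 = q1 \<otimes> w \<oplus> e1"
      "q2 \<in> m" "e2 \<in> Idl S" "s2 = q2 \<otimes> w \<oplus> e2" by blast
    then have c: "q1 \<in> carrier R" "q2 \<in> carrier R" "e1 \<in> carrier R" "e2 \<in> carrier R"
      using m.a_subset E.a_subset by blast+
    have "s1 \<oplus> s2 = (q1 \<oplus> q2) \<otimes> w \<oplus> (e1 \<oplus> e2)"
      unfolding e(3,6) using c S(2) by (simp add: l_distr a_ac)
    then show ?case using m.a_closed[OF e(1,4)] E.a_closed[OF e(2,5)] by blast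
  qed
  then obtain \<mu> e where e: "\<mu> \<in> m" "e \<in> Idl S" "s = \<mu> \<otimes> w \<oplus> e" by blast
  have c: "\<mu> \<in> carrier R" "e \<in> carrier R" "t \<in> carrier R" using e m.a_subset E.a_subset w(3) S(1) by blast+
  define z where "z = r \<otimes> t \<oplus> e"
  have z: "z \<in> Idl S"
    unfolding z_def using E.a_closed[OF E.I_l_closed[OF subsetD[OF genideal_self[OF S(1)] w(3)] w(2)] e(2)] .
  have "w = z \<oplus> \<mu> \<otimes> w"
    using w(1) unfolding e(3) z_def using c w(2) S(2) by (simp add: a_ac)
  then have "w \<ominus> \<mu> \<otimes> w = z \<oplus> \<mu> \<otimes> w \<ominus> \<mu> \<otimes> w" by simp
  also have "\<dots> = z" using z E.a_subset c S(2) by (simp add: minus_eq a_assoc r_neg subset_iff)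
  finally have "(\<one> \<ominus> \<mu>) \<otimes> w = z" using c S(2) by (simp add: minus_eq l_distr l_minus)
  then have "inv (\<one> \<ominus> \<mu>) \<otimes> ((\<one> \<ominus> \<mu>) \<otimes> w) \<in> Idl S"
    using E.I_l_closed[OF z] m(2)[OF e(1)] by simp
  then have "w \<in> Idl S"
    using m(2)[OF e(1)] c S(2) by (simp add: m_assoc[symmetric])
  then have "insert w S \<subseteq> Idl S" using genideal_self[OF S(1)] by blast
  then have "m \<subseteq> Idl S" unfolding S(3) by (rule genideal_minimal[OF E.ideal_axioms])
  moreover have "Idl S \<subseteq> m"
    using S genideal_self[of "insert w S"] by (intro genideal_minimal[OF m(1)]) auto
  ultimately show ?thesis by blast
qed

text \<open>Generators other than \<open>t\<close> are dropped one after another, each being a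
  multiple of \<open>t\<close> modulo the square of \<open>m\<close>.\<close>

lemma (in cring) nakayama_principal:
  assumes m: "ideal m R" "\<And>\<mu>. \<mu> \<in> m \<Longrightarrow> \<one> \<ominus> \<mu> \<in> Units R"
    and W: "finite W" "W \<subseteq> carrier R" "m = Idl (insert t W)" and t: "t \<in> carrier R"
    and w: "\<And>w. w \<in> W \<Longrightarrow> \<exists>r\<in>carrier R. \<exists>s\<in>ideal_prod R m m. w = r \<otimes> t \<oplus> s"
  shows "m = PIdl t"
  using W w
proof (induction W rule: finite_induct)
  case empty
  then show ?case using cgenideal_eq_genideal[OF t] by simp
next
  case (insert w W)
  obtain r s where rs: "w = r \<otimes> t \<oplus> s" "r \<in> carrier R" "s \<in> ideal_prod R m m"
    using insert.prems(3)[of w] by blast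
  have S: "insert t W \<subseteq> carrier R" "w \<in> carrier R" "m = Idl (insert w (insert t W))"
    using insert.prems t by (auto simp: insert_commute)
  have "m = Idl (insert t W)"
    by (rule nakayama_remove[OF m S rs(1,2) insertI1 rs(3)])
  then show ?case using insert by blast
qed

section \<open>Coordinate germs generate the maximal ideal\<close>

context projective_point
begin

text \<open>Dehomogenisation at the coordinate \<open>i0\<close>. At points of \<X> the choice of
  representative is immaterial, as numerator and denominator have equal degree.\<close>

definition chart :: "(('n \<Rightarrow> 'k) \<Rightarrow> 'k) \<Rightarrow> nat \<Rightarrow> ('n, 'k) ppoint \<Rightarrow> 'k" where
  "chart \<phi> d y = \<phi> (SOME v. v \<in> y) / (SOME v. v \<in> y) i0 ^ d"

lemma chart_at:
  assumes "\<phi> \<in> forms d" "y \<in> \<X>" "v \<in> y"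
  shows "chart \<phi> d y = \<phi> v / v i0 ^ d"
  unfolding chart_def
  by (rule form_quotient[OF assms(2,3) someI[of "\<lambda>v. v \<in> y", OF assms(3)] assms(1) forms_coord_power])

lemma chart_regular: "\<phi> \<in> forms d \<Longrightarrow> regular_at \<X> x (chart \<phi> d)"
proof -
  assume \<phi>: "\<phi> \<in> forms d"
  have "represents (chart \<phi> d) d \<phi> (\<lambda>v. v i0 ^ d)"
    unfolding represents_def using \<phi> a chart_at[OF \<phi>] by (auto intro: forms_coord_power)
  then show ?thesis unfolding regular_iff by blast
qed

definition coord :: "'n \<Rightarrow> ('n, 'k) ppoint \<Rightarrow> 'k" where "coord j = chart (\<lambda>v. v j) 1"

definition W :: "('n, 'k) germ set" where "W = range (\<lambda>j. germ (\<lambda>y. coord j y - a j / a i0))"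

lemma coord_regular: "regular_at \<X> x (coord j)"
  unfolding coord_def by (rule chart_regular[OF forms_coord])

lemma regular_diff_const: "regular_at \<X> x f \<Longrightarrow> regular_at \<X> x (\<lambda>y. f y - c)"
  using regular_add[OF _ regular_const[of "- c"], of f] by simp

lemma W_subset: "W \<subseteq> m\<^sub>x"
proof -
  have "coord j x = a j / a i0" for j
    unfolding coord_def using chart_at[OF forms_coord x a_mem, of j] by simp
  then show ?thesis
    unfolding W_def using regular_diff_const[OF coord_regular] by (auto simp: germ_nonunit)
qed

lemma m_carrier: "m\<^sub>x \<subseteq> carrier R\<^sub>x" by (auto simp: nonunits_def)

lemma W_ideal: "ideal (Idl\<^bsub>R\<^sub>x\<^esub> W) R\<^sub>x" "Idl\<^bsub>R\<^sub>x\<^esub> W \<subseteq> m\<^sub>x"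
proof -
  show "ideal (Idl\<^bsub>R\<^sub>x\<^esub> W) R\<^sub>x" using W_subset m_carrier by (intro R.genideal_ideal) blast
  show "Idl\<^bsub>R\<^sub>x\<^esub> W \<subseteq> m\<^sub>x" by (rule R.genideal_minimal[OF m.ideal_axioms W_subset])
qed

text \<open>Being a constant modulo the ideal of the coordinate germs is preserved by sums and
  products and holds for the coordinates, hence for the charts of all forms.\<close>

definition near_const :: "(('n, 'k) ppoint \<Rightarrow> 'k) \<Rightarrow> bool" where
  "near_const f \<longleftrightarrow> regular_at \<X> x f \<and> (\<exists>c. germ (\<lambda>y. f y - c) \<in> Idl\<^bsub>R\<^sub>x\<^esub> W)"

interpretation J: ideal "Idl\<^bsub>R\<^sub>x\<^esub> W" "R\<^sub>x" by (rule W_ideal)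

lemma near_const_const: "near_const (\<lambda>_. c)"
  unfolding near_const_def using regular_const J.zero_closed by (auto simp: germ_simps intro!: exI[of _ c])

lemma near_const_add:
  assumes "near_const f" "near_const g"
  shows "near_const (\<lambda>y. f y + g y)"
proof -
  obtain c d where f: "regular_at \<X> x f" "germ (\<lambda>y. f y - c) \<in> Idl\<^bsub>R\<^sub>x\<^esub> W"
    and g: "regular_at \<X> x g" "germ (\<lambda>y. g y - d) \<in> Idl\<^bsub>R\<^sub>x\<^esub> W"
    using assms by (auto simp: near_const_def)
  have "germ (\<lambda>y. f y - c) \<oplus>\<^bsub>R\<^sub>x\<^esub> germ (\<lambda>y. g y - d) = germ (\<lambda>y. (f y + g y) - (c + d))"
    using regular_diff_const[OF f(1)] regular_diff_const[OF g(1)] by (simp add: germ_simps algebra_simps)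
  then have "germ (\<lambda>y. (f y + g y) - (c + d)) \<in> Idl\<^bsub>R\<^sub>x\<^esub> W"
    using J.a_closed[OF f(2) g(2)] by simp
  then show ?thesis unfolding near_const_def using regular_add[OF f(1) g(1)] by blast
qed

lemma near_const_mult:
  assumes "near_const f" "near_const g"
  shows "near_const (\<lambda>y. f y * g y)"
proof -
  obtain c d where f: "regular_at \<X> x f" "germ (\<lambda>y. f y - c) \<in> Idl\<^bsub>R\<^sub>x\<^esub> W"
    and g: "regular_at \<X> x g" "germ (\<lambda>y. g y - d) \<in> Idl\<^bsub>R\<^sub>x\<^esub> W"
    using assms by (auto simp: near_const_def)
  have "germ f \<otimes>\<^bsub>R\<^sub>x\<^esub> germ (\<lambda>y. g y - d) \<oplus>\<^bsub>R\<^sub>x\<^esub> germ (\<lambda>_. d) \<otimes>\<^bsub>R\<^sub>x\<^esub> germ (\<lambda>y. f y - c) = germ (\<lambda>y. (f y * g y) - (c * d))"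
    using f(1) regular_diff_const[OF f(1)] regular_diff_const[OF g(1)]
    by (simp add: germ_simps regular_const regular_mult) (simp add: algebra_simps)
  moreover have "germ f \<otimes>\<^bsub>R\<^sub>x\<^esub> germ (\<lambda>y. g y - d) \<oplus>\<^bsub>R\<^sub>x\<^esub> germ (\<lambda>_. d) \<otimes>\<^bsub>R\<^sub>x\<^esub> germ (\<lambda>y. f y - c) \<in> Idl\<^bsub>R\<^sub>x\<^esub> W"
    by (intro J.a_closed J.I_l_closed f(2) g(2) germ_closed f(1) regular_const)
  ultimately show ?thesis unfolding near_const_def using regular_mult[OF f(1) g(1)] by metis
qed

lemma near_const_coord: "near_const (coord j)"
proof -
  have "W \<subseteq> Idl\<^bsub>R\<^sub>x\<^esub> W" using W_subset m_carrier by (intro R.genideal_self) blast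
  then have "germ (\<lambda>y. coord j y - a j / a i0) \<in> Idl\<^bsub>R\<^sub>x\<^esub> W" by (auto simp: W_def)
  then show ?thesis unfolding near_const_def using coord_regular by blast
qed

lemma near_const_chart: "\<phi> \<in> forms d \<Longrightarrow> near_const (chart \<phi> d)"
proof (induction \<phi> rule: forms_induct)
  case zero
  have "chart (\<lambda>_. 0) d = (\<lambda>_. 0)" by (auto simp: chart_def)
  then show ?case using near_const_const by simp
next
  case (monomial c m)
  have pow: "near_const (\<lambda>y. coord j y ^ e)" for j e
  proof (induction e)
    case (Suc e)
    show ?case using near_const_mult[OF near_const_coord[of j] Suc] by simp
  qed (use near_const_const in simp)
  have "near_const (\<lambda>y. \<Prod>i\<in>B. coord i y ^ Poly_Mapping.lookup m i)" if "finite B" for B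
    using that
  proof induction
    case (insert i B)
    show ?case using near_const_mult[OF pow[of i "Poly_Mapping.lookup m i"] insert.IH] insert.hyps by simp
  qed (use near_const_const in simp)
  from near_const_mult[OF near_const_const[of c] this[OF finite_UNIV]]
  have "near_const (\<lambda>y. c * (\<Prod>i\<in>UNIV. coord i y ^ Poly_Mapping.lookup m i))" .
  moreover have "chart (\<lambda>v. c * (\<Prod>i\<in>UNIV. v i ^ Poly_Mapping.lookup m i)) d =
    (\<lambda>y. c * (\<Prod>i\<in>UNIV. coord i y ^ Poly_Mapping.lookup m i))"
    unfolding chart_def coord_def monomial[symmetric] by (auto simp: power_divide prod_dividef power_sum)
  ultimately show ?case by simp
next
  case (add \<phi> \<psi>)
  have "chart (\<lambda>v. \<phi> v + \<psi> v) d = (\<lambda>y. chart \<phi> d y + chart \<psi> d y)"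
    by (auto simp: chart_def add_divide_distrib)
  then show ?case using near_const_add[OF add.IH] by simp
qed

text \<open>For \<open>f = g / h\<close> vanishing at \<open>x\<close>, the chart of
  \<open>g\<close> is a constant modulo the ideal of \<open>W\<close>, and evaluation at
  \<open>x\<close> shows that this constant is 0. The chart of \<open>h\<close> is a unit, so the
  germ of \<open>f\<close> lies in the ideal too.\<close>

lemma maximal_ideal_generated: "m\<^sub>x = Idl\<^bsub>R\<^sub>x\<^esub> W"
proof
  show "m\<^sub>x \<subseteq> Idl\<^bsub>R\<^sub>x\<^esub> W"
  proof
    fix r assume "r \<in> m\<^sub>x"
    then obtain f where f: "regular_at \<X> x f" "f x = 0" "r = germ f" by (auto simp: nonunits_eq)
    obtain d g h where gh: "g \<in> forms d" "h \<in> forms d" "h a \<noteq> 0" "\<And>y v. y \<in> \<X> \<Longrightarrow> v \<in> y \<Longrightarrow> h v \<noteq> 0 \<Longrightarrow> f y = g v / h v"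
      using f(1) unfolding regular_iff represents_def by blast
    have "g a = 0" using gh(4)[OF x a_mem gh(3)] f(2) gh(3) by simp
    then have g0: "chart g d x = 0" using chart_at[OF gh(1) x a_mem] by simp
    have h0: "chart h d x \<noteq> 0" using chart_at[OF gh(2) x a_mem] gh(3) a by simp
    note reg = chart_regular[OF gh(1)] chart_regular[OF gh(2)]
    obtain c where c: "germ (\<lambda>y. chart g d y - c) \<in> Idl\<^bsub>R\<^sub>x\<^esub> W"
      using near_const_chart[OF gh(1)] by (auto simp: near_const_def)
    then have "germ (\<lambda>y. chart g d y - c) \<in> m\<^sub>x" using W_ideal(2) by blast
    then have "c = 0" using g0 regular_diff_const[OF reg(1)] by (simp add: germ_nonunit)
    with c have gJ: "germ (chart g d) \<in> Idl\<^bsub>R\<^sub>x\<^esub> W" by simp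
    have "vanishes (\<lambda>y. chart h d y * f y - chart g d y)"
    proof -
      have "chart h d y * f y - chart g d y = 0" if "y \<in> \<X>" "v \<in> y" "h v * v i0 \<noteq> 0" for y v
        using that chart_at[OF gh(1) that(1,2)] chart_at[OF gh(2) that(1,2)] gh(4)[OF that(1,2)] by simp
      moreover have "(\<lambda>v. h v * v i0) \<in> forms (d + 1)" by (rule forms_mult[OF gh(2) forms_coord])
      ultimately show ?thesis unfolding vanishes_def using gh(3) a
        by (intro exI[of _ "d + 1"] exI[of _ "\<lambda>v. h v * v i0"]) auto
    qed
    then have e: "germ (chart h d) \<otimes>\<^bsub>R\<^sub>x\<^esub> germ f = germ (chart g d)"
      using f(1) reg by (simp add: germ_simps germ_eq_iff regular_mult)
    have u: "germ (chart h d) \<in> Units R\<^sub>x" using germ_unit[OF reg(2)] h0 by simp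
    have "inv\<^bsub>R\<^sub>x\<^esub> germ (chart h d) \<otimes>\<^bsub>R\<^sub>x\<^esub> (germ (chart h d) \<otimes>\<^bsub>R\<^sub>x\<^esub> germ f) \<in> Idl\<^bsub>R\<^sub>x\<^esub> W"
      unfolding e by (rule J.I_l_closed[OF gJ R.Units_inv_closed[OF u]])
    then show "r \<in> Idl\<^bsub>R\<^sub>x\<^esub> W"
      using u f(1,3) reg(2) by (simp add: R.m_assoc[symmetric])
  qed
qed (rule W_ideal)

lemma uniformizer_exists:
  assumes ns: "nonsingular_at \<X> x" and dim: "zariski_dim \<X> = 1"
  shows "\<exists>t. uniformized R\<^sub>x (const_germ \<X> x) t"
proof -
  define m2 where "m2 = ideal_prod R\<^sub>x m\<^sub>x m\<^sub>x"
  interpret m2: ideal m2 "R\<^sub>x" unfolding m2_def by (rule R.ideal_prod_is_ideal[OF m.ideal_axioms m.ideal_axioms])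
  interpret Q: ring "R\<^sub>x Quot m2" by (rule m2.quotient_is_ring)
  let ?q = "\<lambda>r. m2 +>\<^bsub>R\<^sub>x\<^esub> r"
  have q: "?q \<in> ring_hom R\<^sub>x (R\<^sub>x Quot m2)" by (rule m2.rcos_ring_hom)
  have q0: "?q \<zero>\<^bsub>R\<^sub>x\<^esub> = \<zero>\<^bsub>R\<^sub>x Quot m2\<^esub>" by (rule ring_hom_zero[OF q R.ring_axioms Q.ring_axioms])
  have q_eq: "?q r = ?q s \<longleftrightarrow> r \<ominus>\<^bsub>R\<^sub>x\<^esub> s \<in> m2" if "r \<in> carrier R\<^sub>x" "s \<in> carrier R\<^sub>x" for r s
    using R.quotient_eq_iff_same_a_r_cos[OF m2.ideal_axioms that] by simp
  obtain d where d: "zariski_dim \<X> = enat d"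
    "ring.dimension (R\<^sub>x Quot m2) d (range (\<lambda>c. ?q (const_germ \<X> x c))) (?q ` m\<^sub>x)"
    using ns unfolding nonsingular_at_def Let_def m2_def by blast
  have "d = Suc 0" using d(1) dim by (simp add: one_enat_def)
  have const: "const_germ \<X> x c \<in> carrier R\<^sub>x" for c by (simp add: const_germ_eq regular_const)
  \<comment> \<open>Dimension one unfolds to a line over the zero space, so every cotangent class is
    a constant multiple of the one class \<open>v\<close>.\<close>
  obtain v E where v: "v \<in> carrier (R\<^sub>x Quot m2)" "v \<notin> E" "Q.dimension 0 (range (\<lambda>c. ?q (const_germ \<X> x c))) E"
    "?q ` m\<^sub>x = Q.line_extension (range (\<lambda>c. ?q (const_germ \<X> x c))) v E"
    using d(2) unfolding \<open>d = Suc 0\<close> by (cases rule: Q.dimension.cases) auto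
  have E: "E = {\<zero>\<^bsub>R\<^sub>x Quot m2\<^esub>}" using v(3) by (cases rule: Q.dimension.cases) auto
  have line: "w \<in> ?q ` m\<^sub>x \<longleftrightarrow> (\<exists>c. w = ?q (const_germ \<X> x c) \<otimes>\<^bsub>R\<^sub>x Quot m2\<^esub> v)" for w
    unfolding v(4) Q.line_extension_mem_iff E using v(1) ring_hom_closed[OF q const] by auto
  have "?q (const_germ \<X> x 1) \<otimes>\<^bsub>R\<^sub>x Quot m2\<^esub> v = v"
    using v(1) ring_hom_one[OF const_germ_hom] ring_hom_one[OF q] by simp
  then have "v \<in> ?q ` m\<^sub>x" using line by metis
  then obtain t where t: "t \<in> m\<^sub>x" "v = ?q t" by blast
  have tc: "t \<in> carrier R\<^sub>x" using t m_carrier by blast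
  have dec: "\<exists>r\<in>carrier R\<^sub>x. \<exists>s\<in>m2. w = r \<otimes>\<^bsub>R\<^sub>x\<^esub> t \<oplus>\<^bsub>R\<^sub>x\<^esub> s" if w: "w \<in> m\<^sub>x" for w
  proof -
    obtain c where "?q w = ?q (const_germ \<X> x c) \<otimes>\<^bsub>R\<^sub>x Quot m2\<^esub> ?q t" using line[of "?q w"] w t by auto
    then have "?q w = ?q (const_germ \<X> x c \<otimes>\<^bsub>R\<^sub>x\<^esub> t)" using ring_hom_mult[OF q const tc] by simp
    moreover have wc: "w \<in> carrier R\<^sub>x" using w m_carrier by blast
    moreover have ct: "const_germ \<X> x c \<otimes>\<^bsub>R\<^sub>x\<^esub> t \<in> carrier R\<^sub>x" using tc const by simp
    ultimately have s: "w \<ominus>\<^bsub>R\<^sub>x\<^esub> const_germ \<X> x c \<otimes>\<^bsub>R\<^sub>x\<^esub> t \<in> m2" by (simp only: q_eq)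
    have "w = const_germ \<X> x c \<otimes>\<^bsub>R\<^sub>x\<^esub> t \<oplus>\<^bsub>R\<^sub>x\<^esub> (w \<ominus>\<^bsub>R\<^sub>x\<^esub> const_germ \<X> x c \<otimes>\<^bsub>R\<^sub>x\<^esub> t)"
      using wc ct by (simp add: R.minus_eq R.a_lcomm R.r_neg)
    then show ?thesis using s const by blast
  qed
  have fin: "finite W" by (simp add: W_def)
  have Wc: "W \<subseteq> carrier R\<^sub>x" using W_subset m_carrier by blast
  \<comment> \<open>Nakayama's lemma needs a finite generating set containing \<open>t\<close>,
    which the coordinate germs supply.\<close>
  have gen: "m\<^sub>x = Idl\<^bsub>R\<^sub>x\<^esub> (insert t W)"
  proof
    show "m\<^sub>x \<subseteq> Idl\<^bsub>R\<^sub>x\<^esub> (insert t W)"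
      unfolding maximal_ideal_generated using R.genideal_self[of "insert t W"] Wc tc
      by (intro R.genideal_minimal R.genideal_ideal) auto
    show "Idl\<^bsub>R\<^sub>x\<^esub> (insert t W) \<subseteq> m\<^sub>x"
      using t(1) W_subset by (intro R.genideal_minimal[OF m.ideal_axioms]) auto
  qed
  have unit: "\<one>\<^bsub>R\<^sub>x\<^esub> \<ominus>\<^bsub>R\<^sub>x\<^esub> r \<in> Units R\<^sub>x" if r: "r \<in> m\<^sub>x" for r
  proof -
    obtain f where "regular_at \<X> x f" "f x = 0" "r = germ f" using r by (auto simp: nonunits_eq)
    moreover from this have "regular_at \<X> x (\<lambda>y. 1 - f y)"
      using regular_add[OF regular_const[of 1] regular_mult[OF regular_const[of "-1"], of f]] by simp
    ultimately show ?thesis by (simp add: germ_simps germ_diff regular_const germ_unit)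
  qed
  have m: "m\<^sub>x = PIdl\<^bsub>R\<^sub>x\<^esub> t"
  proof (rule R.nakayama_principal[OF m.ideal_axioms unit fin Wc gen tc])
    fix w assume "w \<in> W"
    then show "\<exists>r\<in>carrier R\<^sub>x. \<exists>s\<in>ideal_prod R\<^sub>x m\<^sub>x m\<^sub>x. w = r \<otimes>\<^bsub>R\<^sub>x\<^esub> t \<oplus>\<^bsub>R\<^sub>x\<^esub> s"
      using dec W_subset unfolding m2_def by blast
  qed
  \<comment> \<open>The class \<open>v\<close> of \<open>t\<close> lies outside the zero space
    \<open>E\<close>.\<close>
  have "t \<noteq> \<zero>\<^bsub>R\<^sub>x\<^esub>" using v(2) t(2) q0 unfolding E by auto
  then have "t [^]\<^bsub>R\<^sub>x\<^esub> n \<noteq> \<zero>\<^bsub>R\<^sub>x\<^esub>" for n :: nat using reduced[OF tc, of n] by blast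
  then have "uniformized R\<^sub>x (const_germ \<X> x) t"
    using const_germ_hom tc m residue by unfold_locales auto
  then show ?thesis by blast
qed

end

lemma local_ring_uniformized:
  assumes "nonsingular_projective_curve \<X>" "x \<in> \<X>"
  shows "\<exists>t. uniformized (local_ring \<X> x) (const_germ \<X> x) t"
proof -
  have sub: "\<X> \<subseteq> proj_space"
    using assms(1) by (auto simp: nonsingular_projective_curve_def irreducible_closed_def zariski_closed_def zero_locus_def)
  then obtain a i where a: "x = proj_point a" "a i \<noteq> 0" using assms(2) unfolding proj_space_def by blast
  interpret projective_point \<X> x a i by unfold_locales (use sub assms(2) a in auto)
  show ?thesis
    using uniformizer_exists assms unfolding nonsingular_projective_curve_def by blast
qed

section \<open>Local fields as Laurent series fields\<close>

lemma (in type_model) h_sum: "finite A \<Longrightarrow> (\<Oplus>\<^bsub>S\<^esub>i\<in>A. h (f i)) = h (\<Sum>i\<in>A. f i)"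
  by (induction A rule: finite_induct) (auto simp: h_zero h_add S.finsum_insert)

text \<open>In a field some summand of 1 is nonzero; the family that is 1 at its index and 0
  elsewhere selects it.\<close>

lemma type_model_unit_selection:
  fixes h :: "'x::field \<Rightarrow> 's"
  assumes "type_model S h"
  shows "unit_selection S"
  unfolding unit_selection_def
proof (intro allI impI, elim conjE)
  interpret type_model S h by fact
  fix n :: nat and r assume r: "r \<in> {..<n} \<rightarrow> carrier S" and sum: "(\<Oplus>\<^bsub>S\<^esub>i\<in>{..<n}. r i) = \<one>\<^bsub>S\<^esub>"
  have "\<forall>i\<in>{..<n}. \<exists>y. r i = h y" using r h_cases by blast
  then obtain f where f: "\<And>i. i \<in> {..<n} \<Longrightarrow> r i = h (f i)" by metis
  have "(\<Oplus>\<^bsub>S\<^esub>i\<in>{..<n}. r i) = (\<Oplus>\<^bsub>S\<^esub>i\<in>{..<n}. h (f i))"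
    by (rule S.finsum_cong') (auto simp: f)
  then have "h (\<Sum>i<n. f i) = h 1" using sum by (simp add: h_sum h_one)
  then have "(\<Sum>i<n. f i) \<noteq> 0" unfolding h_eq_iff by simp
  then obtain j where j: "j < n" "f j \<noteq> 0" by (metis lessThan_iff sum.neutral)
  let ?e = "\<lambda>i. h (if i = j then 1 else 0)"
  have "(\<Oplus>\<^bsub>S\<^esub>i\<in>{..<n}. ?e i \<otimes>\<^bsub>S\<^esub> ?e i \<otimes>\<^bsub>S\<^esub> r i) = (\<Oplus>\<^bsub>S\<^esub>i\<in>{..<n}. h (if i = j then f i else 0))"
    by (rule S.finsum_cong') (auto simp: f simp flip: h_mult)
  also have "\<dots> = h (f j)" using j by (simp add: h_sum)
  finally have "(\<Oplus>\<^bsub>S\<^esub>i\<in>{..<n}. ?e i \<otimes>\<^bsub>S\<^esub> ?e i \<otimes>\<^bsub>S\<^esub> r i) \<in> Units S" using j(2) by (simp add: h_unit dvd_field_iff)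
  moreover have "\<forall>i<n. \<forall>k<n. i \<noteq> k \<longrightarrow> ?e i \<otimes>\<^bsub>S\<^esub> ?e k = \<zero>\<^bsub>S\<^esub>"
    by (simp flip: h_mult h_zero)
  ultimately show "\<exists>e\<in>{..<n} \<rightarrow> carrier S. (\<forall>i<n. \<forall>j<n. i \<noteq> j \<longrightarrow> e i \<otimes>\<^bsub>S\<^esub> e j = \<zero>\<^bsub>S\<^esub>) \<and>
      (\<Oplus>\<^bsub>S\<^esub>i\<in>{..<n}. e i \<otimes>\<^bsub>S\<^esub> e i \<otimes>\<^bsub>S\<^esub> r i) \<in> Units S"
    by (intro bexI[of _ ?e] conjI) auto
qed

text \<open>Collects what the adelic part uses about a point, so that the geometry can be left
  behind.\<close>

definition laurent_model :: "('n::finite, 'k::field) ppoint set \<Rightarrow> ('n, 'k) ppoint \<Rightarrow> ('k fls \<Rightarrow> ('n, 'k) lfrac) \<Rightarrow> bool" where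
  "laurent_model \<X> x \<Psi> \<longleftrightarrow> type_model (local_field \<X> x) \<Psi> \<and>
     local_integers \<X> x = \<Psi> ` {F. 0 \<le> fls_subdegree F} \<and>
     (\<forall>c. local_const \<X> x c = \<Psi> (fls_const c)) \<and>
     (\<forall>F. F \<noteq> 0 \<longrightarrow> local_valuation \<X> x (\<Psi> F) = fls_subdegree F)"

lemma laurent_model_exists:
  assumes "nonsingular_projective_curve \<X>" "x \<in> \<X>"
  shows "\<exists>\<Psi>. laurent_model \<X> x \<Psi>"
proof -
  obtain t where "uniformized (local_ring \<X> x) (const_germ \<X> x) t"
    using local_ring_uniformized[OF assms] by blast
  then interpret U: uniformized "local_ring \<X> x" "const_germ \<X> x" t .
  interpret L: fps_model "complete_local_ring \<X> x" U.\<Phi>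
    unfolding fps_model_def complete_local_ring_def by (rule U.A.type_model_axioms)
  have "type_model (local_field \<X> x) L.\<Psi>"
    unfolding local_field_def by (rule L.K.type_model_axioms)
  moreover have "local_integers \<X> x = L.\<Psi> ` {F. 0 \<le> fls_subdegree F}"
  proof -
    have "range fps_to_fls = {F :: 'b fls. 0 \<le> fls_subdegree F}"
      using fls_regpart_to_fls_trivial fls_subdegree_fls_to_fps_gt0 by (auto intro!: range_eqI[OF sym])
    moreover have "carrier (complete_local_ring \<X> x) = range U.\<Phi>"
      using L.bij by (simp add: bij_betw_def)
    ultimately show ?thesis
      by (simp add: local_integers_def image_image L.to_fraction_eq flip: \<open>range fps_to_fls = _\<close>)
  qed
  moreover have "local_const \<X> x c = L.\<Psi> (fls_const c)" for c
    by (simp add: local_const_def U.to_completion_const L.to_fraction_eq)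
  moreover have "local_valuation \<X> x (L.\<Psi> F) = fls_subdegree F" if "F \<noteq> 0" for F
    unfolding local_valuation_def by (rule L.dvr_valuation_eq[OF that])
  ultimately show ?thesis unfolding laurent_model_def by blast
qed

text \<open>The unit part has a root by \<open>fps_root_exists\<close>, and the exponent of the
  leading power is divided by \<open>p\<close>.\<close>

lemma fls_root_exists:
  fixes F :: "'k::alg_closed_field fls"
  assumes p: "of_nat p \<noteq> (0::'k)" and F: "F \<noteq> 0" and dvd: "int p dvd fls_subdegree F"
  shows "\<exists>W. W ^ p = F"
proof -
  obtain k where k: "fls_subdegree F = int p * k" using dvd by (elim dvdE)
  obtain V where V: "V ^ p = fls_base_factor_to_fps F"
    using fps_root_exists[OF p fls_base_factor_to_fps_base[OF F]] by blast
  have "(fls_X_intpow k * fps_to_fls V) ^ p = fls_X_intpow (int p * k) * fps_to_fls (V ^ p)"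
    by (simp add: power_mult_distrib fls_X_intpow_power fps_to_fls_power)
  also have "\<dots> = F"
    unfolding V k[symmetric] fls_X_intpow_times_conv_shift
    by (rule fls_conv_base_factor_to_fps_shift_subdegree[symmetric])
  finally show ?thesis by blast
qed

text \<open>If all summands are integral, their constant coefficients sum to 1, so one of these is
  nonzero and its series has order 0. Otherwise any nonzero summand will do.\<close>

lemma fls_integral_pivot:
  fixes f :: "nat \<Rightarrow> 'k::field fls"
  assumes sum: "(\<Sum>i<n. f i) = 1"
  shows "\<exists>j<n. f j \<noteq> 0 \<and> ((\<forall>i<n. 0 \<le> fls_subdegree (f i)) \<longrightarrow> fls_subdegree (f j) = 0)"
proof (cases "\<forall>i<n. 0 \<le> fls_subdegree (f i)")
  case True
  have "(\<Sum>i<n. fls_nth (f i) 0) = fls_nth (\<Sum>i<n. f i) 0" by (simp add: fls_nth_sum)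
  then have "(\<Sum>i<n. fls_nth (f i) 0) \<noteq> 0" using sum by simp
  then obtain j where j: "j < n" "fls_nth (f j) 0 \<noteq> 0" by (metis lessThan_iff sum.neutral)
  then have "fls_subdegree (f j) = 0" using True fls_subdegree_leI[OF j(2)] by force
  then show ?thesis using j by (intro exI[of _ j]) auto
next
  case False
  have "\<exists>j<n. f j \<noteq> 0" using sum by (metis lessThan_iff sum.neutral zero_neq_one)
  then show ?thesis using False by blast
qed

section \<open>Adeles\<close>

text \<open>One model is fixed at every point simultaneously, so that adeles become families of
  Laurent series.\<close>

locale adeles =
  fixes \<X> :: "('n::finite, 'k::alg_closed_field) ppoint set" and \<Psi> :: "('n, 'k) ppoint \<Rightarrow> 'k fls \<Rightarrow> ('n, 'k) lfrac"
  assumes model: "x \<in> \<X> \<Longrightarrow> laurent_model \<X> x (\<Psi> x)" and nonempty: "\<X> \<noteq> {}"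
begin

abbreviation "K \<equiv> local_field \<X>"
abbreviation "A \<equiv> adele_ring \<X>"

lemma K: "x \<in> \<X> \<Longrightarrow> type_model (K x) (\<Psi> x)"
  and integers: "x \<in> \<X> \<Longrightarrow> local_integers \<X> x = \<Psi> x ` {F. 0 \<le> fls_subdegree F}"
  and const: "x \<in> \<X> \<Longrightarrow> local_const \<X> x c = \<Psi> x (fls_const c)"
  and val: "x \<in> \<X> \<Longrightarrow> F \<noteq> 0 \<Longrightarrow> local_valuation \<X> x (\<Psi> x F) = fls_subdegree F"
  using model unfolding laurent_model_def by blast+

lemmas Psi_simps = type_model.h_closed[OF K] type_model.h_eq_iff[OF K]
  type_model.h_add[OF K, symmetric] type_model.h_mult[OF K, symmetric]
  type_model.h_one[OF K, symmetric] type_model.h_zero[OF K, symmetric]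

lemma K_units: "x \<in> \<X> \<Longrightarrow> Units (K x) = \<Psi> x ` {F. F \<noteq> 0}"
proof -
  assume x: "x \<in> \<X>"
  interpret type_model "K x" "\<Psi> x" by (rule K[OF x])
  have "Units (K x) \<subseteq> carrier (K x)" by (auto simp: Units_def)
  moreover have "\<Psi> x F \<in> Units (K x) \<longleftrightarrow> F \<noteq> 0" for F by (simp add: h_unit dvd_field_iff)
  ultimately show ?thesis using h_cases by blast
qed

definition ad :: "(('n, 'k) ppoint \<Rightarrow> 'k fls) \<Rightarrow> ('n, 'k) adele" where
  "ad F = (\<lambda>x\<in>\<X>. \<Psi> x (F x))"

text \<open>The zero series has subdegree 0, so vanishing components count as integral.\<close>

definition adelic :: "(('n, 'k) ppoint \<Rightarrow> 'k fls) \<Rightarrow> bool" where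
  "adelic F \<longleftrightarrow> finite {x \<in> \<X>. fls_subdegree (F x) < 0}"

definition idelic :: "(('n, 'k) ppoint \<Rightarrow> 'k fls) \<Rightarrow> bool" where
  "idelic F \<longleftrightarrow> (\<forall>x\<in>\<X>. F x \<noteq> 0) \<and> finite {x \<in> \<X>. fls_subdegree (F x) \<noteq> 0}"

lemma ad_at: "x \<in> \<X> \<Longrightarrow> ad F x = \<Psi> x (F x)"
  by (simp add: ad_def)

lemma ad_eq_iff: "ad F = ad G \<longleftrightarrow> (\<forall>x\<in>\<X>. F x = G x)"
proof
  assume eq: "ad F = ad G"
  show "\<forall>x\<in>\<X>. F x = G x"
  proof
    fix x assume x: "x \<in> \<X>"
    have "\<Psi> x (F x) = \<Psi> x (G x)" unfolding ad_at[OF x, symmetric] eq ..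
    then show "F x = G x" using x by (simp add: Psi_simps)
  qed
qed (auto simp: ad_def intro!: restrict_ext)

lemma A_ops:
  "ad F \<otimes>\<^bsub>A\<^esub> ad G = ad (\<lambda>x. F x * G x)" "ad F \<oplus>\<^bsub>A\<^esub> ad G = ad (\<lambda>x. F x + G x)"
  "\<one>\<^bsub>A\<^esub> = ad (\<lambda>_. 1)" "\<zero>\<^bsub>A\<^esub> = ad (\<lambda>_. 0)"
  by (auto simp: adele_ring_def ad_def Psi_simps intro!: restrict_ext)

lemma A_closed: "ad F \<in> carrier A \<longleftrightarrow> adelic F"
proof -
  have "ad F x \<notin> local_integers \<X> x \<longleftrightarrow> fls_subdegree (F x) < 0" if "x \<in> \<X>" for x
    using that by (auto simp: ad_at integers Psi_simps)
  then have "{x \<in> \<X>. ad F x \<notin> local_integers \<X> x} = {x \<in> \<X>. fls_subdegree (F x) < 0}" by blast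
  then show ?thesis by (auto simp: adele_ring_def adelic_def ad_def Psi_simps)
qed

lemma A_cases: "\<alpha> \<in> carrier A \<Longrightarrow> \<exists>F. \<alpha> = ad F \<and> adelic F"
proof -
  assume \<alpha>: "\<alpha> \<in> carrier A"
  then have "\<forall>x\<in>\<X>. \<exists>F. \<alpha> x = \<Psi> x F" using type_model.h_cases[OF K] by (auto simp: adele_ring_def PiE_def)
  then obtain F where "\<And>x. x \<in> \<X> \<Longrightarrow> \<alpha> x = \<Psi> x (F x)" by metis
  then have "\<alpha> = ad F" using \<alpha> by (intro extensionalityI[of _ \<X>]) (auto simp: adele_ring_def ad_def PiE_def)
  then show ?thesis using \<alpha> A_closed by blast
qed

lemma A_carrier: "carrier A = ad ` {F. adelic F}"
  using A_cases A_closed by blast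

lemma adelic_const: "fls_subdegree c = 0 \<Longrightarrow> adelic (\<lambda>_. c)"
  by (simp add: adelic_def)

lemma adelic_add: "adelic F \<Longrightarrow> adelic G \<Longrightarrow> adelic (\<lambda>x. F x + G x)"
proof -
  assume "adelic F" "adelic G"
  moreover have "fls_subdegree (F x) < 0 \<or> fls_subdegree (G x) < 0" if "fls_subdegree (F x + G x) < 0" for x
    using that fls_plus_subdegree[of "F x" "G x"] by (cases "F x + G x = 0") auto
  ultimately show ?thesis unfolding adelic_def
    by (auto intro: finite_subset[of _ "{x \<in> \<X>. fls_subdegree (F x) < 0} \<union> {x \<in> \<X>. fls_subdegree (G x) < 0}"])
qed

lemma adelic_mult: "adelic F \<Longrightarrow> adelic G \<Longrightarrow> adelic (\<lambda>x. F x * G x)"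
proof -
  assume "adelic F" "adelic G"
  moreover have "fls_subdegree (F x) < 0 \<or> fls_subdegree (G x) < 0" if "fls_subdegree (F x * G x) < 0" for x
    using that fls_subdegree_mult[of "F x" "G x"] by (cases "F x = 0 \<or> G x = 0") auto
  ultimately show ?thesis unfolding adelic_def
    by (auto intro: finite_subset[of _ "{x \<in> \<X>. fls_subdegree (F x) < 0} \<union> {x \<in> \<X>. fls_subdegree (G x) < 0}"])
qed

lemma adelic_uminus: "adelic F \<Longrightarrow> adelic (\<lambda>x. - F x)"
  by (simp add: adelic_def)

sublocale A: cring A
proof (rule cringI)
  show "abelian_group A"
  proof (rule abelian_groupI)
    fix \<alpha> assume "\<alpha> \<in> carrier A"
    then obtain F where F: "\<alpha> = ad F" "adelic F" using A_cases by blast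
    then have "ad (\<lambda>x. - F x) \<in> carrier A" "ad (\<lambda>x. - F x) \<oplus>\<^bsub>A\<^esub> \<alpha> = \<zero>\<^bsub>A\<^esub>"
      by (simp_all add: A_closed adelic_uminus A_ops)
    then show "\<exists>\<beta>\<in>carrier A. \<beta> \<oplus>\<^bsub>A\<^esub> \<alpha> = \<zero>\<^bsub>A\<^esub>" by blast
  qed (auto simp: A_carrier A_ops adelic_add adelic_const ad_eq_iff ac_simps)
  show "Group.comm_monoid A"
    by (rule comm_monoidI) (auto simp: A_carrier A_ops adelic_mult adelic_const ad_eq_iff ac_simps)
qed (auto simp: A_carrier A_ops distrib_right)

lemma A_pow: "ad F [^]\<^bsub>A\<^esub> (n::nat) = ad (\<lambda>x. F x ^ n)"
  by (induction n) (simp_all add: A_ops mult.commute)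

lemma A_sum:
  assumes "finite I" "\<And>i. i \<in> I \<Longrightarrow> adelic (F i)"
  shows "(\<Oplus>\<^bsub>A\<^esub>i\<in>I. ad (F i)) = ad (\<lambda>x. \<Sum>i\<in>I. F i x)"
  using assms by (induction I rule: finite_induct) (simp_all add: A_ops A.finsum_insert A_closed Pi_iff)

text \<open>An adele and its inverse have opposite orders, and both have finitely many poles, so
  almost all orders are 0.\<close>

lemma A_units: "Units A = ad ` {F. idelic F}"
proof (intro equalityI subsetI)
  fix u assume "u \<in> Units A"
  then obtain v where v: "u \<in> carrier A" "v \<in> carrier A" "u \<otimes>\<^bsub>A\<^esub> v = \<one>\<^bsub>A\<^esub>" by (auto simp: Units_def)
  obtain F where F: "u = ad F" "adelic F" using A_cases[OF v(1)] by blast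
  obtain G where G: "v = ad G" "adelic G" using A_cases[OF v(2)] by blast
  have "ad (\<lambda>x. F x * G x) = ad (\<lambda>_. 1)" using v(3) unfolding F(1) G(1) A_ops .
  then have F: "u = ad F" "adelic F" "adelic G" "\<And>x. x \<in> \<X> \<Longrightarrow> F x * G x = 1"
    using F G unfolding ad_eq_iff by auto
  have nz: "F x \<noteq> 0" "G x \<noteq> 0" if "x \<in> \<X>" for x using F(4)[OF that] by auto
  have "fls_subdegree (F x) + fls_subdegree (G x) = 0" if "x \<in> \<X>" for x
    using fls_subdegree_mult[OF nz[OF that]] F(4)[OF that] by simp
  then have "{x \<in> \<X>. fls_subdegree (F x) \<noteq> 0} \<subseteq> {x \<in> \<X>. fls_subdegree (F x) < 0} \<union> {x \<in> \<X>. fls_subdegree (G x) < 0}"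
    by force
  then have "idelic F" using nz F(2,3) unfolding idelic_def adelic_def by (auto intro: finite_subset)
  then show "u \<in> ad ` {F. idelic F}" using F(1) by blast
next
  fix u assume "u \<in> ad ` {F. idelic F}"
  then obtain F where F: "u = ad F" "idelic F" by blast
  have "{x \<in> \<X>. fls_subdegree (F x) < 0} \<subseteq> {x \<in> \<X>. fls_subdegree (F x) \<noteq> 0}"
    "{x \<in> \<X>. fls_subdegree (inverse (F x)) < 0} \<subseteq> {x \<in> \<X>. fls_subdegree (F x) \<noteq> 0}"
    by auto
  then have "adelic F" "adelic (\<lambda>x. inverse (F x))"
    using F(2) unfolding adelic_def idelic_def by (auto intro: finite_subset)
  moreover have "ad F \<otimes>\<^bsub>A\<^esub> ad (\<lambda>x. inverse (F x)) = \<one>\<^bsub>A\<^esub>" "ad (\<lambda>x. inverse (F x)) \<otimes>\<^bsub>A\<^esub> ad F = \<one>\<^bsub>A\<^esub>"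
    using F(2) by (auto simp: A_ops ad_eq_iff idelic_def)
  ultimately show "u \<in> Units A" unfolding F(1) Units_def using A_closed by blast
qed

text \<open>A pivot index \<open>j x\<close> is chosen at each place. At almost all places all of
  the finitely many summands are integral, so the pivot has order 0 there, and the selected family
  is an idele.\<close>

lemma adele_unit_selection: "unit_selection A"
  unfolding unit_selection_def
proof (intro allI impI, elim conjE)
  fix n :: nat and r assume r: "r \<in> {..<n} \<rightarrow> carrier A" and sum: "(\<Oplus>\<^bsub>A\<^esub>i\<in>{..<n}. r i) = \<one>\<^bsub>A\<^esub>"
  have "\<forall>i\<in>{..<n}. \<exists>F. r i = ad F \<and> adelic F" using r A_cases by blast
  then obtain f where f: "\<And>i. i \<in> {..<n} \<Longrightarrow> r i = ad (f i)" "\<And>i. i \<in> {..<n} \<Longrightarrow> adelic (f i)" by metis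
  have "(\<Oplus>\<^bsub>A\<^esub>i\<in>{..<n}. r i) = (\<Oplus>\<^bsub>A\<^esub>i\<in>{..<n}. ad (f i))"
    by (rule A.finsum_cong') (auto simp: f A_closed)
  then have "ad (\<lambda>x. \<Sum>i<n. f i x) = ad (\<lambda>_. 1)" 
    using sum A_sum[OF finite_lessThan f(2)] by (simp add: A_ops)
  then have "\<forall>x\<in>\<X>. \<exists>j<n. f j x \<noteq> 0 \<and> ((\<forall>i<n. 0 \<le> fls_subdegree (f i x)) \<longrightarrow> fls_subdegree (f j x) = 0)"
    unfolding ad_eq_iff using fls_integral_pivot by blast
  then obtain j where j: "\<And>x. x \<in> \<X> \<Longrightarrow> j x < n" "\<And>x. x \<in> \<X> \<Longrightarrow> f (j x) x \<noteq> 0"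
    "\<And>x. x \<in> \<X> \<Longrightarrow> (\<forall>i<n. 0 \<le> fls_subdegree (f i x)) \<longrightarrow> fls_subdegree (f (j x) x) = 0" by metis
  \<comment> \<open>The idempotent of the set of places with pivot \<open>i\<close>. These sets are
    disjoint, whence orthogonality.\<close>
  define e where "e i = ad (\<lambda>x. if i = j x then 1 else 0)" for i
  have ead: "adelic (\<lambda>x. if i = j x then 1 else 0)" for i by (simp add: adelic_def if_distrib cong: if_cong)
  have "(\<Oplus>\<^bsub>A\<^esub>i\<in>{..<n}. e i \<otimes>\<^bsub>A\<^esub> e i \<otimes>\<^bsub>A\<^esub> r i) = (\<Oplus>\<^bsub>A\<^esub>i\<in>{..<n}. ad (\<lambda>x. if i = j x then f i x else 0))"
  proof (rule A.finsum_cong')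
    fix i assume "i \<in> {..<n}"
    then show "e i \<otimes>\<^bsub>A\<^esub> e i \<otimes>\<^bsub>A\<^esub> r i = ad (\<lambda>x. if i = j x then f i x else 0)"
      by (simp add: f e_def A_ops ad_eq_iff)
  next
    have "adelic (\<lambda>x. (if i = j x then 1 else 0) * f i x)" if "i < n" for i
      using that f(2) by (intro adelic_mult ead) auto
    then show "(\<lambda>i. ad (\<lambda>x. if i = j x then f i x else 0)) \<in> {..<n} \<rightarrow> carrier A"
      by (auto simp: A_closed if_distrib[of "\<lambda>c. c * _"] cong: if_cong)
  qed simp
  also have "\<dots> = ad (\<lambda>x. \<Sum>i<n. if i = j x then f i x else 0)"
  proof (rule A_sum)
    fix i assume "i \<in> {..<n}"
    then have "adelic (\<lambda>x. (if i = j x then 1 else 0) * f i x)" using f(2) by (intro adelic_mult ead) auto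
    then show "adelic (\<lambda>x. if i = j x then f i x else 0)"
      by (simp add: if_distrib[of "\<lambda>c. c * _"] cong: if_cong)
  qed simp
  also have "\<dots> = ad (\<lambda>x. f (j x) x)" unfolding ad_eq_iff using j(1) by simp
  finally have sum_eq: "(\<Oplus>\<^bsub>A\<^esub>i\<in>{..<n}. e i \<otimes>\<^bsub>A\<^esub> e i \<otimes>\<^bsub>A\<^esub> r i) = ad (\<lambda>x. f (j x) x)" .
  have "{x \<in> \<X>. fls_subdegree (f (j x) x) \<noteq> 0} \<subseteq> (\<Union>i<n. {x \<in> \<X>. fls_subdegree (f i x) < 0})"
    using j(3) by force
  moreover have "finite (\<Union>i<n. {x \<in> \<X>. fls_subdegree (f i x) < 0})" using f(2) by (auto simp: adelic_def)
  ultimately have "idelic (\<lambda>x. f (j x) x)" unfolding idelic_def using j(2) finite_subset by blast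
  then have "(\<Oplus>\<^bsub>A\<^esub>i\<in>{..<n}. e i \<otimes>\<^bsub>A\<^esub> e i \<otimes>\<^bsub>A\<^esub> r i) \<in> Units A" unfolding sum_eq A_units by blast
  moreover have "\<forall>i<n. \<forall>k<n. i \<noteq> k \<longrightarrow> e i \<otimes>\<^bsub>A\<^esub> e k = \<zero>\<^bsub>A\<^esub>" by (simp add: e_def A_ops ad_eq_iff)
  moreover have "e \<in> {..<n} \<rightarrow> carrier A" by (simp add: e_def A_closed ead)
  ultimately show "\<exists>e\<in>{..<n} \<rightarrow> carrier A. (\<forall>i<n. \<forall>j<n. i \<noteq> j \<longrightarrow> e i \<otimes>\<^bsub>A\<^esub> e j = \<zero>\<^bsub>A\<^esub>) \<and>
      (\<Oplus>\<^bsub>A\<^esub>i\<in>{..<n}. e i \<otimes>\<^bsub>A\<^esub> e i \<otimes>\<^bsub>A\<^esub> r i) \<in> Units A" by blast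
qed

lemma local_const_hom: "x \<in> \<X> \<Longrightarrow> local_const \<X> x \<in> ring_hom ring_of_type_algebra (K x)"
  by (rule ring_hom_memI) (simp_all add: const Psi_simps fls_plus_const fls_const_mult_const)

lemma adele_const_eq: "adele_const \<X> c = ad (\<lambda>_. fls_const c)"
  by (auto simp: adele_const_def ad_def const intro!: restrict_ext)

lemma adele_const_hom: "adele_const \<X> \<in> ring_hom ring_of_type_algebra A"
  by (rule ring_hom_memI)
    (simp_all add: adele_const_eq A_closed A_ops adelic_const fls_plus_const fls_const_mult_const)

lemma projection_hom: "x \<in> \<X> \<Longrightarrow> (\<lambda>\<alpha>. \<alpha> x) \<in> ring_hom A (K x)"
  by (rule ring_hom_memI) (auto simp: A_carrier A_ops ad_at Psi_simps)

lemma idele_component: "u \<in> Units A \<Longrightarrow> x \<in> \<X> \<Longrightarrow> u x \<in> Units (K x)"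
  by (auto simp: A_units K_units idelic_def ad_at)

lemma idele_mult: "x \<in> \<X> \<Longrightarrow> (u \<otimes>\<^bsub>A\<^esub> v) x = u x \<otimes>\<^bsub>K x\<^esub> v x"
  by (simp add: adele_ring_def)

lemma A_pow_at: "x \<in> \<X> \<Longrightarrow> (u [^]\<^bsub>A\<^esub> (n::nat)) x = u x [^]\<^bsub>K x\<^esub> n"
  by (induction n) (simp_all add: adele_ring_def)

end

section \<open>Induced maps, products of isomorphisms and monomorphisms\<close>

lemma (in cring) kernel_invariant:
  assumes ker: "\<And>u v. u \<in> Units R \<Longrightarrow> v \<in> Units R \<Longrightarrow> f u = f v \<longleftrightarrow> (\<exists>w\<in>Units R. v = w [^] p \<otimes> u)"
  shows "class_function (carrier (unit_classes R p)) f"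
    and "u \<in> Units R \<Longrightarrow> induced f (unit_class R p u) = f u"
proof -
  have inv: "f (w [^] p \<otimes> v) = f v" if "v \<in> Units R" "w \<in> Units R" for v w
    using ker[of v "w [^] p \<otimes> v"] that by (auto simp: Units_pow_closed)
  show "class_function (carrier (unit_classes R p)) f" by (rule class_function_units[OF inv])
  show "u \<in> Units R \<Longrightarrow> induced f (unit_class R p u) = f u" by (rule induced_unit_class[OF _ inv])
qed

lemma product_iso:
  assumes f: "\<And>x. x \<in> I \<Longrightarrow> f x \<in> iso (G x) (H x)"
  shows "(\<lambda>c. \<lambda>x\<in>I. f x (c x)) \<in> iso (product_group I G) (product_group I H)"
proof -
  have hom: "f x \<in> hom (G x) (H x)" and bij: "bij_betw (f x) (carrier (G x)) (carrier (H x))" if "x \<in> I" for x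
    using f[OF that] by (auto simp: iso_def)
  let ?f = "\<lambda>c. \<lambda>x\<in>I. f x (c x)"
  have f_hom: "?f \<in> hom (product_group I G) (product_group I H)"
  proof (rule homI)
    fix c assume "c \<in> carrier (product_group I G)"
    then show "?f c \<in> carrier (product_group I H)" by (auto simp: PiE_iff intro: hom_in_carrier[OF hom])
  next
    fix c d assume "c \<in> carrier (product_group I G)" "d \<in> carrier (product_group I G)"
    then show "?f (c \<otimes>\<^bsub>product_group I G\<^esub> d) = ?f c \<otimes>\<^bsub>product_group I H\<^esub> ?f d"
      by (auto simp: PiE_iff hom_mult[OF hom] intro!: restrict_ext)
  qed
  have "inj_on ?f (carrier (product_group I G))"
  proof (rule inj_onI)
    fix c d assume cd: "c \<in> carrier (product_group I G)" "d \<in> carrier (product_group I G)" and eq: "?f c = ?f d"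
    show "c = d"
    proof (rule extensionalityI)
      show "c \<in> extensional I" "d \<in> extensional I" using cd by (auto simp: PiE_def)
      fix x assume x: "x \<in> I"
      have "f x (c x) = f x (d x)" using fun_cong[OF eq, of x] x by simp
      moreover have "c x \<in> carrier (G x)" "d x \<in> carrier (G x)" using cd x by auto
      ultimately show "c x = d x" using bij[OF x] by (auto simp: bij_betw_def inj_on_def)
    qed
  qed
  moreover have "?f ` carrier (product_group I G) = carrier (product_group I H)"
  proof
    show "?f ` carrier (product_group I G) \<subseteq> carrier (product_group I H)"
      by (rule image_subsetI) (rule hom_in_carrier[OF f_hom])
    show "carrier (product_group I H) \<subseteq> ?f ` carrier (product_group I G)"
    proof
      fix d assume d: "d \<in> carrier (product_group I H)"
      define c where "c = (\<lambda>x\<in>I. inv_into (carrier (G x)) (f x) (d x))"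
      have mem: "d x \<in> f x ` carrier (G x)" if "x \<in> I" for x
        using bij[OF that] d that by (auto simp: bij_betw_def)
      have "c \<in> carrier (product_group I G)" by (auto simp: c_def intro: inv_into_into[OF mem])
      moreover have "d = ?f c"
      proof (rule extensionalityI)
        show "d \<in> extensional I" "?f c \<in> extensional I" using d by (auto simp: PiE_def)
        fix x assume "x \<in> I"
        then show "d x = ?f c x" by (simp add: c_def f_inv_into_f[OF mem])
      qed
      ultimately show "d \<in> ?f ` carrier (product_group I G)" by blast
    qed
  qed
  ultimately show ?thesis using f_hom unfolding iso_def bij_betw_def by blast
qed

text \<open>Transfers injectivity across a commuting square: the isomorphism is undone, and the
  composite along the other sides is already a monomorphism.\<close>

lemma mon_factor:
  assumes i: "i \<in> iso G H" and g: "g \<in> mon G K" and G: "group G"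
    and eq: "\<And>c. c \<in> carrier G \<Longrightarrow> f (i c) = g c"
  shows "f \<in> mon H K"
proof -
  interpret group G by fact
  have ihom: "i \<in> hom G H" and bij: "bij_betw i (carrier G) (carrier H)" using i by (auto simp: iso_def)
  have ghom: "g \<in> hom G K" and ginj: "inj_on g (carrier G)" using g by (auto simp: mon_def)
  have onto: "\<exists>c\<in>carrier G. y = i c" if "y \<in> carrier H" for y
    using bij that by (auto simp: bij_betw_def)
  have "f \<in> hom H K"
  proof (rule homI)
    fix y assume "y \<in> carrier H"
    then obtain c where "c \<in> carrier G" "y = i c" using onto by blast
    then show "f y \<in> carrier K" using eq hom_in_carrier[OF ghom] by simp
  next
    fix y z assume "y \<in> carrier H" "z \<in> carrier H"
    then obtain c d where cd: "c \<in> carrier G" "y = i c" "d \<in> carrier G" "z = i d" using onto by meson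
    have "f (y \<otimes>\<^bsub>H\<^esub> z) = f (i (c \<otimes>\<^bsub>G\<^esub> d))" unfolding cd(2,4) using hom_mult[OF ihom cd(1,3)] by simp
    also have "\<dots> = g c \<otimes>\<^bsub>K\<^esub> g d" using eq[OF m_closed[OF cd(1,3)]] hom_mult[OF ghom cd(1,3)] by simp
    finally show "f (y \<otimes>\<^bsub>H\<^esub> z) = f y \<otimes>\<^bsub>K\<^esub> f z" unfolding cd(2,4) using eq cd(1,3) by simp
  qed
  moreover have "inj_on f (carrier H)"
  proof (rule inj_onI)
    fix y z assume "y \<in> carrier H" "z \<in> carrier H" and fe: "f y = f z"
    then obtain c d where cd: "c \<in> carrier G" "y = i c" "d \<in> carrier G" "z = i d" using onto by meson
    then have "g c = g d" using fe eq by simp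
    then show "y = z" using ginj cd by (auto simp: inj_on_def)
  qed
  ultimately show ?thesis by (simp add: mon_def)
qed

lemma iso_mon_comp:
  assumes "f \<in> mon G H" "i \<in> iso H K"
  shows "(\<lambda>c. i (f c)) \<in> mon G K"
proof -
  have f: "f \<in> hom G H" "inj_on f (carrier G)" and i: "i \<in> hom H K" "inj_on i (carrier H)"
    using assms by (auto simp: mon_def iso_def bij_betw_def)
  have "(\<lambda>c. i (f c)) \<in> hom G K" using f(1) i(1) by (auto simp: hom_def Pi_iff)
  moreover have "inj_on (\<lambda>c. i (f c)) (carrier G)"
    using f i(2) by (auto simp: inj_on_def hom_def Pi_iff)
  ultimately show ?thesis by (simp add: mon_def)
qed

section \<open>The diagram\<close>

locale kummer_adeles = adeles \<X> \<Psi> + G: group G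
  for \<X> :: "('n::finite, 'k::alg_closed_field) ppoint set" and \<Psi> and G :: "('g, 'm) monoid_scheme" +
  fixes p :: nat and \<chi> :: "'g \<Rightarrow> 'k"
  assumes p_prime: "Factorial_Ring.prime p" and p_nonzero: "of_nat p \<noteq> (0::'k)"
    and order: "Coset.order G = p"
    and chi: "\<chi> \<in> hom G scalar_group" and chi_nontriv: "\<exists>g\<in>carrier G. \<chi> g \<noteq> 1"
begin

lemma kummer_A: "kummer_base A G (adele_const \<X>) p \<chi>"
proof
  show "\<one>\<^bsub>A\<^esub> \<noteq> \<zero>\<^bsub>A\<^esub>" using nonempty by (auto simp: A_ops ad_eq_iff)
qed (fact adele_const_hom p_prime p_nonzero order chi chi_nontriv)+

lemma kummer_K: "x \<in> \<X> \<Longrightarrow> kummer_base (K x) G (local_const \<X> x) p \<chi>"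
proof -
  assume x: "x \<in> \<X>"
  interpret type_model "K x" "\<Psi> x" by (rule K[OF x])
  show ?thesis
  proof
    show "\<one>\<^bsub>K x\<^esub> \<noteq> \<zero>\<^bsub>K x\<^esub>" by (simp flip: h_one h_zero)
  qed (fact local_const_hom[OF x] p_prime p_nonzero order chi chi_nontriv)+
qed

sublocale A: kummer_base A G "adele_const \<X>" p \<chi> by (rule kummer_A)

lemma cring_K: "x \<in> \<X> \<Longrightarrow> cring (K x)"
  using kummer_K by (simp add: kummer_base_def)

lemma p_pos: "0 < p" using p_prime by (rule prime_gt_0_nat)

text \<open>The quotient of the two series has a \<open>p\<close>-th root as soon as its order is
  divisible by \<open>p\<close>.\<close>

lemma subdegree_mod_eq_iff:
  fixes F H :: "'k fls"
  assumes "F \<noteq> 0" "H \<noteq> 0"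
  shows "fls_subdegree F mod int p = fls_subdegree H mod int p \<longleftrightarrow> (\<exists>W. W \<noteq> 0 \<and> H = W ^ p * F)"
proof
  assume "fls_subdegree F mod int p = fls_subdegree H mod int p"
  then have "int p dvd fls_subdegree H - fls_subdegree F" by (metis mod_eq_dvd_iff)
  moreover have "fls_subdegree (H * inverse F) = fls_subdegree H - fls_subdegree F"
    using assms by (subst fls_subdegree_mult) auto
  ultimately obtain W where W: "W ^ p = H * inverse F"
    using fls_root_exists[OF p_nonzero, of "H * inverse F"] assms by auto
  then have "W \<noteq> 0" using assms p_pos by (auto simp: power_0_left)
  moreover have "H = W ^ p * F" unfolding W using assms by simp
  ultimately show "\<exists>W. W \<noteq> 0 \<and> H = W ^ p * F" by blast
next
  assume "\<exists>W. W \<noteq> 0 \<and> H = W ^ p * F"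
  then show "fls_subdegree F mod int p = fls_subdegree H mod int p"
    using assms by (auto simp: fls_subdegree_pow)
qed

abbreviation "val\<^sub>K x u \<equiv> local_valuation \<X> x u mod int p"
abbreviation "val\<^sub>A u \<equiv> \<lambda>x\<in>\<X>. val\<^sub>K x (u x)"

lemma val_K_kernel:
  assumes x: "x \<in> \<X>" and uv: "u \<in> Units (K x)" "v \<in> Units (K x)"
  shows "val\<^sub>K x u = val\<^sub>K x v \<longleftrightarrow> (\<exists>w\<in>Units (K x). v = w [^]\<^bsub>K x\<^esub> p \<otimes>\<^bsub>K x\<^esub> u)"
proof -
  interpret type_model "K x" "\<Psi> x" by (rule K[OF x])
  obtain F H where FH: "u = \<Psi> x F" "F \<noteq> 0" "v = \<Psi> x H" "H \<noteq> 0" using uv K_units[OF x] by auto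
  have "(\<exists>w\<in>Units (K x). v = w [^]\<^bsub>K x\<^esub> p \<otimes>\<^bsub>K x\<^esub> u) \<longleftrightarrow> (\<exists>W. W \<noteq> 0 \<and> H = W ^ p * F)"
    unfolding FH K_units[OF x] by (auto simp flip: h_pow h_mult)
  then show ?thesis using subdegree_mod_eq_iff[OF FH(2,4)] FH val[OF x] by simp
qed

lemma val_K_iso: "x \<in> \<X> \<Longrightarrow> induced (val\<^sub>K x) \<in> iso (unit_classes (K x) p) (integer_mod_group p)"
proof -
  assume x: "x \<in> \<X>"
  interpret type_model "K x" "\<Psi> x" by (rule K[OF x])
  show ?thesis
  proof (rule S.induced_iso)
    fix u assume "u \<in> Units (K x)"
    then show "val\<^sub>K x u \<in> carrier (integer_mod_group p)"
      using p_pos by (simp add: carrier_integer_mod_group)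
  next
    fix y assume y: "y \<in> carrier (integer_mod_group p)"
    have "val\<^sub>K x (\<Psi> x (fls_X ^ nat y)) = y"
      using y p_pos by (simp add: val[OF x] carrier_integer_mod_group)
    moreover have "\<Psi> x (fls_X ^ nat y) \<in> Units (K x)" by (simp add: K_units[OF x])
    ultimately show "\<exists>u\<in>Units (K x). val\<^sub>K x u = y" by blast
  next
    fix u v assume "u \<in> Units (K x)" "v \<in> Units (K x)"
    then obtain F H where "u = \<Psi> x F" "F \<noteq> 0" "v = \<Psi> x H" "H \<noteq> 0" using K_units[OF x] by auto
    then show "val\<^sub>K x (u \<otimes>\<^bsub>K x\<^esub> v) = val\<^sub>K x u \<otimes>\<^bsub>integer_mod_group p\<^esub> val\<^sub>K x v"
      by (simp add: val[OF x] mod_add_eq flip: h_mult)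
  qed (rule val_K_kernel[OF x])
qed

lemma idele_cases: "u \<in> Units A \<Longrightarrow> \<exists>F. u = ad F \<and> idelic F"
  using A_units by blast

lemma val_at: "idelic F \<Longrightarrow> val\<^sub>A (ad F) = (\<lambda>x\<in>\<X>. fls_subdegree (F x) mod int p)"
  by (auto simp: ad_at val idelic_def intro!: restrict_ext)

text \<open>Roots are chosen place by place. The result is automatically an idele, because the order
  of the root is determined by those of the two ideles and so vanishes almost everywhere.\<close>

lemma val_A_kernel:
  assumes uv: "u \<in> Units A" "v \<in> Units A"
  shows "val\<^sub>A u = val\<^sub>A v \<longleftrightarrow> (\<exists>w\<in>Units A. v = w [^]\<^bsub>A\<^esub> p \<otimes>\<^bsub>A\<^esub> u)"
proof -
  obtain F H where FH: "u = ad F" "idelic F" "v = ad H" "idelic H" using uv idele_cases by meson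
  have "val\<^sub>A u = val\<^sub>A v \<longleftrightarrow> (\<forall>x\<in>\<X>. fls_subdegree (F x) mod int p = fls_subdegree (H x) mod int p)"
    unfolding FH(1,3) val_at[OF FH(2)] val_at[OF FH(4)] by (auto simp: fun_eq_iff restrict_def)
  also have "\<dots> \<longleftrightarrow> (\<forall>x\<in>\<X>. \<exists>W. W \<noteq> 0 \<and> H x = W ^ p * F x)"
    using FH(2,4) by (intro ball_cong refl subdegree_mod_eq_iff) (auto simp: idelic_def)
  also have "\<dots> \<longleftrightarrow> (\<exists>W. \<forall>x\<in>\<X>. W x \<noteq> 0 \<and> H x = W x ^ p * F x)" by metis
  also have "\<dots> \<longleftrightarrow> (\<exists>W. idelic W \<and> (\<forall>x\<in>\<X>. H x = W x ^ p * F x))"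
  proof -
    have "idelic W" if W: "\<forall>x\<in>\<X>. W x \<noteq> 0 \<and> H x = W x ^ p * F x" for W
    proof -
      have "fls_subdegree (F x) \<noteq> 0 \<or> fls_subdegree (H x) \<noteq> 0" if "x \<in> \<X>" "fls_subdegree (W x) \<noteq> 0" for x
      proof -
        have "F x \<noteq> 0" "W x ^ p \<noteq> 0" using FH(2) W that(1) by (auto simp: idelic_def)
        then have "fls_subdegree (H x) = int p * fls_subdegree (W x) + fls_subdegree (F x)"
          using W that(1) by (simp add: fls_subdegree_pow)
        then show ?thesis using that(2) p_pos by auto
      qed
      then have "{x \<in> \<X>. fls_subdegree (W x) \<noteq> 0} \<subseteq> {x \<in> \<X>. fls_subdegree (F x) \<noteq> 0} \<union> {x \<in> \<X>. fls_subdegree (H x) \<noteq> 0}"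
        by blast
      then show ?thesis using FH(2,4) W unfolding idelic_def by (auto intro: finite_subset)
    qed
    then show ?thesis by (auto simp: idelic_def)
  qed
  also have "\<dots> \<longleftrightarrow> (\<exists>w\<in>Units A. v = w [^]\<^bsub>A\<^esub> p \<otimes>\<^bsub>A\<^esub> u)"
  proof -
    have "v = ad W [^]\<^bsub>A\<^esub> p \<otimes>\<^bsub>A\<^esub> u \<longleftrightarrow> (\<forall>x\<in>\<X>. H x = W x ^ p * F x)" for W
      unfolding FH(1,3) A_pow A_ops ad_eq_iff ..
    then show ?thesis unfolding A_units by blast
  qed
  finally show ?thesis .
qed

lemma val_A_iso: "induced val\<^sub>A \<in> iso (unit_classes A p) (sum_group \<X> (\<lambda>_. integer_mod_group p))"
proof (rule A.induced_iso)
  have car: "carrier (sum_group \<X> (\<lambda>_. integer_mod_group p)) =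
    {y \<in> \<Pi>\<^sub>E x\<in>\<X>. {0..<int p}. finite {x \<in> \<X>. y x \<noteq> 0}}"
    using p_pos by (simp add: carrier_sum_group carrier_integer_mod_group)
  {
    fix u assume "u \<in> Units A"
    then obtain F where F: "u = ad F" "idelic F" using idele_cases by blast
    have "finite {x \<in> \<X>. fls_subdegree (F x) mod int p \<noteq> 0}"
      using F(2) by (auto simp: idelic_def intro: finite_subset[rotated])
    then show "val\<^sub>A u \<in> carrier (sum_group \<X> (\<lambda>_. integer_mod_group p))"
      unfolding car F(1) val_at[OF F(2)] using p_pos by (auto cong: conj_cong)
  next
    fix y assume y: "y \<in> carrier (sum_group \<X> (\<lambda>_. integer_mod_group p))"
    \<comment> \<open>The exponent is the representative of \<open>y x\<close> between 0 and
      \<open>p - 1\<close>. The family is 1 wherever \<open>y\<close> vanishes, hence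
      idelic.\<close>
    let ?F = "\<lambda>x. fls_X ^ nat (y x) :: 'k fls"
    have yx: "0 \<le> y x" "y x < int p" if "x \<in> \<X>" for x using y that unfolding car by (auto simp: PiE_iff)
    have "{x \<in> \<X>. fls_subdegree (?F x) \<noteq> 0} \<subseteq> {x \<in> \<X>. y x \<noteq> 0}" by auto
    moreover have "finite {x \<in> \<X>. y x \<noteq> 0}" using y unfolding car by blast
    ultimately have "finite {x \<in> \<X>. fls_subdegree (?F x) \<noteq> 0}" by (rule finite_subset)
    then have F: "idelic ?F" unfolding idelic_def by simp
    have "val\<^sub>A (ad ?F) = y"
    proof (rule extensionalityI)
      show "val\<^sub>A (ad ?F) \<in> extensional \<X>" by simp
      show "y \<in> extensional \<X>" using y unfolding car by (auto simp: PiE_def)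
      fix x assume "x \<in> \<X>"
      then show "val\<^sub>A (ad ?F) x = y x" unfolding val_at[OF F] using yx by simp
    qed
    then show "\<exists>u\<in>Units A. val\<^sub>A u = y" using A_units F by blast
  next
    fix u v assume "u \<in> Units A" "v \<in> Units A"
    then obtain F H where FH: "u = ad F" "idelic F" "v = ad H" "idelic H" using idele_cases by meson
    have FH': "idelic (\<lambda>x. F x * H x)"
    proof -
      have "{x \<in> \<X>. fls_subdegree (F x * H x) \<noteq> 0} \<subseteq> {x \<in> \<X>. fls_subdegree (F x) \<noteq> 0} \<union> {x \<in> \<X>. fls_subdegree (H x) \<noteq> 0}"
        using FH(2,4) by (auto simp: idelic_def)
      then show ?thesis using FH(2,4) unfolding idelic_def by (auto intro: finite_subset)
    qed
    show "val\<^sub>A (u \<otimes>\<^bsub>A\<^esub> v) = val\<^sub>A u \<otimes>\<^bsub>sum_group \<X> (\<lambda>_. integer_mod_group p)\<^esub> val\<^sub>A v"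
      unfolding FH(1,3) A_ops val_at[OF FH(2)] val_at[OF FH(4)] val_at[OF FH'] mult_sum_group
      using FH(2,4) by (auto simp: idelic_def mod_add_eq intro!: restrict_ext)
  }
qed (rule val_A_kernel)

section \<open>The component maps and the two squares\<close>

abbreviation "comp\<^sub>U u \<equiv> \<lambda>x\<in>\<X>. unit_class (K x) p (u x)"

lemma comp_U_power: "v \<in> Units A \<Longrightarrow> w \<in> Units A \<Longrightarrow> comp\<^sub>U (w [^]\<^bsub>A\<^esub> p \<otimes>\<^bsub>A\<^esub> v) = comp\<^sub>U v"
proof (rule restrict_ext)
  fix x assume vw: "v \<in> Units A" "w \<in> Units A" and x: "x \<in> \<X>"
  interpret Kx: cring "K x" by (rule cring_K[OF x])
  have c: "v x \<in> Units (K x)" "w x \<in> Units (K x)" using idele_component vw x by auto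
  have "unit_class (K x) p (v x) = unit_class (K x) p (w x [^]\<^bsub>K x\<^esub> p \<otimes>\<^bsub>K x\<^esub> v x)"
    using c Kx.Units_pow_closed[OF c(2)] by (subst Kx.unit_class_eq_iff) auto
  then show "unit_class (K x) p ((w [^]\<^bsub>A\<^esub> p \<otimes>\<^bsub>A\<^esub> v) x) = unit_class (K x) p (v x)"
    using x by (simp add: idele_mult A_pow_at)
qed

lemma comp_U_class: "class_function (carrier (unit_classes A p)) comp\<^sub>U"
  by (rule A.class_function_units[OF comp_U_power])

lemma induced_comp_U: "u \<in> Units A \<Longrightarrow> induced comp\<^sub>U (unit_class A p u) = comp\<^sub>U u"
  by (rule A.induced_unit_class[OF _ comp_U_power])

lemma comp_U_closed: "u \<in> Units A \<Longrightarrow> comp\<^sub>U u \<in> carrier (product_group \<X> (\<lambda>x. unit_classes (K x) p))"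
  using cring.unit_classes_carrier[OF cring_K] idele_component by auto

lemma unit_classes_cases: "c \<in> carrier (unit_classes A p) \<Longrightarrow> \<exists>u\<in>Units A. c = unit_class A p u"
  by (auto simp: A.unit_classes_carrier)

lemma comp_U_hom: "induced comp\<^sub>U \<in> hom (unit_classes A p) (product_group \<X> (\<lambda>x. unit_classes (K x) p))"
proof (rule homI)
  fix c assume "c \<in> carrier (unit_classes A p)"
  then obtain u where "u \<in> Units A" "c = unit_class A p u" using unit_classes_cases by blast
  then show "induced comp\<^sub>U c \<in> carrier (product_group \<X> (\<lambda>x. unit_classes (K x) p))"
    using comp_U_closed induced_comp_U by simp
next
  fix c d assume "c \<in> carrier (unit_classes A p)" "d \<in> carrier (unit_classes A p)"
  then obtain u v where uv: "u \<in> Units A" "c = unit_class A p u" "v \<in> Units A" "d = unit_class A p v"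
    using unit_classes_cases by meson
  have "comp\<^sub>U (u \<otimes>\<^bsub>A\<^esub> v) = comp\<^sub>U u \<otimes>\<^bsub>product_group \<X> (\<lambda>x. unit_classes (K x) p)\<^esub> comp\<^sub>U v"
    using idele_component uv by (auto simp: idele_mult cring.unit_class_mult[OF cring_K] intro!: restrict_ext)
  then show "induced comp\<^sub>U (c \<otimes>\<^bsub>unit_classes A p\<^esub> d) =
      induced comp\<^sub>U c \<otimes>\<^bsub>product_group \<X> (\<lambda>x. unit_classes (K x) p)\<^esub> induced comp\<^sub>U d"
    using uv induced_comp_U by (simp add: A.unit_class_mult)
qed

lemma val_diagram:
  "c \<in> carrier (unit_classes A p) \<Longrightarrow>
    induced val\<^sub>A c = (\<lambda>x\<in>\<X>. induced (val\<^sub>K x) (induced comp\<^sub>U c x))"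
proof -
  assume "c \<in> carrier (unit_classes A p)"
  then obtain u where u: "u \<in> Units A" "c = unit_class A p u" using unit_classes_cases by blast
  have "induced val\<^sub>A c = val\<^sub>A u" unfolding u(2) by (rule A.kernel_invariant(2)[OF val_A_kernel u(1)])
  also have "\<dots> = (\<lambda>x\<in>\<X>. induced (val\<^sub>K x) (induced comp\<^sub>U c x))"
  proof (rule restrict_ext)
    fix x assume x: "x \<in> \<X>"
    interpret Kx: cring "K x" by (rule cring_K[OF x])
    have "induced (val\<^sub>K x) (unit_class (K x) p (u x)) = val\<^sub>K x (u x)"
      by (rule Kx.kernel_invariant(2)[OF val_K_kernel[OF x] idele_component[OF u(1) x]])
    then show "val\<^sub>K x (u x) = induced (val\<^sub>K x) (induced comp\<^sub>U c x)"
      using x by (simp add: u induced_comp_U)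
  qed
  finally show ?thesis .
qed

text \<open>The components determine the valuations modulo \<open>p\<close> through the left square,
  and these determine an idele class.\<close>

lemma comp_U_mon: "induced comp\<^sub>U \<in> mon (unit_classes A p) (product_group \<X> (\<lambda>x. unit_classes (K x) p))"
proof -
  have "inj_on (induced comp\<^sub>U) (carrier (unit_classes A p))"
  proof (rule inj_onI)
    fix c d assume cd: "c \<in> carrier (unit_classes A p)" "d \<in> carrier (unit_classes A p)"
      and eq: "induced comp\<^sub>U c = induced comp\<^sub>U d"
    have "induced val\<^sub>A c = induced val\<^sub>A d" using val_diagram[OF cd(1)] val_diagram[OF cd(2)] eq by simp
    then show "c = d" using val_A_iso cd by (auto simp: iso_def bij_betw_def inj_on_def)
  qed
  then show ?thesis using comp_U_hom by (simp add: mon_def)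
qed

definition H\<^sub>A :: "(('n, 'k) adele, 'g, 's) gclass monoid" where
  "H\<^sub>A = harrison_group A (adele_const \<X>) G p"

definition H\<^sub>K :: "('n, 'k) ppoint \<Rightarrow> (('n, 'k) lfrac, 'g, 't) gclass monoid" where
  "H\<^sub>K x = harrison_group (K x) (local_const \<X> x) G p"

definition kum\<^sub>A :: "('n, 'k) adele \<Rightarrow> (('n, 'k) adele, 'g, 's) gclass" where
  "kum\<^sub>A u = harrison_class A G (kummer_ext A (adele_const \<X>) \<chi> p u)"

definition kum\<^sub>K :: "('n, 'k) ppoint \<Rightarrow> ('n, 'k) lfrac \<Rightarrow> (('n, 'k) lfrac, 'g, 't) gclass" where
  "kum\<^sub>K x u = harrison_class (K x) G (kummer_ext (K x) (local_const \<X> x) \<chi> p u)"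

text \<open>The universe parameters \<open>'s\<close> and \<open>'t\<close> of the two rows are
  independent, as the representative of a class may have any type.\<close>

definition comp\<^sub>H :: "(('n, 'k) adele, 'g, (('n, 'k) adele, 's) universe) gext \<Rightarrow>
    ('n, 'k) ppoint \<Rightarrow> (('n, 'k) lfrac, 'g, 't) gclass" where
  "comp\<^sub>H S = (\<lambda>x\<in>\<X>. harrison_class (K x) G (base_change A S (K x) (\<lambda>\<alpha>. \<alpha> x)))"

lemmas harrison_A = A.harrison_iso[OF adele_unit_selection, folded H\<^sub>A_def kum\<^sub>A_def[abs_def]]

lemma kum_K_abs:
  "(\<lambda>u. harrison_class (K x) G (kummer_ext (K x) (local_const \<X> x) \<chi> p u)) = kum\<^sub>K x"
  by (simp add: fun_eq_iff kum\<^sub>K_def)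

lemmas harrison_K = kummer_base.harrison_iso[OF kummer_K type_model_unit_selection[OF K],
  folded H\<^sub>K_def, unfolded kum_K_abs]

abbreviation "kclass\<^sub>K x \<equiv> kummer_base.kclass (K x) G (local_const \<X> x) p \<chi>"

text \<open>Base change carries a Kummer generator over \<open>u\<close> to one over the component
  \<open>u x\<close>, so the result depends on \<open>u\<close> alone.\<close>

lemma comp_H_kclass:
  assumes u: "u \<in> Units A" and S: "S \<in> (A.kclass u :: (('n, 'k) adele, 'g, 's) gclass)"
  shows "comp\<^sub>H S = (\<lambda>x\<in>\<X>. kclass\<^sub>K x (u x))"
  unfolding comp\<^sub>H_def
proof (rule restrict_ext)
  fix x assume x: "x \<in> \<X>"
  interpret Kx: kummer_base "K x" G "local_const \<X> x" p \<chi> by (rule kummer_K[OF x])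
  obtain a where "A.kummer_gen S u a" using S by (auto simp: A.kclass_def)
  then interpret S: kummer_algebra A G "adele_const \<X>" p \<chi> S u a by (rule A.kummer_algebraI)
  have "adele_const \<X> c x = local_const \<X> x c" for c using x by (simp add: adele_const_def)
  then obtain c where "Kx.kummer_gen (base_change A S (K x) (\<lambda>\<alpha>. \<alpha> x)) (u x) c"
    using S.base_change_gen[OF kummer_K[OF x] projection_hom[OF x]] by blast
  then show "harrison_class (K x) G (base_change A S (K x) (\<lambda>\<alpha>. \<alpha> x)) = kclass\<^sub>K x (u x)"
    by (rule Kx.harrison_class_eq)
qed

lemma comp_H_class:
  "class_function (carrier (H\<^sub>A :: (('n, 'k) adele, 'g, 's) gclass monoid))
    (comp\<^sub>H :: _ \<Rightarrow> _ \<Rightarrow> (('n, 'k) lfrac, 'g, 't) gclass)"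
  unfolding class_function_def harrison_A(5)
proof (intro ballI)
  fix C :: "(('n, 'k) adele, 'g, 's) gclass" and S T
  assume "C \<in> A.kclass ` Units A" "S \<in> C" "T \<in> C"
  then obtain u where "u \<in> Units A" "S \<in> A.kclass u" "T \<in> A.kclass u" by blast
  then show "(comp\<^sub>H S :: _ \<Rightarrow> (('n, 'k) lfrac, 'g, 't) gclass) = comp\<^sub>H T"
    by (simp only: comp_H_kclass)
qed

lemma induced_comp_H:
  assumes u: "u \<in> Units A"
  shows "induced (comp\<^sub>H :: _ \<Rightarrow> _ \<Rightarrow> (('n, 'k) lfrac, 'g, 't) gclass)
    (A.kclass u :: (('n, 'k) adele, 'g, 's) gclass) = (\<lambda>x\<in>\<X>. kclass\<^sub>K x (u x))"
proof -
  obtain S :: "(('n, 'k) adele, 'g, (('n, 'k) adele, 's) universe) gext" where "S \<in> A.kclass u"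
    using A.kclass_nonempty[OF u] by blast
  then have ne: "(A.kclass u :: (('n, 'k) adele, 'g, 's) gclass) \<noteq> {}" by blast
  have "(comp\<^sub>H :: _ \<Rightarrow> _ \<Rightarrow> (('n, 'k) lfrac, 'g, 't) gclass) ` (A.kclass u :: (('n, 'k) adele, 'g, 's) gclass) =
    (\<lambda>_. \<lambda>x\<in>\<X>. kclass\<^sub>K x (u x)) ` (A.kclass u :: (('n, 'k) adele, 'g, 's) gclass)"
    by (rule image_cong[OF refl]) (rule comp_H_kclass[OF u])
  also have "\<dots> = {\<lambda>x\<in>\<X>. kclass\<^sub>K x (u x)}" using ne by (simp only: image_constant_conv if_False)
  finally show ?thesis by (simp only: induced_def the_elem_eq)
qed

lemma kum_diagram:
  assumes "c \<in> carrier (unit_classes A p)"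
  shows "induced comp\<^sub>H (induced (kum\<^sub>A :: _ \<Rightarrow> (('n, 'k) adele, 'g, 's) gclass) c) =
    (\<lambda>x\<in>\<X>. induced (kum\<^sub>K x :: _ \<Rightarrow> (('n, 'k) lfrac, 'g, 't) gclass) (induced comp\<^sub>U c x))"
proof -
  obtain u where u: "u \<in> Units A" "c = unit_class A p u" using unit_classes_cases[OF assms] by blast
  have "induced comp\<^sub>H (induced (kum\<^sub>A :: _ \<Rightarrow> (('n, 'k) adele, 'g, 's) gclass) c) =
    (\<lambda>x\<in>\<X>. (kclass\<^sub>K x (u x) :: (('n, 'k) lfrac, 'g, 't) gclass))"
    unfolding u(2) harrison_A(4)[OF u(1)] by (rule induced_comp_H[OF u(1)])
  also have "\<dots> = (\<lambda>x\<in>\<X>. induced (kum\<^sub>K x) (induced comp\<^sub>U c x))"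
  proof (rule restrict_ext)
    fix x assume x: "x \<in> \<X>"
    show "(kclass\<^sub>K x (u x) :: (('n, 'k) lfrac, 'g, 't) gclass) = induced (kum\<^sub>K x) (induced comp\<^sub>U c x)"
      unfolding u(2) induced_comp_U[OF u(1)] restrict_apply'[OF x]
      by (rule harrison_K(4)[OF x x idele_component[OF u(1) x], symmetric])
  qed
  finally show ?thesis .
qed

text \<open>By the right square this map, preceded by the adelic Kummer isomorphism, is
  \<open>induced comp\<^sub>U\<close> followed by the product of the local Kummer
  isomorphisms.\<close>

lemma comp_H_mon:
  "induced comp\<^sub>H \<in> mon (H\<^sub>A :: (('n, 'k) adele, 'g, 's) gclass monoid)
    (product_group \<X> (H\<^sub>K :: _ \<Rightarrow> (('n, 'k) lfrac, 'g, 't) gclass monoid))"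
proof (rule mon_factor)
  show "induced kum\<^sub>A \<in> iso (unit_classes A p) (H\<^sub>A :: (('n, 'k) adele, 'g, 's) gclass monoid)"
    by (rule harrison_A(3))
  have "(\<lambda>c. \<lambda>x\<in>\<X>. induced (kum\<^sub>K x) (c x)) \<in> iso (product_group \<X> (\<lambda>x. unit_classes (K x) p))
    (product_group \<X> (H\<^sub>K :: _ \<Rightarrow> (('n, 'k) lfrac, 'g, 't) gclass monoid))"
    by (rule product_iso) (rule harrison_K(3))
  from iso_mon_comp[OF comp_U_mon this]
  show "(\<lambda>c. \<lambda>x\<in>\<X>. induced (kum\<^sub>K x) (induced comp\<^sub>U c x)) \<in> mon (unit_classes A p)
    (product_group \<X> (H\<^sub>K :: _ \<Rightarrow> (('n, 'k) lfrac, 'g, 't) gclass monoid))" .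
  show "group (unit_classes A p)" using A.unit_classes_comm_group by (simp add: comm_group_def)
qed (rule kum_diagram)

end

theorem theorem3p30:
  fixes \<X> :: "('n::finite, 'k::alg_closed_field) ppoint set"
    and p :: nat
    and C\<^sub>p :: "('g, 'm) monoid_scheme"
    and \<chi> :: "'g \<Rightarrow> 'k"
  assumes "nonsingular_projective_curve \<X>"
    and "Factorial_Ring.prime p" and "p \<noteq> CHAR('k)"
    and "group C\<^sub>p" and "cyclic_group C\<^sub>p" and "Coset.order C\<^sub>p = p"
    and "\<chi> \<in> hom C\<^sub>p scalar_group" and "\<exists>g\<in>carrier C\<^sub>p. \<chi> g \<noteq> 1"
  shows
    "let A = adele_ring \<X>;
         K = local_field \<X>;
         I\<^sub>A = unit_classes A p;
         I\<^sub>K = (\<lambda>x. unit_classes (K x) p);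
         H\<^sub>A = (harrison_group A (adele_const \<X>) C\<^sub>p p
                  :: (('n, 'k) adele, 'g, 's) gclass monoid);
         H\<^sub>K = (\<lambda>x. harrison_group (K x) (local_const \<X> x) C\<^sub>p p
                  :: (('n, 'k) lfrac, 'g, 't) gclass monoid);
         Z\<^sub>A = sum_group \<X> (\<lambda>_. integer_mod_group p);
         Z\<^sub>K = product_group \<X> (\<lambda>_. integer_mod_group p);
         val\<^sub>K = (\<lambda>x u. local_valuation \<X> x u mod int p);
         val\<^sub>A = (\<lambda>u. \<lambda>x\<in>\<X>. val\<^sub>K x (u x));
         kum\<^sub>K = (\<lambda>x u. harrison_class (K x) C\<^sub>p (kummer_ext (K x) (local_const \<X> x) \<chi> p u));
         kum\<^sub>A = (\<lambda>u. harrison_class A C\<^sub>p (kummer_ext A (adele_const \<X>) \<chi> p u));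
         comp\<^sub>U = (\<lambda>u. \<lambda>x\<in>\<X>. unit_class (K x) p (u x));
         comp\<^sub>H = (\<lambda>S. \<lambda>x\<in>\<X>. harrison_class (K x) C\<^sub>p (base_change A S (K x) (\<lambda>\<alpha>. \<alpha> x)));
         \<upsilon>\<^sub>A = induced val\<^sub>A;
         \<upsilon>\<^sub>K = (\<lambda>c. \<lambda>x\<in>\<X>. induced (val\<^sub>K x) (c x));
         i\<^sub>A = induced kum\<^sub>A;
         i\<^sub>K = (\<lambda>c. \<lambda>x\<in>\<X>. induced (kum\<^sub>K x) (c x));
         f\<^sub>Z = (\<lambda>d. d);
         f\<^sub>U = induced comp\<^sub>U;
         f\<^sub>H = induced comp\<^sub>H
     in comm_group I\<^sub>A \<and> (\<forall>x\<in>\<X>. comm_group (I\<^sub>K x)) \<and>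
        comm_group H\<^sub>A \<and> (\<forall>x\<in>\<X>. comm_group (H\<^sub>K x)) \<and>
        class_function (carrier I\<^sub>A) val\<^sub>A \<and>
        class_function (carrier I\<^sub>A) kum\<^sub>A \<and>
        (\<forall>x\<in>\<X>. class_function (carrier (I\<^sub>K x)) (val\<^sub>K x)) \<and>
        (\<forall>x\<in>\<X>. class_function (carrier (I\<^sub>K x)) (kum\<^sub>K x)) \<and>
        class_function (carrier I\<^sub>A) comp\<^sub>U \<and>
        class_function (carrier H\<^sub>A) comp\<^sub>H \<and>
        \<upsilon>\<^sub>A \<in> iso I\<^sub>A Z\<^sub>A \<and>
        i\<^sub>A \<in> iso I\<^sub>A H\<^sub>A \<and>
        \<upsilon>\<^sub>K \<in> iso (product_group \<X> I\<^sub>K) Z\<^sub>K \<and>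
        i\<^sub>K \<in> iso (product_group \<X> I\<^sub>K) (product_group \<X> H\<^sub>K) \<and>
        f\<^sub>Z \<in> mon Z\<^sub>A Z\<^sub>K \<and>
        f\<^sub>U \<in> mon I\<^sub>A (product_group \<X> I\<^sub>K) \<and>
        f\<^sub>H \<in> mon H\<^sub>A (product_group \<X> H\<^sub>K) \<and>
        (\<forall>c\<in>carrier I\<^sub>A. f\<^sub>Z (\<upsilon>\<^sub>A c) = \<upsilon>\<^sub>K (f\<^sub>U c) \<and> f\<^sub>H (i\<^sub>A c) = i\<^sub>K (f\<^sub>U c))"
  proof -
  have "\<forall>x\<in>\<X>. \<exists>\<Psi>. laurent_model \<X> x \<Psi>" using laurent_model_exists[OF assms(1)] by blast
  then obtain \<Psi> where \<Psi>: "\<And>x. x \<in> \<X> \<Longrightarrow> laurent_model \<X> x (\<Psi> x)" by metis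
  have "\<X> \<noteq> {}" using assms(1) by (simp add: nonsingular_projective_curve_def irreducible_closed_def)
  moreover have "of_nat p \<noteq> (0::'k)"
  proof -
    \<comment> \<open>A characteristic dividing the prime \<open>p\<close> would be 1 or
      \<open>p\<close>, and both are excluded.\<close>
    have "\<not> CHAR('k) dvd p"
      using assms(2,3) CHAR_not_1[where 'a = 'k] prime_nat_iff by auto
    then show ?thesis by (simp add: of_nat_eq_0_iff_char_dvd)
  qed
  ultimately interpret D: kummer_adeles \<X> \<Psi> C\<^sub>p p \<chi>
    using assms \<Psi> by (simp add: kummer_adeles_def adeles_def kummer_adeles_axioms_def)
  have kum\<^sub>A: "(\<lambda>u. harrison_class (adele_ring \<X>) C\<^sub>p (kummer_ext (adele_ring \<X>) (adele_const \<X>) \<chi> p u)) = D.kum\<^sub>A"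
    by (simp add: fun_eq_iff D.kum\<^sub>A_def)
  have comp\<^sub>H: "(\<lambda>S. \<lambda>x\<in>\<X>. harrison_class (local_field \<X> x) C\<^sub>p
      (base_change (adele_ring \<X>) S (local_field \<X> x) (\<lambda>\<alpha>. \<alpha> x))) = D.comp\<^sub>H"
    by (simp add: fun_eq_iff D.comp\<^sub>H_def)
  have id: "(\<lambda>d. d) \<in> mon (sum_group \<X> (\<lambda>_. integer_mod_group p)) (product_group \<X> (\<lambda>_. integer_mod_group p))"
    by (auto simp: mon_def hom_def carrier_sum_group)
  have I\<^sub>K: "comm_group (unit_classes (local_field \<X> x) p)"
    "class_function (carrier (unit_classes (local_field \<X> x) p)) (\<lambda>u. local_valuation \<X> x u mod int p)"
    if "x \<in> \<X>" for x
    using cring.unit_classes_comm_group[OF D.cring_K[OF that]]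
      cring.kernel_invariant(1)[OF D.cring_K[OF that] D.val_K_kernel[OF that]] by auto
  show ?thesis
    unfolding Let_def D.kum_K_abs kum\<^sub>A comp\<^sub>H D.H\<^sub>A_def[symmetric] D.H\<^sub>K_def[symmetric]
    by (intro conjI ballI D.A.unit_classes_comm_group I\<^sub>K D.harrison_A(1-3) D.harrison_K(1,2)
        D.A.kernel_invariant(1)[OF D.val_A_kernel] D.comp_U_class D.comp_H_class D.val_A_iso D.comp_U_mon D.comp_H_mon
        product_iso D.val_K_iso D.harrison_K(3) id D.val_diagram D.kum_diagram)
qed

end
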